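(* Let $X$ be an irreducible $\frac{d}{dm}\frac{d}{ds}$-diffusion on $(0,\infty)$ stopped at $0$ with $\mathbb{P}_x[T_0<\infty]=1$ for every $x>0$, and assume that $X$ has infinitely many quasi-stationary distributions. Let $\mu$ be a probability measure on $(0,\infty)$ with $\mathbb{E}_\mu T_0^n<\infty$ for all integers $n\ge 1$, and set $m_n^\mu:=\frac{1}{n!}\mathbb{E}_\mu T_0^n$. Suppose that $$\lim_{n\to\infty}\frac{m^\mu_{n-1}}{m^\mu_n}=\lambda\in(0,\lambda_0].$$ Then $$\lim_{n\to\infty} f_n^\mu(x)=\lambda\psi_{-\lambda}(x)\quad (x>0),\qquad\text{and}\qquad \Phi^n\mu\xrightarrow[n\to\infty]{}\nu_\lambda \ \text{ weakly},$$ where $\Phi$ is the renewal transform, $f_n^\mu$ is the density of $\Phi^n\mu$ with respect to $dm$, and $\nu_\lambda(dx):=\lambda\psi_{-\lambda}(x)\,dm(x)$, which is a quasi-stationary distribution of $X$.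
   Context: Setting: $X$ is a one-dimensional diffusion, i.e. a time-homogeneous strong Markov process with continuous paths up to its lifetime, on $I=[0,\infty)$ or $[0,\infty]$; $\mathbb{P}_x$ is its law started from $x$, $\mathbb{P}_\mu:=\int\mathbb{P}_x\,\mu(dx)$, $\mathbb{E}_\mu$ is the corresponding expectation, and $T_y$ is the first hitting time of $y$. Irreducible means $\mathbb{P}_x[T_y<\infty]>0$ for all $x\in I\setminus\{0\}$, $y\in[0,\infty)$. The point $0$ is a trap: $X_t=0$ for $t\ge T_0$. There are a Radon measure $m$ on $I\setminus\{0\}$ with full support (speed measure) and a strictly increasing continuous function $s$ on $(0,\infty)$ (scale function) such that the local generator of $X$ on $(0,\infty)$ is $\frac{d}{dm}\frac{d}{ds}$; then $X$ is called a $\frac{d}{dm}\frac{d}{ds}$-diffusion. Under these assumptions the boundary $0$ is regular or exit in Feller's classification. A probability measure $\nu$ on $(0,\infty)$ is a quasi-stationary distribution of $X$ if $\mathbb{P}_\nu[X_t\in dx\mid T_0>t]=\nu(dx)$ for all $t>0$. $\lambda_0\ge 0$ is the infimum of the spectrum of the non-negative self-adjoint operator $-\frac{d}{dm}\frac{d}{ds}$ on $L^2(dm)$ with Dirichlet boundary condition at $0$ and, if the boundary $\infty$ is regular, Neumann boundary condition at $\infty$. For $\lambda\in\mathbb{C}$, $u=\psi_\lambda$ is the unique solution of $\frac{d}{dm}\frac{d^+}{ds}u(x)=\lambda u(x)$ $(x\in(0,\infty))$, $\lim_{x\to+0}u(x)=0$, $\lim_{x\to+0}\frac{d^+}{ds}u(x)=1$,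 where $\frac{d^+}{ds}$ is the right derivative with respect to $s$. Renewal transform: for a probability measure $\mu$ on $(0,\infty)$ with $\mathbb{E}_\mu T_0<\infty$, $$\Phi\mu(dx):=\frac{1}{\mathbb{E}_\mu T_0}\int_0^\infty \mathbb{P}_\mu[X_t\in dx,\,T_0>t]\,dt .$$ It maps the set of probability measures on $(0,\infty)$ under which all moments of $T_0$ are finite into itself; $\Phi^n$ is its $n$-th iterate. For such $\mu$ and $n\ge1$, $\Phi^n\mu$ has a density with respect to $dm$, and $f_n^\mu$ denotes its continuous version (unique since $m$ has full support): $\Phi^n\mu(dx)=f_n^\mu(x)\,dm(x)$. *)

theory Defs
  imports "HOL-Probability.Probability"
begin

section \<open>Strong Markov families with continuous paths\<close>

text \<open>
  The type \<^typ>\<open>ennreal\<close> serves as the interval \<open>[0, \<infinity>]\<close>, the largest possible state space.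
  The value \<open>pos X t \<omega>\<close> is meaningful for \<open>0 \<le> t < life X \<omega>\<close> only; after its lifetime the
  process is in no state.  Of \<open>events X\<close> only the measurable space is used.
\<close>

record 'w markov_family =
  events :: "'w measure"
  law :: "ennreal \<Rightarrow> 'w measure"
  pos :: "real \<Rightarrow> 'w \<Rightarrow> ennreal"
  life :: "'w \<Rightarrow> ennreal"

definition located :: "'w markov_family \<Rightarrow> real \<Rightarrow> ennreal set \<Rightarrow> 'w \<Rightarrow> bool" where
  "located X t B \<omega> \<longleftrightarrow> ennreal t < life X \<omega> \<and> pos X t \<omega> \<in> B"

definition natural_filtration :: "'w markov_family \<Rightarrow> ennreal \<Rightarrow> 'w measure" where
  "natural_filtration X t = sigma (space (events X))
     {{\<omega> \<in> space (events X). located X r B \<omega>} | r B. 0 \<le> r \<and> ennreal r \<le> t \<and> B \<in> sets borel}"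

text \<open>
  The right-continuous filtration \<open>F\<^sub>t\<^sub>+\<close>, with time index \<open>[0, \<infinity>]\<close> so that
  \<^const>\<open>stopping_time\<close> covers random times with the value \<open>\<infinity>\<close>.
\<close>

definition right_filtration :: "'w markov_family \<Rightarrow> ennreal \<Rightarrow> 'w measure" where
  "right_filtration X t = sigma (space (events X))
     {A \<in> sets (natural_filtration X \<top>). \<forall>u>t. A \<in> sets (natural_filtration X u)}"

lemma filtration_right_filtration:
  "filtration (space (events X)) (right_filtration X)"
proof -
  have sub: "{A \<in> sets (natural_filtration X \<top>). P A} \<subseteq> Pow (space (events X))" for P
    using sets.space_closed[of "natural_filtration X \<top>"]
    by (auto simp: natural_filtration_def space_measure_of_conv)
  show ?thesis
  proof
    show "space (right_filtration X i) = space (events X)" for i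
      by (simp add: right_filtration_def space_measure_of_conv)
    show "sets (right_filtration X i) \<subseteq> sets (right_filtration X j)" if "i \<le> j" for i j
      unfolding right_filtration_def sets_measure_of[OF sub]
      by (rule sigma_sets_mono') (use that in auto)
  qed
qed

text \<open>
  In the strong Markov property, \<open>T \<omega> < life X \<omega>\<close> forces \<open>T \<omega> < \<infinity>\<close>, so \<^const>\<open>enn2real\<close> loses
  nothing.  Stating it for one further time \<open>t\<close> suffices: finite-dimensional distributions
  after \<open>T\<close> follow by iteration.
\<close>

definition strong_markov :: "'w markov_family \<Rightarrow> ennreal set \<Rightarrow> bool" where
  "strong_markov X I \<longleftrightarrow>
     (\<forall>x\<in>I. \<forall>T. stopping_time (right_filtration X) T \<longrightarrow>
       (\<forall>A \<in> sets (filtration.pre_sigma (space (events X)) (right_filtration X) T).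
        \<forall>t\<ge>0. \<forall>B \<in> sets borel.
          emeasure (law X x)
            {\<omega> \<in> A. T \<omega> < life X \<omega> \<and> located X (enn2real (T \<omega>) + t) B \<omega>} =
          (\<integral>\<^sup>+\<omega> \<in> {\<omega> \<in> A. T \<omega> < life X \<omega>}.
             emeasure (law X (pos X (enn2real (T \<omega>)) \<omega>))
               {\<omega>' \<in> space (events X). located X t B \<omega>'} \<partial>law X x)))"

definition one_dim_diffusion :: "'w markov_family \<Rightarrow> ennreal set \<Rightarrow> bool" where
  "one_dim_diffusion X I \<longleftrightarrow>
     (I = {..<\<top>} \<or> I = UNIV) \<and>
     law X \<in> restrict_space borel I \<rightarrow>\<^sub>M prob_algebra (events X) \<and>
     (\<forall>t\<ge>0. \<forall>B\<in>sets borel. {\<omega> \<in> space (events X). located X t B \<omega>} \<in> sets (events X)) \<and>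
     (\<forall>\<omega>\<in>space (events X). \<forall>t\<ge>0. ennreal t < life X \<omega> \<longrightarrow> pos X t \<omega> \<in> I) \<and>
     (\<forall>\<omega>\<in>space (events X). continuous_on {t. 0 \<le> t \<and> ennreal t < life X \<omega>} (\<lambda>t. pos X t \<omega>)) \<and>
     (\<forall>x\<in>I. AE \<omega> in law X x. located X 0 {x} \<omega>) \<and>
     strong_markov X I"

definition hitting :: "'w markov_family \<Rightarrow> ennreal \<Rightarrow> 'w \<Rightarrow> ennreal" where
  "hitting X y \<omega> = Inf {ennreal t | t. 0 \<le> t \<and> located X t {y} \<omega>}"

definition irreducible_diffusion :: "'w markov_family \<Rightarrow> ennreal set \<Rightarrow> bool" where
  "irreducible_diffusion X I \<longleftrightarrow>
     (\<forall>x \<in> I - {0}. \<forall>y<\<top>. \<P>(\<omega> in law X x. hitting X y \<omega> < \<top>) > 0)"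

definition stopped_at_zero :: "'w markov_family \<Rightarrow> ennreal set \<Rightarrow> bool" where
  "stopped_at_zero X I \<longleftrightarrow>
     (\<forall>x\<in>I. AE \<omega> in law X x. \<forall>t\<ge>0. hitting X 0 \<omega> \<le> ennreal t \<longrightarrow> located X t {0} \<omega>)"


section \<open>The operator \<open>d/dm d/ds\<close>\<close>

definition speed_measure :: "ennreal set \<Rightarrow> ennreal measure \<Rightarrow> bool" where
  "speed_measure I m \<longleftrightarrow>
     sets m = sets borel \<and> emeasure m (- (I - {0})) = 0 \<and>
     (\<forall>K. compact K \<longrightarrow> K \<subseteq> I - {0} \<longrightarrow> emeasure m K < \<top>) \<and>
     (\<forall>U. open U \<longrightarrow> U \<inter> (I - {0}) \<noteq> {} \<longrightarrow> emeasure m (U \<inter> (I - {0})) > 0)"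

text \<open>The restriction of \<open>m\<close> to \<open>(0, \<infinity>)\<close>, as a Borel measure on the real line.\<close>

definition dm :: "ennreal measure \<Rightarrow> real measure" where
  "dm m = distr (restrict_space m {0<..<\<top>}) borel enn2real"

definition scale_function :: "(real \<Rightarrow> real) \<Rightarrow> bool" where
  "scale_function s \<longleftrightarrow> strict_mono_on {0<..} s \<and> continuous_on {0<..} s"

definition ds_quot :: "(real \<Rightarrow> real) \<Rightarrow> (real \<Rightarrow> 'a::real_normed_vector) \<Rightarrow> real \<Rightarrow> real \<Rightarrow> 'a" where
  "ds_quot s u x y = (u y - u x) /\<^sub>R (s y - s x)"

definition right_deriv :: "(real \<Rightarrow> real) \<Rightarrow> (real \<Rightarrow> 'a::real_normed_vector) \<Rightarrow> real \<Rightarrow> 'a" where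
  "right_deriv s u x = Lim (at_right x) (ds_quot s u x)"

text \<open>
  \<open>d/dm d\<^sup>+/ds u = g\<close> on \<open>(0, \<infinity>)\<close>.  Continuity of \<open>u\<close> has to be required: a right-continuous
  step function has right derivative \<open>0\<close> everywhere.
\<close>

definition dmds_eq ::
    "ennreal measure \<Rightarrow> (real \<Rightarrow> real) \<Rightarrow>
     (real \<Rightarrow> 'a::{banach, second_countable_topology}) \<Rightarrow> (real \<Rightarrow> 'a) \<Rightarrow> bool" where
  "dmds_eq m s u g \<longleftrightarrow>
     continuous_on {0<..} u \<and>
     (\<forall>x>0. \<exists>l. (ds_quot s u x \<longlongrightarrow> l) (at_right x)) \<and>
     (\<forall>a b. 0 < a \<longrightarrow> a < b \<longrightarrow>
        set_integrable (dm m) {a<..b} g \<and>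
        right_deriv s u b - right_deriv s u a = (LINT x:{a<..b}|dm m. g x))"

text \<open>
  Exit time from \<open>(a, b)\<close>, and the local generator of \<open>X\<close> at \<open>x\<close> in Dynkin's form
  \<open>lim (E\<^sub>x[u(X\<^sub>\<tau>)] - u(x)) / E\<^sub>x[\<tau>]\<close> as the neighbourhoods \<open>(a, b)\<close> shrink to \<open>x\<close>;
  functions vanish at the state after the lifetime.
\<close>

definition exit_time :: "'w markov_family \<Rightarrow> real \<Rightarrow> real \<Rightarrow> 'w \<Rightarrow> ennreal" where
  "exit_time X a b \<omega> = min (life X \<omega>) (min (hitting X (ennreal a) \<omega>) (hitting X (ennreal b) \<omega>))"

definition dynkin_quot :: "'w markov_family \<Rightarrow> (real \<Rightarrow> real) \<Rightarrow> real \<Rightarrow> real \<Rightarrow> real \<Rightarrow> real" where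
  "dynkin_quot X u x a b =
     ((\<integral>\<omega>. (if exit_time X a b \<omega> < life X \<omega>
             then u (enn2real (pos X (enn2real (exit_time X a b \<omega>)) \<omega>)) else 0) \<partial>law X (ennreal x))
       - u x)
     / enn2real (\<integral>\<^sup>+\<omega>. exit_time X a b \<omega> \<partial>law X (ennreal x))"

definition local_generator_at ::
    "'w markov_family \<Rightarrow> (real \<Rightarrow> real) \<Rightarrow> real \<Rightarrow> real \<Rightarrow> bool" where
  "local_generator_at X u x l \<longleftrightarrow>
     ((\<lambda>(a, b). dynkin_quot X u x a b) \<longlongrightarrow> l) (at_left x \<times>\<^sub>F at_right x)"

definition local_generator_is_dmds ::
    "'w markov_family \<Rightarrow> ennreal measure \<Rightarrow> (real \<Rightarrow> real) \<Rightarrow> bool" where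
  "local_generator_is_dmds X m s \<longleftrightarrow>
     (\<forall>u g. continuous_on {0<..} u \<longrightarrow> continuous_on {0<..} g \<longrightarrow>
        (\<forall>x>0. local_generator_at X u x (g x)) \<longleftrightarrow> dmds_eq m s u g)"

definition dmds_diffusion ::
    "'w markov_family \<Rightarrow> ennreal set \<Rightarrow> ennreal measure \<Rightarrow> (real \<Rightarrow> real) \<Rightarrow> bool" where
  "dmds_diffusion X I m s \<longleftrightarrow>
     one_dim_diffusion X I \<and> speed_measure I m \<and> scale_function s \<and>
     local_generator_is_dmds X m s"


section \<open>Bottom of the spectrum and eigenfunctions\<close>

definition L2 :: "ennreal measure \<Rightarrow> (real \<Rightarrow> real) \<Rightarrow> bool" where
  "L2 m u \<longleftrightarrow> u \<in> borel_measurable (dm m) \<and> integrable (dm m) (\<lambda>x. (u x)\<^sup>2)"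

text \<open>
  By Feller's test, \<open>\<integral>\<^sub>1\<^sup>\<infinity> (s(x) - s(1)) dm(x) < \<infinity>\<close> holds iff \<open>\<infinity>\<close> is regular or entrance.
\<close>

definition infinity_regular_or_entrance :: "ennreal measure \<Rightarrow> (real \<Rightarrow> real) \<Rightarrow> bool" where
  "infinity_regular_or_entrance m s \<longleftrightarrow>
     (\<integral>\<^sup>+x\<in>{1<..}. ennreal (s x - s 1) \<partial>dm m) < \<top>"

text \<open>
  The graph of \<open>-d/dm d/ds\<close> on \<open>L\<^sup>2(dm)\<close>, given through the continuous representatives \<open>u\<close> of
  the elements of its domain.  When \<open>\<infinity>\<close> is an entrance boundary and \<open>s\<close> is not in \<open>L\<^sup>2\<close> near
  \<open>\<infinity>\<close>, the Neumann condition holds automatically for all \<open>u\<close>; when \<open>s\<close> is in \<open>L\<^sup>2\<close> near \<open>\<infinity>\<close>, the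
  operator without this condition would not be self-adjoint.
\<close>

definition minus_dmds_L2 ::
    "ennreal measure \<Rightarrow> (real \<Rightarrow> real) \<Rightarrow> (real \<Rightarrow> real) \<Rightarrow> (real \<Rightarrow> real) \<Rightarrow> bool" where
  "minus_dmds_L2 m s u h \<longleftrightarrow>
     L2 m u \<and> L2 m h \<and> dmds_eq m s u (\<lambda>x. - h x) \<and> (u \<longlongrightarrow> 0) (at_right 0) \<and>
     (infinity_regular_or_entrance m s \<longrightarrow> (right_deriv s u \<longlongrightarrow> 0) at_top)"

text \<open>
  The resolvent set consists of the \<open>\<kappa>\<close> for which the operator minus \<open>\<kappa>\<close> is onto and has a bounded
  inverse.  The operator being self-adjoint, its spectrum is real, and real functions suffice.
\<close>

definition in_resolvent_set :: "ennreal measure \<Rightarrow> (real \<Rightarrow> real) \<Rightarrow> real \<Rightarrow> bool" where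
  "in_resolvent_set m s \<kappa> \<longleftrightarrow>
     (\<forall>g. L2 m g \<longrightarrow> (\<exists>u h. minus_dmds_L2 m s u h \<and> (AE x in dm m. h x - \<kappa> * u x = g x))) \<and>
     (\<exists>C. \<forall>u h. minus_dmds_L2 m s u h \<longrightarrow>
        (\<integral>x. (u x)\<^sup>2 \<partial>dm m) \<le> C * (\<integral>x. (h x - \<kappa> * u x)\<^sup>2 \<partial>dm m))"

definition lambda0 :: "ennreal measure \<Rightarrow> (real \<Rightarrow> real) \<Rightarrow> real" where
  "lambda0 m s = Inf {\<kappa>. \<not> in_resolvent_set m s \<kappa>}"

text \<open>
  The function \<open>\<psi>\<close> for real and for complex parameters.  The value \<open>0\<close> on \<open>(-\<infinity>, 0]\<close> only makes the function
  unique.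
\<close>

definition psi ::
    "ennreal measure \<Rightarrow> (real \<Rightarrow> real) \<Rightarrow>
     'a::{real_normed_field, banach, second_countable_topology} \<Rightarrow> real \<Rightarrow> 'a" where
  "psi m s lam = (THE u. (\<forall>x\<le>0. u x = 0) \<and> dmds_eq m s u (\<lambda>x. lam * u x) \<and>
     (u \<longlongrightarrow> 0) (at_right 0) \<and> (right_deriv s u \<longlongrightarrow> 1) (at_right 0))"


section \<open>Quasi-stationary distributions and the renewal transform\<close>

text \<open>Probability measures on \<open>(0, \<infinity>)\<close> are represented as Borel measures on the real line.\<close>

definition prob_on_pos :: "real measure \<Rightarrow> bool" where
  "prob_on_pos \<mu> \<longleftrightarrow> prob_space \<mu> \<and> sets \<mu> = sets borel \<and> (AE x in \<mu>. 0 < x)"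

definition law_from :: "'w markov_family \<Rightarrow> real measure \<Rightarrow> 'w measure" where
  "law_from X \<mu> = \<mu> \<bind> (\<lambda>x. law X (ennreal x))"

definition quasi_stationary :: "'w markov_family \<Rightarrow> real measure \<Rightarrow> bool" where
  "quasi_stationary X \<nu> \<longleftrightarrow> prob_on_pos \<nu> \<and>
     (\<forall>t>0. \<forall>A\<in>sets borel. A \<subseteq> {0<..} \<longrightarrow>
        \<P>(\<omega> in law_from X \<nu>. located X t (ennreal ` A) \<omega> \<bar> ennreal t < hitting X 0 \<omega>)
          = measure \<nu> A)"

definition T0_moment :: "'w markov_family \<Rightarrow> real measure \<Rightarrow> nat \<Rightarrow> ennreal" where
  "T0_moment X \<mu> n = (\<integral>\<^sup>+\<omega>. (hitting X 0 \<omega>) ^ n \<partial>law_from X \<mu>)"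

definition normalized_moment :: "'w markov_family \<Rightarrow> real measure \<Rightarrow> nat \<Rightarrow> real" where
  "normalized_moment X \<mu> n = enn2real (T0_moment X \<mu> n) / fact n"

definition renewal_transform :: "'w markov_family \<Rightarrow> real measure \<Rightarrow> real measure" where
  "renewal_transform X \<mu> = measure_of UNIV (sets borel)
     (\<lambda>A. (\<integral>\<^sup>+t\<in>{0..}. emeasure (law_from X \<mu>)
              {\<omega> \<in> space (law_from X \<mu>).
                 located X t (ennreal ` (A \<inter> {0<..})) \<omega> \<and> ennreal t < hitting X 0 \<omega>} \<partial>lborel)
          / T0_moment X \<mu> 1)"

text \<open>
  The continuous version on \<open>(0, \<infinity>)\<close> of the density of \<open>\<nu>\<close> with respect to \<open>dm\<close>; it is unique as \<open>m\<close>
  has full support.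
\<close>

definition cont_density :: "ennreal measure \<Rightarrow> real measure \<Rightarrow> real \<Rightarrow> real" where
  "cont_density m \<nu> = (THE f. (\<forall>x\<le>0. f x = 0) \<and> (\<forall>x>0. 0 \<le> f x) \<and> continuous_on {0<..} f \<and>
     \<nu> = density (dm m) (\<lambda>x. ennreal (f x)))"

definition nu_lambda :: "ennreal measure \<Rightarrow> (real \<Rightarrow> real) \<Rightarrow> real \<Rightarrow> real measure" where
  "nu_lambda m s lam = density (dm m) (\<lambda>x. ennreal (lam * psi m s (- lam) x))"

end

(*
Write S = s - s(0+). The killed process has Green measure S(min x y) dm(y): adding a multiple of s to a
local solution with generator -1 gives monotone functions whose Dynkin quotients bound mean exit times;
hence x |-> E_x (integral of phi(X_t) up to T_0) is continuous, has generator -phi, and solves the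
corresponding dm ds equation. So the density f_n of Phi^n mu satisfies f_(n+1) = r_n (S - K f_n), where
r_n = m_(n-1) / m_n up to the index shift and K g(x) = integral of (s x - s y) g(y) dm(y) over y < x.
The oscillation of (f_n) is dominated by K applied to itself, so it vanishes by a Gronwall argument, and
the limit f = lam (S - K f) is lam psi_(-lam).

No mass is lost: otherwise f is bounded below by a multiple of S at infinity, so S is integrable; but then
every quasi-stationary density is bounded and, as the Green kernel is symmetric, two of them would be
orthogonal unless they are equal. Scheffe's lemma gives weak convergence. Finally, since f dm is an
eigenmeasure of the Green operator, H(t) = P_nu [X_t in B] satisfies H(t) = lam * (integral of H over
(t, infinity)), so H decays exponentially and nu is quasi-stationary.
*)
theory Submission
  imports Defs
begin

section \<open>Functions with a right derivative with respect to the scale\<close>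

text \<open>The generator hypothesis speaks of continuous functions \<open>u\<close> and
  \<open>g\<close>. A Green potential can therefore not be inserted into it before its continuity is
  known, and continuity has to be extracted from exit formulas. Nothing is known in advance about
  \<open>s\<close> near 0 either: that it is bounded below there is read off from the sign of one
  potential, and only then can S be formed.

  The speed measure may have atoms. Slopes are integrals over (0, y], and the Volterra estimate uses
  the open interval (0, y), since the kernel vanishes at its end point; this distinction carries the
  Gronwall argument.

  The state space may contain infinity. That no time is spent there is inferred from a
  quasi-stationary distribution, which lives on (0, \<infinity>) by definition. Facts that hold for
  almost every starting point under some law, such as this one and the finiteness of the mean
  absorption time, are carried to every starting point by irreducibility.

  The convergent ratios are bounded by some C, so f_n \<le> C S uniformly in n. This bound dominates
  all Volterra integrals in the passage to the limit.\<close>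

lemma sets_dm [simp, measurable_cong]: "sets (dm m) = sets borel"
  by (simp add: dm_def)

lemma space_dm [simp]: "space (dm m) = UNIV"
  by (simp add: dm_def)

lemma ds_quot_diff:
  "ds_quot s (\<lambda>x. u x - v x) x y = ds_quot s u x y - ds_quot s v x y"
  by (simp add: ds_quot_def algebra_simps)

lemma ds_quot_cmult:
  fixes u :: "real \<Rightarrow> real"
  shows "ds_quot s (\<lambda>x. c * u x) x y = c * ds_quot s u x y"
  by (simp add: ds_quot_def algebra_simps)

lemma right_deriv_eqI:
  fixes u :: "real \<Rightarrow> real"
  assumes "(ds_quot s u x \<longlongrightarrow> l) (at_right x)"
  shows "right_deriv s u x = l"
  unfolding right_deriv_def by (rule tendsto_Lim[OF _ assms]) simp

lemma abs_set_integral_le: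
  fixes f :: "'a \<Rightarrow> real"
  shows "\<bar>LINT x:A|N. f x\<bar> \<le> (LINT x:A|N. \<bar>f x\<bar>)"
  unfolding set_lebesgue_integral_def
  using integral_abs_bound[of N "\<lambda>x. indicator A x *\<^sub>R f x"] by (simp add: abs_mult)

section \<open>Speed measure, scale and right derivatives\<close>

locale speed_scale =
  fixes I :: "ennreal set" and m :: "ennreal measure" and s :: "real \<Rightarrow> real"
  assumes speed: "speed_measure I m" and scale: "scale_function s"
    and state_space: "I = {..<\<top>} \<or> I = UNIV"
begin

abbreviation "M \<equiv> dm m"

lemma sets_m [simp, measurable_cong]: "sets m = sets borel"
  using speed by (simp add: speed_measure_def)

lemma space_m [simp]: "space m = UNIV"
  using sets_eq_imp_space_eq[OF sets_m] by simp

lemma emeasure_M: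
  assumes A: "A \<in> sets borel"
  shows "emeasure M A = emeasure m (enn2real -` A \<inter> {0<..<\<top>})"
proof -
  have 1: "enn2real \<in> measurable (restrict_space m {0<..<\<top>}) borel"
    by (intro measurable_restrict_space1) simp
  have "emeasure M A = emeasure (restrict_space m {0<..<\<top>}) (enn2real -` A \<inter> space (restrict_space m {0<..<\<top>}))"
    unfolding dm_def by (rule emeasure_distr[OF 1 A])
  also have "\<dots> = emeasure m (enn2real -` A \<inter> {0<..<\<top>})"
    by (subst emeasure_restrict_space) (auto simp: space_restrict_space)
  finally show ?thesis .
qed

lemma M_nonpos: "emeasure M {..0} = 0"
proof -
  have "enn2real -` {..0} \<inter> {0<..<\<top>} = {}"
  proof (intro equals0I)
    fix x assume "x \<in> enn2real -` {..0} \<inter> {0<..<\<top>}"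
    then show False by (cases x) auto
  qed
  then show ?thesis by (subst emeasure_M) auto
qed

lemma AE_M_pos: "AE x in M. 0 < x"
  by (rule AE_I[OF _ M_nonpos]) auto

lemma M_compact: assumes "0 < a" shows "emeasure M {a..b} < \<top>"
proof -
  have c: "compact (ennreal ` {a..b})"
    by (intro compact_continuous_image continuous_on_ennreal continuous_on_id) simp
  have "enn2real -` {a..b} \<inter> {0<..<\<top>} = ennreal ` {a..b}"
  proof (intro set_eqI iffI)
    fix x assume "x \<in> enn2real -` {a..b} \<inter> {0<..<\<top>}"
    then show "x \<in> ennreal ` {a..b}" by (intro image_eqI[of _ _ "enn2real x"]) auto
  next
    fix x assume "x \<in> ennreal ` {a..b}"
    then obtain r where "x = ennreal r" "a \<le> r" "r \<le> b" by auto
    then show "x \<in> enn2real -` {a..b} \<inter> {0<..<\<top>}" using assms by auto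
  qed
  moreover have "ennreal ` {a..b} \<subseteq> I - {0}" using assms state_space by auto
  ultimately show ?thesis using speed c by (simp add: speed_measure_def emeasure_M)
qed

lemma M_open_pos: assumes "0 \<le> a" "a < b" shows "emeasure M {a<..<b} > 0"
proof -
  have "enn2real -` {a<..<b} \<inter> {0<..<\<top>} = {ennreal a<..<ennreal b}"
  proof (intro set_eqI iffI)
    fix x assume "x \<in> enn2real -` {a<..<b} \<inter> {0<..<\<top>}"
    then show "x \<in> {ennreal a<..<ennreal b}" using assms
      by (cases x) (auto simp: ennreal_less_iff)
  next
    fix x assume "x \<in> {ennreal a<..<ennreal b}"
    then show "x \<in> enn2real -` {a<..<b} \<inter> {0<..<\<top>}" using assms
      by (cases x) (auto simp: ennreal_less_iff)
  qed
  moreover have "{ennreal a<..<ennreal b} \<inter> (I - {0}) = {ennreal a<..<ennreal b}" using state_space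
    by (auto simp: less_top[symmetric])
  moreover have "ennreal ((a+b)/2) \<in> {ennreal a<..<ennreal b}" using assms by (auto simp: ennreal_less_iff)
  ultimately show ?thesis using speed
    unfolding speed_measure_def by (metis (no_types) emeasure_M empty_iff greaterThanLessThan_borel open_greaterThanLessThan)
qed

sublocale M: sigma_finite_measure M
proof
  \<comment> \<open>The nonpositive half-line is a null set and [1/(n+1), n+1] is compact in (0,
    \<infinity>), so this cover has finite masses although \<open>M\<close> may be infinite near
    both ends.\<close>
  let ?A = "insert {..0} (range (\<lambda>n::nat. {1 / real (Suc n)..real (Suc n)}))"
  have "\<Union>?A = UNIV"
  proof -
    have "x \<in> \<Union>?A" for x :: real
    proof (cases "x \<le> 0")
      case False
      obtain n :: nat where n: "max x (1/x) < real n" using reals_Archimedean2 by blast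
      have "1/x \<le> real (Suc n)" using n by simp
      then have "1 / real (Suc n) \<le> x" using False by (simp add: field_simps)
      then have "x \<in> {1 / real (Suc n)..real (Suc n)}" using n by auto
      then show ?thesis by blast
    qed auto
    then show ?thesis by blast
  qed
  moreover have "a \<in> ?A \<Longrightarrow> emeasure M a \<noteq> \<infinity>" for a
    using M_compact[of "1 / real (Suc n)" "real (Suc n)" for n] by (auto simp: M_nonpos less_top)
  ultimately show "\<exists>A. countable A \<and> A \<subseteq> sets M \<and> \<Union>A = space M \<and> (\<forall>a\<in>A. emeasure M a \<noteq> \<infinity>)"
    by (intro exI[of _ ?A]) auto
qed

lemma s_strict: "0 < x \<Longrightarrow> x < y \<Longrightarrow> s x < s y"
  using scale by (auto simp: scale_function_def strict_mono_on_def)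

lemma s_mono: "0 < x \<Longrightarrow> x \<le> y \<Longrightarrow> s x \<le> s y"
  using s_strict[of x y] by (cases "x = y") auto

lemma s_cont: "continuous_on {0<..} s"
  using scale by (simp add: scale_function_def)

lemma s_isCont: "0 < x \<Longrightarrow> isCont s x"
  using s_cont continuous_on_eq_continuous_at[of "{0<..}" s] by auto

text \<open>Rolle's theorem is of no use for one-sided derivatives. The reason is a continuation
  argument: the estimate with the slightly larger slope \<open>B + e\<close> persists up to a point
  \<open>c\<close> by continuity, and the right derivative at \<open>c\<close> carries it a little
  further, so there is no first failure.\<close>

lemma mean_value_bound:
  fixes v :: "real \<Rightarrow> real"
  assumes ab: "0 < a" "a \<le> b" and v: "continuous_on {a..b} v"
    and D: "\<And>x. a \<le> x \<Longrightarrow> x < b \<Longrightarrow> (ds_quot s v x \<longlongrightarrow> D x) (at_right x)"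
    and B: "\<And>x. a \<le> x \<Longrightarrow> x < b \<Longrightarrow> \<bar>D x\<bar> \<le> B"
  shows "\<bar>v b - v a\<bar> \<le> B * (s b - s a)"
proof (rule field_le_epsilon)
  fix e0 :: real assume "e0 > 0"
  \<comment> \<open>The summand 1 avoids a zero denominator and still gives
    \<open>e * (s b - s a) \<le> e0\<close>.\<close>
  define e where "e = e0 / (s b - s a + 1)"
  have sab: "s a \<le> s b" using ab s_mono by auto
  have e: "e > 0" and ee: "e * (s b - s a) \<le> e0" using \<open>e0 > 0\<close> sab by (auto simp: e_def field_simps)
  define f where "f z = \<bar>v z - v a\<bar> - (B + e) * (s z - s a)" for z
  have sc: "continuous_on {a..b} s" using s_cont by (rule continuous_on_subset) (use ab in auto)
  have fc: "continuous_on {a..b} f" unfolding f_def by (intro continuous_intros v sc)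
  have "f b \<le> 0"
  proof (rule ccontr)
    assume nb: "\<not> f b \<le> 0"
    define S where "S = {z\<in>{a..b}. f z > 0}"
    have bS: "b \<in> S" using nb ab by (auto simp: S_def)
    have bdd: "bdd_below S" unfolding S_def by (auto intro!: bdd_belowI[of _ a])
    define c where "c = Inf S"
    have ca: "a \<le> c" unfolding c_def using bS by (intro cInf_greatest) (auto simp: S_def)
    have cb: "c \<le> b" unfolding c_def using bS bdd by (intro cInf_lower)
    have below: "f z \<le> 0" if "a \<le> z" "z < c" for z
    proof (rule ccontr)
      assume "\<not> f z \<le> 0"
      then have "z \<in> S" using that cb by (auto simp: S_def)
      then have "c \<le> z" unfolding c_def using bdd by (rule cInf_lower)
      then show False using that by simp
    qed
    have fc0: "f c \<le> 0"
    proof (rule ccontr)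
      assume n: "\<not> f c \<le> 0"
      have "f a = 0" by (simp add: f_def)
      then have ac: "a < c" using n ca by (cases "a = c") auto
      have "\<exists>d>0. \<forall>x'\<in>{a..b}. dist x' c < d \<longrightarrow> dist (f x') (f c) < f c"
        using fc n ca cb unfolding continuous_on_iff by auto
      then obtain d where d: "d > 0" "\<And>x'. x' \<in> {a..b} \<Longrightarrow> dist x' c < d \<Longrightarrow> dist (f x') (f c) < f c" by auto
      define z where "z = max a (c - d/2)"
      have z: "a \<le> z" "z < c" "dist z c < d" using d(1) ac by (auto simp: z_def dist_real_def)
      then have "dist (f z) (f c) < f c" using d(2)[of z] cb by auto
      then have "f z > 0" by (auto simp: dist_real_def)
      with below[of z] z show False by auto
    qed
    then have cb': "c < b" using nb cb by (cases "c = b") auto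
    have "\<forall>\<^sub>F z in at_right c. dist (ds_quot s v c z) (D c) < e"
      using D[OF ca cb'] e by (rule tendstoD)
    then obtain d where d: "d > c" "\<And>z. c < z \<Longrightarrow> z < d \<Longrightarrow> dist (ds_quot s v c z) (D c) < e"
      unfolding eventually_at_right_field by auto
    \<comment> \<open>Just to the right of \<open>c\<close> the quotient from \<open>c\<close> stays
      below \<open>B + e\<close>; added to the estimate at \<open>c\<close>, this keeps every point
      below \<open>min d b\<close> out of \<open>S\<close>.\<close>
    have "min d b \<le> c" unfolding c_def
    proof (rule cInf_greatest)
      show "S \<noteq> {}" using bS by auto
      fix z assume zS: "z \<in> S"
      show "min d b \<le> z"
      proof (rule ccontr)
        assume "\<not> min d b \<le> z"
        then have zd: "z < d" "z < b" by auto
        have "c \<le> z" unfolding c_def using zS bdd by (intro cInf_lower)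
        moreover have "z \<noteq> c" using zS fc0 by (auto simp: S_def)
        ultimately have cz: "c < z" by simp
        have ss: "s c < s z" using s_strict cz ca ab by auto
        have "\<bar>ds_quot s v c z\<bar> < B + e"
          using d(2)[OF cz zd(1)] B[OF ca cb'] by (auto simp: dist_real_def)
        then have "\<bar>v z - v c\<bar> < (B + e) * (s z - s c)"
          using ss by (auto simp: ds_quot_def abs_mult field_simps)
        moreover have "\<bar>v c - v a\<bar> \<le> (B + e) * (s c - s a)" using fc0 by (simp add: f_def)
        ultimately have "\<bar>v z - v a\<bar> \<le> (B + e) * (s z - s c) + (B + e) * (s c - s a)" by linarith
        then have "f z \<le> 0" by (simp add: f_def algebra_simps)
        then show False using zS by (simp add: S_def)
      qed
    qed
    then show False using d(1) cb' by auto
  qed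
  then have "\<bar>v b - v a\<bar> \<le> (B + e) * (s b - s a)" by (simp add: f_def)
  also have "\<dots> = B * (s b - s a) + e * (s b - s a)" by (simp add: algebra_simps)
  also have "\<dots> \<le> B * (s b - s a) + e0" using ee by simp
  finally show "\<bar>v b - v a\<bar> \<le> B * (s b - s a) + e0" .
qed

lemma zero_right_deriv_const:
  fixes v :: "real \<Rightarrow> real"
  assumes v: "continuous_on {0<..} v" and D: "\<And>x. 0 < x \<Longrightarrow> (ds_quot s v x \<longlongrightarrow> 0) (at_right x)"
    and xy: "0 < x" "0 < y"
  shows "v x = v y"
proof -
  have *: "v a = v b" if "0 < a" "a \<le> b" for a b
  proof -
    have "\<bar>v b - v a\<bar> \<le> 0 * (s b - s a)"
    proof (rule mean_value_bound[where D="\<lambda>_. 0"])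
      show "continuous_on {a..b} v" using v by (rule continuous_on_subset) (use that in auto)
    qed (use that D in auto)
    then show ?thesis by simp
  qed
  show ?thesis
  proof (cases "x \<le> y")
    case True then show ?thesis by (rule *[OF xy(1)])
  next
    case False then show ?thesis using *[OF xy(2), of x] by simp
  qed
qed

lemma dmds_eq_right_deriv:
  fixes u :: "real \<Rightarrow> real"
  assumes "dmds_eq m s u g" "0 < x"
  shows "(ds_quot s u x \<longlongrightarrow> right_deriv s u x) (at_right x)"
proof -
  obtain l where "(ds_quot s u x \<longlongrightarrow> l) (at_right x)"
    using assms unfolding dmds_eq_def by blast
  then show ?thesis using right_deriv_eqI by metis
qed

text \<open>The operator K: formally the solution of d/dm d/ds \<open>u = h\<close> with zero value
  and zero slope at 0.\<close>

definition volterra :: "(real \<Rightarrow> real) \<Rightarrow> real \<Rightarrow> real" where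
  "volterra h y = (LINT x:{0<..y}|M. (s y - s x) * h x)"

text \<open>Integrability of \<open>h\<close> and of \<open>s * h\<close> is asked separately
  because at this stage \<open>s\<close> might still tend to minus infinity at 0.\<close>

definition volterra_integrable :: "(real \<Rightarrow> real) \<Rightarrow> bool" where
  "volterra_integrable h \<longleftrightarrow> (\<forall>y>0. set_integrable M {0<..y} h \<and> set_integrable M {0<..y} (\<lambda>x. s x * h x))"

lemma volterra_integrableD:
  assumes "volterra_integrable h" 
  shows "0 \<le> a \<Longrightarrow> set_integrable M {a<..b} h"
    "0 \<le> a \<Longrightarrow> set_integrable M {a<..b} (\<lambda>x. (c - s x) * h x)"
proof -
  have b: "set_integrable M {0<..b} h \<and> set_integrable M {0<..b} (\<lambda>x. s x * h x)"
    using assms by (cases "b > 0") (auto simp: volterra_integrable_def set_integrable_def)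
  show "set_integrable M {a<..b} h" if "0 \<le> a"
    by (rule set_integrable_subset[of _ "{0<..b}"]) (use b that in auto)
  have "set_integrable M {0<..b} (\<lambda>x. c * h x - s x * h x)" using b by auto
  then have "set_integrable M {0<..b} (\<lambda>x. (c - s x) * h x)" by (simp add: algebra_simps)
  then show "set_integrable M {a<..b} (\<lambda>x. (c - s x) * h x)" if "0 \<le> a"
    by (rule set_integrable_subset) (use that in auto)
qed

lemma set_integral_Ioc_split:
  fixes h :: "real \<Rightarrow> real"
  assumes "set_integrable M {a<..c} h" "a \<le> b" "b \<le> c"
  shows "(LINT x:{a<..c}|M. h x) = (LINT x:{a<..b}|M. h x) + (LINT x:{b<..c}|M. h x)"
proof -
  have "{a<..c} = {a<..b} \<union> {b<..c}" using assms by auto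
  moreover have "set_integrable M {a<..b} h" "set_integrable M {b<..c} h"
    by (rule set_integrable_subset[OF assms(1)]; use assms in auto)+
  ultimately show ?thesis by (simp add: set_integral_Un)
qed

text \<open>Linear extrapolation from \<open>x\<close>, with slope the integral of \<open>h\<close>
  over (0, x]: for all mass in (0, x] the kernel grows by the same amount, and only the mass in (x,
  y] is left as an error.\<close>

lemma volterra_increment:
  assumes h: "volterra_integrable h" and xy: "0 < x" "x < y"
  shows "\<bar>volterra h y - volterra h x - (s y - s x) * (LINT z:{0<..x}|M. h z)\<bar>
           \<le> (s y - s x) * (LINT z:{x<..y}|M. \<bar>h z\<bar>)"
proof -
  note i = volterra_integrableD[OF h]
  have "volterra h y = (LINT z:{0<..x}|M. (s y - s z) * h z) + (LINT z:{x<..y}|M. (s y - s z) * h z)"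
    unfolding volterra_def using xy by (intro set_integral_Ioc_split i) auto
  also have "(LINT z:{0<..x}|M. (s y - s z) * h z) = (LINT z:{0<..x}|M. (s y - s x) * h z + (s x - s z) * h z)"
    by (rule arg_cong[where f="set_lebesgue_integral M _"]) (auto simp: algebra_simps)
  also have "\<dots> = (s y - s x) * (LINT z:{0<..x}|M. h z) + volterra h x"
    unfolding volterra_def using i by (subst set_integral_add) auto
  finally have *: "volterra h y - volterra h x - (s y - s x) * (LINT z:{0<..x}|M. h z) =
      (LINT z:{x<..y}|M. (s y - s z) * h z)" by simp
  have "\<bar>LINT z:{x<..y}|M. (s y - s z) * h z\<bar> \<le> (LINT z:{x<..y}|M. \<bar>(s y - s z) * h z\<bar>)"
    by (rule abs_set_integral_le)
  also have "\<dots> \<le> (LINT z:{x<..y}|M. (s y - s x) * \<bar>h z\<bar>)"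
  proof (rule set_integral_mono)
    show "set_integrable M {x<..y} (\<lambda>z. \<bar>(s y - s z) * h z\<bar>)" using i xy by (intro set_integrable_abs) auto
    show "set_integrable M {x<..y} (\<lambda>z. (s y - s x) * \<bar>h z\<bar>)" using i xy by (intro set_integrable_mult_right set_integrable_abs) auto
    fix z assume "z \<in> {x<..y}"
    then have "s x \<le> s z" "s z \<le> s y" using xy s_mono by auto
    then show "\<bar>(s y - s z) * h z\<bar> \<le> (s y - s x) * \<bar>h z\<bar>" by (auto simp: abs_mult intro!: mult_right_mono)
  qed
  finally show ?thesis using * by simp
qed

text \<open>The interval leaves out its left end point, so an atom at \<open>x\<close> does no harm.
  The case \<open>x = 0\<close> gives the behaviour of slopes at the boundary.\<close>

lemma set_integral_Ioc_right_limit: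
  assumes h: "volterra_integrable h" and x: "0 \<le> x"
  shows "((\<lambda>y. LINT z:{x<..y}|M. \<bar>h z\<bar>) \<longlongrightarrow> 0) (at_right x)"
proof (rule tendsto_at_right_sequentially[of _ "x+1"])
  show "x < x + 1" by simp
  fix S :: "nat \<Rightarrow> real" assume S: "\<And>n. x < S n" "\<And>n. S n < x + 1" "decseq S" "S \<longlonglongrightarrow> x"
  have i: "set_integrable M {x<..x+1} (\<lambda>z. \<bar>h z\<bar>)" using volterra_integrableD(1)[OF h, of x "x+1"] x
    by (intro set_integrable_abs) auto
  have "(\<lambda>n. LINT z:{x<..S n}|M. \<bar>h z\<bar>) \<longlonglongrightarrow> (LINT z|M. 0)"
    unfolding set_lebesgue_integral_def
  proof (rule integral_dominated_convergence[where w="\<lambda>z. indicator {x<..x+1} z * \<bar>h z\<bar>"])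
    show "integrable M (\<lambda>z. indicator {x<..x+1} z * \<bar>h z\<bar>)" using i by (simp add: set_integrable_def)
    show "(\<lambda>z. indicator {x<..S n} z *\<^sub>R \<bar>h z\<bar>) \<in> borel_measurable M" for n
    proof -
      have "set_integrable M {x<..S n} (\<lambda>z. \<bar>h z\<bar>)" by (rule set_integrable_subset[OF i]) (use S(2)[of n] in auto)
      then show ?thesis by (auto simp: set_integrable_def)
    qed
    show "AE z in M. (\<lambda>n. indicator {x<..S n} z *\<^sub>R \<bar>h z\<bar>) \<longlonglongrightarrow> 0"
    proof (rule AE_I2)
      fix z
      show "(\<lambda>n. indicator {x<..S n} z *\<^sub>R \<bar>h z\<bar>) \<longlonglongrightarrow> 0"
      proof (cases "z \<le> x")
        case True then show ?thesis by (simp add: indicator_def)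
      next
        case False
        have "\<forall>\<^sub>F n in sequentially. S n < z" using S(4) False by (intro order_tendstoD) auto
        then have "\<forall>\<^sub>F n in sequentially. indicator {x<..S n} z *\<^sub>R \<bar>h z\<bar> = 0"
          by eventually_elim (auto simp: indicator_def)
        then show ?thesis by (rule tendsto_eventually)
      qed
    qed
    show "AE z in M. norm (indicator {x<..S n} z *\<^sub>R \<bar>h z\<bar>) \<le> indicator {x<..x+1} z * \<bar>h z\<bar>" for n
      using S(2)[of n] by (auto simp: indicator_def)
  qed simp
  then show "(\<lambda>n. LINT z:{x<..S n}|M. \<bar>h z\<bar>) \<longlonglongrightarrow> 0" by simp
qed

lemma volterra_right_deriv:
  assumes h: "volterra_integrable h" and x: "0 < x"
  shows "(ds_quot s (volterra h) x \<longlongrightarrow> (LINT z:{0<..x}|M. h z)) (at_right x)"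
proof -
  have "((\<lambda>y. ds_quot s (volterra h) x y - (LINT z:{0<..x}|M. h z)) \<longlongrightarrow> 0) (at_right x)"
  proof (rule Lim_null_comparison[OF _ set_integral_Ioc_right_limit[OF h less_imp_le[OF x]]])
    have "\<forall>\<^sub>F y in at_right x. x < y" by (simp add: eventually_at_right_less)
    then show "\<forall>\<^sub>F y in at_right x. norm (ds_quot s (volterra h) x y - (LINT z:{0<..x}|M. h z)) \<le> (LINT z:{x<..y}|M. \<bar>h z\<bar>)"
    proof eventually_elim
      case (elim y)
      define d I0 J where "d = s y - s x" and "I0 = (LINT z:{0<..x}|M. h z)" and "J = (LINT z:{x<..y}|M. \<bar>h z\<bar>)"
      have d: "d > 0" using s_strict[of x y] x elim by (simp add: d_def)
      have "\<bar>volterra h y - volterra h x - d * I0\<bar> \<le> d * J"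
        using volterra_increment[OF h x elim] by (simp add: d_def I0_def J_def)
      then have "\<bar>(volterra h y - volterra h x - d * I0) / d\<bar> \<le> J" using d
        by (simp add: abs_divide field_simps)
      moreover have "(volterra h y - volterra h x - d * I0) / d = ds_quot s (volterra h) x y - I0"
        using d by (simp add: ds_quot_def d_def[symmetric] field_simps)
      ultimately show ?case unfolding I0_def[symmetric] J_def[symmetric] real_norm_def by simp
    qed
  qed
  then show ?thesis by (simp add: LIM_zero_iff)
qed

lemma volterra_lipschitz:
  assumes h: "volterra_integrable h" and xy: "0 < x" "x \<le> y"
  shows "\<bar>volterra h y - volterra h x\<bar> \<le> (s y - s x) * (LINT z:{0<..y}|M. \<bar>h z\<bar>)"
proof (cases "x = y")
  case False
  then have xy': "x < y" using xy by auto
  have a: "set_integrable M {0<..y} (\<lambda>z. \<bar>h z\<bar>)" for y using volterra_integrableD(1)[OF h] by (intro set_integrable_abs) auto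
  have "\<bar>LINT z:{0<..x}|M. h z\<bar> \<le> (LINT z:{0<..x}|M. \<bar>h z\<bar>)"
    by (rule abs_set_integral_le)
  then have "\<bar>(s y - s x) * (LINT z:{0<..x}|M. h z)\<bar> \<le> (s y - s x) * (LINT z:{0<..x}|M. \<bar>h z\<bar>)"
    using s_mono[of x y] xy by (auto simp: abs_mult intro!: mult_left_mono)
  then have "\<bar>volterra h y - volterra h x\<bar> \<le> (s y - s x) * (LINT z:{0<..x}|M. \<bar>h z\<bar>) + (s y - s x) * (LINT z:{x<..y}|M. \<bar>h z\<bar>)"
    using volterra_increment[OF h xy(1) xy'] by linarith
  also have "\<dots> = (s y - s x) * (LINT z:{0<..y}|M. \<bar>h z\<bar>)"
    using set_integral_Ioc_split[OF a[of y], of x] xy by (simp add: algebra_simps)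
  finally show ?thesis .
qed simp

text \<open>A modulus of continuity in \<open>s\<close> suffices as \<open>s\<close> itself is
  continuous. The constant may grow with the right end \<open>Y\<close>, since continuity is local;
  near \<open>x\<close> the choice \<open>Y = x + 1\<close> will do.\<close>

lemma lipschitz_in_scale_continuous:
  fixes f :: "real \<Rightarrow> real"
  assumes "\<And>x y Y. 0 < x \<Longrightarrow> x \<le> y \<Longrightarrow> y \<le> Y \<Longrightarrow> \<bar>f y - f x\<bar> \<le> (s y - s x) * C Y"
  shows "continuous_on {0<..} f"
proof -
  have "isCont f x" if x: "0 < x" for x
  proof -
    have "((\<lambda>y. f y - f x) \<longlongrightarrow> 0) (at x)"
    proof (rule Lim_null_comparison)
      have "((\<lambda>y. \<bar>s y - s x\<bar> * C (x+1)) \<longlongrightarrow> \<bar>s x - s x\<bar> * C (x+1)) (at x)"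
        using s_isCont[OF x] by (intro tendsto_intros) (simp add: isCont_def)
      then show "((\<lambda>y. \<bar>s y - s x\<bar> * C (x+1)) \<longlongrightarrow> 0) (at x)" by simp
      have "\<forall>\<^sub>F y in at x. y \<in> {0<..<x+1}"
        using x by (intro eventually_at_in_open') auto
      then show "\<forall>\<^sub>F y in at x. norm (f y - f x) \<le> \<bar>s y - s x\<bar> * C (x+1)"
      proof eventually_elim
        case (elim y)
        then show ?case
        proof (cases "x \<le> y")
          case True
          then show ?thesis using assms[of x y "x+1"] s_mono[of x y] x elim by auto
        next
          case False
          then show ?thesis using assms[of y x "x+1"] s_mono[of y x] x elim by (auto simp: abs_minus_commute)
        qed
      qed
    qed
    then show ?thesis unfolding isCont_def by (simp add: LIM_zero_iff)
  qed
  then show ?thesis by (intro continuous_at_imp_continuous_on) auto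
qed

lemma volterra_continuous:
  assumes h: "volterra_integrable h" shows "continuous_on {0<..} (volterra h)"
proof (rule lipschitz_in_scale_continuous)
  fix x y Y :: real assume xy: "0 < x" "x \<le> y" "y \<le> Y"
  have a: "set_integrable M {0<..y} (\<lambda>z. \<bar>h z\<bar>)" for y using volterra_integrableD(1)[OF h] by (intro set_integrable_abs) auto
  have "(LINT z:{0<..Y}|M. \<bar>h z\<bar>) = (LINT z:{0<..y}|M. \<bar>h z\<bar>) + (LINT z:{y<..Y}|M. \<bar>h z\<bar>)"
    using set_integral_Ioc_split[OF a] xy by auto
  moreover have "0 \<le> (LINT z:{y<..Y}|M. \<bar>h z\<bar>)" unfolding set_lebesgue_integral_def
    by (intro integral_nonneg_AE) (auto simp: indicator_def)
  ultimately have "(LINT z:{0<..y}|M. \<bar>h z\<bar>) \<le> (LINT z:{0<..Y}|M. \<bar>h z\<bar>)" by simp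
  then have "(s y - s x) * (LINT z:{0<..y}|M. \<bar>h z\<bar>) \<le> (s y - s x) * (LINT z:{0<..Y}|M. \<bar>h z\<bar>)"
    using s_mono[of x y] xy by (intro mult_left_mono) auto
  then show "\<bar>volterra h y - volterra h x\<bar> \<le> (s y - s x) * (LINT z:{0<..Y}|M. \<bar>h z\<bar>)"
    using volterra_lipschitz[OF h xy(1,2)] by linarith
qed

lemma ds_quot_scale: "0 < x \<Longrightarrow> (ds_quot s (\<lambda>x. c * s x) x \<longlongrightarrow> c) (at_right x)"
proof (rule tendsto_eventually)
  assume x: "0 < x"
  have "\<forall>\<^sub>F y in at_right x. x < y" by (simp add: eventually_at_right_less)
  then show "\<forall>\<^sub>F y in at_right x. ds_quot s (\<lambda>x. c * s x) x y = c"
    by eventually_elim (use s_strict[OF x] in \<open>force simp: ds_quot_def field_simps\<close>)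
qed

text \<open>A supply of explicit functions with prescribed d/dm d/ds. They can be inserted into the
  generator hypothesis before anything is known about potentials, and the free slope
  \<open>c\<close> can be used to make them monotone.\<close>

lemma dmds_eq_scale_minus_volterra:
  assumes h: "volterra_integrable h"
  shows "dmds_eq m s (\<lambda>x. c * s x - volterra h x) (\<lambda>x. - h x)"
    and "0 < x \<Longrightarrow> (ds_quot s (\<lambda>x. c * s x - volterra h x) x \<longlongrightarrow> c - (LINT z:{0<..x}|M. h z)) (at_right x)"
proof -
  show 1: "(ds_quot s (\<lambda>x. c * s x - volterra h x) x \<longlongrightarrow> c - (LINT z:{0<..x}|M. h z)) (at_right x)" if "0 < x" for x
    unfolding ds_quot_diff by (intro tendsto_intros volterra_right_deriv[OF h that] ds_quot_scale[OF that])
  show "dmds_eq m s (\<lambda>x. c * s x - volterra h x) (\<lambda>x. - h x)"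
    unfolding dmds_eq_def
  proof (intro conjI allI impI)
    show "continuous_on {0<..} (\<lambda>x. c * s x - volterra h x)"
      by (intro continuous_intros s_cont volterra_continuous h)
    show "\<exists>l. (ds_quot s (\<lambda>x. c * s x - volterra h x) x \<longlongrightarrow> l) (at_right x)" if "0 < x" for x
      using 1[OF that] by blast
    fix a b :: real assume ab: "0 < a" "a < b"
    note i = volterra_integrableD(1)[OF h]
    show "set_integrable M {a<..b} (\<lambda>x. - h x)" using i[of a b] ab by (simp add: set_integrable_def)
    have "right_deriv s (\<lambda>x. c * s x - volterra h x) b - right_deriv s (\<lambda>x. c * s x - volterra h x) a
      = - (LINT x:{a<..b}|M. h x)"
      using right_deriv_eqI[OF 1[of a]] right_deriv_eqI[OF 1[of b]] ab
        set_integral_Ioc_split[OF i[of 0 b], of a] by simp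
    then show "right_deriv s (\<lambda>x. c * s x - volterra h x) b - right_deriv s (\<lambda>x. c * s x - volterra h x) a
      = (LINT x:{a<..b}|M. - h x)" by (simp add: set_lebesgue_integral_def)
  qed
qed

text \<open>On a compact support inside (0, \<infinity>) the scale is bounded and the mass of
  \<open>M\<close> is finite, so the behaviour at 0 does not enter.\<close>

lemma volterra_integrable_compact:
  assumes "continuous_on UNIV h" "0 < c" "\<And>z. z \<notin> {c..d} \<Longrightarrow> h z = 0"
  shows "volterra_integrable h"
proof -
  have fin: "emeasure M ({0<..y} \<inter> {c..d}) < \<top>" for y
    using M_compact[OF assms(2), of d] emeasure_mono[of "{0<..y} \<inter> {c..d}" "{c..d}" M] by (auto simp: order_le_less_trans)
  have b: "\<exists>B. \<forall>z\<in>{c..d}. norm (g z) \<le> B" if "continuous_on {c..d} g" for g :: "real \<Rightarrow> real"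
    using compact_imp_bounded[OF compact_continuous_image[OF that]] by (auto simp: bounded_iff)
  have i: "set_integrable M {0<..y} g" if g: "continuous_on {c..d} g" "\<And>z. z \<notin> {c..d} \<Longrightarrow> g z = 0" for g :: "real \<Rightarrow> real" and y
  proof -
    obtain B where B: "\<And>z. z \<in> {c..d} \<Longrightarrow> norm (g z) \<le> B" using b[OF g(1)] by blast
    have "(\<lambda>x. indicator {c..d} x *\<^sub>R g x) \<in> borel_measurable borel"
      by (rule borel_measurable_continuous_on_indicator) (use g in auto)
    moreover have "(\<lambda>x. indicator {c..d} x *\<^sub>R g x) = g" using g(2) by (auto simp: fun_eq_iff indicator_def)
    ultimately have gm: "g \<in> borel_measurable borel" by simp
    have "integrable M (\<lambda>x. indicator ({0<..y} \<inter> {c..d}) x * g x)"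
    proof (rule Bochner_Integration.integrable_bound)
      show "integrable M (\<lambda>x. B * indicator ({0<..y} \<inter> {c..d}) x)" using fin by simp
      show "AE x in M. norm (indicator ({0<..y} \<inter> {c..d}) x * g x) \<le> norm (B * indicator ({0<..y} \<inter> {c..d}) x)"
        using B by (intro AE_I2) (force simp: indicator_def)
    qed (use gm in auto)
    moreover have "(\<lambda>x. indicator ({0<..y} \<inter> {c..d}) x * g x) = (\<lambda>x. indicator {0<..y} x *\<^sub>R g x)"
      using g(2) by (auto simp: fun_eq_iff indicator_def)
    ultimately show ?thesis by (simp add: set_integrable_def)
  qed
  have hc: "continuous_on {c..d} h" using assms(1) by (rule continuous_on_subset) simp
  have sc: "continuous_on {c..d} s" using s_cont by (rule continuous_on_subset) (use assms in auto)
  show ?thesis unfolding volterra_integrable_def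
    by (intro allI impI conjI i hc continuous_intros sc) (use assms in auto)
qed

end

section \<open>Measurability of paths and hitting times\<close>

text \<open>The comprehension makes Borel measurability immediate; the image form in which the
  renewal transform uses such sets is recovered in \<open>pos_part_lift_eq\<close>.\<close>

definition pos_part_lift :: "real set \<Rightarrow> ennreal set" where
  "pos_part_lift A = {z. 0 < z \<and> z < \<top> \<and> enn2real z \<in> A}"

lemma pos_part_lift_eq: "pos_part_lift A = ennreal ` (A \<inter> {0<..})"
proof (intro set_eqI iffI)
  fix z assume "z \<in> pos_part_lift A"
  then show "z \<in> ennreal ` (A \<inter> {0<..})"
    by (intro image_eqI[of _ _ "enn2real z"]) (auto simp: pos_part_lift_def enn2real_positive_iff less_top)
next
  fix z assume "z \<in> ennreal ` (A \<inter> {0<..})"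
  then show "z \<in> pos_part_lift A" by (auto simp: pos_part_lift_def)
qed

lemma pos_part_lift_borel [measurable]:
  assumes [measurable]: "A \<in> sets borel" shows "pos_part_lift A \<in> sets borel"
  unfolding pos_part_lift_def by measurable

lemma zero_notin_pos_part_lift [simp]: "0 \<notin> pos_part_lift A" "\<top> \<notin> pos_part_lift A"
  by (auto simp: pos_part_lift_def)

lemma pos_part_lift_UNIV: "pos_part_lift UNIV = {0<..<\<top>}"
  by (auto simp: pos_part_lift_def)

lemma hitting_le: "0 \<le> t \<Longrightarrow> located X t {y} \<omega> \<Longrightarrow> hitting X y \<omega> \<le> ennreal t"
  unfolding hitting_def by (rule Inf_lower) auto

lemma less_ennreal_add_inverse_Suc:
  fixes t u :: ennreal
  assumes "t < u"
  shows "\<exists>n. t + ennreal (1 / real (Suc n)) < u"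
proof -
  have "(\<lambda>n. t + ennreal (1 / real (Suc n))) \<longlonglongrightarrow> t + ennreal 0"
    by (intro tendsto_add tendsto_const tendsto_ennrealI LIMSEQ_Suc[OF lim_1_over_n])
  then have "\<forall>\<^sub>F n in sequentially. t + ennreal (1 / real (Suc n)) < u"
    using assms by (intro order_tendstoD) auto
  then show ?thesis by (auto simp: eventually_sequentially)
qed

lemma ennreal_less_life_rat:
  assumes "ennreal r < l" "0 \<le> r"
  shows "\<exists>q\<in>\<rat>. r < q \<and> ennreal q < l"
proof (cases l)
  case (real l')
  then have "r < l'" using assms by (auto simp: ennreal_less_iff)
  then obtain q where "q \<in> \<rat>" "r < q" "q < l'" using Rats_dense_in_real by blast
  then show ?thesis using assms real by (auto simp: ennreal_less_iff)
next
  case top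
  obtain q where "q \<in> \<rat>" "r < q" "q < r+1" using Rats_dense_in_real[of r "r+1"] by auto
  then show ?thesis using top by auto
qed

locale diffusion_family =
  fixes X :: "'w markov_family" and I :: "ennreal set"
  assumes diffusion: "one_dim_diffusion X I"
begin

abbreviation "E \<equiv> events X"
abbreviation "\<Omega> \<equiv> space (events X)"

lemma I_cases: "I = {..<\<top>} \<or> I = UNIV"
  using diffusion by (simp add: one_dim_diffusion_def)

lemma finite_in_I: "y < \<top> \<Longrightarrow> y \<in> I"
  using I_cases by auto

lemma law_measurable: "law X \<in> restrict_space borel I \<rightarrow>\<^sub>M prob_algebra E"
  using diffusion by (simp add: one_dim_diffusion_def)

lemma law_in_prob_algebra: "y \<in> I \<Longrightarrow> law X y \<in> space (prob_algebra E)"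
  using measurable_space[OF law_measurable, of y] by (simp add: space_restrict_space)

lemma sets_law: "y \<in> I \<Longrightarrow> sets (law X y) = sets E"
  using law_in_prob_algebra[of y] by (simp add: space_prob_algebra)

lemma space_law: "y \<in> I \<Longrightarrow> space (law X y) = \<Omega>"
  using sets_law by (rule sets_eq_imp_space_eq)

lemma prob_space_law: "y \<in> I \<Longrightarrow> prob_space (law X y)"
  using law_in_prob_algebra[of y] by (simp add: space_prob_algebra)

lemma law_ennreal_measurable: "(\<lambda>x::real. law X (ennreal x)) \<in> borel \<rightarrow>\<^sub>M prob_algebra E"
proof -
  have "(\<lambda>x::real. ennreal x) \<in> borel \<rightarrow>\<^sub>M restrict_space borel I"
    by (rule measurable_restrict_space2) (auto intro: finite_in_I)
  from measurable_compose[OF this law_measurable] show ?thesis .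
qed

lemma located_sets: "0 \<le> t \<Longrightarrow> B \<in> sets borel \<Longrightarrow> {\<omega> \<in> \<Omega>. located X t B \<omega>} \<in> sets E"
  using diffusion by (simp add: one_dim_diffusion_def)

lemma path_continuous:
  "\<omega> \<in> \<Omega> \<Longrightarrow> continuous_on {t. 0 \<le> t \<and> ennreal t < life X \<omega>} (\<lambda>t. pos X t \<omega>)"
  using diffusion by (simp add: one_dim_diffusion_def)

lemma path_continuous_Icc:
  assumes "\<omega> \<in> \<Omega>" "0 \<le> r" "ennreal t < life X \<omega>" shows "continuous_on {r..t} (\<lambda>t. pos X t \<omega>)"
proof (rule continuous_on_subset[OF path_continuous[OF assms(1)]])
  show "{r..t} \<subseteq> {t. 0 \<le> t \<and> ennreal t < life X \<omega>}"
    using assms(2,3) by (auto intro: le_less_trans[OF ennreal_leI])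
qed

lemma start: "y \<in> I \<Longrightarrow> AE \<omega> in law X y. located X 0 {y} \<omega>"
  using diffusion by (simp add: one_dim_diffusion_def)

text \<open>\<open>pos\<close> made total with the default value 0. The default does not distort
  occupation times, which count positive states before the lifetime.\<close>

definition path :: "real \<Rightarrow> 'w \<Rightarrow> ennreal" where
  "path t \<omega> = (if 0 \<le> t \<and> ennreal t < life X \<omega> then pos X t \<omega> else 0)"

lemma path_measurable_at:
  assumes r: "0 \<le> r" shows "path r \<in> borel_measurable E"
proof (rule measurableI)
  fix B :: "ennreal set" assume B: "B \<in> sets borel"
  have "path r -` B \<inter> \<Omega> = {\<omega>\<in>\<Omega>. located X r B \<omega>} \<union> (if 0 \<in> B then \<Omega> - {\<omega>\<in>\<Omega>. located X r UNIV \<omega>} else {})"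
    using r by (auto simp: path_def located_def split: if_splits)
  then show "path r -` B \<inter> \<Omega> \<in> sets E"
    using located_sets[OF r B] located_sets[OF r, of UNIV] by simp
qed simp

text \<open>Approximating \<open>t\<close> strictly from the right by the grid of mesh \<open>1/(n+1)\<close>, right-continuity of
  the paths (also at the lifetime) gives joint measurability.\<close>

definition grid :: "nat \<Rightarrow> real \<Rightarrow> real" where
  "grid n t = (real (nat \<lfloor>t * (real n + 1)\<rfloor>) + 1) / (real n + 1)"

lemma grid_bounds: assumes "0 \<le> t" shows "t < grid n t" "grid n t \<le> t + 1 / real (Suc n)"
proof -
  define k where "k = real (nat \<lfloor>t * (real n + 1)\<rfloor>)"
  have k: "k = real_of_int \<lfloor>t * (real n + 1)\<rfloor>" using assms by (simp add: k_def)
  have "t * (real n + 1) < k + 1" "k \<le> t * (real n + 1)" unfolding k by linarith+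
  then show "t < grid n t" unfolding grid_def k_def[symmetric] by (simp add: field_simps)
  have "k / (real n + 1) \<le> t" using \<open>k \<le> t * (real n + 1)\<close> by (simp add: field_simps)
  then show "grid n t \<le> t + 1 / real (Suc n)"
    unfolding grid_def k_def[symmetric] by (simp add: add_divide_distrib add.commute)
qed

lemma grid_tendsto: assumes t: "0 \<le> t" shows "(\<lambda>n. grid n t) \<longlonglongrightarrow> t"
proof (rule tendsto_sandwich)
  show "\<forall>\<^sub>F n in sequentially. t \<le> grid n t"
    by (intro always_eventually allI less_imp_le grid_bounds(1) t)
  show "\<forall>\<^sub>F n in sequentially. grid n t \<le> t + 1 / real (Suc n)"
    by (intro always_eventually allI grid_bounds(2) t)
  show "(\<lambda>n. t + 1 / real (Suc n)) \<longlonglongrightarrow> t"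
    using tendsto_add[OF tendsto_const LIMSEQ_Suc[OF lim_1_over_n], of t] by simp
qed simp

lemma grid_measurable:
  assumes "\<And>r. 0 \<le> r \<Longrightarrow> f r \<in> E \<rightarrow>\<^sub>M N"
  shows "(\<lambda>p. f (grid n (fst p)) (snd p)) \<in> borel \<Otimes>\<^sub>M E \<rightarrow>\<^sub>M N"
proof -
  have "(\<lambda>p. (\<lambda>i p. f ((real i + 1) / (real n + 1)) (snd p)) (nat \<lfloor>fst p * (real n + 1)\<rfloor>) p) \<in> borel \<Otimes>\<^sub>M E \<rightarrow>\<^sub>M N"
  proof (rule measurable_compose_countable[where f="\<lambda>i p. f ((real i + 1) / (real n + 1)) (snd p)"])
    show "(\<lambda>p. f ((real i + 1) / (real n + 1)) (snd p)) \<in> borel \<Otimes>\<^sub>M E \<rightarrow>\<^sub>M N" for i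
      using assms by (intro measurable_compose[OF measurable_snd]) auto
    show "(\<lambda>p. nat \<lfloor>fst p * (real n + 1)\<rfloor>) \<in> borel \<Otimes>\<^sub>M E \<rightarrow>\<^sub>M count_space UNIV"
      by measurable
  qed
  then show ?thesis by (simp add: grid_def)
qed

lemma eventually_grid_alive:
  assumes "0 \<le> t" "ennreal t < l"
  shows "\<forall>\<^sub>F n in sequentially. ennreal (grid n t) < l"
  using assms by (intro order_tendstoD(2)[OF tendsto_ennrealI[OF grid_tendsto]])

lemma alive_measurable: "Measurable.pred (borel \<Otimes>\<^sub>M E) (\<lambda>p. 0 \<le> fst p \<and> ennreal (fst p) < life X (snd p))"
proof -
  have 1: "located X r UNIV \<in> E \<rightarrow>\<^sub>M count_space UNIV" if "0 \<le> r" for r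
    using located_sets[OF that, of UNIV] by (simp add: pred_def)
  have [measurable]: "Measurable.pred (borel \<Otimes>\<^sub>M E) (\<lambda>p. located X (grid n (fst p)) UNIV (snd p))" for n
    by (rule grid_measurable[OF 1])
  \<comment> \<open>Grid times lie strictly after \<open>t\<close>, so being alive at one of them
    implies being alive at \<open>t\<close>; conversely they converge to \<open>t\<close>, which
    lies strictly below the lifetime.\<close>
  have "(0 \<le> t \<and> ennreal t < life X \<omega>) \<longleftrightarrow> (0 \<le> t \<and> (\<exists>n. located X (grid n t) UNIV \<omega>))" for t \<omega>
    using eventually_happens[OF eventually_grid_alive[of t "life X \<omega>"]] grid_bounds[of t]
    by (auto simp: located_def intro: le_less_trans[OF ennreal_leI[OF less_imp_le]])
  then show ?thesis by simp
qed

lemma path_measurable: "(\<lambda>p. path (fst p) (snd p)) \<in> borel_measurable (borel \<Otimes>\<^sub>M E)"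
proof (rule borel_measurable_LIMSEQ_order)
  let ?u = "\<lambda>n p. if 0 \<le> fst p then path (grid n (fst p)) (snd p) else 0"
  show "?u n \<in> borel_measurable (borel \<Otimes>\<^sub>M E)" for n
    using grid_measurable[OF path_measurable_at] by measurable
  fix p :: "real \<times> 'w" assume p: "p \<in> space (borel \<Otimes>\<^sub>M E)"
  obtain t \<omega> where [simp]: "p = (t, \<omega>)" by (cases p)
  have \<omega>: "\<omega> \<in> \<Omega>" using p by (auto simp: space_pair_measure)
  show "(\<lambda>n. ?u n p) \<longlonglongrightarrow> path (fst p) (snd p)"
  proof (cases "0 \<le> t \<and> ennreal t < life X \<omega>")
    case True
    then have ev: "\<forall>\<^sub>F n in sequentially. ennreal (grid n t) < life X \<omega>" by (intro eventually_grid_alive) auto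
    have 0: "0 \<le> grid n t" for n using True grid_bounds(1)[of t n] by auto
    have "(\<lambda>n. pos X (grid n t) \<omega>) \<longlonglongrightarrow> pos X t \<omega>"
      using continuous_on_tendsto_compose[OF path_continuous[OF \<omega>] grid_tendsto[of t]] True ev 0 by simp
    moreover have "\<forall>\<^sub>F n in sequentially. pos X (grid n t) \<omega> = ?u n p"
      using ev by eventually_elim (use True 0 in \<open>simp add: path_def\<close>)
    ultimately show ?thesis using True by (auto simp: path_def intro: Lim_transform_eventually)
  next
    case False
    then have "?u n p = 0" for n using grid_bounds(1)[of t n]
      by (auto simp: path_def dest: le_less_trans[OF ennreal_leI[OF less_imp_le]])
    then show ?thesis using False by (auto simp: path_def)
  qed
qed

lemma located_eq_path: "0 \<le> t \<Longrightarrow> located X t B \<omega> \<longleftrightarrow> ennreal t < life X \<omega> \<and> path t \<omega> \<in> B"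
  by (auto simp: located_def path_def)

lemma located_measurable [measurable (raw)]:
  assumes "f \<in> N \<rightarrow>\<^sub>M borel" "g \<in> N \<rightarrow>\<^sub>M E" and [measurable]: "B \<in> sets borel"
  shows "Measurable.pred N (\<lambda>z. 0 \<le> f z \<and> located X (f z) B (g z))"
proof -
  note [measurable] = path_measurable alive_measurable
  have "Measurable.pred (borel \<Otimes>\<^sub>M E) (\<lambda>p. (0 \<le> fst p \<and> ennreal (fst p) < life X (snd p)) \<and> path (fst p) (snd p) \<in> B)"
    by measurable
  then have 1: "Measurable.pred (borel \<Otimes>\<^sub>M E) (\<lambda>p. 0 \<le> fst p \<and> located X (fst p) B (snd p))"
    by (simp add: located_eq_path conj_ac cong: conj_cong)
  have "(\<lambda>z. (f z, g z)) \<in> N \<rightarrow>\<^sub>M borel \<Otimes>\<^sub>M E" using assms by simp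
  from measurable_compose[OF this 1] show ?thesis by simp
qed

lemma path_measurable' [measurable (raw)]:
  assumes "f \<in> N \<rightarrow>\<^sub>M borel" "g \<in> N \<rightarrow>\<^sub>M E"
  shows "(\<lambda>z. path (f z) (g z)) \<in> borel_measurable N"
proof -
  have "(\<lambda>z. (f z, g z)) \<in> N \<rightarrow>\<^sub>M borel \<Otimes>\<^sub>M E" using assms by simp
  from measurable_compose[OF this path_measurable] show ?thesis by simp
qed

text \<open>Paths are continuous below the lifetime only. Cutting at the time \<open>t\<close> of
  some visit to \<open>y\<close> leaves the compact interval [0, t] inside this range, where the
  visits form a closed set.\<close>

lemma hitting_attained:
  assumes \<omega>: "\<omega> \<in> \<Omega>" and fin: "hitting X y \<omega> < \<top>"
  shows "located X (enn2real (hitting X y \<omega>)) {y} \<omega>"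
proof -
  obtain t where t: "0 \<le> t" "located X t {y} \<omega>"
    using fin unfolding hitting_def by (auto simp: Inf_less_iff)
  define S where "S = {0..t} \<inter> (\<lambda>t. pos X t \<omega>) -` {y}"
  have tl: "ennreal t < life X \<omega>" using t by (auto simp: located_def)
  have cl: "closed S" unfolding S_def
    by (rule continuous_closed_preimage[OF path_continuous_Icc[OF \<omega> _ tl]]) auto
  have tS: "t \<in> S" using t by (auto simp: S_def located_def)
  have bdd: "bdd_below S" by (auto simp: S_def intro!: bdd_belowI[of _ 0])
  define \<tau> where "\<tau> = Inf S"
  have \<tau>S: "\<tau> \<in> S" unfolding \<tau>_def using cl tS bdd by (intro closed_contains_Inf) auto
  then have \<tau>: "0 \<le> \<tau>" "\<tau> \<le> t" "pos X \<tau> \<omega> = y" by (auto simp: S_def)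
  have l: "located X \<tau> {y} \<omega>" using \<tau> tl by (auto simp: located_def intro: le_less_trans[OF ennreal_leI])
  have "hitting X y \<omega> = ennreal \<tau>"
  proof (rule antisym)
    show "hitting X y \<omega> \<le> ennreal \<tau>" using \<tau> l by (intro hitting_le)
    show "ennreal \<tau> \<le> hitting X y \<omega>" unfolding hitting_def
    proof (rule Inf_greatest)
      fix z assume "z \<in> {ennreal t |t. 0 \<le> t \<and> located X t {y} \<omega>}"
      then obtain t' where t': "z = ennreal t'" "0 \<le> t'" "located X t' {y} \<omega>" by auto
      have "\<tau> \<le> t'"
      proof (cases "t' \<le> t")
        case True
        then have "t' \<in> S" using t' by (auto simp: S_def located_def)
        then show ?thesis unfolding \<tau>_def using bdd by (rule cInf_lower)
      qed (use \<tau> in auto)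
      then show "ennreal \<tau> \<le> z" using t' by (auto intro: ennreal_leI)
    qed
  qed
  then show ?thesis using l \<tau> by simp
qed

lemma path_ivt:
  assumes \<omega>: "\<omega> \<in> \<Omega>" and t: "0 \<le> t" "ennreal t < life X \<omega>"
    and y: "pos X 0 \<omega> \<le> y \<and> y \<le> pos X t \<omega> \<or> pos X t \<omega> \<le> y \<and> y \<le> pos X 0 \<omega>"
  shows "hitting X y \<omega> \<le> ennreal t"
proof -
  have c: "continuous_on {0..t} (\<lambda>t. pos X t \<omega>)" using path_continuous_Icc[OF \<omega> _ t(2), of 0] by simp
  have "\<exists>r\<ge>0. r \<le> t \<and> pos X r \<omega> = y" using y IVT'[OF _ _ t(1) c] IVT2'[OF _ _ t(1) c] by blast
  then obtain r where r: "0 \<le> r" "r \<le> t" "pos X r \<omega> = y" by auto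
  then have "hitting X y \<omega> \<le> ennreal r"
    using t by (intro hitting_le) (auto simp: located_def intro: le_less_trans[OF ennreal_leI])
  then show ?thesis using r(2) by (meson ennreal_leI order_trans)
qed

section \<open>Hitting times as stopping times\<close>

lemma natural_filtration_mono:
  assumes "t \<le> u" shows "sets (natural_filtration X t) \<subseteq> sets (natural_filtration X u)"
proof -
  let ?G = "\<lambda>t. {{\<omega> \<in> \<Omega>. located X r B \<omega>} | r B. 0 \<le> r \<and> ennreal r \<le> t \<and> B \<in> sets borel}"
  have "?G v \<subseteq> Pow \<Omega>" for v by auto
  moreover have "?G t \<subseteq> ?G u" using assms by (blast intro: order_trans)
  ultimately show ?thesis unfolding natural_filtration_def by (simp add: sigma_sets_mono')
qed

lemma natural_filtration_located:
  assumes "0 \<le> r" "ennreal r \<le> t" "B \<in> sets borel"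
  shows "{\<omega> \<in> \<Omega>. located X r B \<omega>} \<in> sets (natural_filtration X t)"
proof -
  let ?G = "{{\<omega> \<in> \<Omega>. located X r B \<omega>} | r B. 0 \<le> r \<and> ennreal r \<le> t \<and> B \<in> sets borel}"
  have "?G \<subseteq> Pow \<Omega>" by auto
  then show ?thesis unfolding natural_filtration_def using assms by (auto intro!: sigma_sets.Basic)
qed

lemma space_natural_filtration [simp]: "space (natural_filtration X t) = \<Omega>"
  by (simp add: natural_filtration_def space_measure_of_conv)

lemma natural_filtration_sub: "sets (natural_filtration X t) \<subseteq> sets E"
proof -
  let ?G = "{{\<omega> \<in> \<Omega>. located X r B \<omega>} | r B. 0 \<le> r \<and> ennreal r \<le> t \<and> B \<in> sets borel}"
  have "?G \<subseteq> Pow \<Omega>" by auto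
  moreover have "?G \<subseteq> sets E" using located_sets by auto
  ultimately show ?thesis unfolding natural_filtration_def by (simp add: sets.sigma_sets_subset)
qed

text \<open>Countably many times suffice: \<open>y\<close> is hit before \<open>c\<close> iff, for
  some rational \<open>q < c\<close> at which the path is alive, the path enters each neighbourhood
  of a countable base at \<open>y\<close> at a rational time up to \<open>q\<close>. The image of
  [0, q] is compact, so coming arbitrarily close means hitting.\<close>

lemma hitting_less_sets: "{\<omega> \<in> \<Omega>. hitting X y \<omega> < c} \<in> sets (natural_filtration X c)"
proof -
  obtain U :: "nat \<Rightarrow> ennreal set" where U: "\<And>i. open (U i)" "\<And>i. y \<in> U i"
    "\<And>S. open S \<Longrightarrow> y \<in> S \<Longrightarrow> eventually (\<lambda>i. U i \<subseteq> S) sequentially"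
    by (rule countable_basis_at_decseq[of y]) blast
  let ?N = "natural_filtration X c"
  have "{\<omega> \<in> \<Omega>. hitting X y \<omega> < c} =
     (\<Union>q\<in>{q\<in>\<rat>. 0 \<le> q \<and> ennreal q < c}. {\<omega> \<in> \<Omega>. located X q UNIV \<omega>} \<inter>
        (\<Inter>n. (\<Union>r\<in>{r\<in>\<rat>. 0 \<le> r \<and> r \<le> q}. {\<omega> \<in> \<Omega>. located X r (U n) \<omega>})))" (is "?L = ?R")
  proof (intro set_eqI iffI)
    fix \<omega> assume "\<omega> \<in> ?L"
    then have \<omega>: "\<omega> \<in> \<Omega>" and h: "hitting X y \<omega> < c" by auto
    have "hitting X y \<omega> < \<top>" using h by (rule less_le_trans) simp
    from hitting_attained[OF \<omega> this] have l: "located X (enn2real (hitting X y \<omega>)) {y} \<omega>" .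
    define r0 where "r0 = enn2real (hitting X y \<omega>)"
    have r0: "0 \<le> r0" "ennreal r0 = hitting X y \<omega>" using \<open>hitting X y \<omega> < \<top>\<close> by (auto simp: r0_def)
    have l0: "ennreal r0 < life X \<omega>" "pos X r0 \<omega> = y" using l by (auto simp: located_def r0_def)
    \<comment> \<open>\<open>q\<close> lies strictly after the hitting time, which leaves room for
      rational times to the right of it.\<close>
    obtain q where q: "q \<in> \<rat>" "r0 < q" "ennreal q < min c (life X \<omega>)"
      using ennreal_less_life_rat[of r0 "min c (life X \<omega>)"] h r0 l0 by auto
    have ql: "ennreal q < life X \<omega>" using q by auto
    have "\<exists>r\<in>{r\<in>\<rat>. 0 \<le> r \<and> r \<le> q}. located X r (U n) \<omega>" for n
    proof -
      have c: "continuous_on {0..q} (\<lambda>t. pos X t \<omega>)" using path_continuous_Icc[OF \<omega> _ ql, of 0] by simp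
      have "((\<lambda>t. pos X t \<omega>) \<longlongrightarrow> pos X r0 \<omega>) (at r0 within {0..q})"
        using c q r0 by (auto simp: continuous_on_def)
      then have "\<forall>\<^sub>F t in at r0 within {0..q}. pos X t \<omega> \<in> U n"
        using U l0 by (auto intro: topological_tendstoD)
      then obtain d where d: "d > 0" "\<And>t. t \<in> {0..q} \<Longrightarrow> t \<noteq> r0 \<Longrightarrow> dist t r0 < d \<Longrightarrow> pos X t \<omega> \<in> U n"
        unfolding eventually_at by blast
      obtain r where r: "r \<in> \<rat>" "r0 < r" "r < min q (r0 + d)" using Rats_dense_in_real[of r0 "min q (r0+d)"] q d by auto
      then have "pos X r \<omega> \<in> U n" using d(2)[of r] r0 by (auto simp: dist_real_def)
      moreover have "ennreal r < life X \<omega>" using r ql by (auto intro: le_less_trans[OF ennreal_leI[OF less_imp_le]])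
      ultimately show ?thesis using r r0 by (auto simp: located_def)
    qed
    then show "\<omega> \<in> ?R" using q r0 \<omega> by (auto simp: located_def intro!: bexI[of _ q])
  next
    fix \<omega> assume "\<omega> \<in> ?R"
    then obtain q where q1: "q \<in> {q\<in>\<rat>. 0 \<le> q \<and> ennreal q < c}" and q2: "\<omega> \<in> {\<omega> \<in> \<Omega>. located X q UNIV \<omega>}"
      and q3: "\<omega> \<in> (\<Inter>n. (\<Union>r\<in>{r\<in>\<rat>. 0 \<le> r \<and> r \<le> q}. {\<omega> \<in> \<Omega>. located X r (U n) \<omega>}))"
      by (elim UN_E IntE)
    then have q: "0 \<le> q" "ennreal q < c" "located X q UNIV \<omega>" and \<omega>: "\<omega> \<in> \<Omega>" by auto
    have r: "\<exists>r. 0 \<le> r \<and> r \<le> q \<and> located X r (U n) \<omega>" for n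
      using INT_D[OF q3 UNIV_I, of n] by auto
    have ql: "ennreal q < life X \<omega>" using q by (auto simp: located_def)
    have "compact ((\<lambda>t. pos X t \<omega>) ` {0..q})"
      using path_continuous_Icc[OF \<omega> _ ql, of 0] by (intro compact_continuous_image) auto
    then have cl: "closed ((\<lambda>t. pos X t \<omega>) ` {0..q})" by (rule compact_imp_closed)
    have "y \<in> (\<lambda>t. pos X t \<omega>) ` {0..q}"
    proof (rule ccontr)
      assume "y \<notin> (\<lambda>t. pos X t \<omega>) ` {0..q}"
      then have "eventually (\<lambda>i. U i \<subseteq> - ((\<lambda>t. pos X t \<omega>) ` {0..q})) sequentially"
        using cl by (intro U) auto
      then obtain i where "U i \<subseteq> - ((\<lambda>t. pos X t \<omega>) ` {0..q})" by (auto simp: eventually_sequentially)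
      then show False using r[of i] by (auto simp: located_def)
    qed
    then obtain r where "0 \<le> r" "r \<le> q" "pos X r \<omega> = y" by auto
    then have "hitting X y \<omega> \<le> ennreal r"
      using ql by (intro hitting_le) (auto simp: located_def intro: le_less_trans[OF ennreal_leI])
    also have "\<dots> \<le> ennreal q" using \<open>r \<le> q\<close> by (rule ennreal_leI)
    finally show "\<omega> \<in> ?L" using q \<omega> by auto
  qed
  also have "?R \<in> sets ?N"
  proof (rule sets.countable_UN'')
    show "countable {q\<in>\<rat>. 0 \<le> q \<and> ennreal q < c}" by (rule countable_subset[OF _ countable_rat]) auto
    fix q :: real assume q: "q \<in> {q\<in>\<rat>. 0 \<le> q \<and> ennreal q < c}"
    have r: "ennreal r \<le> c" if "r \<le> q" for r
      using q that by (auto intro: order_trans[OF ennreal_leI less_imp_le])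
    have 1: "(\<Union>r\<in>{r\<in>\<rat>. 0 \<le> r \<and> r \<le> q}. {\<omega> \<in> \<Omega>. located X r (U n) \<omega>}) \<in> sets ?N" for n
    proof (rule sets.countable_UN'')
      show "countable {r\<in>\<rat>. 0 \<le> r \<and> r \<le> q}" by (rule countable_subset[OF _ countable_rat]) auto
    qed (use U(1) r in \<open>auto intro!: natural_filtration_located\<close>)
    have "(\<Inter>n. (\<Union>r\<in>{r\<in>\<rat>. 0 \<le> r \<and> r \<le> q}. {\<omega> \<in> \<Omega>. located X r (U n) \<omega>})) \<in> sets ?N"
      by (rule sets.countable_INT) (use 1 in auto)
    moreover have "{\<omega> \<in> \<Omega>. located X q UNIV \<omega>} \<in> sets ?N"
      using q r[of q] by (intro natural_filtration_located) auto
    ultimately show "{\<omega> \<in> \<Omega>. located X q UNIV \<omega>} \<inter>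
        (\<Inter>n. (\<Union>r\<in>{r\<in>\<rat>. 0 \<le> r \<and> r \<le> q}. {\<omega> \<in> \<Omega>. located X r (U n) \<omega>})) \<in> sets ?N"
      by (rule sets.Int[rotated])
  qed
  finally show ?thesis .
qed

lemma hitting_measurable [measurable]: "hitting X y \<in> borel_measurable E"
  by (rule borel_measurableI_less) (use hitting_less_sets natural_filtration_sub in auto)

lemma right_filtrationI:
  assumes "A \<in> sets (natural_filtration X \<top>)" "\<And>u. t < u \<Longrightarrow> A \<in> sets (natural_filtration X u)"
  shows "A \<in> sets (right_filtration X t)"
proof -
  have "{A \<in> sets (natural_filtration X \<top>). \<forall>u>t. A \<in> sets (natural_filtration X u)} \<subseteq> Pow \<Omega>"
    using sets.sets_into_space[of _ "natural_filtration X \<top>"] by auto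
  then show ?thesis unfolding right_filtration_def using assms by (auto intro!: sigma_sets.Basic)
qed

sublocale F: filtration \<Omega> "right_filtration X"
  by (rule filtration_right_filtration)

text \<open>The strict inequalities are events of the past, and the non-strict one is their limit
  from the right; \<open>right_filtration\<close> is closed under such limits.\<close>

lemma hitting_stopping_time: "stopping_time (right_filtration X) (hitting X y)"
proof (rule stopping_timeI)
  fix t
  have u: "{\<omega> \<in> \<Omega>. hitting X y \<omega> \<le> t} \<in> sets (natural_filtration X u)" if "t < u" for u
  proof -
    \<comment> \<open>The minimum with \<open>u\<close> keeps every set of the intersection in the
      past of \<open>u\<close>.\<close>
    have "{\<omega> \<in> \<Omega>. hitting X y \<omega> \<le> t} = (\<Inter>n. {\<omega> \<in> \<Omega>. hitting X y \<omega> < min u (t + ennreal (1 / real (Suc n)))})"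
    proof (intro set_eqI iffI)
      fix \<omega> assume *: "\<omega> \<in> {\<omega> \<in> \<Omega>. hitting X y \<omega> \<le> t}"
      have "t < \<top>" using that by (rule less_le_trans) simp
      then have "t < t + ennreal (1 / real (Suc n))" for n by (cases t) (auto simp: ennreal_plus[symmetric] ennreal_less_iff simp del: ennreal_plus)
      then show "\<omega> \<in> (\<Inter>n. {\<omega> \<in> \<Omega>. hitting X y \<omega> < min u (t + ennreal (1 / real (Suc n)))})"
        using * that by (auto intro: le_less_trans)
    next
      fix \<omega> assume *: "\<omega> \<in> (\<Inter>n. {\<omega> \<in> \<Omega>. hitting X y \<omega> < min u (t + ennreal (1 / real (Suc n)))})"
      have "hitting X y \<omega> \<le> t"
      proof (rule ccontr)
        assume "\<not> hitting X y \<omega> \<le> t"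
        then obtain n where "t + ennreal (1 / real (Suc n)) < hitting X y \<omega>"
          using less_ennreal_add_inverse_Suc[of t "hitting X y \<omega>"] by (metis not_le)
        moreover have "hitting X y \<omega> < t + ennreal (1 / real (Suc n))" using * by auto
        ultimately show False by auto
      qed
      then show "\<omega> \<in> {\<omega> \<in> \<Omega>. hitting X y \<omega> \<le> t}" using * by auto
    qed
    also have "\<dots> \<in> sets (natural_filtration X u)"
    proof (rule sets.countable_INT')
      show "range (\<lambda>n. {\<omega> \<in> \<Omega>. hitting X y \<omega> < min u (t + ennreal (1 / real (Suc n)))}) \<subseteq> sets (natural_filtration X u)"
        using hitting_less_sets natural_filtration_mono[of "min u v" u for v] by (blast intro: min.cobounded1)
    qed auto
    finally show ?thesis .
  qed
  have "{\<omega> \<in> \<Omega>. hitting X y \<omega> \<le> t} \<in> sets (natural_filtration X \<top>)"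
  proof (cases "t = \<top>")
    case True
    then show ?thesis using sets.top[of "natural_filtration X \<top>"] by simp
  next
    case False
    then show ?thesis by (intro u) (simp add: less_top)
  qed
  from right_filtrationI[OF this u] show "Measurable.pred (right_filtration X t) (\<lambda>\<omega>. hitting X y \<omega> \<le> t)"
    by (simp add: pred_def F.space_F)
qed

lemma strong_markov_at:
  assumes "x \<in> I" "stopping_time (right_filtration X) T" "0 \<le> t" "B \<in> sets borel"
  shows "emeasure (law X x) {\<omega> \<in> \<Omega>. T \<omega> < life X \<omega> \<and> located X (enn2real (T \<omega>) + t) B \<omega>} =
    (\<integral>\<^sup>+\<omega> \<in> {\<omega> \<in> \<Omega>. T \<omega> < life X \<omega>}.
       emeasure (law X (pos X (enn2real (T \<omega>)) \<omega>)) {\<omega>' \<in> \<Omega>. located X t B \<omega>'} \<partial>law X x)"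
proof -
  have "\<Omega> \<in> sets (F.pre_sigma T)" using sets.top[of "F.pre_sigma T"] by (simp add: F.space_pre_sigma)
  then show ?thesis using diffusion assms unfolding one_dim_diffusion_def strong_markov_def by blast
qed

end

section \<open>Occupation measures\<close>

text \<open>Serves for splitting occupation measures: at a hitting time, with \<open>q = 0\<close>,
  and at the exit from an interval, with one coefficient for each end point.\<close>

lemma nn_integral_eq_combination:
  assumes [measurable_cong]: "sets N = sets N0" "sets N1 = sets N0" "sets N2 = sets N0" "sets N3 = sets N0"
    and eq: "\<And>A. A \<in> sets N0 \<Longrightarrow> emeasure N A = emeasure N1 A + p * emeasure N2 A + q * emeasure N3 A"
    and f: "f \<in> borel_measurable N0"
  shows "(\<integral>\<^sup>+x. f x \<partial>N) = (\<integral>\<^sup>+x. f x \<partial>N1) + p * (\<integral>\<^sup>+x. f x \<partial>N2) + q * (\<integral>\<^sup>+x. f x \<partial>N3)"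
  using f
proof induction
  case (cong f g)
  have sp: "space N = space N0" "space N1 = space N0" "space N2 = space N0" "space N3 = space N0"
    using assms(1-4)[THEN sets_eq_imp_space_eq] by auto
  show ?case using cong(4) nn_integral_cong[of N f g] nn_integral_cong[of N1 f g]
    nn_integral_cong[of N2 f g] nn_integral_cong[of N3 f g] cong(3) sp by simp
next
  case (set A)
  then show ?case using eq by simp
next
  case (mult u c)
  then have [measurable]: "u \<in> borel_measurable N0" by simp
  show ?case using mult by (simp add: nn_integral_cmult distrib_left mult.left_commute)
next
  case (add u v)
  then have [measurable]: "u \<in> borel_measurable N0" "v \<in> borel_measurable N0" by simp_all
  show ?case using add by (simp add: nn_integral_add distrib_left ac_simps)
next
  case (seq U)
  then have Um: "\<And>i. U i \<in> borel_measurable N0" by simp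
  have "(\<integral>\<^sup>+x. (SUP i. U i) x \<partial>K) = (SUP i. \<integral>\<^sup>+x. U i x \<partial>K)" if "sets K = sets N0" for K
  proof -
    have "U i \<in> borel_measurable K" for i unfolding measurable_cong_sets[OF that refl] by (rule Um)
    from nn_integral_monotone_convergence_SUP[OF seq(3) this] show ?thesis by (simp add: image_image)
  qed
  note sup = this
  have "incseq (\<lambda>i. \<integral>\<^sup>+x. U i x \<partial>K)" for K
    using seq(3) by (auto simp: incseq_def le_fun_def intro!: nn_integral_mono)
  note inc = this
  have inc2: "incseq (\<lambda>i. p * (\<integral>\<^sup>+x. U i x \<partial>N2))" "incseq (\<lambda>i. q * (\<integral>\<^sup>+x. U i x \<partial>N3))"
    using inc by (auto simp: incseq_def intro!: mult_left_mono)
  have inc3: "incseq (\<lambda>i. (\<integral>\<^sup>+x. U i x \<partial>N1) + p * (\<integral>\<^sup>+x. U i x \<partial>N2))"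
    using inc inc2 by (auto simp: incseq_def intro!: add_mono)
  have "(\<integral>\<^sup>+x. (SUP i. U i) x \<partial>N) = (SUP i. (\<integral>\<^sup>+x. U i x \<partial>N1) + p * (\<integral>\<^sup>+x. U i x \<partial>N2) + q * (\<integral>\<^sup>+x. U i x \<partial>N3))"
    unfolding sup[OF assms(1)] using seq.IH by simp
  also have "\<dots> = (SUP i. \<integral>\<^sup>+x. U i x \<partial>N1) + p * (SUP i. \<integral>\<^sup>+x. U i x \<partial>N2) + q * (SUP i. \<integral>\<^sup>+x. U i x \<partial>N3)"
    by (simp add: ennreal_SUP_add inc inc2 inc3 SUP_mult_left_ennreal)
  finally show ?case unfolding sup[OF assms(2)] sup[OF assms(3)] sup[OF assms(4)] seq(4) .
qed

context diffusion_family
begin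

text \<open>Time spent at 0 is not counted, so that \<open>W = \<top>\<close> yields the Green
  measure of the killed process without naming the absorption time.\<close>

definition occ_set :: "('w \<Rightarrow> ennreal) \<Rightarrow> ('w \<times> real) set" where
  "occ_set W = {p. 0 \<le> snd p \<and> located X (snd p) {0<..} (fst p) \<and> ennreal (snd p) < W (fst p)}"

text \<open>An image of the law times Lebesgue measure: it is a measure by construction, and its
  integrals are instances of Fubini's theorem.\<close>

definition occ :: "ennreal \<Rightarrow> ('w \<Rightarrow> ennreal) \<Rightarrow> ennreal measure" where
  "occ y W = distr (restrict_space (law X y \<Otimes>\<^sub>M lborel) (occ_set W)) borel (\<lambda>p. path (snd p) (fst p))"

abbreviation "potential y \<equiv> occ y (\<lambda>_. \<top>)"

lemma sets_occ [simp, measurable_cong]: "sets (occ y W) = sets borel"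
  by (simp add: occ_def)

lemma space_occ [simp]: "space (occ y W) = UNIV"
  by (simp add: occ_def)

lemma occ_set_measurable [measurable]:
  assumes [measurable]: "W \<in> borel_measurable E"
  shows "Measurable.pred (E \<Otimes>\<^sub>M borel) (\<lambda>p. p \<in> occ_set W)"
proof -
  have "Measurable.pred (E \<Otimes>\<^sub>M borel) (\<lambda>p. (0 \<le> snd p \<and> located X (snd p) {0<..} (fst p)) \<and> ennreal (snd p) < W (fst p))"
    by measurable
  then show ?thesis by (simp add: occ_set_def)
qed

lemma nn_integral_occ:
  assumes y: "y \<in> I" and W: "W \<in> borel_measurable E" and \<phi>[measurable]: "\<phi> \<in> borel_measurable borel"
  shows "(\<integral>\<^sup>+z. \<phi> z \<partial>occ y W) =
    (\<integral>\<^sup>+\<omega>. \<integral>\<^sup>+t. \<phi> (path t \<omega>) * indicator (occ_set W) (\<omega>, t) \<partial>lborel \<partial>law X y)"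
proof -
  note [measurable_cong] = sets_law[OF y]
  note [measurable] = occ_set_measurable[OF W]
  have "occ_set W \<inter> space (law X y \<Otimes>\<^sub>M lborel) = {p\<in>space (law X y \<Otimes>\<^sub>M lborel). p \<in> occ_set W}" by auto
  also have "\<dots> \<in> sets (law X y \<Otimes>\<^sub>M lborel)" by measurable
  finally have s: "occ_set W \<inter> space (law X y \<Otimes>\<^sub>M lborel) \<in> sets (law X y \<Otimes>\<^sub>M lborel)" .
  have "(\<integral>\<^sup>+z. \<phi> z \<partial>occ y W) =
     (\<integral>\<^sup>+p. \<phi> (path (snd p) (fst p)) \<partial>restrict_space (law X y \<Otimes>\<^sub>M lborel) (occ_set W))"
  proof -
    have pm: "(\<lambda>p. path (snd p) (fst p)) \<in> borel_measurable (law X y \<Otimes>\<^sub>M lborel)" by measurable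
    show ?thesis unfolding occ_def by (rule nn_integral_distr[OF measurable_restrict_space1[OF pm]]) simp
  qed
  also have "\<dots> = (\<integral>\<^sup>+p. \<phi> (path (snd p) (fst p)) * indicator (occ_set W) p \<partial>(law X y \<Otimes>\<^sub>M lborel))"
    by (rule nn_integral_restrict_space[OF s])
  also have "\<dots> = (\<integral>\<^sup>+\<omega>. \<integral>\<^sup>+t. \<phi> (path t \<omega>) * indicator (occ_set W) (\<omega>, t) \<partial>lborel \<partial>law X y)"
    by (subst lborel.nn_integral_fst[symmetric]) (simp_all, measurable)
  finally show ?thesis .
qed

lemma pair_law: "y \<in> I \<Longrightarrow> pair_sigma_finite (law X y) lborel"
  using prob_space_law[of y] by (auto simp: pair_sigma_finite_def prob_space_imp_sigma_finite lborel.sigma_finite_measure_axioms)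

lemma emeasure_occ:
  assumes y: "y \<in> I" and W[measurable]: "W \<in> borel_measurable E" and B[measurable]: "B \<in> sets borel"
  shows "emeasure (occ y W) B =
    (\<integral>\<^sup>+t\<in>{0..}. emeasure (law X y) {\<omega> \<in> \<Omega>. located X t (B \<inter> {0<..}) \<omega> \<and> ennreal t < W \<omega>} \<partial>lborel)"
proof -
  note [measurable_cong] = sets_law[OF y]
  interpret pair_sigma_finite "law X y" lborel by (rule pair_law[OF y])
  have "emeasure (occ y W) B = (\<integral>\<^sup>+z. indicator B z \<partial>occ y W)" by simp
  also have "\<dots> = (\<integral>\<^sup>+\<omega>. \<integral>\<^sup>+t. indicator B (path t \<omega>) * indicator (occ_set W) (\<omega>, t) \<partial>lborel \<partial>law X y)"
    by (rule nn_integral_occ[OF y W]) measurable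
  also have "\<dots> = (\<integral>\<^sup>+t. \<integral>\<^sup>+\<omega>. indicator B (path t \<omega>) * indicator (occ_set W) (\<omega>, t) \<partial>law X y \<partial>lborel)"
    by (rule Fubini'[symmetric]) measurable
  also have "\<dots> = (\<integral>\<^sup>+t\<in>{0..}. emeasure (law X y) {\<omega> \<in> \<Omega>. located X t (B \<inter> {0<..}) \<omega> \<and> ennreal t < W \<omega>} \<partial>lborel)"
  proof (rule nn_integral_cong)
    fix t :: real
    show "(\<integral>\<^sup>+\<omega>. indicator B (path t \<omega>) * indicator (occ_set W) (\<omega>, t) \<partial>law X y) =
       emeasure (law X y) {\<omega> \<in> \<Omega>. located X t (B \<inter> {0<..}) \<omega> \<and> ennreal t < W \<omega>} * indicator {0..} t"
    proof (cases "0 \<le> t")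
      case True
      have "(\<integral>\<^sup>+\<omega>. indicator B (path t \<omega>) * indicator (occ_set W) (\<omega>, t) \<partial>law X y) =
         (\<integral>\<^sup>+\<omega>. indicator {\<omega> \<in> \<Omega>. located X t (B \<inter> {0<..}) \<omega> \<and> ennreal t < W \<omega>} \<omega> \<partial>law X y)"
        using True by (intro nn_integral_cong) (auto simp: occ_set_def located_def path_def space_law[OF y] split: split_indicator)
      also have "\<dots> = emeasure (law X y) {\<omega> \<in> \<Omega>. located X t (B \<inter> {0<..}) \<omega> \<and> ennreal t < W \<omega>}"
      proof (rule nn_integral_indicator)
        have "{\<omega> \<in> \<Omega>. located X t (B \<inter> {0<..}) \<omega> \<and> ennreal t < W \<omega>} =
          {\<omega> \<in> \<Omega>. located X t (B \<inter> {0<..}) \<omega>} \<inter> {\<omega>\<in>\<Omega>. ennreal t < W \<omega>}" by auto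
        also have "\<dots> \<in> sets E" by (intro sets.Int located_sets True) measurable
        finally show "{\<omega> \<in> \<Omega>. located X t (B \<inter> {0<..}) \<omega> \<and> ennreal t < W \<omega>} \<in> sets (law X y)"
          by (simp add: sets_law[OF y])
      qed
      finally show ?thesis using True by simp
    next
      case False
      then show ?thesis by (simp add: occ_set_def)
    qed
  qed
  finally show ?thesis .
qed

definition transition :: "real \<Rightarrow> ennreal \<Rightarrow> ennreal set \<Rightarrow> ennreal" where
  "transition t y B = emeasure (law X y) {\<omega> \<in> \<Omega>. located X t B \<omega>}"

lemma emeasure_potential:
  assumes y: "y \<in> I" and B: "B \<in> sets borel"
  shows "emeasure (potential y) B = (\<integral>\<^sup>+t\<in>{0..}. transition t y (B \<inter> {0<..}) \<partial>lborel)"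
  using emeasure_occ[OF y _ B, of "\<lambda>_. \<top>"] by (simp add: transition_def)

text \<open>The time integral is split at \<open>T\<close>, and in the later part time is counted
  from \<open>T\<close>. The strong Markov property is applied for each fixed further time and
  integrated afterwards, which avoids any statement about whole shifted paths.\<close>

lemma occ_strong_markov:
  assumes y: "y \<in> I" and T: "stopping_time (right_filtration X) T" and Tm[measurable]: "T \<in> borel_measurable E"
    and TL: "\<And>\<omega>. \<omega> \<in> \<Omega> \<Longrightarrow> T \<omega> < \<top> \<Longrightarrow> T \<omega> < life X \<omega>" and B[measurable]: "B \<in> sets borel"
  shows "emeasure (potential y) B = emeasure (occ y T) B +
    (\<integral>\<^sup>+t\<in>{0..}. (\<integral>\<^sup>+\<omega>\<in>{\<omega>\<in>\<Omega>. T \<omega> < \<top>}. transition t (pos X (enn2real (T \<omega>)) \<omega>) (B \<inter> {0<..}) \<partial>law X y) \<partial>lborel)"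
proof -
  note [measurable_cong] = sets_law[OF y]
  interpret pair_sigma_finite "law X y" lborel by (rule pair_law[OF y])
  define B' where "B' = B \<inter> {0<..}"
  have [measurable]: "B' \<in> sets borel" by (simp add: B'_def)
  let ?f = "\<lambda>\<omega> t. (indicator B (path t \<omega>) * indicator (occ_set (\<lambda>_. \<top>)) (\<omega>, t) :: ennreal)"
  \<comment> \<open>The condition \<open>0 \<le> enn2real (T \<omega>) + t\<close> gives the
    predicate the form in which \<open>located\<close> is jointly measurable.\<close>
  let ?g = "\<lambda>\<omega> t. if 0 \<le> t \<and> T \<omega> < \<top> \<and> 0 \<le> enn2real (T \<omega>) + t \<and> located X (enn2real (T \<omega>) + t) B' \<omega> then 1 else (0::ennreal)"
  have gm: "(\<lambda>p. ?g (fst p) (snd p)) \<in> borel_measurable (law X y \<Otimes>\<^sub>M lborel)"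
    by measurable
  have fm: "(\<lambda>p. ?f (fst p) (snd p)) \<in> borel_measurable (law X y \<Otimes>\<^sub>M lborel)"
    by measurable
  have f_split: "?f \<omega> t = indicator B (path t \<omega>) * indicator (occ_set T) (\<omega>, t) + ?f \<omega> t * indicator {t. T \<omega> \<le> ennreal t} t" for \<omega> t
    by (auto simp: occ_set_def split: split_indicator)
  have shift: "(\<integral>\<^sup>+t. ?f \<omega> t * indicator {t. T \<omega> \<le> ennreal t} t \<partial>lborel) = (\<integral>\<^sup>+t. ?g \<omega> t \<partial>lborel)" if \<omega>: "\<omega> \<in> \<Omega>" for \<omega>
  proof (cases "T \<omega> = \<top>")
    case True
    then show ?thesis by (simp add: indicator_def top_unique)
  next
    case False
    define c where "c = enn2real (T \<omega>)"
    have c: "T \<omega> = ennreal c" "0 \<le> c" using False by (auto simp: c_def less_top)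
    have [measurable]: "(\<lambda>t. ?f \<omega> t * indicator {t. T \<omega> \<le> ennreal t} t) \<in> borel_measurable lborel"
      using \<omega> fm measurable_Pair2[of "\<lambda>p. ?f (fst p) (snd p)" "law X y" lborel borel \<omega>] by (simp add: space_law[OF y])
    have "(\<integral>\<^sup>+t. ?f \<omega> t * indicator {t. T \<omega> \<le> ennreal t} t \<partial>lborel) =
       ennreal \<bar>1\<bar> * (\<integral>\<^sup>+t. ?f \<omega> (c + 1 * t) * indicator {t. T \<omega> \<le> ennreal t} (c + 1 * t) \<partial>lborel)"
      by (rule nn_integral_real_affine) simp_all
    also have "\<dots> = (\<integral>\<^sup>+t. ?f \<omega> (c + t) * indicator {t. T \<omega> \<le> ennreal t} (c + t) \<partial>lborel)" by simp
    also have "\<dots> = (\<integral>\<^sup>+t. ?g \<omega> t \<partial>lborel)"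
    proof (rule nn_integral_cong_AE)
      have "AE t in lborel. t \<noteq> - c" by (rule AE_lborel_singleton)
      then show "AE t in lborel. ?f \<omega> (c + t) * indicator {t. T \<omega> \<le> ennreal t} (c + t) = ?g \<omega> t"
      proof eventually_elim
        case (elim t)
        have "ennreal c \<le> ennreal (c + t) \<longleftrightarrow> 0 \<le> t \<or> c = 0" using c
          by (cases "0 \<le> c + t") (auto simp: ennreal_neg)
        then show ?case using c elim unfolding c(1) enn2real_ennreal[OF c(2)]
          by (cases "0 \<le> t") (auto simp: occ_set_def B'_def located_def path_def split: split_indicator)
      qed
    qed
    finally show ?thesis .
  qed
  have "emeasure (potential y) B = (\<integral>\<^sup>+\<omega>. \<integral>\<^sup>+t. ?f \<omega> t \<partial>lborel \<partial>law X y)"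
    using nn_integral_occ[OF y, of "\<lambda>_. \<top>" "indicator B"] by simp
  also have "\<dots> = (\<integral>\<^sup>+\<omega>. (\<integral>\<^sup>+t. indicator B (path t \<omega>) * indicator (occ_set T) (\<omega>, t) \<partial>lborel)
       + (\<integral>\<^sup>+t. ?g \<omega> t \<partial>lborel) \<partial>law X y)"
  proof (rule nn_integral_cong)
    fix \<omega> assume "\<omega> \<in> space (law X y)"
    then have \<omega>: "\<omega> \<in> \<Omega>" by (simp add: space_law[OF y])
    have 1: "(\<lambda>t. indicator B (path t \<omega>) * indicator (occ_set T) (\<omega>, t) :: ennreal) \<in> borel_measurable lborel"
      using \<omega> measurable_Pair2[of "\<lambda>p. indicator B (path (snd p) (fst p)) * indicator (occ_set T) p :: ennreal" "law X y" lborel borel \<omega>]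
      by (simp add: space_law[OF y])
    have 2: "(\<lambda>t. ?f \<omega> t * indicator {t. T \<omega> \<le> ennreal t} t) \<in> borel_measurable lborel"
      using \<omega> fm measurable_Pair2[of "\<lambda>p. ?f (fst p) (snd p)" "law X y" lborel borel \<omega>] by (simp add: space_law[OF y])
    have "(\<integral>\<^sup>+t. ?f \<omega> t \<partial>lborel) = (\<integral>\<^sup>+t. (indicator B (path t \<omega>) * indicator (occ_set T) (\<omega>, t)) + ?f \<omega> t * indicator {t. T \<omega> \<le> ennreal t} t \<partial>lborel)"
      by (rule nn_integral_cong) (rule f_split)
    also have "\<dots> = (\<integral>\<^sup>+t. indicator B (path t \<omega>) * indicator (occ_set T) (\<omega>, t) \<partial>lborel) + (\<integral>\<^sup>+t. ?f \<omega> t * indicator {t. T \<omega> \<le> ennreal t} t \<partial>lborel)"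
      by (rule nn_integral_add[OF 1 2])
    finally show "(\<integral>\<^sup>+t. ?f \<omega> t \<partial>lborel) = (\<integral>\<^sup>+t. indicator B (path t \<omega>) * indicator (occ_set T) (\<omega>, t) \<partial>lborel)
       + (\<integral>\<^sup>+t. ?g \<omega> t \<partial>lborel)" unfolding shift[OF \<omega>] .
  qed
  also have "\<dots> = (\<integral>\<^sup>+\<omega>. (\<integral>\<^sup>+t. indicator B (path t \<omega>) * indicator (occ_set T) (\<omega>, t) \<partial>lborel) \<partial>law X y)
       + (\<integral>\<^sup>+\<omega>. (\<integral>\<^sup>+t. ?g \<omega> t \<partial>lborel) \<partial>law X y)"
    using gm by (intro nn_integral_add) measurable
  also have "(\<integral>\<^sup>+\<omega>. (\<integral>\<^sup>+t. indicator B (path t \<omega>) * indicator (occ_set T) (\<omega>, t) \<partial>lborel) \<partial>law X y) = emeasure (occ y T) B"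
    using nn_integral_occ[OF y Tm, of "indicator B"] by simp
  also have "(\<integral>\<^sup>+\<omega>. (\<integral>\<^sup>+t. ?g \<omega> t \<partial>lborel) \<partial>law X y) = (\<integral>\<^sup>+t. (\<integral>\<^sup>+\<omega>. ?g \<omega> t \<partial>law X y) \<partial>lborel)"
    by (rule Fubini'[symmetric]) (simp add: case_prod_beta gm)
  also have "\<dots> = (\<integral>\<^sup>+t\<in>{0..}. (\<integral>\<^sup>+\<omega>\<in>{\<omega>\<in>\<Omega>. T \<omega> < \<top>}. transition t (pos X (enn2real (T \<omega>)) \<omega>) B' \<partial>law X y) \<partial>lborel)"
  proof (rule nn_integral_cong)
    fix t :: real
    show "(\<integral>\<^sup>+\<omega>. ?g \<omega> t \<partial>law X y) =
      (\<integral>\<^sup>+\<omega>\<in>{\<omega>\<in>\<Omega>. T \<omega> < \<top>}. transition t (pos X (enn2real (T \<omega>)) \<omega>) B' \<partial>law X y) * indicator {0..} t"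
    proof (cases "0 \<le> t")
      case True
      \<comment> \<open>A finite \<open>T\<close> lies below the lifetime, so the event in the
        strong Markov property is the finiteness of \<open>T\<close>.\<close>
      have TT: "T \<omega> < \<top> \<longleftrightarrow> T \<omega> < life X \<omega>" if "\<omega> \<in> \<Omega>" for \<omega> using TL[OF that] by (auto intro: less_le_trans)
      define S where "S = {\<omega> \<in> \<Omega>. T \<omega> < life X \<omega> \<and> located X (enn2real (T \<omega>) + t) B' \<omega>}"
      have SE: "S = {\<omega>\<in>\<Omega>. T \<omega> < \<top> \<and> (0 \<le> enn2real (T \<omega>) + t \<and> located X (enn2real (T \<omega>) + t) B' \<omega>)}"
        using True TT by (auto simp: S_def)
      have SS: "S \<in> sets (law X y)" unfolding SE sets_law[OF y] by measurable
      have "(\<integral>\<^sup>+\<omega>. ?g \<omega> t \<partial>law X y) = (\<integral>\<^sup>+\<omega>. indicator S \<omega> \<partial>law X y)"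
        using True by (intro nn_integral_cong) (auto simp: SE space_law[OF y] split: split_indicator)
      also have "\<dots> = emeasure (law X y) S" using SS by simp
      also have "\<dots> = (\<integral>\<^sup>+\<omega> \<in> {\<omega> \<in> \<Omega>. T \<omega> < life X \<omega>}. transition t (pos X (enn2real (T \<omega>)) \<omega>) B' \<partial>law X y)"
        unfolding S_def transition_def by (rule strong_markov_at[OF y T True]) measurable
      also have "{\<omega> \<in> \<Omega>. T \<omega> < life X \<omega>} = {\<omega> \<in> \<Omega>. T \<omega> < \<top>}" using TT by auto
      finally show ?thesis using True by simp
    qed simp
  qed
  finally show ?thesis by (simp add: B'_def)
qed

lemma hitting_less_life: "\<omega> \<in> \<Omega> \<Longrightarrow> hitting X a \<omega> < \<top> \<Longrightarrow> hitting X a \<omega> < life X \<omega>"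
  using hitting_attained[of \<omega> a] by (auto simp: located_def)

lemma pos_hitting: "\<omega> \<in> \<Omega> \<Longrightarrow> hitting X a \<omega> < \<top> \<Longrightarrow> pos X (enn2real (hitting X a \<omega>)) \<omega> = a"
  using hitting_attained[of \<omega> a] by (auto simp: located_def)

lemma hitting_neq:
  assumes "\<omega> \<in> \<Omega>" "a \<noteq> b" shows "hitting X a \<omega> < hitting X b \<omega> \<or> hitting X b \<omega> < hitting X a \<omega> \<or> hitting X a \<omega> = \<top> \<and> hitting X b \<omega> = \<top>"
proof (cases "hitting X a \<omega> = hitting X b \<omega>")
  case True
  have "\<not> hitting X a \<omega> < \<top>"
  proof
    assume "hitting X a \<omega> < \<top>"
    then have "a = b" using True pos_hitting[OF assms(1), of a] pos_hitting[OF assms(1), of b] by metis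
    then show False using assms(2) by simp
  qed
  then have "hitting X a \<omega> = \<top>" by (simp add: not_less top_unique)
  then show ?thesis using True by simp
next
  case False
  then show ?thesis by (meson neq_iff)
qed

lemma transition_measurable_time:
  assumes y: "y \<in> I" and B[measurable]: "B \<in> sets borel"
  shows "(\<lambda>t. transition t y B * indicator {0..} t) \<in> borel_measurable borel"
proof -
  note [measurable_cong] = sets_law[OF y]
  interpret prob_space "law X y" by (rule prob_space_law[OF y])
  have "(\<lambda>t. \<integral>\<^sup>+\<omega>. (if 0 \<le> t \<and> located X t B \<omega> then 1 else 0) \<partial>law X y) \<in> borel_measurable borel"
    by measurable
  also have "(\<lambda>t. \<integral>\<^sup>+\<omega>. (if 0 \<le> t \<and> located X t B \<omega> then 1 else 0) \<partial>law X y) = (\<lambda>t. transition t y B * indicator {0..} t)"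
  proof
    fix t
    show "(\<integral>\<^sup>+\<omega>. (if 0 \<le> t \<and> located X t B \<omega> then 1 else 0) \<partial>law X y) = transition t y B * indicator {0..} t"
    proof (cases "0 \<le> t")
      case True
      have "(\<integral>\<^sup>+\<omega>. (if 0 \<le> t \<and> located X t B \<omega> then 1 else 0) \<partial>law X y) = (\<integral>\<^sup>+\<omega>. indicator {\<omega>\<in>\<Omega>. located X t B \<omega>} \<omega> \<partial>law X y)"
        using True by (intro nn_integral_cong) (auto simp: space_law[OF y] split: split_indicator)
      then show ?thesis using True located_sets[OF True B] by (simp add: transition_def sets_law[OF y])
    qed simp
  qed
  finally show ?thesis .
qed

text \<open>At the hitting time the path sits in \<open>a\<close>, so the integrand of the later
  part is constant on the event of hitting and the integral factorises.\<close>

lemma potential_hitting: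
  assumes y: "y \<in> I" and a: "a \<in> I" and \<phi>: "\<phi> \<in> borel_measurable borel"
  shows "(\<integral>\<^sup>+z. \<phi> z \<partial>potential y) = (\<integral>\<^sup>+z. \<phi> z \<partial>occ y (hitting X a)) +
    emeasure (law X y) {\<omega>\<in>\<Omega>. hitting X a \<omega> < \<top>} * (\<integral>\<^sup>+z. \<phi> z \<partial>potential a)"
proof -
  note [measurable_cong] = sets_law[OF y]
  let ?p = "emeasure (law X y) {\<omega>\<in>\<Omega>. hitting X a \<omega> < \<top>}"
  have "emeasure (potential y) B = emeasure (occ y (hitting X a)) B + ?p * emeasure (potential a) B + 0 * emeasure (potential a) B"
    if B: "B \<in> sets borel" for B
  proof -
    have "(\<integral>\<^sup>+\<omega>\<in>{\<omega>\<in>\<Omega>. hitting X a \<omega> < \<top>}. transition t (pos X (enn2real (hitting X a \<omega>)) \<omega>) (B \<inter> {0<..}) \<partial>law X y)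
       = ?p * transition t a (B \<inter> {0<..})" for t
    proof -
      have "(\<integral>\<^sup>+\<omega>\<in>{\<omega>\<in>\<Omega>. hitting X a \<omega> < \<top>}. transition t (pos X (enn2real (hitting X a \<omega>)) \<omega>) (B \<inter> {0<..}) \<partial>law X y) =
        (\<integral>\<^sup>+\<omega>. transition t a (B \<inter> {0<..}) * indicator {\<omega>\<in>\<Omega>. hitting X a \<omega> < \<top>} \<omega> \<partial>law X y)"
        by (intro nn_integral_cong) (auto simp: pos_hitting split: split_indicator)
      also have "\<dots> = transition t a (B \<inter> {0<..}) * ?p" by (rule nn_integral_cmult_indicator) measurable
      finally show ?thesis by (simp add: mult.commute)
    qed
    then have "emeasure (potential y) B = emeasure (occ y (hitting X a)) B + (\<integral>\<^sup>+t\<in>{0..}. ?p * transition t a (B \<inter> {0<..}) \<partial>lborel)"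
      using occ_strong_markov[OF y hitting_stopping_time hitting_measurable hitting_less_life B, of a] by simp
    also have "(\<integral>\<^sup>+t\<in>{0..}. ?p * transition t a (B \<inter> {0<..}) \<partial>lborel) = ?p * emeasure (potential a) B"
      unfolding emeasure_potential[OF a B] mult.assoc
      using transition_measurable_time[OF a, of "B \<inter> {0<..}"] B by (intro nn_integral_cmult) auto
    finally show ?thesis by simp
  qed
  from nn_integral_eq_combination[OF _ _ _ _ this \<phi>] show ?thesis by simp
qed

text \<open>Two distinct points are never hit at the same finite time. The event of exit therefore
  splits into exit at \<open>a\<close> and exit at \<open>b\<close>, and the position is known in
  each case.\<close>

lemma potential_exit:
  assumes y: "y \<in> I" and a: "a \<in> I" "b \<in> I" "a \<noteq> b" and \<phi>: "\<phi> \<in> borel_measurable borel"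
  shows "(\<integral>\<^sup>+z. \<phi> z \<partial>potential y) = (\<integral>\<^sup>+z. \<phi> z \<partial>occ y (\<lambda>\<omega>. min (hitting X a \<omega>) (hitting X b \<omega>))) +
    emeasure (law X y) {\<omega>\<in>\<Omega>. hitting X a \<omega> < hitting X b \<omega>} * (\<integral>\<^sup>+z. \<phi> z \<partial>potential a) +
    emeasure (law X y) {\<omega>\<in>\<Omega>. hitting X b \<omega> < hitting X a \<omega>} * (\<integral>\<^sup>+z. \<phi> z \<partial>potential b)"
proof -
  note [measurable_cong] = sets_law[OF y]
  let ?Sa = "{\<omega>\<in>\<Omega>. hitting X a \<omega> < hitting X b \<omega>}" and ?Sb = "{\<omega>\<in>\<Omega>. hitting X b \<omega> < hitting X a \<omega>}"
  let ?p = "emeasure (law X y) ?Sa" and ?q = "emeasure (law X y) ?Sb"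
  let ?T = "\<lambda>\<omega>. min (hitting X a \<omega>) (hitting X b \<omega>)"
  have T: "stopping_time (right_filtration X) ?T"
    by (intro stopping_time_min hitting_stopping_time)
  have TL: "?T \<omega> < life X \<omega>" if "\<omega> \<in> \<Omega>" "?T \<omega> < \<top>" for \<omega>
    using that hitting_less_life[of \<omega> a] hitting_less_life[of \<omega> b] by (auto simp: min_def split: if_splits)
  have "emeasure (potential y) B = emeasure (occ y ?T) B + ?p * emeasure (potential a) B + ?q * emeasure (potential b) B"
    if B: "B \<in> sets borel" for B
  proof -
    let ?B = "B \<inter> {0<..}"
    have "(\<integral>\<^sup>+\<omega>\<in>{\<omega>\<in>\<Omega>. ?T \<omega> < \<top>}. transition t (pos X (enn2real (?T \<omega>)) \<omega>) ?B \<partial>law X y)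
       = ?p * transition t a ?B + ?q * transition t b ?B" for t
    proof -
      have "(\<integral>\<^sup>+\<omega>\<in>{\<omega>\<in>\<Omega>. ?T \<omega> < \<top>}. transition t (pos X (enn2real (?T \<omega>)) \<omega>) ?B \<partial>law X y) =
        (\<integral>\<^sup>+\<omega>. transition t a ?B * indicator ?Sa \<omega> + transition t b ?B * indicator ?Sb \<omega> \<partial>law X y)"
      proof (intro nn_integral_cong)
        fix \<omega> assume "\<omega> \<in> space (law X y)"
        then have \<omega>: "\<omega> \<in> \<Omega>" by (simp add: space_law[OF y])
        show "transition t (pos X (enn2real (?T \<omega>)) \<omega>) ?B * indicator {\<omega>\<in>\<Omega>. ?T \<omega> < \<top>} \<omega> =
          transition t a ?B * indicator ?Sa \<omega> + transition t b ?B * indicator ?Sb \<omega>"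
          using hitting_neq[OF \<omega> a(3)]
        proof (elim disjE)
          assume *: "hitting X a \<omega> < hitting X b \<omega>"
          then have "hitting X a \<omega> < \<top>" by (rule less_le_trans) simp
          moreover have "?T \<omega> = hitting X a \<omega>" using * by (intro min_absorb1 less_imp_le)
          moreover have "\<not> hitting X b \<omega> < hitting X a \<omega>" using * by (rule less_not_sym)
          ultimately show ?thesis using * \<omega> by (simp add: pos_hitting indicator_def)
        next
          assume *: "hitting X b \<omega> < hitting X a \<omega>"
          then have "hitting X b \<omega> < \<top>" by (rule less_le_trans) simp
          moreover have "?T \<omega> = hitting X b \<omega>" using * by (intro min_absorb2 less_imp_le)
          moreover have "\<not> hitting X a \<omega> < hitting X b \<omega>" using * by (rule less_not_sym)
          ultimately show ?thesis using * \<omega> by (simp add: pos_hitting indicator_def)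
        qed (simp add: \<omega>)
      qed
      also have "\<dots> = transition t a ?B * ?p + transition t b ?B * ?q"
      proof -
        have S: "?Sa \<in> sets (law X y)" "?Sb \<in> sets (law X y)" by measurable
        show ?thesis using S by (simp add: nn_integral_add nn_integral_cmult_indicator)
      qed
      finally show ?thesis by (simp add: mult.commute)
    qed
    then have "emeasure (potential y) B = emeasure (occ y ?T) B +
        (\<integral>\<^sup>+t. ?p * (transition t a ?B * indicator {0..} t) + ?q * (transition t b ?B * indicator {0..} t) \<partial>lborel)"
      using occ_strong_markov[OF y T _ TL B] by (simp add: distrib_right mult.assoc)
    also have "(\<integral>\<^sup>+t. ?p * (transition t a ?B * indicator {0..} t) + ?q * (transition t b ?B * indicator {0..} t) \<partial>lborel)
       = ?p * emeasure (potential a) B + ?q * emeasure (potential b) B"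
      unfolding emeasure_potential[OF a(1) B] emeasure_potential[OF a(2) B]
      using transition_measurable_time[OF a(1), of ?B] transition_measurable_time[OF a(2), of ?B] B
      by (simp add: nn_integral_add nn_integral_cmult)
    finally show ?thesis by (simp add: add.assoc)
  qed
  from nn_integral_eq_combination[OF _ _ _ _ this \<phi>] show ?thesis by simp
qed

end

section \<open>Paths of the diffusion absorbed at 0\<close>

locale absorbed_diffusion = diffusion_family X I for X :: "'w markov_family" and I +
  assumes irreducible: "irreducible_diffusion X I"
    and stopped: "stopped_at_zero X I"
    and hits_zero: "\<And>x::real. 0 < x \<Longrightarrow> \<P>(\<omega> in law X (ennreal x). hitting X 0 \<omega> < \<top>) = 1"
begin

abbreviation "P x \<equiv> law X (ennreal x)"

lemma ennreal_in_I [simp]: "ennreal x \<in> I"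
  by (rule finite_in_I) simp

lemma sets_P [simp, measurable_cong]: "sets (P x) = sets E"
  by (rule sets_law) simp

lemma space_P [simp]: "space (P x) = \<Omega>"
  by (rule space_law) simp

lemma prob_space_P: "prob_space (P x)"
  by (rule prob_space_law) simp

text \<open>Collects the almost sure properties once, so that the path arguments that follow are
  deterministic.\<close>

definition regular_path :: "real \<Rightarrow> 'w \<Rightarrow> bool" where
  "regular_path x \<omega> \<longleftrightarrow> \<omega> \<in> \<Omega> \<and> located X 0 {ennreal x} \<omega> \<and> hitting X 0 \<omega> < \<top> \<and>
     (\<forall>t\<ge>0. hitting X 0 \<omega> \<le> ennreal t \<longrightarrow> located X t {0} \<omega>)"

lemma AE_regular_path: assumes "0 < x" shows "AE \<omega> in P x. regular_path x \<omega>"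
proof -
  interpret prob_space "P x" by (rule prob_space_P)
  have "AE \<omega> in P x. hitting X 0 \<omega> < \<top>"
    using hits_zero[OF assms] by (subst (asm) prob_Collect_eq_1) auto
  moreover have "AE \<omega> in P x. located X 0 {ennreal x} \<omega>" by (rule start) simp
  moreover have "AE \<omega> in P x. \<forall>t\<ge>0. hitting X 0 \<omega> \<le> ennreal t \<longrightarrow> located X t {0} \<omega>"
    using stopped by (simp add: stopped_at_zero_def)
  ultimately show ?thesis
    using AE_space by eventually_elim (auto simp: regular_path_def)
qed

lemma regular_path_start: "regular_path x \<omega> \<Longrightarrow> 0 < life X \<omega> \<and> pos X 0 \<omega> = ennreal x"
  by (auto simp: regular_path_def located_def)

lemma hitting_below:
  assumes \<omega>: "regular_path x \<omega>" and a: "a \<le> x"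
  shows "hitting X (ennreal a) \<omega> \<le> hitting X 0 \<omega>"
proof -
  have \<omega>': "\<omega> \<in> \<Omega>" "hitting X 0 \<omega> < \<top>" using \<omega> by (auto simp: regular_path_def)
  have "hitting X (ennreal a) \<omega> \<le> ennreal (enn2real (hitting X 0 \<omega>))"
  proof (rule path_ivt[OF \<omega>'(1)])
    show "ennreal (enn2real (hitting X 0 \<omega>)) < life X \<omega>"
      using hitting_less_life[OF \<omega>'] \<omega>'(2) by simp
    show "pos X 0 \<omega> \<le> ennreal a \<and> ennreal a \<le> pos X (enn2real (hitting X 0 \<omega>)) \<omega> \<or>
      pos X (enn2real (hitting X 0 \<omega>)) \<omega> \<le> ennreal a \<and> ennreal a \<le> pos X 0 \<omega>"
      using pos_hitting[OF \<omega>'] regular_path_start[OF \<omega>] a by (auto intro: ennreal_leI)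
  qed simp
  then show ?thesis using \<omega>'(2) by simp
qed

lemma alive_before_zero:
  assumes \<omega>: "regular_path x \<omega>" and t: "ennreal t < hitting X 0 \<omega>"
  shows "ennreal t < life X \<omega>"
  using hitting_less_life[of \<omega> 0] \<omega> t by (auto simp: regular_path_def)

text \<open>The converse direction is absorption: once 0 has been hit, the path stays there. Being
  in a positive state is thus the same as survival, which turns occupation of positive states into
  time before absorption.\<close>

lemma less_hitting_zero_iff:
  assumes \<omega>: "regular_path x \<omega>" and t: "0 \<le> t"
  shows "ennreal t < hitting X 0 \<omega> \<longleftrightarrow> located X t {0<..} \<omega>"
proof
  assume *: "ennreal t < hitting X 0 \<omega>"
  have "ennreal t < life X \<omega>" by (rule alive_before_zero[OF \<omega> *])
  moreover have "pos X t \<omega> \<noteq> 0"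
  proof
    assume "pos X t \<omega> = 0"
    then have "hitting X 0 \<omega> \<le> ennreal t" using t \<open>ennreal t < life X \<omega>\<close> by (intro hitting_le) (auto simp: located_def)
    then show False using * by simp
  qed
  ultimately show "located X t {0<..} \<omega>" by (simp add: located_def zero_less_iff_neq_zero)
next
  assume *: "located X t {0<..} \<omega>"
  show "ennreal t < hitting X 0 \<omega>"
  proof (rule ccontr)
    assume "\<not> ennreal t < hitting X 0 \<omega>"
    then have "located X t {0} \<omega>" using \<omega> t by (simp add: regular_path_def not_less)
    then show False using * by (simp add: located_def)
  qed
qed

lemma above_before_hitting:
  assumes \<omega>: "regular_path x \<omega>" and t: "0 \<le> t" "ennreal t < hitting X (ennreal a) \<omega>" and a: "a \<le> x"
  shows "ennreal a < pos X t \<omega>"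
proof (rule ccontr)
  assume n: "\<not> ennreal a < pos X t \<omega>"
  have "ennreal t < life X \<omega>" using hitting_below[OF \<omega> a] alive_before_zero[OF \<omega>] t by auto
  then have "hitting X (ennreal a) \<omega> \<le> ennreal t"
    using \<omega> n t a regular_path_start[OF \<omega>] by (intro path_ivt) (auto simp: regular_path_def not_less intro: ennreal_leI)
  then show False using t by simp
qed

lemma below_before_hitting:
  assumes \<omega>: "regular_path x \<omega>" and t: "0 \<le> t" "ennreal t < hitting X (ennreal b) \<omega>" "ennreal t < life X \<omega>" and b: "x \<le> b"
  shows "pos X t \<omega> < ennreal b"
proof (rule ccontr)
  assume n: "\<not> pos X t \<omega> < ennreal b"
  then have "hitting X (ennreal b) \<omega> \<le> ennreal t"
    using \<omega> n t b regular_path_start[OF \<omega>] by (intro path_ivt) (auto simp: regular_path_def not_less intro: ennreal_leI)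
  then show False using t by simp
qed

lemma occ_set_iff:
  assumes \<omega>: "regular_path x \<omega>" and W: "W \<omega> \<le> hitting X 0 \<omega>"
  shows "(\<omega>, t) \<in> occ_set W \<longleftrightarrow> 0 \<le> t \<and> ennreal t < W \<omega>"
  using less_hitting_zero_iff[OF \<omega>, of t] W by (auto simp: occ_set_def)

text \<open>The comparison is required only along a path before \<open>W\<close>, where the
  confinement of the path to an interval can be used.\<close>

lemma nn_integral_occ_mono:
  assumes x: "0 < x" and m: "W \<in> borel_measurable E" "\<phi> \<in> borel_measurable borel" "\<psi> \<in> borel_measurable borel"
    and le: "\<And>\<omega> t. regular_path x \<omega> \<Longrightarrow> (\<omega>, t) \<in> occ_set W \<Longrightarrow> \<phi> (path t \<omega>) \<le> \<psi> (path t \<omega>)"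
  shows "(\<integral>\<^sup>+z. \<phi> z \<partial>occ (ennreal x) W) \<le> (\<integral>\<^sup>+z. \<psi> z \<partial>occ (ennreal x) W)"
  unfolding nn_integral_occ[OF ennreal_in_I m(1,2)] nn_integral_occ[OF ennreal_in_I m(1,3)]
proof (rule nn_integral_mono_AE)
  show "AE \<omega> in P x. (\<integral>\<^sup>+t. \<phi> (path t \<omega>) * indicator (occ_set W) (\<omega>, t) \<partial>lborel) \<le>
     (\<integral>\<^sup>+t. \<psi> (path t \<omega>) * indicator (occ_set W) (\<omega>, t) \<partial>lborel)"
    using AE_regular_path[OF x]
    by eventually_elim (use le in \<open>auto intro!: nn_integral_mono split: split_indicator\<close>)
qed

lemma emeasure_lborel_less: "emeasure lborel {t::real. 0 \<le> t \<and> ennreal t < w} = w"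
proof (cases w)
  case (real r)
  then have "{t::real. 0 \<le> t \<and> ennreal t < w} = {0..<r}" by (auto simp: ennreal_less_iff)
  then show ?thesis using real by simp
next
  case top
  have "of_nat n \<le> emeasure lborel {t::real. 0 \<le> t \<and> ennreal t < w}" for n
  proof -
    have "of_nat n = emeasure lborel {0..real n}" by (simp add: ennreal_of_nat_eq_real_of_nat)
    also have "\<dots> \<le> emeasure lborel {t::real. 0 \<le> t \<and> ennreal t < w}"
      using top by (intro emeasure_mono) auto
    finally show ?thesis .
  qed
  then have "(SUP n. of_nat n :: ennreal) \<le> emeasure lborel {t::real. 0 \<le> t \<and> ennreal t < w}" by (rule SUP_least)
  then show ?thesis using top by (simp add: ennreal_SUP_of_nat_eq_top top_unique)
qed

lemma emeasure_occ_UNIV: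
  assumes x: "0 < x" and W: "W \<in> borel_measurable E" and le: "\<And>\<omega>. regular_path x \<omega> \<Longrightarrow> W \<omega> \<le> hitting X 0 \<omega>"
  shows "emeasure (occ (ennreal x) W) UNIV = (\<integral>\<^sup>+\<omega>. W \<omega> \<partial>P x)"
proof -
  have "emeasure (occ (ennreal x) W) UNIV = (\<integral>\<^sup>+z. 1 \<partial>occ (ennreal x) W)" by simp
  also have "\<dots> = (\<integral>\<^sup>+\<omega>. \<integral>\<^sup>+t. 1 * indicator (occ_set W) (\<omega>, t) \<partial>lborel \<partial>P x)"
    by (rule nn_integral_occ) (use W in auto)
  also have "\<dots> = (\<integral>\<^sup>+\<omega>. W \<omega> \<partial>P x)"
  proof (rule nn_integral_cong_AE)
    show "AE \<omega> in P x. (\<integral>\<^sup>+t. 1 * indicator (occ_set W) (\<omega>, t) \<partial>lborel) = W \<omega>"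
      using AE_regular_path[OF x]
    proof eventually_elim
      case (elim \<omega>)
      have "(\<integral>\<^sup>+t. 1 * indicator (occ_set W) (\<omega>, t) \<partial>lborel) = (\<integral>\<^sup>+t. indicator {t. 0 \<le> t \<and> ennreal t < W \<omega>} t \<partial>lborel)"
        using occ_set_iff[of x \<omega> W, OF elim le[OF elim]] by (intro nn_integral_cong) (auto split: split_indicator)
      also have "\<dots> = emeasure lborel {t::real. 0 \<le> t \<and> ennreal t < W \<omega>}" by (rule nn_integral_indicator) measurable
      finally show ?case by (simp add: emeasure_lborel_less)
    qed
  qed
  finally show ?thesis .
qed

lemma potential_UNIV: assumes "0 < x" shows "emeasure (potential (ennreal x)) UNIV = (\<integral>\<^sup>+\<omega>. hitting X 0 \<omega> \<partial>P x)"
proof -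
  have "emeasure (potential (ennreal x)) UNIV = emeasure (occ (ennreal x) (hitting X 0)) UNIV"
  proof -
    have "(\<integral>\<^sup>+z. 1 \<partial>potential (ennreal x)) = (\<integral>\<^sup>+z. 1 \<partial>occ (ennreal x) (hitting X 0))"
      unfolding nn_integral_occ[OF ennreal_in_I borel_measurable_const borel_measurable_const]
        nn_integral_occ[OF ennreal_in_I hitting_measurable borel_measurable_const]
    proof (rule nn_integral_cong_AE)
      show "AE \<omega> in P x. (\<integral>\<^sup>+t. 1 * indicator (occ_set (\<lambda>_. \<top>)) (\<omega>, t) \<partial>lborel) =
         (\<integral>\<^sup>+t. 1 * indicator (occ_set (hitting X 0)) (\<omega>, t) \<partial>lborel)"
        using AE_regular_path[OF assms]
      proof eventually_elim
        case (elim \<omega>)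
        then show ?case using less_hitting_zero_iff[OF elim]
          by (intro nn_integral_cong) (auto simp: occ_set_def split: split_indicator)
      qed
    qed
    then show ?thesis by simp
  qed
  also have "\<dots> = (\<integral>\<^sup>+\<omega>. hitting X 0 \<omega> \<partial>P x)" by (rule emeasure_occ_UNIV[OF assms]) auto
  finally show ?thesis .
qed

lemma hitting_positive_prob:
  assumes "0 < x" shows "emeasure (P x) {\<omega>\<in>\<Omega>. hitting X (ennreal y) \<omega> < \<top>} > 0"
proof -
  interpret prob_space "P x" by (rule prob_space_P)
  have "\<P>(\<omega> in P x. hitting X (ennreal y) \<omega> < \<top>) > 0"
  proof -
    have "ennreal x \<in> I - {0}" using assms by simp
    from irreducible[unfolded irreducible_diffusion_def, rule_format, OF this, of "ennreal y"] show ?thesis by simp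
  qed
  then show ?thesis by (simp add: emeasure_eq_measure)
qed

text \<open>A path from \<open>x\<close> reaches \<open>y\<close> with positive probability
  \<open>?p\<close>, and \<open>?p\<close> times the potential from \<open>y\<close> is a part of
  the potential from \<open>x\<close>. A fact valid for one starting point thus spreads to all,
  including those that a given law does not charge.\<close>

lemma potential_transfer:
  assumes x: "0 < x" and B: "B \<in> sets borel"
  shows "emeasure (potential (ennreal x)) B < \<top> \<Longrightarrow> emeasure (potential (ennreal y)) B < \<top>"
    and "emeasure (potential (ennreal x)) B = 0 \<Longrightarrow> emeasure (potential (ennreal y)) B = 0"
proof -
  let ?p = "emeasure (P x) {\<omega>\<in>\<Omega>. hitting X (ennreal y) \<omega> < \<top>}"
  have "?p * emeasure (potential (ennreal y)) B \<le> emeasure (potential (ennreal x)) B"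
    using potential_hitting[of "ennreal x" "ennreal y" "indicator B"] B by simp
  then show "emeasure (potential (ennreal x)) B < \<top> \<Longrightarrow> emeasure (potential (ennreal y)) B < \<top>"
    "emeasure (potential (ennreal x)) B = 0 \<Longrightarrow> emeasure (potential (ennreal y)) B = 0"
    using hitting_positive_prob[OF x, of y]
    by (auto simp: ennreal_mult_eq_top_iff less_top[symmetric] top_unique) 
qed

lemma hitting_below_prob:
  assumes x: "0 < x" and a: "a \<le> x"
  shows "emeasure (P x) {\<omega>\<in>\<Omega>. hitting X (ennreal a) \<omega> < \<top>} = 1"
proof -
  interpret prob_space "P x" by (rule prob_space_P)
  have "AE \<omega> in P x. hitting X (ennreal a) \<omega> < \<top>"
    using AE_regular_path[OF x] by eventually_elim (use hitting_below[OF _ a] in \<open>auto simp: regular_path_def intro: le_less_trans\<close>)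
  then have "AE \<omega> in P x. \<omega> \<in> {\<omega>\<in>\<Omega>. hitting X (ennreal a) \<omega> < \<top>}"
    using AE_space by eventually_elim auto
  then show ?thesis by (intro emeasure_eq_1_AE) auto
qed

lemma potential_above:
  assumes x: "0 < x" and a: "a \<le> x" and \<phi>: "\<phi> \<in> borel_measurable borel"
  shows "(\<integral>\<^sup>+z. \<phi> z \<partial>potential (ennreal x)) =
    (\<integral>\<^sup>+z. \<phi> z \<partial>occ (ennreal x) (hitting X (ennreal a))) + (\<integral>\<^sup>+z. \<phi> z \<partial>potential (ennreal a))"
  using potential_hitting[OF ennreal_in_I ennreal_in_I \<phi>, of x a] hitting_below_prob[OF x a] by simp

text \<open>On [0, t] the path attains a minimum, which is positive before absorption; a level
  1/(n+1) below this minimum has not been reached.\<close>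

lemma hitting_approaches_zero:
  assumes \<omega>: "regular_path x \<omega>" and t: "0 \<le> t" "ennreal t < hitting X 0 \<omega>"
  shows "\<exists>n. ennreal t < hitting X (ennreal (1 / real (Suc n))) \<omega>"
proof -
  have \<omega>': "\<omega> \<in> \<Omega>" using \<omega> by (auto simp: regular_path_def)
  have tl: "ennreal t < life X \<omega>" by (rule alive_before_zero[OF \<omega> t(2)])
  have "compact ((\<lambda>t. pos X t \<omega>) ` {0..t})"
    using path_continuous_Icc[OF \<omega>' _ tl, of 0] by (intro compact_continuous_image) auto
  then obtain c where c: "c \<in> (\<lambda>t. pos X t \<omega>) ` {0..t}" "\<And>z. z \<in> (\<lambda>t. pos X t \<omega>) ` {0..t} \<Longrightarrow> c \<le> z"
    using compact_attains_inf[of "(\<lambda>t. pos X t \<omega>) ` {0..t}"] t by auto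
  then obtain r where r: "0 \<le> r" "r \<le> t" "c = pos X r \<omega>" by auto
  have "ennreal r < hitting X 0 \<omega>" using t(2) r(2) by (auto intro: le_less_trans[OF ennreal_leI])
  then have "0 < c" using less_hitting_zero_iff[OF \<omega> r(1)] r by (auto simp: located_def)
  then obtain n where n: "ennreal (1 / real (Suc n)) < c" using less_ennreal_add_inverse_Suc[of 0 c] by auto
  have "ennreal t < hitting X (ennreal (1 / real (Suc n))) \<omega>"
  proof (rule ccontr)
    assume *: "\<not> ennreal t < hitting X (ennreal (1 / real (Suc n))) \<omega>"
    then have h: "hitting X (ennreal (1 / real (Suc n))) \<omega> \<le> ennreal t" by simp
    also have "\<dots> < \<top>" by simp
    finally have fin: "hitting X (ennreal (1 / real (Suc n))) \<omega> < \<top>" .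
    have "enn2real (hitting X (ennreal (1 / real (Suc n))) \<omega>) \<in> {0..t}"
      using enn2real_mono[OF h] t by simp
    then have "c \<le> pos X (enn2real (hitting X (ennreal (1 / real (Suc n))) \<omega>)) \<omega>" by (intro c) auto
    also have "\<dots> = ennreal (1 / real (Suc n))" by (rule pos_hitting[OF \<omega>' fin])
    finally show False using n by simp
  qed
  then show ?thesis by blast
qed

text \<open>The Dirichlet condition at 0. From 1 the path passes through 1/(n+1), and the occupation
  before this passage exhausts the whole potential as n grows; what remains is the potential from
  1/(n+1). Finiteness permits the subtraction.\<close>

lemma potential_at_zero_limit:
  assumes \<phi>[measurable]: "\<phi> \<in> borel_measurable borel" and fin: "(\<integral>\<^sup>+z. \<phi> z \<partial>potential (ennreal 1)) < \<top>"
  shows "(\<lambda>n. \<integral>\<^sup>+z. \<phi> z \<partial>potential (ennreal (1 / real (Suc n)))) \<longlonglongrightarrow> 0"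
proof -
  let ?F = "\<lambda>x. \<integral>\<^sup>+z. \<phi> z \<partial>potential (ennreal x)"
  let ?a = "\<lambda>n. 1 / real (Suc n)"
  let ?O = "\<lambda>n. \<integral>\<^sup>+z. \<phi> z \<partial>occ (ennreal 1) (hitting X (ennreal (?a n)))"
  have eq: "?F 1 = ?O n + ?F (?a n)" for n by (rule potential_above) (auto simp: \<phi>)
  let ?g = "\<lambda>n \<omega>. \<integral>\<^sup>+t. \<phi> (path t \<omega>) * indicator (occ_set (hitting X (ennreal (?a n)))) (\<omega>, t) \<partial>lborel"
  \<comment> \<open>A continuous path descending from 1 meets the higher level first.\<close>
  have anti: "hitting X (ennreal (?a n)) \<omega> \<le> hitting X (ennreal (?a (Suc n))) \<omega>" if \<omega>: "regular_path 1 \<omega>" for \<omega> n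
  proof (rule ccontr)
    let ?h = "hitting X (ennreal (?a (Suc n))) \<omega>"
    assume "\<not> hitting X (ennreal (?a n)) \<omega> \<le> ?h"
    then have *: "?h < hitting X (ennreal (?a n)) \<omega>" by simp
    then have fin: "?h < \<top>" by (rule less_le_trans) simp
    have "ennreal (?a n) < pos X (enn2real ?h) \<omega>"
      by (rule above_before_hitting[OF \<omega>]) (use * fin in auto)
    also have "\<dots> = ennreal (?a (Suc n))" using fin \<omega> by (intro pos_hitting) (auto simp: regular_path_def)
    finally show False by (simp add: ennreal_less_iff field_simps)
  qed
  have "(\<lambda>n. \<integral>\<^sup>+\<omega>. ?g n \<omega> \<partial>P 1) \<longlonglongrightarrow> (\<integral>\<^sup>+\<omega>. \<integral>\<^sup>+t. \<phi> (path t \<omega>) * indicator (occ_set (\<lambda>_. \<top>)) (\<omega>, t) \<partial>lborel \<partial>P 1)"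
  proof (rule nn_integral_dominated_convergence[where w="\<lambda>\<omega>. \<integral>\<^sup>+t. \<phi> (path t \<omega>) * indicator (occ_set (\<lambda>_. \<top>)) (\<omega>, t) \<partial>lborel"])
    show "?g n \<in> borel_measurable (P 1)" for n by measurable
    show wm: "(\<lambda>\<omega>. \<integral>\<^sup>+t. \<phi> (path t \<omega>) * indicator (occ_set (\<lambda>_. \<top>)) (\<omega>, t) \<partial>lborel) \<in> borel_measurable (P 1)"
      by measurable
    show "(\<lambda>\<omega>. \<integral>\<^sup>+t. \<phi> (path t \<omega>) * indicator (occ_set (\<lambda>_. \<top>)) (\<omega>, t) \<partial>lborel) \<in> borel_measurable (P 1)"
      by (rule wm)
    show "(\<integral>\<^sup>+\<omega>. \<integral>\<^sup>+t. \<phi> (path t \<omega>) * indicator (occ_set (\<lambda>_. \<top>)) (\<omega>, t) \<partial>lborel \<partial>P 1) < \<infinity>"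
      using fin nn_integral_occ[OF ennreal_in_I _ \<phi>, of "\<lambda>_. \<top>" 1] by simp
    have *: "(\<lambda>n. ?g n \<omega>) \<longlonglongrightarrow> (\<integral>\<^sup>+t. \<phi> (path t \<omega>) * indicator (occ_set (\<lambda>_. \<top>)) (\<omega>, t) \<partial>lborel)"
      if \<omega>: "regular_path 1 \<omega>" for \<omega>
    proof -
      have \<omega>': "\<omega> \<in> space (P 1)" using \<omega> unfolding space_P regular_path_def by blast
      show "(\<lambda>n. ?g n \<omega>) \<longlonglongrightarrow> (\<integral>\<^sup>+t. \<phi> (path t \<omega>) * indicator (occ_set (\<lambda>_. \<top>)) (\<omega>, t) \<partial>lborel)"
      proof (rule nn_integral_LIMSEQ)
        show "incseq (\<lambda>n t. \<phi> (path t \<omega>) * indicator (occ_set (hitting X (ennreal (?a n)))) (\<omega>, t))"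
          using anti[OF \<omega>] by (intro incseq_SucI le_funI mult_left_mono) (auto simp: occ_set_def split: split_indicator intro: less_le_trans)
        show "(\<lambda>t. \<phi> (path t \<omega>) * indicator (occ_set (hitting X (ennreal (?a n)))) (\<omega>, t)) \<in> borel_measurable lborel" for n
        proof -
          have "(\<lambda>p. \<phi> (path (snd p) (fst p)) * indicator (occ_set (hitting X (ennreal (?a n)))) p) \<in> borel_measurable (P 1 \<Otimes>\<^sub>M lborel)"
            by measurable
          from measurable_Pair2[OF this \<omega>'] show ?thesis by simp
        qed
        fix t
        have "\<forall>\<^sub>F n in sequentially. \<phi> (path t \<omega>) * indicator (occ_set (hitting X (ennreal (?a n)))) (\<omega>, t) = \<phi> (path t \<omega>) * indicator (occ_set (\<lambda>_. \<top>)) (\<omega>, t)"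
        proof (cases "0 \<le> t \<and> located X t {0<..} \<omega>")
          case True
          then obtain n where n: "ennreal t < hitting X (ennreal (?a n)) \<omega>"
            using hitting_approaches_zero[OF \<omega>, of t] less_hitting_zero_iff[OF \<omega>, of t] by auto
          have "ennreal t < hitting X (ennreal (?a k)) \<omega>" if "n \<le> k" for k
            using that by (induction k rule: dec_induct) (use n anti[OF \<omega>] in \<open>auto intro: less_le_trans\<close>)
          then show ?thesis using True by (auto simp: eventually_sequentially occ_set_def split: split_indicator intro!: exI[of _ n])
        next
          case False
          then show ?thesis by (intro always_eventually) (auto simp: occ_set_def)
        qed
        then show "(\<lambda>n. \<phi> (path t \<omega>) * indicator (occ_set (hitting X (ennreal (?a n)))) (\<omega>, t)) \<longlonglongrightarrow> \<phi> (path t \<omega>) * indicator (occ_set (\<lambda>_. \<top>)) (\<omega>, t)"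
          by (rule tendsto_eventually)
      qed
    qed
    show "AE \<omega> in P 1. ?g n \<omega> \<le> (\<integral>\<^sup>+t. \<phi> (path t \<omega>) * indicator (occ_set (\<lambda>_. \<top>)) (\<omega>, t) \<partial>lborel)" for n
      by (intro AE_I2 nn_integral_mono mult_left_mono) (auto simp: occ_set_def top.not_eq_extremum split: split_indicator intro: less_le_trans)
    show "AE \<omega> in P 1. (\<lambda>n. ?g n \<omega>) \<longlonglongrightarrow> (\<integral>\<^sup>+t. \<phi> (path t \<omega>) * indicator (occ_set (\<lambda>_. \<top>)) (\<omega>, t) \<partial>lborel)"
      using AE_regular_path[OF zero_less_one] by (rule eventually_mono) (rule *)
  qed
  then have "?O \<longlonglongrightarrow> ?F 1"
    unfolding nn_integral_occ[OF ennreal_in_I hitting_measurable \<phi>] nn_integral_occ[OF ennreal_in_I borel_measurable_const \<phi>] .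
  then have "(\<lambda>n. ?F 1 - ?O n) \<longlonglongrightarrow> ?F 1 - ?F 1" using fin by (intro tendsto_diff_ennreal tendsto_const) auto
  moreover have "?F 1 - ?O n = ?F (?a n)" for n
  proof -
    have "?O n \<noteq> \<top>" using fin eq[of n] by auto
    then show ?thesis unfolding eq[of n] by (metis add.commute ennreal_add_diff_cancel_right)
  qed
  ultimately show ?thesis using fin by simp
qed

end

section \<open>The Green function\<close>

text \<open>Finite mean absorption times are a locale assumption here; they come from the first
  moment of the initial law through \<open>mean_finite_of_moment\<close>.\<close>

locale green_diffusion = absorbed_diffusion X I + speed_scale I m s
  for X :: "'w markov_family" and I and m :: "ennreal measure" and s :: "real \<Rightarrow> real" +
  assumes generator: "local_generator_is_dmds X m s"
    and mean_finite: "\<And>x. 0 < x \<Longrightarrow> emeasure (potential (ennreal x)) UNIV < \<top>"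
begin

text \<open>Extended by 0 to infinity: the Green density is a statement about (0, \<infinity>), and
  mass at infinity is treated separately.\<close>

definition lft :: "(real \<Rightarrow> real) \<Rightarrow> ennreal \<Rightarrow> ennreal" where
  "lft \<phi> z = (if z = \<top> then 0 else ennreal (\<phi> (enn2real z)))"

definition green :: "(real \<Rightarrow> real) \<Rightarrow> real \<Rightarrow> real" where
  "green \<phi> x = enn2real (\<integral>\<^sup>+z. lft \<phi> z \<partial>potential (ennreal x))"

text \<open>The bound 1 makes every potential finite by comparison with the mean absorption time.
  Compact support is imposed separately, in the representation of potentials.\<close>

definition test_fun :: "(real \<Rightarrow> real) \<Rightarrow> bool" where
  "test_fun \<phi> \<longleftrightarrow> continuous_on UNIV \<phi> \<and> (\<forall>z. 0 \<le> \<phi> z \<and> \<phi> z \<le> 1)"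

lemma test_fun_measurable: "test_fun \<phi> \<Longrightarrow> \<phi> \<in> borel_measurable borel"
  by (auto simp: test_fun_def intro: borel_measurable_continuous_onI)

lemma lft_measurable: "\<phi> \<in> borel_measurable borel \<Longrightarrow> lft \<phi> \<in> borel_measurable borel"
proof -
  assume [measurable]: "\<phi> \<in> borel_measurable borel"
  show ?thesis unfolding lft_def[abs_def] by measurable
qed

lemma lft_le_one: "test_fun \<phi> \<Longrightarrow> lft \<phi> z \<le> 1"
  by (auto simp: lft_def test_fun_def)

lemma green_integral_finite:
  assumes "test_fun \<phi>" "0 < x" shows "(\<integral>\<^sup>+z. lft \<phi> z \<partial>potential (ennreal x)) < \<top>"
proof -
  have "(\<integral>\<^sup>+z. lft \<phi> z \<partial>potential (ennreal x)) \<le> (\<integral>\<^sup>+z. 1 \<partial>potential (ennreal x))"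
    by (intro nn_integral_mono lft_le_one assms)
  then show ?thesis using mean_finite[OF assms(2)] by (simp add: le_less_trans)
qed

lemma ennreal_green:
  assumes "test_fun \<phi>" "0 < x" shows "ennreal (green \<phi> x) = (\<integral>\<^sup>+z. lft \<phi> z \<partial>potential (ennreal x))"
  using green_integral_finite[OF assms] by (simp add: green_def)

lemma green_nonneg: "0 \<le> green \<phi> x"
  by (simp add: green_def)

section \<open>Exit from a bounded interval\<close>

definition exitT :: "real \<Rightarrow> real \<Rightarrow> 'w \<Rightarrow> ennreal" where
  "exitT a b \<omega> = min (hitting X (ennreal a) \<omega>) (hitting X (ennreal b) \<omega>)"

definition exit_left :: "real \<Rightarrow> real \<Rightarrow> real \<Rightarrow> real" where
  "exit_left a x b = measure (P x) {\<omega>\<in>\<Omega>. hitting X (ennreal a) \<omega> < hitting X (ennreal b) \<omega>}"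

definition exit_right :: "real \<Rightarrow> real \<Rightarrow> real \<Rightarrow> real" where
  "exit_right a x b = measure (P x) {\<omega>\<in>\<Omega>. hitting X (ennreal b) \<omega> < hitting X (ennreal a) \<omega>}"

definition mean_exit :: "real \<Rightarrow> real \<Rightarrow> real \<Rightarrow> real" where
  "mean_exit a x b = enn2real (emeasure (occ (ennreal x) (exitT a b)) UNIV)"

definition occ_exit :: "(real \<Rightarrow> real) \<Rightarrow> real \<Rightarrow> real \<Rightarrow> real \<Rightarrow> real" where
  "occ_exit \<phi> a x b = enn2real (\<integral>\<^sup>+z. lft \<phi> z \<partial>occ (ennreal x) (exitT a b))"

lemma exitT_measurable [measurable]: "exitT a b \<in> borel_measurable E"
  unfolding exitT_def[abs_def] by measurable

lemma exitT_le_zero: "regular_path x \<omega> \<Longrightarrow> a < x \<Longrightarrow> exitT a b \<omega> \<le> hitting X 0 \<omega>"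
  using hitting_below[of x \<omega> a] by (auto simp: exitT_def intro: min.coboundedI1)

lemma occ_exit_finite:
  assumes "0 \<le> a" "a < x" "x < b"
  shows "emeasure (occ (ennreal x) (exitT a b)) UNIV < \<top>"
proof -
  have "emeasure (occ (ennreal x) (exitT a b)) UNIV \<le> emeasure (potential (ennreal x)) UNIV"
    using potential_exit[of "ennreal x" "ennreal a" "ennreal b" "\<lambda>_. 1"] assms
    unfolding exitT_def[abs_def] by (auto simp: add.assoc)
  then show ?thesis using mean_finite[of x] assms by (simp add: le_less_trans)
qed

text \<open>A path from \<open>x\<close> that reaches 0 has passed \<open>a\<close>, so exit through
  one of the end points is almost certain.\<close>

lemma exit_sum:
  assumes "0 \<le> a" "a < x" "x < b"
  shows "exit_left a x b + exit_right a x b = 1"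
proof -
  interpret prob_space "P x" by (rule prob_space_P)
  let ?A = "{\<omega>\<in>\<Omega>. hitting X (ennreal a) \<omega> < hitting X (ennreal b) \<omega>}"
  let ?B = "{\<omega>\<in>\<Omega>. hitting X (ennreal b) \<omega> < hitting X (ennreal a) \<omega>}"
  have s: "?A \<in> events" "?B \<in> events" by (simp_all only: sets_P) measurable
  have ab: "ennreal a \<noteq> ennreal b" using assms by simp
  have "AE \<omega> in P x. \<omega> \<in> ?A \<union> ?B"
    using AE_regular_path[OF order_le_less_trans[OF assms(1,2)]]
  proof eventually_elim
    case (elim \<omega>)
    show ?case using hitting_neq[OF _ ab, of \<omega>] hitting_below[of x \<omega> a] elim assms
      by (auto simp: regular_path_def top_unique)
  qed
  then have "prob (?A \<union> ?B) = 1" using s by (subst prob_eq_1) auto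
  moreover have "prob (?A \<union> ?B) = prob ?A + prob ?B" by (rule finite_measure_Union[OF s]) auto
  ultimately show ?thesis by (simp add: exit_left_def exit_right_def)
qed

lemma exit_probs: "0 \<le> exit_left a x b" "0 \<le> exit_right a x b"
  by (auto simp: exit_left_def exit_right_def)

lemma mean_exit_nonneg: "0 \<le> mean_exit a x b"
  by (simp add: mean_exit_def)

text \<open>Exit happens no later than absorption, hence almost surely before the lifetime. The
  numerator then involves exit probabilities only.\<close>

lemma dynkin_quot_eq:
  assumes "0 \<le> a" "a < x" "x < b"
  shows "dynkin_quot X u x a b = (exit_left a x b * u a + exit_right a x b * u b - u x) / mean_exit a x b"
proof -
  interpret prob_space "P x" by (rule prob_space_P)
  let ?A = "{\<omega>\<in>\<Omega>. hitting X (ennreal a) \<omega> < hitting X (ennreal b) \<omega>}"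
  let ?B = "{\<omega>\<in>\<Omega>. hitting X (ennreal b) \<omega> < hitting X (ennreal a) \<omega>}"
  have s: "?A \<in> events" "?B \<in> events" by (simp_all only: sets_P) measurable
  have ab: "ennreal a \<noteq> ennreal b" using assms by simp
  have x0: "0 < x" using assms by simp
  have T: "exit_time X a b \<omega> = exitT a b \<omega> \<and> exitT a b \<omega> < life X \<omega> \<and> exitT a b \<omega> < \<top>" if \<omega>: "regular_path x \<omega>" for \<omega>
  proof -
    have "exitT a b \<omega> \<le> hitting X 0 \<omega>" by (rule exitT_le_zero[OF \<omega> assms(2)])
    moreover have "hitting X 0 \<omega> < life X \<omega>" "hitting X 0 \<omega> < \<top>" using \<omega> hitting_less_life by (auto simp: regular_path_def)
    ultimately have "exitT a b \<omega> < life X \<omega>" "exitT a b \<omega> < \<top>" by auto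
    then show ?thesis by (simp add: exit_time_def exitT_def[symmetric] min_absorb2 less_imp_le)
  qed
  have "(\<integral>\<omega>. (if exit_time X a b \<omega> < life X \<omega> then u (enn2real (pos X (enn2real (exit_time X a b \<omega>)) \<omega>)) else 0) \<partial>P x)
    = (\<integral>\<omega>. u a * indicator ?A \<omega> + u b * indicator ?B \<omega> \<partial>P x)"
  proof (rule Bochner_Integration.integral_cong)
    fix \<omega> assume "\<omega> \<in> space (P x)"
    then have \<omega>: "\<omega> \<in> \<Omega>" by simp
    have e: "exit_time X a b \<omega> = min (life X \<omega>) (exitT a b \<omega>)" by (simp add: exit_time_def exitT_def)
    show "(if exit_time X a b \<omega> < life X \<omega> then u (enn2real (pos X (enn2real (exit_time X a b \<omega>)) \<omega>)) else 0) =
        u a * indicator ?A \<omega> + u b * indicator ?B \<omega>"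
      using hitting_neq[OF \<omega> ab]
    proof (elim disjE)
      assume 1: "hitting X (ennreal a) \<omega> < hitting X (ennreal b) \<omega>"
      then have T: "exitT a b \<omega> = hitting X (ennreal a) \<omega>" by (simp add: exitT_def min_absorb1 less_imp_le)
      have fin: "hitting X (ennreal a) \<omega> < \<top>" using 1 by (rule less_le_trans) simp
      have "exit_time X a b \<omega> = hitting X (ennreal a) \<omega>" using hitting_less_life[OF \<omega> fin]
        by (simp add: e T min_absorb2 less_imp_le)
      moreover have "\<not> hitting X (ennreal b) \<omega> < hitting X (ennreal a) \<omega>" using 1 by (rule less_not_sym)
      ultimately show ?thesis using 1 hitting_less_life[OF \<omega> fin] pos_hitting[OF \<omega> fin] \<omega> assms by simp
    next
      assume 1: "hitting X (ennreal b) \<omega> < hitting X (ennreal a) \<omega>"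
      then have T: "exitT a b \<omega> = hitting X (ennreal b) \<omega>" by (simp add: exitT_def min_absorb2 less_imp_le)
      have fin: "hitting X (ennreal b) \<omega> < \<top>" using 1 by (rule less_le_trans) simp
      have "exit_time X a b \<omega> = hitting X (ennreal b) \<omega>" using hitting_less_life[OF \<omega> fin]
        by (simp add: e T min_absorb2 less_imp_le)
      moreover have "\<not> hitting X (ennreal a) \<omega> < hitting X (ennreal b) \<omega>" using 1 by (rule less_not_sym)
      ultimately show ?thesis using 1 hitting_less_life[OF \<omega> fin] pos_hitting[OF \<omega> fin] \<omega> assms by simp
    next
      assume "hitting X (ennreal a) \<omega> = \<top> \<and> hitting X (ennreal b) \<omega> = \<top>"
      then show ?thesis by (simp add: e exitT_def min_def)
    qed
  qed simp
  also have "\<dots> = u a * exit_left a x b + u b * exit_right a x b"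
  proof -
    have "integrable (P x) (\<lambda>\<omega>. u a * indicator ?A \<omega>)" "integrable (P x) (\<lambda>\<omega>. u b * indicator ?B \<omega>)"
      by (intro integrable_mult_right integrable_real_indicator s; simp add: less_top[symmetric])+
    then show ?thesis using s by (subst Bochner_Integration.integral_add) (simp_all add: exit_left_def exit_right_def)
  qed
  finally have 1: "(\<integral>\<omega>. (if exit_time X a b \<omega> < life X \<omega> then u (enn2real (pos X (enn2real (exit_time X a b \<omega>)) \<omega>)) else 0) \<partial>P x)
    = u a * exit_left a x b + u b * exit_right a x b" .
  have "(\<integral>\<^sup>+\<omega>. exit_time X a b \<omega> \<partial>P x) = (\<integral>\<^sup>+\<omega>. exitT a b \<omega> \<partial>P x)"
    by (rule nn_integral_cong_AE) (use T AE_regular_path[OF x0] in \<open>auto elim!: eventually_mono\<close>)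
  also have "\<dots> = emeasure (occ (ennreal x) (exitT a b)) UNIV"
    by (rule emeasure_occ_UNIV[symmetric, OF x0]) (use exitT_le_zero assms in auto)
  finally show ?thesis unfolding dynkin_quot_def 1 by (simp add: mean_exit_def mult.commute)
qed

text \<open>Together with \<open>dynkin_quot_eq\<close> this identifies the numerator of Dynkin's
  quotient for a potential: it is minus the occupation before exit.\<close>

lemma green_exit:
  assumes \<phi>: "test_fun \<phi>" and ab: "0 < a" "a < x" "x < b"
  shows "green \<phi> x = occ_exit \<phi> a x b + exit_left a x b * green \<phi> a + exit_right a x b * green \<phi> b"
proof -
  interpret prob_space "P x" by (rule prob_space_P)
  have ne: "ennreal a \<noteq> ennreal b" using ab by simp
  have fin: "(\<integral>\<^sup>+z. lft \<phi> z \<partial>potential (ennreal y)) = ennreal (green \<phi> y)" if "0 < y" for y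
    using ennreal_green[OF \<phi> that] by simp
  have "(\<integral>\<^sup>+z. lft \<phi> z \<partial>occ (ennreal x) (exitT a b)) \<le> (\<integral>\<^sup>+z. 1 \<partial>occ (ennreal x) (exitT a b))"
    by (intro nn_integral_mono lft_le_one \<phi>)
  also have "\<dots> < \<top>" using occ_exit_finite[of a x b] ab by simp
  finally have o: "(\<integral>\<^sup>+z. lft \<phi> z \<partial>occ (ennreal x) (exitT a b)) = ennreal (occ_exit \<phi> a x b)"
    by (simp add: occ_exit_def)
  have "ennreal (green \<phi> x) = ennreal (occ_exit \<phi> a x b) + ennreal (exit_left a x b) * ennreal (green \<phi> a) + ennreal (exit_right a x b) * ennreal (green \<phi> b)"
    using potential_exit[of "ennreal x" "ennreal a" "ennreal b" "lft \<phi>"] ne lft_measurable[OF test_fun_measurable[OF \<phi>]] ab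
    using o[unfolded exitT_def[abs_def]] by (simp add: fin emeasure_eq_measure exit_left_def exit_right_def)
  also have "\<dots> = ennreal (occ_exit \<phi> a x b + exit_left a x b * green \<phi> a + exit_right a x b * green \<phi> b)"
    by (simp add: ennreal_mult' ennreal_plus green_nonneg exit_probs occ_exit_def)
  finally show ?thesis
    by (subst (asm) ennreal_inj) (auto intro!: add_nonneg_nonneg mult_nonneg_nonneg simp: green_nonneg exit_probs occ_exit_def)
qed

lemma green_mono:
  assumes \<phi>: "test_fun \<phi>" and ab: "0 < a" "a \<le> x"
  shows "green \<phi> a \<le> green \<phi> x"
  unfolding green_def
proof (rule enn2real_mono)
  show "(\<integral>\<^sup>+z. lft \<phi> z \<partial>potential (ennreal a)) \<le> (\<integral>\<^sup>+z. lft \<phi> z \<partial>potential (ennreal x))"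
    using potential_above[of x a "lft \<phi>"] lft_measurable[OF test_fun_measurable[OF \<phi>]] ab by simp
qed (use green_integral_finite[OF \<phi>] ab in auto)

text \<open>Before exit the path stays in (a, b) by continuity, so bounds for \<phi> there are
  enough. The lower bound \<open>l\<close> may be negative, which \<open>ennreal\<close> cannot see;
  its sign is therefore distinguished.\<close>

lemma occ_exit_bounds:
  assumes \<phi>: "test_fun \<phi>" and ab: "0 < a" "a < x" "x < b" and lu: "0 \<le> u" "\<And>z. a < z \<Longrightarrow> z < b \<Longrightarrow> l \<le> \<phi> z \<and> \<phi> z \<le> u"
  shows "l * mean_exit a x b \<le> occ_exit \<phi> a x b" "occ_exit \<phi> a x b \<le> u * mean_exit a x b"
proof -
  note lm = lft_measurable[OF test_fun_measurable[OF \<phi>]]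
  have e: "emeasure (occ (ennreal x) (exitT a b)) UNIV = ennreal (mean_exit a x b)"
    using occ_exit_finite[of a x b] ab by (simp add: mean_exit_def)
  have "(\<integral>\<^sup>+z. lft \<phi> z \<partial>occ (ennreal x) (exitT a b)) \<le> (\<integral>\<^sup>+z. 1 \<partial>occ (ennreal x) (exitT a b))"
    by (intro nn_integral_mono lft_le_one \<phi>)
  also have "\<dots> < \<top>" using occ_exit_finite[of a x b] ab by simp
  finally have o: "(\<integral>\<^sup>+z. lft \<phi> z \<partial>occ (ennreal x) (exitT a b)) = ennreal (occ_exit \<phi> a x b)"
    by (simp add: occ_exit_def)
  have inside: "\<exists>z. path t \<omega> = ennreal z \<and> a < z \<and> z < b" if \<omega>: "regular_path x \<omega>" and t: "(\<omega>, t) \<in> occ_set (exitT a b)" for \<omega> t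
  proof -
    have t': "0 \<le> t" "ennreal t < hitting X (ennreal a) \<omega>" "ennreal t < hitting X (ennreal b) \<omega>" "ennreal t < life X \<omega>"
      using t by (auto simp: occ_set_def exitT_def located_def)
    have "ennreal a < pos X t \<omega>" using \<omega> t' ab by (intro above_before_hitting) auto
    moreover have "pos X t \<omega> < ennreal b" using \<omega> t' ab by (intro below_before_hitting) auto
    ultimately have "ennreal a < path t \<omega>" "path t \<omega> < ennreal b" using t' by (auto simp: path_def)
    then show ?thesis using ab by (cases "path t \<omega>") (auto simp: ennreal_less_iff)
  qed
  have "(\<integral>\<^sup>+z. ennreal l \<partial>occ (ennreal x) (exitT a b)) \<le> (\<integral>\<^sup>+z. lft \<phi> z \<partial>occ (ennreal x) (exitT a b))"
  proof (rule nn_integral_occ_mono)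
    fix \<omega> t assume "regular_path x \<omega>" "(\<omega>, t) \<in> occ_set (exitT a b)"
    from inside[OF this] obtain z where "path t \<omega> = ennreal z" "a < z" "z < b" by auto
    then show "ennreal l \<le> lft \<phi> (path t \<omega>)" using lu ab by (auto simp: lft_def intro: ennreal_leI)
  qed (use ab lm in auto)
  then have "ennreal l * ennreal (mean_exit a x b) \<le> ennreal (occ_exit \<phi> a x b)" by (simp add: e o)
  then show "l * mean_exit a x b \<le> occ_exit \<phi> a x b"
    using mult_nonpos_nonneg[of l "mean_exit a x b"]
    by (cases "0 \<le> l") (auto simp: ennreal_mult'[symmetric] mean_exit_nonneg occ_exit_def[of \<phi>] intro: order_trans[OF mult_nonpos_nonneg])
  have "(\<integral>\<^sup>+z. lft \<phi> z \<partial>occ (ennreal x) (exitT a b)) \<le> (\<integral>\<^sup>+z. ennreal u \<partial>occ (ennreal x) (exitT a b))"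
  proof (rule nn_integral_occ_mono)
    fix \<omega> t assume "regular_path x \<omega>" "(\<omega>, t) \<in> occ_set (exitT a b)"
    from inside[OF this] obtain z where "path t \<omega> = ennreal z" "a < z" "z < b" by auto
    then show "lft \<phi> (path t \<omega>) \<le> ennreal u" using lu ab by (auto simp: lft_def intro: ennreal_leI)
  qed (use ab lm in auto)
  then have "ennreal (occ_exit \<phi> a x b) \<le> ennreal u * ennreal (mean_exit a x b)" by (simp add: e o)
  then show "occ_exit \<phi> a x b \<le> u * mean_exit a x b"
    using lu(1) by (simp add: ennreal_mult'[symmetric] mean_exit_nonneg)
qed

section \<open>Continuity and generator of Green potentials\<close>

definition tent :: "real \<Rightarrow> real \<Rightarrow> real" where
  "tent x z = max 0 (1 - \<bar>z - x\<bar> / (x / 2))"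

text \<open>The half-width \<open>x / 2\<close> keeps the support in a compact subset of (0,
  \<infinity>). The value 1 at \<open>x\<close> produces generator -1 there, and the bound 1/2 near
  \<open>x\<close> produces a positive integral.\<close>

lemma tent_props:
  assumes "0 < x"
  shows "continuous_on UNIV (tent x)" "tent x x = 1" "z \<notin> {x/2..3*x/2} \<Longrightarrow> tent x z = 0" "0 \<le> tent x z" "tent x z \<le> 1"
    "\<bar>z - x\<bar> < x / 4 \<Longrightarrow> 1/2 \<le> tent x z"
  using assms by (auto simp: tent_def[abs_def] field_simps intro!: continuous_intros)

lemma tent_test_fun: "0 < x \<Longrightarrow> test_fun (tent x)"
  using tent_props by (auto simp: test_fun_def)

lemma tent_volterra_integrable: "0 < x \<Longrightarrow> volterra_integrable (tent x)"
  by (rule volterra_integrable_compact[of _ "x/2" "3*x/2"]) (use tent_props in auto)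

text \<open>A function with generator \<open>-1\<close> at \<open>x\<close>; adding a large multiple of the scale makes it monotone, so
  the Dynkin quotients at \<open>x\<close> bound the mean exit time and one of the exit probabilities.\<close>

lemma monotone_local_solution:
  assumes x: "0 < x"
  shows "\<exists>u. continuous_on {0<..} u \<and> local_generator_at X u x (-1) \<and> (\<forall>y z. 0 < y \<longrightarrow> y < z \<longrightarrow> z \<le> 2*x \<longrightarrow> u y < u z)"
    and "\<exists>u. continuous_on {0<..} u \<and> local_generator_at X u x (-1) \<and> (\<forall>y z. 0 < y \<longrightarrow> y < z \<longrightarrow> z \<le> 2*x \<longrightarrow> u z < u y)"
proof -
  let ?g = "tent x"
  note vi = tent_volterra_integrable[OF x]
  \<comment> \<open>A Lipschitz constant of \<open>volterra ?g\<close> with respect to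
    \<open>s\<close> on (0, 2x]; the slopes \<open>C + 1\<close> and \<open>- C - 1\<close> dominate
    it.\<close>
  define C where "C = (LINT z:{0<..2*x}|M. \<bar>?g z\<bar>)"
  have V: "\<bar>volterra ?g z - volterra ?g y\<bar> \<le> C * (s z - s y)" if "0 < y" "y < z" "z \<le> 2*x" for y z
  proof -
    have a: "set_integrable M {0<..y} (\<lambda>z. \<bar>?g z\<bar>)" for y using volterra_integrableD(1)[OF vi] by (intro set_integrable_abs) auto
    have "(LINT w:{0<..2*x}|M. \<bar>?g w\<bar>) = (LINT w:{0<..z}|M. \<bar>?g w\<bar>) + (LINT w:{z<..2*x}|M. \<bar>?g w\<bar>)"
      using set_integral_Ioc_split[OF a] that by auto
    moreover have "0 \<le> (LINT w:{z<..2*x}|M. \<bar>?g w\<bar>)" unfolding set_lebesgue_integral_def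
      by (intro integral_nonneg_AE) (auto simp: indicator_def)
    ultimately have "(LINT w:{0<..z}|M. \<bar>?g w\<bar>) \<le> C" by (simp add: C_def)
    then have "(s z - s y) * (LINT w:{0<..z}|M. \<bar>?g w\<bar>) \<le> (s z - s y) * C"
      using s_mono[of y z] that by (intro mult_left_mono) auto
    then show ?thesis using volterra_lipschitz[OF vi that(1) less_imp_le[OF that(2)]] by (simp add: mult.commute)
  qed
  have gen: "continuous_on {0<..} (\<lambda>x. c * s x - volterra ?g x) \<and> local_generator_at X (\<lambda>x. c * s x - volterra ?g x) x (-1)" for c
  proof -
    have 1: "continuous_on {0<..} (\<lambda>x. c * s x - volterra ?g x)" by (intro continuous_intros s_cont volterra_continuous vi)
    have 2: "continuous_on {0<..} (\<lambda>z. - ?g z)" using tent_props(1)[OF x] by (intro continuous_intros) (rule continuous_on_subset, auto)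
    show ?thesis using generator[unfolded local_generator_is_dmds_def, rule_format, OF 1 2] dmds_eq_scale_minus_volterra(1)[OF vi, of c] x 1
        tent_props(2)[OF x] by auto
  qed
  show "\<exists>u. continuous_on {0<..} u \<and> local_generator_at X u x (-1) \<and> (\<forall>y z. 0 < y \<longrightarrow> y < z \<longrightarrow> z \<le> 2*x \<longrightarrow> u y < u z)"
  proof (intro exI conjI allI impI)
    show "continuous_on {0<..} (\<lambda>x. (C+1) * s x - volterra ?g x)" "local_generator_at X (\<lambda>x. (C+1) * s x - volterra ?g x) x (-1)" using gen by auto
    fix y z assume "0 < y" "y < z" "z \<le> 2*x"
    then show "(C+1) * s y - volterra ?g y < (C+1) * s z - volterra ?g z"
      using V[of y z] s_strict[of y z] by (auto simp: algebra_simps)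
  qed
  show "\<exists>u. continuous_on {0<..} u \<and> local_generator_at X u x (-1) \<and> (\<forall>y z. 0 < y \<longrightarrow> y < z \<longrightarrow> z \<le> 2*x \<longrightarrow> u z < u y)"
  proof (intro exI conjI allI impI)
    show "continuous_on {0<..} (\<lambda>x. (- C - 1) * s x - volterra ?g x)" "local_generator_at X (\<lambda>x. (- C - 1) * s x - volterra ?g x) x (-1)" using gen by auto
    fix y z assume "0 < y" "y < z" "z \<le> 2*x"
    then show "(- C - 1) * s z - volterra ?g z < (- C - 1) * s y - volterra ?g y"
      using V[of y z] s_strict[of y z] by (auto simp: algebra_simps)
  qed
qed

lemma dynkin_quot_near:
  assumes "local_generator_at X u x l" "0 < e"
  shows "\<exists>d>0. \<forall>a b. x - d < a \<longrightarrow> a < x \<longrightarrow> x < b \<longrightarrow> b < x + d \<longrightarrow> \<bar>dynkin_quot X u x a b - l\<bar> < e"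
proof -
  have "\<forall>\<^sub>F p in at_left x \<times>\<^sub>F at_right x. dist (case p of (a, b) \<Rightarrow> dynkin_quot X u x a b) l < e"
    using assms unfolding local_generator_at_def by (rule tendstoD)
  then obtain Q R where QR: "eventually Q (at_left x)" "eventually R (at_right x)"
    "\<And>a b. Q a \<Longrightarrow> R b \<Longrightarrow> dist (dynkin_quot X u x a b) l < e"
    unfolding eventually_prod_filter by auto
  obtain d1 where d1: "d1 < x" "\<And>y. d1 < y \<Longrightarrow> y < x \<Longrightarrow> Q y" using QR(1) unfolding eventually_at_left_field by auto
  obtain d2 where d2: "x < d2" "\<And>y. x < y \<Longrightarrow> y < d2 \<Longrightarrow> R y" using QR(2) unfolding eventually_at_right_field by auto
  show ?thesis
  proof (intro exI[of _ "min (x - d1) (d2 - x)"] conjI allI impI)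
    fix a b assume "x - min (x - d1) (d2 - x) < a" "a < x" "x < b" "b < x + min (x - d1) (d2 - x)"
    then show "\<bar>dynkin_quot X u x a b - l\<bar> < e" using QR(3)[OF d1(2) d2(2)] by (auto simp: dist_real_def)
  qed (use d1 d2 in auto)
qed

text \<open>The quotient is close to -1, hence below -1/2. As division by zero has the value 0, the
  mean exit time in the denominator must be positive, and multiplying by it gives the
  estimate.\<close>

lemma exit_control:
  assumes u: "local_generator_at X u x (-1)" and x: "0 < x"
  shows "\<exists>d>0. d \<le> x \<and> (\<forall>a b. x - d < a \<longrightarrow> a < x \<longrightarrow> x < b \<longrightarrow> b < x + d \<longrightarrow> 0 < mean_exit a x b \<and>
     exit_left a x b * u a + exit_right a x b * u b - u x < - mean_exit a x b / 2)"
proof -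
  obtain d where d: "d > 0" "\<And>a b. x - d < a \<Longrightarrow> a < x \<Longrightarrow> x < b \<Longrightarrow> b < x + d \<Longrightarrow> \<bar>dynkin_quot X u x a b - (-1)\<bar> < 1/2"
    using dynkin_quot_near[OF u, of "1/2"] by auto
  show ?thesis
  proof (intro exI[of _ "min d x"] conjI allI impI)
    fix a b assume *: "x - min d x < a" "a < x" "x < b" "b < x + min d x"
    then have "\<bar>dynkin_quot X u x a b - (-1)\<bar> < 1/2" by (intro d(2)) auto
    then have q: "dynkin_quot X u x a b < - 1/2" by linarith
    have eq: "dynkin_quot X u x a b = (exit_left a x b * u a + exit_right a x b * u b - u x) / mean_exit a x b"
      using * by (intro dynkin_quot_eq) auto
    then have "mean_exit a x b \<noteq> 0" using q by auto
    then show pos: "0 < mean_exit a x b" using mean_exit_nonneg[of a x b] by simp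
    show "exit_left a x b * u a + exit_right a x b * u b - u x < - mean_exit a x b / 2"
      using q pos unfolding eq by (simp add: field_simps)
  qed (use d x in auto)
qed

text \<open>For the left limit \<open>b\<close> is kept fixed while \<open>a\<close> tends to
  \<open>x\<close>. An increasing \<open>u\<close> with generator -1 bounds both the mean exit time
  and the probability of leaving at \<open>b\<close> by multiples of \<open>u x - u a\<close>, so
  both contributions to \<open>green \<phi> x - green \<phi> a\<close> vanish. For the right limit a
  decreasing \<open>u\<close> does the same with the ends exchanged.\<close>

lemma green_continuous:
  assumes \<phi>: "test_fun \<phi>" shows "continuous_on {0<..} (green \<phi>)"
proof -
  have occ: "occ_exit \<phi> a x b \<le> mean_exit a x b" "0 \<le> occ_exit \<phi> a x b" if "0 < a" "a < x" "x < b" for a x b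
    using occ_exit_bounds(2)[OF \<phi> that, of 1 0] \<phi> by (auto simp: test_fun_def occ_exit_def)
  have "isCont (green \<phi>) x" if x: "0 < x" for x
  proof -
    have left: "(green \<phi> \<longlongrightarrow> green \<phi> x) (at_left x)"
    proof -
      obtain u where u: "continuous_on {0<..} u" "local_generator_at X u x (-1)" "\<And>y z. 0 < y \<Longrightarrow> y < z \<Longrightarrow> z \<le> 2*x \<Longrightarrow> u y < u z"
        using monotone_local_solution(1)[OF x] by auto
      obtain d where d: "d > 0" "d \<le> x" "\<And>a b. x - d < a \<Longrightarrow> a < x \<Longrightarrow> x < b \<Longrightarrow> b < x + d \<Longrightarrow> 0 < mean_exit a x b \<and>
         exit_left a x b * u a + exit_right a x b * u b - u x < - mean_exit a x b / 2"
        using exit_control[OF u(2) x] by metis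
      define b where "b = x + d/2"
      have b: "x < b" "b < x + d" "b \<le> 2*x" using d by (auto simp: b_def)
      define D where "D = u b - u x"
      have D: "D > 0" using u(3)[of x b] x b by (simp add: D_def)
      \<comment> \<open>The 2 comes from the occupation before exit, bounded by the mean exit time;
        the other summand comes from the exit probability, at most \<open>(u x - u a) / D\<close>,
        times \<open>green \<phi> b\<close>.\<close>
      define C where "C = 2 + green \<phi> b / D"
      have bound: "norm (green \<phi> a - green \<phi> x) \<le> C * (u x - u a)" if a: "x - d < a" "a < x" for a
      proof -
        have a0: "0 < a" using a d by auto
        note ctl = d(3)[OF a b(1,2)]
        let ?p = "exit_left a x b" and ?q = "exit_right a x b"
        have pq: "?p = 1 - ?q" using exit_sum[of a x b] a0 a b by simp
        have q0: "0 \<le> ?q" by (rule exit_probs)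
        have ux: "u a < u x" using u(3)[of a x] a0 a x by simp
        have q1: "?q \<le> 1" using pq exit_probs(1)[of a x b] by simp
        have h: "?q * D + mean_exit a x b / 2 < (1 - ?q) * (u x - u a)" using ctl unfolding pq D_def by (simp add: algebra_simps)
        also have "\<dots> \<le> 1 * (u x - u a)" using q0 ux by (intro mult_right_mono) auto
        finally have h: "?q * D + mean_exit a x b / 2 < u x - u a" by simp
        have m: "mean_exit a x b \<le> 2 * (u x - u a)"
        proof -
          have aux: "B \<le> 2 * w" if "A + B / 2 < w" "0 \<le> A" for A B w :: real using that by linarith
          show ?thesis by (rule aux[OF h mult_nonneg_nonneg[OF q0 less_imp_le[OF D]]])
        qed
        have "?q * D \<le> u x - u a" using h mean_exit_nonneg[of a x b] by linarith
        then have q: "?q \<le> (u x - u a) / D" using D by (simp add: field_simps)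
        have ge: "green \<phi> x - green \<phi> a = occ_exit \<phi> a x b + ?q * (green \<phi> b - green \<phi> a)"
          using green_exit[OF \<phi> a0 a(2) b(1)] unfolding pq by (simp add: algebra_simps)
        have gab: "green \<phi> a \<le> green \<phi> b" using a0 a b by (intro green_mono[OF \<phi>]) auto
        have gax: "green \<phi> a \<le> green \<phi> x" using a0 a by (intro green_mono[OF \<phi>]) auto
        have "?q * (green \<phi> b - green \<phi> a) \<le> (u x - u a) / D * green \<phi> b"
          using q gab green_nonneg[of \<phi> a] q0 ux D by (intro mult_mono) auto
        then have "green \<phi> x - green \<phi> a \<le> 2 * (u x - u a) + (u x - u a) / D * green \<phi> b"
          using ge m occ(1)[OF a0 a(2) b(1)] by linarith
        then show ?thesis using gax by (simp add: C_def algebra_simps)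
      qed
      have "((\<lambda>a. green \<phi> a - green \<phi> x) \<longlongrightarrow> 0) (at_left x)"
      proof (rule Lim_null_comparison)
        have "(u \<longlongrightarrow> u x) (at_left x)" using u(1) x
          by (metis continuous_on_eq_continuous_at continuous_within greaterThan_iff open_greaterThan tendsto_mono at_le subset_UNIV)
        then have "((\<lambda>a. C * (u x - u a)) \<longlongrightarrow> C * (u x - u x)) (at_left x)" by (intro tendsto_intros)
        then show "((\<lambda>a. C * (u x - u a)) \<longlongrightarrow> 0) (at_left x)" by simp
        show "\<forall>\<^sub>F a in at_left x. norm (green \<phi> a - green \<phi> x) \<le> C * (u x - u a)"
          unfolding eventually_at_left_field by (rule exI[of _ "x - d"]) (use bound d in auto)
      qed
      then show ?thesis by (simp add: LIM_zero_iff)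
    qed
    have right: "(green \<phi> \<longlongrightarrow> green \<phi> x) (at_right x)"
    proof -
      obtain u where u: "continuous_on {0<..} u" "local_generator_at X u x (-1)" "\<And>y z. 0 < y \<Longrightarrow> y < z \<Longrightarrow> z \<le> 2*x \<Longrightarrow> u z < u y"
        using monotone_local_solution(2)[OF x] by auto
      obtain d where d: "d > 0" "d \<le> x" "\<And>a b. x - d < a \<Longrightarrow> a < x \<Longrightarrow> x < b \<Longrightarrow> b < x + d \<Longrightarrow> 0 < mean_exit a x b \<and>
         exit_left a x b * u a + exit_right a x b * u b - u x < - mean_exit a x b / 2"
        using exit_control[OF u(2) x] by metis
      define a where "a = x - d/2"
      have a: "x - d < a" "a < x" "0 < a" using d by (auto simp: a_def)
      define D where "D = u a - u x"
      have D: "D > 0" using u(3)[of a x] x a by (simp add: D_def)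
      \<comment> \<open>Here \<open>b\<close> moves, and monotonicity bounds
        \<open>green \<phi> b\<close> by the value at the fixed point \<open>x + d\<close>.\<close>
      define C where "C = 2 + green \<phi> (x + d) / D"
      have bound: "norm (green \<phi> b - green \<phi> x) \<le> C * (u x - u b)" if b: "x < b" "b < x + d" for b
      proof -
        note ctl = d(3)[OF a(1,2) b]
        let ?p = "exit_left a x b" and ?q = "exit_right a x b"
        have qp: "?q = 1 - ?p" using exit_sum[of a x b] a b by simp
        have p0: "0 \<le> ?p" by (rule exit_probs)
        have ux: "u b < u x" using u(3)[of x b] b x d by simp
        have h: "?p * D + mean_exit a x b / 2 < (1 - ?p) * (u x - u b)" using ctl unfolding qp D_def by (simp add: algebra_simps)
        also have "\<dots> \<le> 1 * (u x - u b)" using p0 ux by (intro mult_right_mono) auto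
        finally have h: "?p * D + mean_exit a x b / 2 < u x - u b" by simp
        have m: "mean_exit a x b \<le> 2 * (u x - u b)"
        proof -
          have aux: "B \<le> 2 * w" if "A + B / 2 < w" "0 \<le> A" for A B w :: real using that by linarith
          show ?thesis by (rule aux[OF h mult_nonneg_nonneg[OF p0 less_imp_le[OF D]]])
        qed
        have "?p * D \<le> u x - u b" using h mean_exit_nonneg[of a x b] by linarith
        then have p: "?p \<le> (u x - u b) / D" using D by (simp add: field_simps)
        have ge: "green \<phi> b - green \<phi> x = ?p * (green \<phi> b - green \<phi> a) - occ_exit \<phi> a x b"
          using green_exit[OF \<phi> a(3,2) b(1)] unfolding qp by (simp add: algebra_simps)
        have gab: "green \<phi> a \<le> green \<phi> b" using a b by (intro green_mono[OF \<phi>]) auto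
        have gxb: "green \<phi> x \<le> green \<phi> b" using x b by (intro green_mono[OF \<phi>]) auto
        have gb: "green \<phi> b \<le> green \<phi> (x + d)" using x b by (intro green_mono[OF \<phi>]) auto
        have "?p * (green \<phi> b - green \<phi> a) \<le> (u x - u b) / D * green \<phi> (x + d)"
          using p gab gb green_nonneg[of \<phi> a] p0 ux D by (intro mult_mono) auto
        then have "green \<phi> b - green \<phi> x \<le> (u x - u b) / D * green \<phi> (x + d)"
          using ge occ(2)[OF a(3,2) b(1)] by linarith
        also have "\<dots> \<le> C * (u x - u b)" using ux by (simp add: C_def algebra_simps)
        finally show ?thesis using gxb by simp
      qed
      have "((\<lambda>b. green \<phi> b - green \<phi> x) \<longlongrightarrow> 0) (at_right x)"
      proof (rule Lim_null_comparison)
        have "(u \<longlongrightarrow> u x) (at_right x)" using u(1) x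
          by (metis continuous_on_eq_continuous_at continuous_within greaterThan_iff open_greaterThan tendsto_mono at_le subset_UNIV)
        then have "((\<lambda>b. C * (u x - u b)) \<longlongrightarrow> C * (u x - u x)) (at_right x)" by (intro tendsto_intros)
        then show "((\<lambda>b. C * (u x - u b)) \<longlongrightarrow> 0) (at_right x)" by simp
        show "\<forall>\<^sub>F b in at_right x. norm (green \<phi> b - green \<phi> x) \<le> C * (u x - u b)"
          unfolding eventually_at_right_field by (rule exI[of _ "x + d"]) (use bound d in auto)
      qed
      then show ?thesis by (simp add: LIM_zero_iff)
    qed
    show ?thesis using left right unfolding continuous_at_split by (simp add: continuous_within)
  qed
  then show ?thesis by (intro continuous_at_imp_continuous_on) auto
qed

text \<open>By the exit formula the Dynkin quotient is minus an average of \<phi> over the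
  occupation before exit, and \<phi> is nearly constant on a small interval.\<close>

lemma green_generator:
  assumes \<phi>: "test_fun \<phi>" and x: "0 < x"
  shows "local_generator_at X (green \<phi>) x (- \<phi> x)"
  unfolding local_generator_at_def
proof (rule tendstoI)
  fix e :: real assume e: "0 < e"
  have "isCont \<phi> x" using \<phi> by (simp add: test_fun_def continuous_on_eq_continuous_at)
  then obtain d1 where d1: "d1 > 0" "\<And>z. dist z x < d1 \<Longrightarrow> dist (\<phi> z) (\<phi> x) < e/2"
    unfolding continuous_at_eps_delta using e by (metis dist_real_def half_gt_zero)
  obtain u where u: "local_generator_at X u x (-1)" using monotone_local_solution(1)[OF x] by auto
  obtain d2 where d2: "d2 > 0" "d2 \<le> x" "\<And>a b. x - d2 < a \<Longrightarrow> a < x \<Longrightarrow> x < b \<Longrightarrow> b < x + d2 \<Longrightarrow> 0 < mean_exit a x b"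
    using exit_control[OF u x] by metis
  define d where "d = min d1 d2"
  have d: "d > 0" "d \<le> d1" "d \<le> d2" using d1 d2 by (auto simp: d_def)
  have main: "dist (dynkin_quot X (green \<phi>) x a b) (- \<phi> x) < e" if ab: "x - d < a" "a < x" "x < b" "b < x + d" for a b
  proof -
    have a0: "0 < a" using ab d d2 by auto
    have E: "0 < mean_exit a x b" using ab d by (intro d2) auto
    have q: "dynkin_quot X (green \<phi>) x a b = - occ_exit \<phi> a x b / mean_exit a x b"
      using dynkin_quot_eq[of a x b "green \<phi>"] green_exit[OF \<phi> a0 ab(2,3)] a0 ab by simp
    have phi: "\<phi> x - e/2 \<le> \<phi> z \<and> \<phi> z \<le> \<phi> x + e/2" if "a < z" "z < b" for z
    proof -
      have "dist z x < d1" using that ab d by (auto simp: dist_real_def)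
      from d1(2)[OF this] show ?thesis unfolding dist_real_def by linarith
    qed
    have u0: "0 \<le> \<phi> x + e/2" using \<phi> e by (auto simp: test_fun_def intro: add_nonneg_nonneg)
    have "(\<phi> x - e/2) * mean_exit a x b \<le> occ_exit \<phi> a x b" "occ_exit \<phi> a x b \<le> (\<phi> x + e/2) * mean_exit a x b"
      by (rule occ_exit_bounds[OF \<phi> a0 ab(2,3) u0 phi]; assumption)+
    then have "\<phi> x - e/2 \<le> occ_exit \<phi> a x b / mean_exit a x b" "occ_exit \<phi> a x b / mean_exit a x b \<le> \<phi> x + e/2"
      using E by (simp_all add: field_simps)
    then show ?thesis unfolding q dist_real_def using e by (simp add: abs_less_iff)
  qed
  show "\<forall>\<^sub>F p in at_left x \<times>\<^sub>F at_right x. dist (case p of (a, b) \<Rightarrow> dynkin_quot X (green \<phi>) x a b) (- \<phi> x) < e"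
    unfolding eventually_prod_filter
  proof (intro exI conjI allI impI)
    show "\<forall>\<^sub>F a in at_left x. x - d < a \<and> a < x" unfolding eventually_at_left_field by (rule exI[of _ "x - d"]) (use d in auto)
    show "\<forall>\<^sub>F b in at_right x. x < b \<and> b < x + d" unfolding eventually_at_right_field by (rule exI[of _ "x + d"]) (use d in auto)
  qed (use main in auto)
qed

lemma green_dmds: assumes \<phi>: "test_fun \<phi>" shows "dmds_eq m s (green \<phi>) (\<lambda>x. - \<phi> x)"
proof -
  have 1: "continuous_on {0<..} (\<lambda>x. - \<phi> x)" using \<phi> by (auto simp: test_fun_def intro!: continuous_intros intro: continuous_on_subset)
  from generator[unfolded local_generator_is_dmds_def, rule_format, OF green_continuous[OF \<phi>] 1] green_generator[OF \<phi>]
  show ?thesis by auto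
qed

text \<open>Started above the support, the process collects nothing until it reaches
  \<open>d\<close>. The potential is flat there, which supplies the boundary condition on its
  slope.\<close>

lemma green_const_above:
  assumes \<phi>: "test_fun \<phi>" and cd: "0 < d" "\<And>z. d < z \<Longrightarrow> \<phi> z = 0" and x: "d \<le> x"
  shows "green \<phi> x = green \<phi> d"
proof -
  note lm = lft_measurable[OF test_fun_measurable[OF \<phi>]]
  have "(\<integral>\<^sup>+z. lft \<phi> z \<partial>occ (ennreal x) (hitting X (ennreal d))) \<le> (\<integral>\<^sup>+z. 0 \<partial>occ (ennreal x) (hitting X (ennreal d)))"
  proof (rule nn_integral_occ_mono)
    fix \<omega> t assume \<omega>: "regular_path x \<omega>" and t: "(\<omega>, t) \<in> occ_set (hitting X (ennreal d))"
    have t': "0 \<le> t" "ennreal t < hitting X (ennreal d) \<omega>" "ennreal t < life X \<omega>"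
      using t by (auto simp: occ_set_def located_def)
    have "ennreal d < path t \<omega>" using above_before_hitting[OF \<omega> t'(1,2) x] t' by (simp add: path_def)
    then show "lft \<phi> (path t \<omega>) \<le> 0" using cd by (cases "path t \<omega>") (auto simp: lft_def ennreal_less_iff)
  qed (use x cd lm in auto)
  then show ?thesis using potential_above[of x d "lft \<phi>"] x cd lm unfolding green_def by simp
qed

text \<open>Flatness above \<open>d\<close> and the equation determine the right derivative
  everywhere. It agrees with that of the explicit solution, so the two differ by a constant.\<close>

lemma green_representation:
  assumes \<phi>: "test_fun \<phi>" and cd: "0 < c" "c \<le> d" "\<And>z. z \<notin> {c..d} \<Longrightarrow> \<phi> z = 0"
  shows "\<exists>C. \<forall>x>0. green \<phi> x = (LINT z:{0<..d}|M. \<phi> z) * s x - volterra \<phi> x + C"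
proof -
  have vi: "volterra_integrable \<phi>" using \<phi> by (intro volterra_integrable_compact[OF _ cd(1,3)]) (auto simp: test_fun_def)
  note i = volterra_integrableD(1)[OF vi]
  let ?k = "LINT z:{0<..d}|M. \<phi> z"
  let ?u = "\<lambda>x. ?k * s x - volterra \<phi> x"
  have d0: "0 < d" using cd by simp
  have rd0: "(ds_quot s (green \<phi>) x \<longlongrightarrow> 0) (at_right x)" if "d \<le> x" for x
  proof (rule tendsto_eventually)
    have "\<forall>\<^sub>F y in at_right x. x < y" by (simp add: eventually_at_right_less)
    then show "\<forall>\<^sub>F y in at_right x. ds_quot s (green \<phi>) x y = 0"
    proof eventually_elim
      case (elim y)
      then show ?case using green_const_above[OF \<phi> d0, of x] green_const_above[OF \<phi> d0, of y] that cd by (simp add: ds_quot_def)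
    qed
  qed
  have rd: "right_deriv s (green \<phi>) x = ?k - (LINT z:{0<..x}|M. \<phi> z)" if x: "0 < x" for x
  proof (cases "x < d")
    case True
    have "right_deriv s (green \<phi>) d - right_deriv s (green \<phi>) x = (LINT z:{x<..d}|M. - \<phi> z)"
      using green_dmds[OF \<phi>] x True unfolding dmds_eq_def by blast
    moreover have "right_deriv s (green \<phi>) d = 0" by (rule right_deriv_eqI[OF rd0]) simp
    ultimately have "right_deriv s (green \<phi>) x = (LINT z:{x<..d}|M. \<phi> z)" by (simp add: set_lebesgue_integral_def)
    then show ?thesis using set_integral_Ioc_split[OF i[of 0 d], of x] x True by simp
  next
    case False
    have "right_deriv s (green \<phi>) x = 0" by (rule right_deriv_eqI[OF rd0]) (use False in simp)
    moreover have "(LINT z:{d<..x}|M. \<phi> z) = (LINT z:{d<..x}|M. 0)" by (rule set_lebesgue_integral_cong) (use cd in auto)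
    ultimately show ?thesis using set_integral_Ioc_split[OF i[of 0 x], of d] d0 False by simp
  qed
  have 0: "(ds_quot s (\<lambda>x. green \<phi> x - ?u x) x \<longlongrightarrow> 0) (at_right x)" if x: "0 < x" for x
  proof -
    have "(ds_quot s (\<lambda>x. green \<phi> x - ?u x) x \<longlongrightarrow> right_deriv s (green \<phi>) x - (?k - (LINT z:{0<..x}|M. \<phi> z))) (at_right x)"
      unfolding ds_quot_diff[of s "green \<phi>"]
      by (intro tendsto_diff dmds_eq_right_deriv[OF green_dmds[OF \<phi>] x] dmds_eq_scale_minus_volterra(2)[OF vi x])
    then show ?thesis by (simp add: rd[OF x])
  qed
  have cont: "continuous_on {0<..} (\<lambda>x. green \<phi> x - ?u x)"
    by (intro continuous_intros green_continuous \<phi> s_cont volterra_continuous vi)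
  have "green \<phi> x - ?u x = green \<phi> 1 - ?u 1" if "0 < x" for x
    using zero_right_deriv_const[OF cont 0 that, of 1] by simp
  then show ?thesis by (intro exI[of _ "green \<phi> 1 - ?u 1"]) (auto simp: algebra_simps)
qed

section \<open>The scale at 0 and the density of the Green measure\<close>

lemma volterra_zero_below:
  assumes "\<And>z. z < c \<Longrightarrow> \<phi> z = 0" "x < c" shows "volterra \<phi> x = 0"
proof -
  have "volterra \<phi> x = (LINT z:{0<..x}|M. 0)" unfolding volterra_def
    by (rule set_lebesgue_integral_cong) (use assms in auto)
  then show ?thesis by simp
qed

text \<open>Below the support of the tent its potential is \<open>?k * s + C\<close> with
  \<open>?k\<close> positive. A potential is nonnegative, so \<open>s\<close> cannot tend to minus
  infinity at 0.\<close>

lemma scale_bounded_below: "bdd_below (s ` {0<..})"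
proof -
  let ?\<phi> = "tent 1"
  have vi: "volterra_integrable ?\<phi>" by (rule tent_volterra_integrable) simp
  obtain C where C: "\<And>x. 0 < x \<Longrightarrow> green ?\<phi> x = (LINT z:{0<..3/2}|M. ?\<phi> z) * s x - volterra ?\<phi> x + C"
    using green_representation[OF tent_test_fun, of 1 "1/2" "3/2"] tent_props(3)[of 1] by auto
  let ?k = "LINT z:{0<..3/2}|M. ?\<phi> z"
  have fin: "emeasure M {3/4<..<5/4} < \<top>"
    by (rule le_less_trans[OF emeasure_mono M_compact[of "3/4" "5/4"]]) auto
  \<comment> \<open>Full support gives mass to (3/4, 5/4), where the tent is at least 1/2.\<close>
  have "0 < (1/2) * measure M {3/4<..<5/4}"
    using M_open_pos[of "3/4" "5/4"] fin by (simp add: measure_def enn2real_positive_iff)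
  also have "\<dots> = (\<integral>z. (1/2) * indicator {3/4<..<5/4} z \<partial>M)" (is "_ = integral\<^sup>L M ?i") by simp
  also have "\<dots> \<le> ?k" unfolding set_lebesgue_integral_def
  proof (rule integral_mono)
    show "integrable M ?i" using fin by simp
    show "integrable M (\<lambda>z. indicator {0<..3/2} z *\<^sub>R ?\<phi> z)" using volterra_integrableD(1)[OF vi, of 0 "3/2"] by (simp add: set_integrable_def)
    show "(1/2) * indicator {3/4<..<5/4} z \<le> indicator {0<..3/2} z *\<^sub>R ?\<phi> z" for z :: real
    proof (cases "z \<in> {3/4<..<5/4}")
      case True
      then have "\<bar>z - 1\<bar> < 1/4" unfolding greaterThanLessThan_iff by linarith
      then show ?thesis using tent_props(6)[of 1 z] True by (auto simp: indicator_def)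
    next
      case False
      then show ?thesis using tent_props(4)[of 1 z] by (auto simp: indicator_def)
    qed
  qed
  finally have k: "0 < ?k" .
  have "- C / ?k \<le> s x" if "0 < x" for x
  proof -
    \<comment> \<open>Below 1/2 the Volterra term vanishes; larger \<open>x\<close> are covered by
      monotonicity of \<open>s\<close>.\<close>
    define y where "y = min x (1/4)"
    have y: "0 < y" "y \<le> x" "y < 1/2" using that by (auto simp: y_def)
    have "0 \<le> ?k * s y + C" using C[OF y(1)] volterra_zero_below[of "1/2" ?\<phi> y] tent_props(3)[of 1] y green_nonneg[of ?\<phi> y] by simp
    then have "- C / ?k \<le> s y" using k by (simp add: field_simps)
    also have "\<dots> \<le> s x" using y by (intro s_mono) auto
    finally show ?thesis .
  qed
  then show ?thesis by (intro bdd_belowI[of _ "- C / ?k"]) auto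
qed

text \<open>S, normalised to vanish at 0. The value 0 on the nonpositive half-line makes it monotone
  on the whole line, hence Borel.\<close>

definition Sc :: "real \<Rightarrow> real" where
  "Sc x = (if x \<le> 0 then 0 else s x - Inf (s ` {0<..}))"

lemma Sc_pos: assumes "0 < x" shows "0 < Sc x"
proof -
  have "Inf (s ` {0<..}) \<le> s (x/2)" using assms by (intro cInf_lower scale_bounded_below) auto
  also have "\<dots> < s x" using assms by (intro s_strict) auto
  finally show ?thesis using assms by (simp add: Sc_def)
qed

lemma Sc_nonneg: "0 \<le> Sc x"
  using Sc_pos[of x] by (cases "0 < x") (auto simp: Sc_def)

lemma Sc_diff: "0 < x \<Longrightarrow> 0 < y \<Longrightarrow> Sc y - Sc x = s y - s x"
  by (simp add: Sc_def)

lemma Sc_mono: assumes "x \<le> y" shows "Sc x \<le> Sc y"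
proof (cases "0 < x")
  case True
  then show ?thesis using Sc_diff[of x y] s_mono[of x y] assms by simp
next
  case False
  then show ?thesis using Sc_nonneg[of y] by (simp add: Sc_def)
qed

lemma Sc_measurable [measurable]: "Sc \<in> borel_measurable borel"
  by (intro borel_measurable_mono monoI Sc_mono)

lemma Sc_tendsto_0: "(Sc \<longlongrightarrow> 0) (at_right 0)"
proof (rule tendstoI)
  fix e :: real assume "0 < e"
  then have "Inf (s ` {0<..}) < Inf (s ` {0<..}) + e" by simp
  then obtain x0 where x0: "0 < x0" "s x0 < Inf (s ` {0<..}) + e"
    using cInf_lessD[of "s ` {0<..}" "Inf (s ` {0<..}) + e"] by auto
  have "dist (Sc y) 0 < e" if "0 < y" "y < x0" for y
    using Sc_mono[of y x0] Sc_nonneg[of y] x0 that by (simp add: dist_real_def Sc_def)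
  then show "\<forall>\<^sub>F y in at_right 0. dist (Sc y) 0 < e"
    unfolding eventually_at_right_field using x0 by blast
qed

text \<open>The constant left open by \<open>green_representation\<close> is found by letting the
  starting point tend to 0, where both the potential and S vanish. Splitting at \<open>x\<close>
  then turns \<open>k * Sc x - volterra \<phi> x\<close> into an integral against the symmetric
  kernel \<open>Sc (min x z)\<close>.\<close>

lemma green_density_test:
  assumes \<phi>: "test_fun \<phi>" and cd: "0 < c" "c \<le> d" "\<And>z. z \<notin> {c..d} \<Longrightarrow> \<phi> z = 0" and x: "0 < x"
  shows "(\<integral>\<^sup>+z. lft \<phi> z \<partial>potential (ennreal x)) = (\<integral>\<^sup>+z. ennreal (Sc (min x z)) * ennreal (\<phi> z) \<partial>M)"
proof -
  note lm = lft_measurable[OF test_fun_measurable[OF \<phi>]]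
  note [measurable] = test_fun_measurable[OF \<phi>]
  have vi: "volterra_integrable \<phi>" using \<phi> by (intro volterra_integrable_compact[OF _ cd(1,3)]) (auto simp: test_fun_def)
  note i = volterra_integrableD[OF vi]
  define k where "k = (LINT z:{0<..d}|M. \<phi> z)"
  define s0 where "s0 = Inf (s ` {0<..})"
  obtain C where C: "\<And>x. 0 < x \<Longrightarrow> green \<phi> x = k * s x - volterra \<phi> x + C"
    using green_representation[OF \<phi> cd] k_def by auto
  have "C = - k * s0"
  proof -
    let ?a = "\<lambda>n. 1 / real (Suc n)"
    have a0: "?a \<longlonglongrightarrow> 0" by (rule LIMSEQ_Suc[OF lim_1_over_n])
    have "(\<lambda>n. \<integral>\<^sup>+z. lft \<phi> z \<partial>potential (ennreal (?a n))) \<longlonglongrightarrow> ennreal 0"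
      using potential_at_zero_limit[OF lm] green_integral_finite[OF \<phi>, of 1] by simp
    then have 1: "(\<lambda>n. green \<phi> (?a n)) \<longlonglongrightarrow> 0"
      unfolding green_def by (rule tendsto_enn2real) simp
    have "filterlim ?a (at_right 0) sequentially"
      by (rule tendsto_imp_filterlim_at_right[OF a0]) auto
    then have "(\<lambda>n. Sc (?a n)) \<longlonglongrightarrow> 0" by (rule filterlim_compose[OF Sc_tendsto_0])
    then have "(\<lambda>n. k * (Sc (?a n) + s0) + C) \<longlonglongrightarrow> k * (0 + s0) + C" by (intro tendsto_intros)
    moreover have "\<forall>\<^sub>F n in sequentially. k * (Sc (?a n) + s0) + C = green \<phi> (?a n)"
    proof -
      have "\<forall>\<^sub>F n in sequentially. ?a n < c" using a0 cd(1) by (rule order_tendstoD)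
      then show ?thesis
      proof eventually_elim
        case (elim n)
        have "volterra \<phi> (?a n) = 0" by (rule volterra_zero_below[OF _ elim]) (use cd in auto)
        then show ?case using C[of "?a n"] by (simp add: Sc_def s0_def)
      qed
    qed
    ultimately have "(\<lambda>n. green \<phi> (?a n)) \<longlonglongrightarrow> k * (0 + s0) + C" by (rule Lim_transform_eventually)
    from LIMSEQ_unique[OF this 1] show ?thesis by simp
  qed
  then have gx: "green \<phi> x = k * Sc x - volterra \<phi> x" using C[OF x] x by (simp add: Sc_def s0_def algebra_simps)
  \<comment> \<open>An end point beyond both \<open>x\<close> and the support of \<phi>, so that all
    integrals live on (0, D].\<close>
  define D where "D = max x d"
  have D: "x \<le> D" "d \<le> D" "0 < D" using x by (auto simp: D_def)
  let ?h = "\<lambda>z. Sc (min x z) * \<phi> z"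
  have i1: "set_integrable M {0<..x} ?h" "(LINT z:{0<..x}|M. ?h z) = Sc x * (LINT z:{0<..x}|M. \<phi> z) - volterra \<phi> x"
  proof -
    have eq: "indicator {0<..x} z *\<^sub>R ?h z = indicator {0<..x} z *\<^sub>R (Sc x * \<phi> z - (s x - s z) * \<phi> z)" for z
    proof (cases "z \<in> {0<..x}")
      case True
      then have "Sc (min x z) = Sc x - (s x - s z)" using Sc_diff[of z x] x by (simp add: min_absorb2)
      then show ?thesis by (simp add: left_diff_distrib)
    qed simp
    have j: "set_integrable M {0<..x} (\<lambda>z. Sc x * \<phi> z)" "set_integrable M {0<..x} (\<lambda>z. (s x - s z) * \<phi> z)" using i by auto
    show "set_integrable M {0<..x} ?h" using set_integral_diff(1)[OF j] unfolding set_integrable_def eq .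
    have "(LINT z:{0<..x}|M. ?h z) = (LINT z:{0<..x}|M. Sc x * \<phi> z - (s x - s z) * \<phi> z)"
      unfolding set_lebesgue_integral_def eq ..
    also have "\<dots> = Sc x * (LINT z:{0<..x}|M. \<phi> z) - volterra \<phi> x"
      using set_integral_diff(2)[OF j] by (simp add: volterra_def)
    finally show "(LINT z:{0<..x}|M. ?h z) = Sc x * (LINT z:{0<..x}|M. \<phi> z) - volterra \<phi> x" .
  qed
  have i2: "set_integrable M {x<..D} ?h" "(LINT z:{x<..D}|M. ?h z) = Sc x * (LINT z:{x<..D}|M. \<phi> z)"
  proof -
    have eq: "indicator {x<..D} z *\<^sub>R ?h z = indicator {x<..D} z *\<^sub>R (Sc x * \<phi> z)" for z by (auto simp: indicator_def min_def)
    have j: "set_integrable M {x<..D} (\<lambda>z. Sc x * \<phi> z)" using i x by auto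
    then show "set_integrable M {x<..D} ?h" unfolding set_integrable_def eq .
    have "(LINT z:{x<..D}|M. ?h z) = (LINT z:{x<..D}|M. Sc x * \<phi> z)" unfolding set_lebesgue_integral_def eq ..
    then show "(LINT z:{x<..D}|M. ?h z) = Sc x * (LINT z:{x<..D}|M. \<phi> z)" by simp
  qed
  have un: "{0<..D} = {0<..x} \<union> {x<..D}" using x D by auto
  have ih: "set_integrable M {0<..D} ?h" unfolding un by (rule set_integrable_Un[OF i1(1) i2(1)]) auto
  have kD: "k = (LINT z:{0<..D}|M. \<phi> z)"
  proof -
    have "(LINT z:{d<..D}|M. \<phi> z) = (LINT z:{d<..D}|M. 0)" by (rule set_lebesgue_integral_cong) (use cd in auto)
    then show ?thesis using set_integral_Ioc_split[OF i(1)[of 0 D], of d] D cd by (simp add: k_def)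
  qed
  have "(LINT z:{0<..D}|M. ?h z) = (LINT z:{0<..x}|M. ?h z) + (LINT z:{x<..D}|M. ?h z)"
    using set_integral_Ioc_split[OF ih, of x] x D by simp
  also have "\<dots> = Sc x * ((LINT z:{0<..x}|M. \<phi> z) + (LINT z:{x<..D}|M. \<phi> z)) - volterra \<phi> x"
    unfolding i1(2) i2(2) by (simp add: algebra_simps)
  also have "(LINT z:{0<..x}|M. \<phi> z) + (LINT z:{x<..D}|M. \<phi> z) = k"
    using set_integral_Ioc_split[OF i(1)[of 0 D], of x] x D kD by simp
  finally have gi: "green \<phi> x = (LINT z:{0<..D}|M. ?h z)" by (simp add: gx mult.commute)
  have "(\<integral>\<^sup>+z. ennreal (Sc (min x z)) * ennreal (\<phi> z) \<partial>M) = (\<integral>\<^sup>+z. ennreal (indicator {0<..D} z *\<^sub>R ?h z) \<partial>M)"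
  proof (rule nn_integral_cong)
    fix z
    have "0 \<le> \<phi> z" using \<phi> by (simp add: test_fun_def)
    moreover have "\<phi> z = 0" if "z \<notin> {0<..D}" using that cd D by (intro cd(3)) auto
    ultimately show "ennreal (Sc (min x z)) * ennreal (\<phi> z) = ennreal (indicator {0<..D} z *\<^sub>R ?h z)"
      by (auto simp: ennreal_mult[OF Sc_nonneg] indicator_def)
  qed
  also have "\<dots> = ennreal (LINT z:{0<..D}|M. ?h z)"
    unfolding set_lebesgue_integral_def
  proof (rule nn_integral_eq_integral)
    show "integrable M (\<lambda>z. indicator {0<..D} z *\<^sub>R ?h z)" using ih by (simp add: set_integrable_def)
    show "AE z in M. 0 \<le> indicator {0<..D} z *\<^sub>R ?h z" using \<phi> Sc_nonneg by (auto simp: test_fun_def indicator_def)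
  qed
  finally show ?thesis using ennreal_green[OF \<phi> x] gi by simp
qed

text \<open>Approximates the indicator of (a, \<infinity>) from below: the first term opens at
  \<open>a + 1 / n\<close>, the second closes at \<open>n\<close>. For nonnegative \<open>a\<close>
  the support stays compact in (0, \<infinity>).\<close>

definition ramp :: "real \<Rightarrow> nat \<Rightarrow> real \<Rightarrow> real" where
  "ramp a n z = max 0 (min 1 (min (real n * (z - a) - 1) (real n - z)))"

lemma ramp_props:
  assumes "0 \<le> a"
  shows "test_fun (ramp a n)" "incseq (\<lambda>n. ramp a n z)" "z \<le> a \<Longrightarrow> ramp a n z = 0" "a < z \<Longrightarrow> \<exists>n. ramp a n z = 1"
    "z \<notin> {1 / (real n + 1)..real n + 1} \<Longrightarrow> ramp a n z = 0"
proof -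
  show "test_fun (ramp a n)" unfolding test_fun_def ramp_def[abs_def] by (auto intro!: continuous_intros)
  show z: "ramp a n z = 0" if "z \<le> a" for z n
  proof -
    have "real n * (z - a) \<le> 0" using that by (simp add: mult_nonneg_nonpos)
    then show ?thesis by (simp add: ramp_def)
  qed
  show "incseq (\<lambda>n. ramp a n z)"
  proof (cases "z \<le> a")
    case True then show ?thesis by (simp add: z)
  next
    case False
    then have "real k * (z - a) \<le> real n * (z - a)" if "k \<le> n" for k n using that by (intro mult_right_mono) auto
    then show ?thesis unfolding ramp_def by (intro incseq_def[THEN iffD2] allI impI max.mono min.mono diff_right_mono) auto
  qed
  show "\<exists>n. ramp a n z = 1" if "a < z"
  proof -
    obtain n :: nat where n: "max (2 / (z - a)) (z + 1) < real n" using reals_Archimedean2 by blast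
    then have "2 / (z - a) < real n" "z + 1 < real n" by auto
    then have "2 \<le> real n * (z - a)" using that by (simp add: field_simps)
    then show ?thesis using \<open>z + 1 < real n\<close> by (intro exI[of _ n]) (simp add: ramp_def)
  qed
  show "ramp a n z = 0" if "z \<notin> {1 / (real n + 1)..real n + 1}"
  proof (cases "z < 1 / (real n + 1)")
    case True
    show ?thesis
    proof (cases "z \<le> 0")
      case True then show ?thesis using assms by (intro z) simp
    next
      case False
      have "real n * (z - a) \<le> real n * z" using assms by (intro mult_left_mono) auto
      also have "\<dots> \<le> (real n + 1) * z" using False by (simp add: algebra_simps)
      also have "\<dots> \<le> 1" using True by (simp add: field_simps)
      finally show ?thesis by (simp add: ramp_def)
    qed
  next
    case False
    then have "real n - z < 0" using that by auto
    then show ?thesis by (simp add: ramp_def)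
  qed
qed

lemma emeasure_real_potential:
  assumes A: "A \<in> sets borel"
  shows "emeasure (distr (restrict_space (potential y) {0<..<\<top>}) borel enn2real) A = emeasure (potential y) (pos_part_lift A)"
proof -
  have "emeasure (distr (restrict_space (potential y) {0<..<\<top>}) borel enn2real) A
      = emeasure (restrict_space (potential y) {0<..<\<top>}) (enn2real -` A \<inter> space (restrict_space (potential y) {0<..<\<top>}))"
    by (rule emeasure_distr[OF measurable_restrict_space1 A]) simp
  also have "enn2real -` A \<inter> space (restrict_space (potential y) {0<..<\<top>}) = pos_part_lift A"
    by (auto simp: pos_part_lift_def space_restrict_space)
  also have "emeasure (restrict_space (potential y) {0<..<\<top>}) (pos_part_lift A) = emeasure (potential y) (pos_part_lift A)"
    by (rule emeasure_restrict_space) (auto simp: pos_part_lift_def)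
  finally show ?thesis .
qed

text \<open>Two finite measures on the line agree if they agree on all half-lines (a, \<infinity>),
  and the ramps reach these by monotone convergence. A negative \<open>a\<close> reduces to 0
  because neither measure charges the nonpositive half-line.\<close>

lemma real_potential_eq_density:
  assumes x: "0 < x"
  shows "distr (restrict_space (potential (ennreal x)) {0<..<\<top>}) borel enn2real = density M (\<lambda>z. ennreal (Sc (min x z)))"
proof -
  define K where "K = density M (\<lambda>z. ennreal (Sc (min x z)))"
  define N where "N = distr (restrict_space (potential (ennreal x)) {0<..<\<top>}) borel enn2real"
  have N: "emeasure N A = emeasure (potential (ennreal x)) (pos_part_lift A)" if "A \<in> sets borel" for A
    unfolding N_def by (rule emeasure_real_potential[OF that])
  have K: "emeasure K A = (\<integral>\<^sup>+z\<in>A. ennreal (Sc (min x z)) \<partial>M)" if A: "A \<in> sets borel" for A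
    unfolding K_def using A by (subst emeasure_density) auto
  have gt: "emeasure N {a<..} = emeasure K {a<..}" if a: "0 \<le> a" for a
  proof -
    have [measurable]: "ramp a n \<in> borel_measurable borel" for n by (rule test_fun_measurable[OF ramp_props(1)[OF a]])
    have S: "(SUP n. ennreal (ramp a n z)) = indicator {a<..} z" for z
    proof (cases "z \<le> a")
      case True then show ?thesis using ramp_props(3)[OF a True] by simp
    next
      case False
      then obtain n where n: "ramp a n z = 1" using ramp_props(4)[OF a, of z] by auto
      have "(SUP n. ennreal (ramp a n z)) = 1"
      proof (rule antisym)
        show "(SUP n. ennreal (ramp a n z)) \<le> 1" using ramp_props(1)[OF a] by (intro SUP_least) (auto simp: test_fun_def)
        show "1 \<le> (SUP n. ennreal (ramp a n z))" by (rule SUP_upper2[of n]) (auto simp: n)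
      qed
      then show ?thesis using False by simp
    qed
    have inc: "incseq (\<lambda>n. ennreal (ramp a n z))" for z
      using ramp_props(2)[OF a, of z] by (auto simp: incseq_def intro: ennreal_leI)
    have "emeasure N {a<..} = (\<integral>\<^sup>+z. indicator (pos_part_lift {a<..}) z \<partial>potential (ennreal x))"
      by (simp add: N)
    also have "\<dots> = (\<integral>\<^sup>+z. (SUP n. lft (ramp a n) z) \<partial>potential (ennreal x))"
    proof (rule nn_integral_cong)
      fix z :: ennreal
      show "indicator (pos_part_lift {a<..}) z = (SUP n. lft (ramp a n) z)"
        using S[of "enn2real z"] a
        by (cases z) (auto simp: lft_def pos_part_lift_def indicator_def)
    qed
    also have "\<dots> = (SUP n. \<integral>\<^sup>+z. lft (ramp a n) z \<partial>potential (ennreal x))"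
    proof (rule nn_integral_monotone_convergence_SUP)
      show "incseq (\<lambda>n. lft (ramp a n))" using inc by (auto simp: incseq_def le_fun_def lft_def)
      show "lft (ramp a n) \<in> borel_measurable (potential (ennreal x))" for n
        using lft_measurable[of "ramp a n"] by simp
    qed
    also have "\<dots> = (SUP n. \<integral>\<^sup>+z. ennreal (Sc (min x z)) * ennreal (ramp a n z) \<partial>M)"
    proof (rule SUP_cong[OF refl])
      fix n
      have "1 / (real n + 1) \<le> real n + 1"
      proof -
        have "1 / (real n + 1) \<le> 1" by simp
        then show ?thesis by linarith
      qed
      then show "(\<integral>\<^sup>+z. lft (ramp a n) z \<partial>potential (ennreal x)) = (\<integral>\<^sup>+z. ennreal (Sc (min x z)) * ennreal (ramp a n z) \<partial>M)"
        by (intro green_density_test[OF ramp_props(1)[OF a] _ _ ramp_props(5)[OF a] x]) auto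
    qed
    also have "\<dots> = (\<integral>\<^sup>+z. (SUP n. ennreal (Sc (min x z)) * ennreal (ramp a n z)) \<partial>M)"
    proof (rule nn_integral_monotone_convergence_SUP[symmetric])
      show "incseq (\<lambda>n z. ennreal (Sc (min x z)) * ennreal (ramp a n z))" using inc by (auto simp: incseq_def le_fun_def intro!: mult_left_mono)
    qed measurable
    also have "\<dots> = (\<integral>\<^sup>+z\<in>{a<..}. ennreal (Sc (min x z)) \<partial>M)"
      by (simp add: SUP_mult_left_ennreal[symmetric] S)
    finally show ?thesis by (simp add: K)
  qed
  have le0: "emeasure N {..0} = 0" "emeasure K {..0} = 0"
  proof -
    have "pos_part_lift {..0} = {}" by (auto simp: pos_part_lift_def enn2real_positive_iff not_less[symmetric] less_top)
    then show "emeasure N {..0} = 0" by (simp add: N)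
    have "(\<integral>\<^sup>+z\<in>{..0}. ennreal (Sc (min x z)) \<partial>M) = (\<integral>\<^sup>+z. 0 \<partial>M)"
      by (rule nn_integral_cong_AE) (use AE_M_pos in \<open>auto elim!: eventually_mono simp: indicator_def\<close>)
    then show "emeasure K {..0} = 0" by (simp add: K)
  qed
  have fin: "emeasure N B < \<infinity>" if "B \<in> sets borel" for B
  proof -
    have "emeasure N B \<le> emeasure (potential (ennreal x)) UNIV" unfolding N[OF that] by (rule emeasure_mono) auto
    then show ?thesis using mean_finite[OF x] by (simp add: le_less_trans)
  qed
  have "N = K"
  proof (rule measure_eqI_lessThan)
    show "sets N = sets borel" "sets K = sets borel" by (auto simp: N_def K_def)
    show "emeasure N {y<..} < \<infinity>" for y using fin by simp
    fix y :: real
    show "emeasure N {y<..} = emeasure K {y<..}"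
    proof (cases "0 \<le> y")
      case False
      have sp: "{y<..} = {y<..0} \<union> {0<..}" using False by auto
      have *: "emeasure L {y<..} = emeasure L {0<..}" if "emeasure L {..0} = 0" "sets L = sets borel" for L :: "real measure"
      proof -
        have "emeasure L {y<..} \<le> emeasure L {y<..0} + emeasure L {0<..}" unfolding sp by (rule emeasure_subadditive) (auto simp: that)
        moreover have "emeasure L {y<..0} \<le> emeasure L {..0}" by (rule emeasure_mono) (auto simp: that)
        moreover have "emeasure L {0<..} \<le> emeasure L {y<..}" by (rule emeasure_mono) (use False in \<open>auto simp: that\<close>)
        ultimately show ?thesis using that by simp
      qed
      show ?thesis using *[OF le0(1)] *[OF le0(2)] gt[of 0] by (simp add: N_def K_def)
    qed (rule gt)
  qed
  then show ?thesis by (simp add: N_def K_def)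
qed

lemma potential_density:
  assumes x: "0 < x" and A[measurable]: "A \<in> sets borel"
  shows "emeasure (potential (ennreal x)) (pos_part_lift A) = (\<integral>\<^sup>+z\<in>A. ennreal (Sc (min x z)) \<partial>M)"
  unfolding emeasure_real_potential[OF A, symmetric] real_potential_eq_density[OF x]
  by (subst emeasure_density) auto

lemma nn_integral_potential:
  assumes x: "0 < x" and \<phi>[measurable]: "\<phi> \<in> borel_measurable borel"
  shows "(\<integral>\<^sup>+z\<in>{0<..<\<top>}. \<phi> (enn2real z) \<partial>potential (ennreal x)) = (\<integral>\<^sup>+z. ennreal (Sc (min x z)) * \<phi> z \<partial>M)"
proof -
  have "(\<integral>\<^sup>+z\<in>{0<..<\<top>}. \<phi> (enn2real z) \<partial>potential (ennreal x)) = (\<integral>\<^sup>+z. \<phi> (enn2real z) \<partial>restrict_space (potential (ennreal x)) {0<..<\<top>})"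
    by (rule nn_integral_restrict_space[symmetric]) simp
  also have "\<dots> = (\<integral>\<^sup>+z. \<phi> z \<partial>distr (restrict_space (potential (ennreal x)) {0<..<\<top>}) borel enn2real)"
    by (rule nn_integral_distr[symmetric, OF measurable_restrict_space1]) simp_all
  also have "\<dots> = (\<integral>\<^sup>+z. ennreal (Sc (min x z)) * \<phi> z \<partial>M)"
    unfolding real_potential_eq_density[OF x] by (rule nn_integral_density) simp_all
  finally show ?thesis .
qed

end

section \<open>Volterra equations\<close>

context speed_scale
begin

text \<open>Constants are invisible and only values on (0, \<infinity>) count; this passes from
  \<open>s\<close> to its normalised version.\<close>

lemma dmds_eq_add_const:
  fixes u v :: "real \<Rightarrow> real"
  assumes v: "dmds_eq m s v g" and uv: "\<And>x. 0 < x \<Longrightarrow> u x = v x + k" and gf: "\<And>x. 0 < x \<Longrightarrow> f x = g x"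
  shows "dmds_eq m s u f" "0 < x \<Longrightarrow> right_deriv s u x = right_deriv s v x"
proof -
  have q: "(ds_quot s u x \<longlongrightarrow> right_deriv s v x) (at_right x)" if x: "0 < x" for x
  proof (rule Lim_transform_eventually[OF dmds_eq_right_deriv[OF v x]])
    have "\<forall>\<^sub>F y in at_right x. x < y" by (simp add: eventually_at_right_less)
    then show "\<forall>\<^sub>F y in at_right x. ds_quot s v x y = ds_quot s u x y"
      by eventually_elim (use uv x in \<open>simp add: ds_quot_def\<close>)
  qed
  show rd: "right_deriv s u x = right_deriv s v x" if "0 < x" for x by (rule right_deriv_eqI[OF q[OF that]])
  show "dmds_eq m s u f" unfolding dmds_eq_def
  proof (intro conjI allI impI)
    have "continuous_on {0<..} (\<lambda>x. v x + k)" using v by (auto simp: dmds_eq_def intro!: continuous_intros)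
    then show "continuous_on {0<..} u" using uv by (subst continuous_on_cong[OF refl]) auto
    show "\<exists>l. (ds_quot s u x \<longlongrightarrow> l) (at_right x)" if "0 < x" for x using q[OF that] by blast
    fix a b :: real assume ab: "0 < a" "a < b"
    have e: "indicator {a<..b} x *\<^sub>R f x = indicator {a<..b} x *\<^sub>R g x" for x using gf ab by (auto simp: indicator_def)
    show "set_integrable M {a<..b} f" using v ab unfolding dmds_eq_def set_integrable_def e by blast
    show "right_deriv s u b - right_deriv s u a = (LINT x:{a<..b}|M. f x)"
      using v ab rd[of a] rd[of b] unfolding dmds_eq_def set_lebesgue_integral_def e by auto
  qed
qed

lemma dmds_eq_diff:
  fixes u v :: "real \<Rightarrow> real"
  assumes u: "dmds_eq m s u f" and v: "dmds_eq m s v g"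
  shows "dmds_eq m s (\<lambda>x. u x - v x) (\<lambda>x. f x - g x)"
    "0 < x \<Longrightarrow> right_deriv s (\<lambda>x. u x - v x) x = right_deriv s u x - right_deriv s v x"
proof -
  have q: "(ds_quot s (\<lambda>x. u x - v x) x \<longlongrightarrow> right_deriv s u x - right_deriv s v x) (at_right x)" if x: "0 < x" for x
    unfolding ds_quot_diff by (intro tendsto_diff dmds_eq_right_deriv[OF u x] dmds_eq_right_deriv[OF v x])
  show rd: "right_deriv s (\<lambda>x. u x - v x) x = right_deriv s u x - right_deriv s v x" if "0 < x" for x
    by (rule right_deriv_eqI[OF q[OF that]])
  show "dmds_eq m s (\<lambda>x. u x - v x) (\<lambda>x. f x - g x)" unfolding dmds_eq_def
  proof (intro conjI allI impI)
    show "continuous_on {0<..} (\<lambda>x. u x - v x)" using u v by (auto simp: dmds_eq_def intro!: continuous_intros)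
    show "\<exists>l. (ds_quot s (\<lambda>x. u x - v x) x \<longlongrightarrow> l) (at_right x)" if "0 < x" for x using q[OF that] by blast
    fix a b :: real assume ab: "0 < a" "a < b"
    have i: "set_integrable M {a<..b} f" "set_integrable M {a<..b} g" using u v ab unfolding dmds_eq_def by blast+
    then show "set_integrable M {a<..b} (\<lambda>x. f x - g x)" by (rule set_integral_diff)
    have "right_deriv s u b - right_deriv s u a = (LINT x:{a<..b}|M. f x)" "right_deriv s v b - right_deriv s v a = (LINT x:{a<..b}|M. g x)"
      using u v ab unfolding dmds_eq_def by blast+
    then show "right_deriv s (\<lambda>x. u x - v x) b - right_deriv s (\<lambda>x. u x - v x) a = (LINT x:{a<..b}|M. f x - g x)"
      using rd[of a] rd[of b] ab set_integral_diff(2)[OF i] by simp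
  qed
qed

end

section \<open>Homogeneous Volterra equations and uniqueness of \<open>psi\<close>\<close>

context green_diffusion
begin

text \<open>The integral is the part of the mean absorption time spent in finite states. It makes S
  integrable near 0, which all Volterra estimates use.\<close>

lemma Sc_integral_finite: assumes "0 < x" shows "(\<integral>\<^sup>+z. ennreal (Sc (min x z)) \<partial>M) < \<top>"
proof -
  have "(\<integral>\<^sup>+z. ennreal (Sc (min x z)) \<partial>M) = emeasure (potential (ennreal x)) (pos_part_lift UNIV)"
    using potential_density[OF assms, of UNIV] by simp
  also have "\<dots> \<le> emeasure (potential (ennreal x)) UNIV" by (rule emeasure_mono) auto
  finally show ?thesis using mean_finite[OF assms] by (simp add: le_less_trans)
qed

lemma Sc_integrable_Ioc: "set_integrable M {0<..y} Sc"
proof (cases "0 < y")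
  case True
  have "(\<integral>\<^sup>+z. ennreal (norm (indicator {0<..y} z *\<^sub>R Sc z)) \<partial>M) \<le> (\<integral>\<^sup>+z. ennreal (Sc (min y z)) \<partial>M)"
    by (intro nn_integral_mono ennreal_leI) (auto simp: indicator_def Sc_nonneg min_def)
  also have "\<dots> < \<infinity>" using Sc_integral_finite[OF True] by simp
  finally show ?thesis unfolding set_integrable_def by (intro integrableI_bounded) auto
qed (simp add: set_integrable_def)

text \<open>Near 0 the scale is bounded and S is integrable, so a bound by a multiple of S is
  enough. Measurability is asked of the restriction to (0, \<infinity>), where solutions are known
  to be continuous.\<close>

lemma volterra_integrable_bound:
  assumes h[measurable]: "(\<lambda>z. indicator {0<..} z * h z) \<in> borel_measurable borel"
    and b: "\<And>Y. 0 < Y \<Longrightarrow> \<exists>C. \<forall>z. 0 < z \<longrightarrow> z \<le> Y \<longrightarrow> \<bar>h z\<bar> \<le> C * Sc z"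
  shows "volterra_integrable h"
  unfolding volterra_integrable_def
proof (intro allI impI conjI)
  fix y :: real assume y: "0 < y"
  obtain C where C: "\<And>z. 0 < z \<Longrightarrow> z \<le> y \<Longrightarrow> \<bar>h z\<bar> \<le> C * Sc z" using b[OF y] by blast
  have i: "integrable M (\<lambda>z. indicator {0<..y} z *\<^sub>R Sc z)" using Sc_integrable_Ioc[of y] by (simp add: set_integrable_def)
  have e: "indicator {0<..y} z *\<^sub>R h z = indicator {..y} z * (indicator {0<..} z * h z)" for z
    by (auto simp: indicator_def)
  have e2: "indicator {0<..y} z *\<^sub>R (s z * h z) = indicator {..y} z * (indicator {0<..} z * h z) * (Sc z + Inf (s ` {0<..}))" for z
    by (auto simp: indicator_def Sc_def)
  show "set_integrable M {0<..y} h" unfolding set_integrable_def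
  proof (rule Bochner_Integration.integrable_bound)
    show "integrable M (\<lambda>z. C * (indicator {0<..y} z *\<^sub>R Sc z))" using i by simp
    show "(\<lambda>z. indicator {0<..y} z *\<^sub>R h z) \<in> borel_measurable M" unfolding e by measurable
    show "AE z in M. norm (indicator {0<..y} z *\<^sub>R h z) \<le> norm (C * (indicator {0<..y} z *\<^sub>R Sc z))"
      using C by (intro AE_I2) (auto simp: indicator_def intro: order_trans[OF _ abs_ge_self])
  qed
  define B where "B = Sc y + \<bar>Inf (s ` {0<..})\<bar>"
  show "set_integrable M {0<..y} (\<lambda>x. s x * h x)" unfolding set_integrable_def
  proof (rule Bochner_Integration.integrable_bound)
    show "integrable M (\<lambda>z. B * C * (indicator {0<..y} z *\<^sub>R Sc z))" using i by simp
    show "(\<lambda>z. indicator {0<..y} z *\<^sub>R (s z * h z)) \<in> borel_measurable M" unfolding e2 by measurable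
    show "AE z in M. norm (indicator {0<..y} z *\<^sub>R (s z * h z)) \<le> norm (B * C * (indicator {0<..y} z *\<^sub>R Sc z))"
    proof (rule AE_I2)
      fix z
      show "norm (indicator {0<..y} z *\<^sub>R (s z * h z)) \<le> norm (B * C * (indicator {0<..y} z *\<^sub>R Sc z))"
      proof (cases "0 < z \<and> z \<le> y")
        case True
        have "\<bar>s z\<bar> \<le> B" using Sc_mono[of z y] Sc_nonneg[of z] True by (auto simp: B_def Sc_def)
        then have "\<bar>s z\<bar> * \<bar>h z\<bar> \<le> B * (C * Sc z)" using C[of z] True by (intro mult_mono) auto
        then have "\<bar>s z * h z\<bar> \<le> \<bar>B * C * Sc z\<bar>" by (simp add: abs_mult mult.assoc) (metis abs_ge_self abs_mult mult.assoc order_trans)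
        then show ?thesis using True by simp
      qed (auto simp: indicator_def)
    qed
  qed
qed

text \<open>The kernel vanishes at \<open>z = y\<close>, so the integral extends over the open
  interval (0, y) and an atom at \<open>y\<close> does not enter. The Gronwall argument rests on
  this.\<close>

lemma volterra_bound:
  assumes h: "volterra_integrable h" and y: "0 < y"
  shows "ennreal \<bar>volterra h y\<bar> \<le> ennreal (Sc y) * (\<integral>\<^sup>+z\<in>{0<..<y}. ennreal \<bar>h z\<bar> \<partial>M)"
proof -
  note i = volterra_integrableD[OF h]
  have "\<bar>volterra h y\<bar> \<le> (LINT z:{0<..y}|M. \<bar>(s y - s z) * h z\<bar>)"
    unfolding volterra_def by (rule abs_set_integral_le)
  also have "\<dots> \<le> (LINT z:{0<..y}|M. Sc y * (indicator {0<..<y} z * \<bar>h z\<bar>))"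
  proof (rule set_integral_mono)
    show "set_integrable M {0<..y} (\<lambda>z. \<bar>(s y - s z) * h z\<bar>)" using i by (intro set_integrable_abs) auto
    have "set_integrable M {0<..y} (\<lambda>z. indicator {0<..<y} z * \<bar>h z\<bar>)"
    proof -
      have "set_integrable M {0<..<y} (\<lambda>z. \<bar>h z\<bar>)" using i(1)[of 0 y]
        by (intro set_integrable_abs) (auto intro: set_integrable_subset)
      moreover have "(\<lambda>z. indicator {0<..<y} z *\<^sub>R \<bar>h z\<bar>) = (\<lambda>z. indicator {0<..y} z *\<^sub>R (indicator {0<..<y} z * \<bar>h z\<bar>))" by (auto simp: indicator_def)
      ultimately show ?thesis unfolding set_integrable_def by simp
    qed
    then show "set_integrable M {0<..y} (\<lambda>z. Sc y * (indicator {0<..<y} z * \<bar>h z\<bar>))" by auto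
    fix z assume z: "z \<in> {0<..y}"
    show "\<bar>(s y - s z) * h z\<bar> \<le> Sc y * (indicator {0<..<y} z * \<bar>h z\<bar>)"
    proof (cases "z = y")
      case False
      then have "\<bar>s y - s z\<bar> \<le> Sc y" using Sc_diff[of z y] Sc_nonneg[of z] s_mono[of z y] z by auto
      then show ?thesis using z False by (auto simp: abs_mult intro!: mult_right_mono)
    qed simp
  qed
  also have "\<dots> = (\<integral>z. Sc y * (indicator {0<..<y} z * \<bar>h z\<bar>) \<partial>M)"
    unfolding set_lebesgue_integral_def by (rule Bochner_Integration.integral_cong) (auto simp: indicator_def)
  finally have "ennreal \<bar>volterra h y\<bar> \<le> ennreal (\<integral>z. Sc y * (indicator {0<..<y} z * \<bar>h z\<bar>) \<partial>M)" by (rule ennreal_leI)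
  also have "\<dots> = (\<integral>\<^sup>+z. ennreal (Sc y * (indicator {0<..<y} z * \<bar>h z\<bar>)) \<partial>M)"
  proof (rule nn_integral_eq_integral[symmetric])
    have "set_integrable M {0<..<y} (\<lambda>z. \<bar>h z\<bar>)" using i(1)[of 0 y]
      by (intro set_integrable_abs) (auto intro: set_integrable_subset)
    then show "integrable M (\<lambda>z. Sc y * (indicator {0<..<y} z * \<bar>h z\<bar>))" by (simp add: set_integrable_def)
  qed (auto simp: Sc_nonneg indicator_def)
  also have "\<dots> = (\<integral>\<^sup>+z. ennreal (Sc y) * (ennreal \<bar>h z\<bar> * indicator {0<..<y} z) \<partial>M)"
    by (rule nn_integral_cong) (auto simp: ennreal_mult Sc_nonneg indicator_def)
  also have "\<dots> = ennreal (Sc y) * (\<integral>\<^sup>+z\<in>{0<..<y}. ennreal \<bar>h z\<bar> \<partial>M)"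
  proof (rule nn_integral_cmult)
    have "(\<lambda>z. indicator {0<..<y} z *\<^sub>R h z) \<in> borel_measurable M"
    proof -
      have "set_integrable M {0<..<y} h" by (rule set_integrable_subset[OF i(1)[of 0 y]]) auto
      then show ?thesis unfolding set_integrable_def by (rule borel_measurable_integrable)
    qed
    then have "(\<lambda>z. ennreal \<bar>indicator {0<..<y} z *\<^sub>R h z\<bar>) \<in> borel_measurable M" by measurable
    moreover have "(\<lambda>z. ennreal \<bar>indicator {0<..<y} z *\<^sub>R h z\<bar>) = (\<lambda>z. ennreal \<bar>h z\<bar> * indicator {0<..<y} z)" by (auto simp: indicator_def)
    ultimately show "(\<lambda>z. ennreal \<bar>h z\<bar> * indicator {0<..<y} z) \<in> borel_measurable M" by metis
  qed
  finally show ?thesis .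
qed

text \<open>The set on which \<open>E\<close> vanishes extends beyond any of its points, because the right neighbourhoods
  of a point have small \<open>Sc dM\<close>-mass even if the point itself is an atom.\<close>

lemma gronwall:
  fixes E :: "real \<Rightarrow> ennreal"
  assumes [measurable]: "E \<in> borel_measurable borel" and Y: "0 \<le> Y" and C: "0 \<le> C1"
    and b: "\<And>y. 0 < y \<Longrightarrow> y \<le> Y \<Longrightarrow> E y \<le> ennreal (C1 * Sc y)"
    and E: "\<And>y. 0 < y \<Longrightarrow> y \<le> Y \<Longrightarrow> E y \<le> ennreal C * ennreal (Sc y) * (\<integral>\<^sup>+z\<in>{0<..<y}. E z \<partial>M)"
    and y: "0 < y" "y \<le> Y"
  shows "E y = 0"
proof -
  \<comment> \<open>Initial intervals on which \<open>E\<close> vanishes. The supremum is itself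
    reached, because the inequality at a point involves strictly smaller points only.\<close>
  define Z where "Z = {z\<in>{0..Y}. \<forall>y. 0 < y \<longrightarrow> y \<le> z \<longrightarrow> E y = 0}"
  have Z0: "0 \<in> Z" using Y by (auto simp: Z_def)
  have bdd: "bdd_above Z" by (auto simp: Z_def intro!: bdd_aboveI[of _ Y])
  define c where "c = Sup Z"
  have c0: "0 \<le> c" unfolding c_def using Z0 bdd by (intro cSup_upper)
  have cY: "c \<le> Y" unfolding c_def using Z0 by (intro cSup_least) (auto simp: Z_def)
  have below: "E z = 0" if z: "0 < z" "z < c" for z
  proof -
    obtain w where "w \<in> Z" "z < w" using less_cSupD[of Z z] Z0 z by (auto simp: c_def)
    then show ?thesis using z by (auto simp: Z_def)
  qed
  have upto: "E z = 0" if z: "0 < z" "z \<le> c" for z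
  proof (cases "z < c")
    case False
    have "E z \<le> ennreal C * ennreal (Sc z) * (\<integral>\<^sup>+w\<in>{0<..<z}. E w \<partial>M)" using z cY by (intro E) auto
    also have "(\<integral>\<^sup>+w\<in>{0<..<z}. E w \<partial>M) = (\<integral>\<^sup>+w. 0 \<partial>M)"
      by (rule nn_integral_cong) (use below z in \<open>auto simp: indicator_def\<close>)
    finally show ?thesis by simp
  qed (use below z in auto)
  have "c = Y"
  proof (rule ccontr)
    assume "c \<noteq> Y"
    then have cY': "c < Y" using cY by simp
    \<comment> \<open>The measure with density S on (0, Y]. It is finite, so the masses of (c, c +
      1/(n+1)) tend to the mass of the empty set.\<close>
    define N where "N = density M (\<lambda>z. ennreal (indicator {0<..Y} z * Sc z))"
    have [simp]: "sets N = sets borel" by (simp add: N_def)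
    have Nf: "emeasure N A \<noteq> \<infinity>" if "A \<in> sets borel" for A
    proof -
      have "emeasure N A \<le> emeasure N UNIV" by (rule emeasure_mono) (auto)
      also have "emeasure N UNIV = (\<integral>\<^sup>+z. ennreal (indicator {0<..Y} z *\<^sub>R Sc z) \<partial>M)"
        unfolding N_def by (subst emeasure_density) auto
      also have "\<dots> < \<infinity>"
        using Sc_integrable_Ioc[of Y] unfolding set_integrable_def integrable_iff_bounded by (simp add: Sc_nonneg)
      finally show ?thesis by simp
    qed
    let ?A = "\<lambda>n. {c<..<c + 1 / real (Suc n)}"
    have "(\<lambda>n. emeasure N (?A n)) \<longlonglongrightarrow> emeasure N (\<Inter>n. ?A n)"
    proof (rule Lim_emeasure_decseq)
      show "decseq ?A"
      proof (rule decseq_SucI)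
        fix n
        have "1 / real (Suc (Suc n)) \<le> 1 / real (Suc n)" by (simp add: field_simps)
        then show "?A (Suc n) \<subseteq> ?A n" by auto
      qed
    qed (use Nf in auto)
    also have "(\<Inter>n. ?A n) = {}"
    proof (rule ccontr)
      assume "(\<Inter>n. ?A n) \<noteq> {}"
      then obtain w where "w \<in> (\<Inter>n. ?A n)" by blast
      then have w: "w \<in> ?A n" for n by blast
      have "w - c > 0" using w[of 0] by auto
      then obtain n where "1 / real (Suc n) < w - c" using nat_approx_posE by blast
      then show False using w[of n] by auto
    qed
    finally have lim: "(\<lambda>n. ennreal C * emeasure N (?A n)) \<longlonglongrightarrow> ennreal C * 0" by (intro ennreal_tendsto_cmult) auto
    have ev1: "\<forall>\<^sub>F n in sequentially. ennreal C * emeasure N (?A n) < ennreal (1/2)"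
    proof (rule order_tendstoD(2)[OF lim])
      have "(0::ennreal) < ennreal (1/2)" by (subst ennreal_less_zero_iff) simp
      then show "ennreal C * 0 < ennreal (1/2)" unfolding mult_zero_right .
    qed
    have "(\<lambda>n. c + 1 / real (Suc n)) \<longlonglongrightarrow> c + 0" by (intro tendsto_intros LIMSEQ_Suc[OF lim_1_over_n])
    then have "\<forall>\<^sub>F n in sequentially. c + 1 / real (Suc n) < Y" using cY' by (intro order_tendstoD(2)) auto
    then have "\<forall>\<^sub>F n in sequentially. c + 1 / real (Suc n) < Y \<and> ennreal C * emeasure N (?A n) < ennreal (1/2)"
      using ev1 by eventually_elim auto
    then obtain n where n: "c + 1 / real (Suc n) < Y" "ennreal C * emeasure N (?A n) < ennreal (1/2)"
      by (auto simp: eventually_sequentially)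
    define e where "e = c + 1 / real (Suc n)"
    have e: "c < e" "e < Y" "ennreal C * emeasure N {c<..<e} \<le> ennreal (1/2)" using n by (auto simp: e_def)
    \<comment> \<open>On this interval \<open>C\<close> times the mass is at most 1/2: each use of
      the inequality halves the bound, starting from the a priori bound
      \<open>C1 * Sc z\<close>.\<close>
    have *: "E z \<le> ennreal (C1 * Sc z / 2 ^ k)" if z: "c < z" "z \<le> e" for z k
      using z
    proof (induction k arbitrary: z)
      case 0
      then show ?case using b[of z] c0 e by auto
    next
      case (Suc k)
      have z0: "0 < z" "z \<le> Y" using Suc.prems c0 e by auto
      have "(\<integral>\<^sup>+w\<in>{0<..<z}. E w \<partial>M) \<le> (\<integral>\<^sup>+w. ennreal (C1 / 2 ^ k) * (ennreal (indicator {0<..Y} w * Sc w) * indicator {c<..<e} w) \<partial>M)"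
      proof (rule nn_integral_mono)
        fix w
        show "E w * indicator {0<..<z} w \<le> ennreal (C1 / 2 ^ k) * (ennreal (indicator {0<..Y} w * Sc w) * indicator {c<..<e} w)"
        proof (cases "w \<in> {0<..<z}")
          case w: True
          show ?thesis
          proof (cases "w \<le> c")
            case True then show ?thesis using upto w by simp
          next
            case False
            then have "E w \<le> ennreal (C1 * Sc w / 2 ^ k)" using w Suc.prems by (intro Suc.IH) auto
            then show ?thesis using w False Suc.prems z0 C Sc_nonneg[of w] by (simp add: ennreal_mult[symmetric])
          qed
        qed simp
      qed
      also have "\<dots> = ennreal (C1 / 2 ^ k) * (\<integral>\<^sup>+w. (ennreal (indicator {0<..Y} w * Sc w) * indicator {c<..<e} w) \<partial>M)"
        by (rule nn_integral_cmult) measurable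
      also have "(\<integral>\<^sup>+w. (ennreal (indicator {0<..Y} w * Sc w) * indicator {c<..<e} w) \<partial>M) = emeasure N {c<..<e}"
        unfolding N_def by (subst emeasure_density) auto
      finally have i: "(\<integral>\<^sup>+w\<in>{0<..<z}. E w \<partial>M) \<le> ennreal (C1 / 2 ^ k) * emeasure N {c<..<e}" .
      have "E z \<le> ennreal C * ennreal (Sc z) * (\<integral>\<^sup>+w\<in>{0<..<z}. E w \<partial>M)" by (rule E[OF z0])
      also have "\<dots> \<le> ennreal C * ennreal (Sc z) * (ennreal (C1 / 2 ^ k) * emeasure N {c<..<e})" by (rule mult_left_mono[OF i]) simp
      also have "\<dots> = ennreal (Sc z) * ennreal (C1 / 2 ^ k) * (ennreal C * emeasure N {c<..<e})" by (simp only: ac_simps)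
      also have "\<dots> \<le> ennreal (Sc z) * ennreal (C1 / 2 ^ k) * ennreal (1/2)" by (rule mult_left_mono[OF e(3)]) simp
      also have "ennreal (Sc z) * ennreal (C1 / 2 ^ k) = ennreal (Sc z * (C1 / 2 ^ k))"
        by (rule ennreal_mult'[symmetric]) (rule Sc_nonneg)
      also have "\<dots> * ennreal (1/2) = ennreal (Sc z * (C1 / 2 ^ k) * (1/2))"
        by (rule ennreal_mult'[symmetric]) (use C Sc_nonneg in auto)
      also have "Sc z * (C1 / 2 ^ k) * (1/2) = C1 * Sc z / 2 ^ Suc k" by (simp add: mult.commute)
      finally show ?case .
    qed
    have "E z = 0" if z: "c < z" "z \<le> e" for z
    proof -
      have "(\<lambda>k. C1 * Sc z * (1/2) ^ k) \<longlonglongrightarrow> C1 * Sc z * 0" by (intro tendsto_intros LIMSEQ_power_zero) simp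
      then have "(\<lambda>k. ennreal (C1 * Sc z / 2 ^ k)) \<longlonglongrightarrow> ennreal 0" by (intro tendsto_ennrealI) (simp add: power_divide)
      then have "E z \<le> ennreal 0" using *[OF z] by (intro LIMSEQ_le_const) auto
      then show ?thesis by simp
    qed
    then have "e \<in> Z" using upto e c0 unfolding Z_def by (auto simp: not_le) (metis linorder_not_le)
    then have "e \<le> c" unfolding c_def using bdd by (rule cSup_upper)
    then show False using e by simp
  qed
  then show ?thesis using upto y by simp
qed

text \<open>Zero data at 0 make the solution a fixed point of \<open>c\<close> times the Volterra
  operator, and the Gronwall argument applies. The a priori bound by a multiple of S comes from the
  mean value inequality near 0 and from compactness further away.\<close>

lemma homogeneous_solution_zero:
  fixes d :: "real \<Rightarrow> real"
  assumes d: "dmds_eq m s d (\<lambda>x. c * d x)" and d0: "(d \<longlongrightarrow> 0) (at_right 0)"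
    and D0: "(right_deriv s d \<longlongrightarrow> 0) (at_right 0)" and y: "0 < y"
  shows "d y = 0"
proof -
  have cont: "continuous_on {0<..} d" using d by (simp add: dmds_eq_def)
  have cIcc: "continuous_on {a..b} d" if "0 < a" for a b by (rule continuous_on_subset[OF cont]) (use that in auto)
  have [measurable]: "(\<lambda>z. indicator {0<..} z * d z) \<in> borel_measurable borel"
    using borel_measurable_continuous_on_indicator[OF _ cont] by simp
  obtain \<delta> where \<delta>: "0 < \<delta>" "\<And>x. 0 < x \<Longrightarrow> x < \<delta> \<Longrightarrow> \<bar>right_deriv s d x\<bar> \<le> 1"
  proof -
    have "\<forall>\<^sub>F x in at_right 0. dist (right_deriv s d x) 0 < 1" using D0 by (rule tendstoD) simp
    then obtain \<delta> where "0 < \<delta>" "\<And>x. 0 < x \<Longrightarrow> x < \<delta> \<Longrightarrow> dist (right_deriv s d x) 0 < 1"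
      unfolding eventually_at_right_field by auto
    then show ?thesis by (intro that[of \<delta>]) (auto simp: dist_real_def intro: less_imp_le)
  qed
  \<comment> \<open>The increment from \<open>a\<close> to \<open>x\<close> is at most
    \<open>s x - s a\<close> as the slope is at most 1; then \<open>a\<close> tends to 0.\<close>
  have near: "\<bar>d x\<bar> \<le> Sc x" if x: "0 < x" "x < \<delta>" for x
  proof (rule tendsto_upperbound)
    show "((\<lambda>a. \<bar>d x - d a\<bar>) \<longlongrightarrow> \<bar>d x\<bar>) (at_right 0)"
      using tendsto_rabs[OF tendsto_diff[OF tendsto_const d0, of "d x"]] by simp
    show "\<forall>\<^sub>F a in at_right 0. \<bar>d x - d a\<bar> \<le> Sc x"
      unfolding eventually_at_right_field
    proof (intro exI[of _ x] conjI allI impI)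
      fix a assume a: "0 < a" "a < x"
      have "\<bar>d x - d a\<bar> \<le> 1 * (s x - s a)"
        by (rule mean_value_bound[OF a(1) less_imp_le[OF a(2)] cIcc[OF a(1)] dmds_eq_right_deriv[OF d]])
           (use a x \<delta> in auto)
      also have "\<dots> \<le> Sc x" using Sc_diff[of a x] Sc_nonneg[of a] a by simp
      finally show "\<bar>d x - d a\<bar> \<le> Sc x" .
    qed (use x in auto)
  qed simp
  have bound: "\<exists>C\<ge>0. \<forall>z. 0 < z \<longrightarrow> z \<le> Y \<longrightarrow> \<bar>d z\<bar> \<le> C * Sc z" for Y
  proof -
    let ?e = "\<delta>/2"
    have e: "0 < ?e" "?e < \<delta>" using \<delta> by auto
    obtain B where B: "\<And>z. z \<in> {?e..Y} \<Longrightarrow> norm (d z) \<le> B"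
      using compact_imp_bounded[OF compact_continuous_image[OF cIcc[OF e(1), of Y]]] unfolding bounded_iff by blast
    \<comment> \<open>Beyond \<open>?e\<close> the function is bounded by \<open>B\<close> while S
      is at least \<open>Sc ?e\<close>; closer to 0 the constant 1 suffices.\<close>
    define C where "C = max 1 (B / Sc ?e)"
    have "\<bar>d z\<bar> \<le> C * Sc z" if z: "0 < z" "z \<le> Y" for z
    proof (cases "z < \<delta>")
      case True
      have "\<bar>d z\<bar> \<le> 1 * Sc z" using near[OF z(1) True] by simp
      also have "\<dots> \<le> C * Sc z" using Sc_nonneg by (intro mult_right_mono) (auto simp: C_def)
      finally show ?thesis .
    next
      case False
      have S: "0 < Sc ?e" "Sc ?e \<le> Sc z" using Sc_pos[of ?e] e Sc_mono[of ?e z] False by auto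
      have "\<bar>d z\<bar> \<le> B / Sc ?e * Sc ?e" using B[of z] z False e S by simp
      also have "\<dots> \<le> C * Sc ?e" using S by (intro mult_right_mono) (auto simp: C_def)
      also have "\<dots> \<le> C * Sc z" using S by (intro mult_left_mono) (auto simp: C_def)
      finally show ?thesis .
    qed
    moreover have "0 \<le> C" by (simp add: C_def)
    ultimately show ?thesis by blast
  qed
  have vi: "volterra_integrable d" 
  proof (rule volterra_integrable_bound)
    show "\<exists>C. \<forall>z. 0 < z \<longrightarrow> z \<le> Y \<longrightarrow> \<bar>d z\<bar> \<le> C * Sc z" for Y using bound[of Y] by blast
  qed measurable
  note i = volterra_integrableD[OF vi]
  let ?I = "\<lambda>x. LINT z:{0<..x}|M. d z"
  have I0: "(?I \<longlongrightarrow> 0) (at_right 0)"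
    by (rule Lim_null_comparison[OF _ set_integral_Ioc_right_limit[OF vi order_refl]])
       (simp add: abs_set_integral_le)
  \<comment> \<open>The difference is constant by the integrated equation and tends to 0 at
    0.\<close>
  have L: "right_deriv s d x - c * ?I x = 0" if x: "0 < x" for x
  proof -
    have const: "right_deriv s d a - c * ?I a = right_deriv s d x - c * ?I x" if a: "0 < a" "a < x" for a
    proof -
      have "right_deriv s d x - right_deriv s d a = (LINT z:{a<..x}|M. c * d z)"
        using d a x unfolding dmds_eq_def by blast
      also have "\<dots> = c * (?I x - ?I a)" using set_integral_Ioc_split[OF i(1)[of 0 x], of a] a by simp
      finally show ?thesis by (simp add: algebra_simps)
    qed
    have "((\<lambda>a. right_deriv s d a - c * ?I a) \<longlongrightarrow> 0 - c * 0) (at_right 0)" by (intro tendsto_intros D0 I0)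
    moreover have "\<forall>\<^sub>F a in at_right 0. right_deriv s d a - c * ?I a = right_deriv s d x - c * ?I x"
      unfolding eventually_at_right_field by (rule exI[of _ x]) (use const x in auto)
    ultimately have "((\<lambda>a. right_deriv s d x - c * ?I x) \<longlongrightarrow> 0) (at_right (0::real))"
      by (simp add: tendsto_cong)
    then show ?thesis by (simp add: tendsto_const_iff)
  qed
  have V0: "(volterra d \<longlongrightarrow> 0) (at_right 0)"
  proof (rule Lim_null_comparison)
    show "((\<lambda>x. Sc x * (LINT z:{0<..1}|M. \<bar>d z\<bar>)) \<longlongrightarrow> 0) (at_right 0)"
      using tendsto_mult_left_zero[OF Sc_tendsto_0] .
    have ai: "set_integrable M {0<..x} (\<lambda>z. \<bar>d z\<bar>)" for x using i by (intro set_integrable_abs) auto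
    have "norm (volterra d x) \<le> Sc x * (LINT z:{0<..1}|M. \<bar>d z\<bar>)" if x: "0 < x" "x < 1" for x
    proof -
      have "ennreal \<bar>volterra d x\<bar> \<le> ennreal (Sc x) * (\<integral>\<^sup>+z\<in>{0<..<x}. ennreal \<bar>d z\<bar> \<partial>M)" by (rule volterra_bound[OF vi x(1)])
      also have "\<dots> \<le> ennreal (Sc x) * (\<integral>\<^sup>+z. ennreal (indicator {0<..1} z *\<^sub>R \<bar>d z\<bar>) \<partial>M)"
        using x by (intro mult_left_mono nn_integral_mono) (auto simp: indicator_def)
      also have "(\<integral>\<^sup>+z. ennreal (indicator {0<..1} z *\<^sub>R \<bar>d z\<bar>) \<partial>M) = ennreal (LINT z:{0<..1}|M. \<bar>d z\<bar>)"
        unfolding set_lebesgue_integral_def using ai[of 1] by (intro nn_integral_eq_integral) (auto simp: set_integrable_def)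
      finally have "ennreal \<bar>volterra d x\<bar> \<le> ennreal (Sc x * (LINT z:{0<..1}|M. \<bar>d z\<bar>))"
        by (simp add: ennreal_mult' Sc_nonneg)
      then have "\<bar>volterra d x\<bar> \<le> Sc x * (LINT z:{0<..1}|M. \<bar>d z\<bar>)"
        by (subst (asm) ennreal_le_iff) (auto intro!: mult_nonneg_nonneg Sc_nonneg integral_nonneg_AE simp: set_lebesgue_integral_def)
      then show ?thesis by simp
    qed
    then show "\<forall>\<^sub>F x in at_right 0. norm (volterra d x) \<le> Sc x * (LINT z:{0<..1}|M. \<bar>d z\<bar>)"
      unfolding eventually_at_right_field by (intro exI[of _ 1]) auto
  qed
  \<comment> \<open>The same device one order lower: the difference has zero right derivative, hence
    is constant, and it vanishes at 0.\<close>
  have "d x = c * volterra d x" if x: "0 < x" for x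
  proof -
    define v where "v x = d x - c * volterra d x" for x
    have vc: "continuous_on {0<..} v" unfolding v_def by (intro continuous_intros cont volterra_continuous vi)
    have vd: "(ds_quot s v x \<longlongrightarrow> 0) (at_right x)" if "0 < x" for x
    proof -
      have "(ds_quot s v x \<longlongrightarrow> right_deriv s d x - c * ?I x) (at_right x)"
        unfolding v_def[abs_def] ds_quot_diff ds_quot_cmult
        by (intro tendsto_intros dmds_eq_right_deriv[OF d that] volterra_right_deriv[OF vi that])
      then show ?thesis by (simp add: L[OF that])
    qed
    have "(v \<longlongrightarrow> 0 - c * 0) (at_right 0)" unfolding v_def by (intro tendsto_intros d0 V0)
    moreover have "\<forall>\<^sub>F a in at_right 0. v a = v x"
      unfolding eventually_at_right_field
    proof (intro exI[of _ x] conjI allI impI x)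
      show "v a = v x" if "0 < a" for a by (rule zero_right_deriv_const[OF vc vd that x])
    qed
    ultimately have "((\<lambda>a. v x) \<longlongrightarrow> 0) (at_right (0::real))" by (simp add: tendsto_cong)
    then have "v x = 0" by (simp add: tendsto_const_iff)
    then show ?thesis by (simp add: v_def)
  qed
  note dV = this
  obtain C where C: "0 \<le> C" "\<And>z. 0 < z \<Longrightarrow> z \<le> y \<Longrightarrow> \<bar>d z\<bar> \<le> C * Sc z" using bound[of y] by blast
  have ind: "ennreal \<bar>indicator {0<..} z * d z\<bar> = ennreal \<bar>d z\<bar>" if "0 < z" for z using that by simp
  have "ennreal \<bar>indicator {0<..} y * d y\<bar> = 0"
  proof (rule gronwall[where E="\<lambda>z. ennreal \<bar>indicator {0<..} z * d z\<bar>" and Y=y and ?C1.0=C and C="\<bar>c\<bar>"])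
    fix z assume z: "0 < z" "z \<le> y"
    show "ennreal \<bar>indicator {0<..} z * d z\<bar> \<le> ennreal (C * Sc z)" using C(2)[OF z] z by (simp add: ennreal_leI)
    have "ennreal \<bar>indicator {0<..} z * d z\<bar> = ennreal \<bar>c\<bar> * ennreal \<bar>volterra d z\<bar>"
      using dV[OF z(1)] z by (metis abs_ge_zero abs_mult ennreal_mult ind)
    also have "\<dots> \<le> ennreal \<bar>c\<bar> * (ennreal (Sc z) * (\<integral>\<^sup>+w\<in>{0<..<z}. ennreal \<bar>d w\<bar> \<partial>M))"
      by (intro mult_left_mono volterra_bound vi z) simp
    also have "(\<integral>\<^sup>+w\<in>{0<..<z}. ennreal \<bar>d w\<bar> \<partial>M) = (\<integral>\<^sup>+w\<in>{0<..<z}. ennreal \<bar>indicator {0<..} w * d w\<bar> \<partial>M)"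
      by (rule nn_integral_cong) (auto simp: indicator_def)
    finally show "ennreal \<bar>indicator {0<..} z * d z\<bar> \<le> ennreal \<bar>c\<bar> * ennreal (Sc z) * (\<integral>\<^sup>+w\<in>{0<..<z}. ennreal \<bar>indicator {0<..} w * d w\<bar> \<partial>M)"
      by (simp add: mult.assoc)
  qed (use C y in auto)
  then show ?thesis using y by simp
qed

text \<open>The difference of two candidates has zero data at 0, so it vanishes; this resolves the
  definite description.\<close>

lemma psi_eqI:
  fixes u :: "real \<Rightarrow> real"
  assumes "\<And>x. x \<le> 0 \<Longrightarrow> u x = 0" and u: "dmds_eq m s u (\<lambda>x. c * u x)" "(u \<longlongrightarrow> 0) (at_right 0)" "(right_deriv s u \<longlongrightarrow> 1) (at_right 0)"
  shows "psi m s c = u"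
  unfolding psi_def
proof (rule the_equality)
  show "(\<forall>x\<le>0. u x = 0) \<and> dmds_eq m s u (\<lambda>x. c * u x) \<and> (u \<longlongrightarrow> 0) (at_right 0) \<and> (right_deriv s u \<longlongrightarrow> 1) (at_right 0)"
    using assms by auto
  fix v assume v: "(\<forall>x\<le>0. v x = 0) \<and> dmds_eq m s v (\<lambda>x. c * v x) \<and> (v \<longlongrightarrow> 0) (at_right 0) \<and> (right_deriv s v \<longlongrightarrow> 1) (at_right 0)"
  have d: "dmds_eq m s (\<lambda>x. v x - u x) (\<lambda>x. c * (v x - u x))"
    using dmds_eq_diff(1)[of v "\<lambda>x. c * v x" u "\<lambda>x. c * u x"] v u by (simp add: algebra_simps)
  have d0: "((\<lambda>x. v x - u x) \<longlongrightarrow> 0) (at_right 0)" using tendsto_diff[of v 0 _ u 0] v u by simp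
  have D0: "(right_deriv s (\<lambda>x. v x - u x) \<longlongrightarrow> 0) (at_right 0)"
  proof (rule Lim_transform_eventually)
    show "((\<lambda>x. right_deriv s v x - right_deriv s u x) \<longlongrightarrow> 0) (at_right 0)"
      using tendsto_diff[of "right_deriv s v" 1 _ "right_deriv s u" 1] v u by simp
    show "\<forall>\<^sub>F x in at_right 0. right_deriv s v x - right_deriv s u x = right_deriv s (\<lambda>x. v x - u x) x"
      unfolding eventually_at_right_field
      by (rule exI[of _ 1]) (use dmds_eq_diff(2)[of v "\<lambda>x. c * v x" u "\<lambda>x. c * u x"] v u in auto)
  qed
  show "v = u"
  proof
    fix x show "v x = u x"
      using homogeneous_solution_zero[OF d d0 D0, of x] v assms(1)[of x] by (cases "0 < x") auto
  qed
qed

text \<open>Dividing by \<open>lam\<close> gives \<open>u = Sc - volterra f\<close> with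
  \<open>f = lam * u\<close>: slope 1 at 0 and d/dm d/ds \<open>u = - lam * u\<close>.\<close>

lemma psi_volterra:
  assumes [measurable]: "f \<in> borel_measurable borel" and C: "\<And>y. 0 < y \<Longrightarrow> \<bar>f y\<bar> \<le> C * Sc y"
    and lam: "lam \<noteq> 0" and f: "\<And>y. 0 < y \<Longrightarrow> f y = lam * (Sc y - volterra f y)"
    and f0: "\<And>y. y \<le> 0 \<Longrightarrow> f y = 0"
  shows "lam * psi m s (- lam) y = f y"
proof -
  have vi: "volterra_integrable f" 
  proof (rule volterra_integrable_bound)
    show "\<exists>C. \<forall>z. 0 < z \<longrightarrow> z \<le> Y \<longrightarrow> \<bar>f z\<bar> \<le> C * Sc z" for Y using C by blast
  qed measurable
  define u where "u x = (if x \<le> 0 then 0 else f x / lam)" for x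
  have u: "u x = (1 * s x - volterra f x) + (- Inf (s ` {0<..}))" if "0 < x" for x
    using f[OF that] that lam by (simp add: u_def Sc_def)
  note dd = dmds_eq_scale_minus_volterra(1)[OF vi, where c=1] dmds_eq_scale_minus_volterra(2)[OF vi, where c=1]
  have 1: "dmds_eq m s u (\<lambda>x. - lam * u x)" by (rule dmds_eq_add_const(1)[OF dd(1) u]) (use lam in \<open>auto simp: u_def\<close>)
  have 2: "right_deriv s u x = 1 - (LINT z:{0<..x}|M. f z)" if "0 < x" for x
  proof -
    have "right_deriv s u x = right_deriv s (\<lambda>x. 1 * s x - volterra f x) x"
      by (rule dmds_eq_add_const(2)[OF dd(1) u refl that])
    then show ?thesis using right_deriv_eqI[OF dd(2)[OF that]] by simp
  qed
  have "psi m s (- lam) = u"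
  proof (rule psi_eqI[OF _ 1])
    show "(u \<longlongrightarrow> 0) (at_right 0)"
    proof (rule Lim_null_comparison)
      have "((\<lambda>x. \<bar>C / lam\<bar> * Sc x) \<longlongrightarrow> \<bar>C / lam\<bar> * 0) (at_right 0)" by (intro tendsto_intros Sc_tendsto_0)
      then show "((\<lambda>x. \<bar>C / lam\<bar> * Sc x) \<longlongrightarrow> 0) (at_right 0)" by simp
      show "\<forall>\<^sub>F x in at_right 0. norm (u x) \<le> \<bar>C / lam\<bar> * Sc x"
        unfolding eventually_at_right_field
      proof (intro exI[of _ 1] conjI allI impI)
        fix x :: real assume x: "0 < x" "x < 1"
        have "\<bar>f x\<bar> \<le> \<bar>C\<bar> * Sc x" using C[OF x(1)] Sc_nonneg[of x] by (meson abs_ge_self mult_right_mono order_trans)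
        then have "\<bar>f x\<bar> / \<bar>lam\<bar> \<le> \<bar>C\<bar> * Sc x / \<bar>lam\<bar>" using lam by (intro divide_right_mono) auto
        then show "norm (u x) \<le> \<bar>C / lam\<bar> * Sc x" using x by (simp add: u_def abs_divide)
      qed simp
    qed
    show "(right_deriv s u \<longlongrightarrow> 1) (at_right 0)"
    proof (rule Lim_transform_eventually)
      have "((\<lambda>x. LINT z:{0<..x}|M. f z) \<longlongrightarrow> 0) (at_right 0)"
        by (rule Lim_null_comparison[OF _ set_integral_Ioc_right_limit[OF vi order_refl]]) (simp add: abs_set_integral_le)
      from tendsto_diff[OF tendsto_const this, of 1]
      show "((\<lambda>x. 1 - (LINT z:{0<..x}|M. f z)) \<longlongrightarrow> 1) (at_right 0)" by simp
      show "\<forall>\<^sub>F x in at_right 0. 1 - (LINT z:{0<..x}|M. f z) = right_deriv s u x"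
        unfolding eventually_at_right_field by (rule exI[of _ 1]) (use 2 in auto)
    qed
  qed (simp add: u_def)
  then show ?thesis using f0[of y] lam by (simp add: u_def)
qed

section \<open>Convergence of the Volterra iteration\<close>

lemma volterra_diff:
  assumes "volterra_integrable f" "volterra_integrable g"
  shows "volterra_integrable (\<lambda>x. f x - g x)" "volterra (\<lambda>x. f x - g x) y = volterra f y - volterra g y"
proof -
  have "set_integrable M {0<..y} (\<lambda>x. s x * f x - s x * g x)" if "0 < y" for y
    using assms that unfolding volterra_integrable_def by (intro set_integral_diff(1)) auto
  then show "volterra_integrable (\<lambda>x. f x - g x)"
    using assms unfolding volterra_integrable_def by (auto simp: right_diff_distrib)
  show "volterra (\<lambda>x. f x - g x) y = volterra f y - volterra g y"
    unfolding volterra_def right_diff_distrib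
    by (rule set_integral_diff(2)) (use volterra_integrableD(2)[OF assms(1)] volterra_integrableD(2)[OF assms(2)] in auto)
qed

lemma volterra_nonneg: "(\<And>z. 0 < z \<Longrightarrow> z \<le> y \<Longrightarrow> 0 \<le> f z) \<Longrightarrow> 0 \<le> volterra f y"
  unfolding volterra_def set_lebesgue_integral_def
  by (intro integral_nonneg_AE AE_I2) (auto simp: indicator_def intro!: mult_nonneg_nonneg s_mono)

text \<open>The oscillation \<open>E\<close> of the sequence satisfies the homogeneous Volterra inequality.\<close>

lemma volterra_iteration_convergent:
  fixes f :: "nat \<Rightarrow> real \<Rightarrow> real" and r :: "nat \<Rightarrow> real"
  assumes [measurable]: "\<And>n. f n \<in> borel_measurable borel"
    and f: "\<And>n y. 0 < y \<Longrightarrow> 0 \<le> f n y \<and> f n y \<le> C * Sc y"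
    and r: "\<And>n. 0 < r n" "\<And>n. r n \<le> C" "convergent r"
    and rec: "\<And>n y. 0 < y \<Longrightarrow> f (Suc n) y = r n * (Sc y - volterra (f n) y)"
    and y: "0 < y"
  shows "convergent (\<lambda>n. f n y)"
proof -
  have C0: "0 < C" using r(1,2)[of 0] by simp
  have vi: "volterra_integrable (f n)" for n
  proof (rule volterra_integrable_bound)
    show "\<exists>C. \<forall>z. 0 < z \<longrightarrow> z \<le> Y \<longrightarrow> \<bar>f n z\<bar> \<le> C * Sc z" for Y
      using f by (intro exI[of _ C]) auto
  qed measurable
  \<comment> \<open>The oscillation is a supremum over pairs of late indices, followed by an infimum
    over \<open>N\<close>; in \<open>ennreal\<close> both exist without further proof.\<close>
  define J where "J N = {p::nat \<times> nat. N \<le> fst p \<and> N \<le> snd p}" for N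
  define \<Delta> where "\<Delta> N x = (SUP p\<in>J N. ennreal \<bar>f (fst p) x - f (snd p) x\<bar>)" for N x
  have [measurable]: "\<Delta> N \<in> borel_measurable borel" for N
    unfolding \<Delta>_def[abs_def] by (rule borel_measurable_SUP) auto
  define E where "E x = (INF N. \<Delta> N x)" for x
  have Em[measurable]: "E \<in> borel_measurable borel" unfolding E_def[abs_def] by measurable
  have dec: "\<Delta> N x \<le> \<Delta> K x" if "K \<le> N" for N K x
    unfolding \<Delta>_def by (rule SUP_subset_mono) (use that in \<open>auto simp: J_def\<close>)
  have \<Delta>b: "\<Delta> N x \<le> ennreal (2 * C * Sc x)" if x: "0 < x" for N x
    unfolding \<Delta>_def
  proof (rule SUP_least)
    fix p show "ennreal \<bar>f (fst p) x - f (snd p) x\<bar> \<le> ennreal (2 * C * Sc x)"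
      using f[OF x, of "fst p"] f[OF x, of "snd p"] by (intro ennreal_leI) (auto simp: abs_le_iff)
  qed
  have key: "E z \<le> ennreal C * ennreal (Sc z) * (\<integral>\<^sup>+w\<in>{0<..<z}. E w \<partial>M)" if z: "0 < z" for z
  proof (rule ennreal_le_epsilon)
    fix e :: real assume e: "0 < e"
    have Sz: "0 < Sc z" by (rule Sc_pos[OF z])
    \<comment> \<open>The tolerance is divided by \<open>Sc z\<close> because differences of the
      ratios get multiplied by at most \<open>Sc z\<close>.\<close>
    have "Cauchy r" using r(3) by (rule convergent_Cauchy)
    then obtain N0 where N0: "\<And>i j. N0 \<le> i \<Longrightarrow> N0 \<le> j \<Longrightarrow> dist (r i) (r j) < e / Sc z"
      unfolding Cauchy_def using e Sz by (meson divide_pos_pos)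
    have step: "\<Delta> (Suc N) z \<le> ennreal e + ennreal C * ennreal (Sc z) * (\<integral>\<^sup>+w\<in>{0<..<z}. \<Delta> N w \<partial>M)" if N: "N0 \<le> N" for N
      unfolding \<Delta>_def[of "Suc N"]
    proof (rule SUP_least)
      fix p assume p: "p \<in> J (Suc N)"
      obtain i j where ij: "fst p = Suc i" "snd p = Suc j" "N \<le> i" "N \<le> j"
        using p by (cases "fst p"; cases "snd p") (auto simp: J_def)
      have V: "0 \<le> volterra (f j) z" by (rule volterra_nonneg) (use f in auto)
      have Vd: "volterra (f i) z - volterra (f j) z = volterra (\<lambda>x. f i x - f j x) z"
        using volterra_diff(2)[OF vi vi] by simp
      have le1: "0 \<le> Sc z - volterra (f j) z"
        using f[OF z, of "Suc j"] r(1)[of j] unfolding rec[OF z] by (simp add: zero_le_mult_iff)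
      \<comment> \<open>The change of the ratio is separated from the change of the function: the
        first term is small by the Cauchy property, the second is K applied to a difference of
        earlier members.\<close>
      have "f (Suc i) z - f (Suc j) z = (r i - r j) * (Sc z - volterra (f j) z) - r i * (volterra (f i) z - volterra (f j) z)"
        unfolding rec[OF z] by (simp add: algebra_simps)
      then have "\<bar>f (Suc i) z - f (Suc j) z\<bar> \<le> \<bar>r i - r j\<bar> * (Sc z - volterra (f j) z) + r i * \<bar>volterra (f i) z - volterra (f j) z\<bar>"
        using abs_triangle_ineq4[of "(r i - r j) * (Sc z - volterra (f j) z)" "r i * (volterra (f i) z - volterra (f j) z)"] le1 r(1)[of i]
        by (simp add: abs_mult)
      also have "\<dots> \<le> e / Sc z * Sc z + C * \<bar>volterra (f i) z - volterra (f j) z\<bar>"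
        using N0[of i j] N ij V le1 r(2)[of i] C0 by (intro add_mono mult_mono) (auto simp: dist_real_def)
      also have "\<dots> = e + C * \<bar>volterra (\<lambda>x. f i x - f j x) z\<bar>" using Sz Vd by simp
      finally have "ennreal \<bar>f (Suc i) z - f (Suc j) z\<bar> \<le> ennreal (e + C * \<bar>volterra (\<lambda>x. f i x - f j x) z\<bar>)" by (rule ennreal_leI)
      also have "\<dots> = ennreal e + ennreal C * ennreal \<bar>volterra (\<lambda>x. f i x - f j x) z\<bar>"
        using e C0 by (simp add: ennreal_plus ennreal_mult)
      also have "\<dots> \<le> ennreal e + ennreal C * (ennreal (Sc z) * (\<integral>\<^sup>+w\<in>{0<..<z}. ennreal \<bar>f i w - f j w\<bar> \<partial>M))"
        by (intro add_left_mono mult_left_mono volterra_bound volterra_diff vi z) simp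
      also have "\<dots> \<le> ennreal e + ennreal C * (ennreal (Sc z) * (\<integral>\<^sup>+w\<in>{0<..<z}. \<Delta> N w \<partial>M))"
      proof (intro add_left_mono mult_left_mono nn_integral_mono mult_right_mono)
        show "ennreal \<bar>f i w - f j w\<bar> \<le> \<Delta> N w" for w
          unfolding \<Delta>_def by (rule SUP_upper2[of "(i, j)"]) (use ij in \<open>auto simp: J_def\<close>)
      qed simp_all
      finally show "ennreal \<bar>f (fst p) z - f (snd p) z\<bar> \<le> ennreal e + ennreal C * ennreal (Sc z) * (\<integral>\<^sup>+w\<in>{0<..<z}. \<Delta> N w \<partial>M)"
        by (simp add: ij mult.assoc)
    qed
    \<comment> \<open>The decreasing limit passes through the integral as \<open>\<Delta> 0\<close>
      is at most \<open>2 * C * Sc\<close>, which is integrable on (0, z].\<close>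
    have lim: "(INF N. \<integral>\<^sup>+w\<in>{0<..<z}. \<Delta> N w \<partial>M) = (\<integral>\<^sup>+w\<in>{0<..<z}. E w \<partial>M)"
    proof -
      have "(\<integral>\<^sup>+w\<in>{0<..<z}. E w \<partial>M) = (\<integral>\<^sup>+w. (INF N. \<Delta> N w * indicator {0<..<z} w) \<partial>M)"
        by (rule nn_integral_cong) (auto simp: E_def indicator_def)
      also have "\<dots> = (INF N. \<integral>\<^sup>+w\<in>{0<..<z}. \<Delta> N w \<partial>M)"
      proof (rule nn_integral_monotone_convergence_INF_decseq[where i=0])
        show "decseq (\<lambda>N w. \<Delta> N w * indicator {0<..<z} w)"
          by (intro decseq_SucI le_funI mult_right_mono dec) auto
        have "(\<integral>\<^sup>+w. \<Delta> 0 w * indicator {0<..<z} w \<partial>M) \<le> (\<integral>\<^sup>+w. ennreal (2 * C) * ennreal (indicator {0<..z} w *\<^sub>R Sc w) \<partial>M)"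
          using \<Delta>b[of _ 0] C0 Sc_nonneg by (intro nn_integral_mono) (auto simp: indicator_def ennreal_mult[symmetric])
        also have "\<dots> = ennreal (2 * C) * (\<integral>\<^sup>+w. ennreal (indicator {0<..z} w *\<^sub>R Sc w) \<partial>M)" by (rule nn_integral_cmult) simp
        also have "\<dots> < \<infinity>" using Sc_integrable_Ioc[of z] unfolding set_integrable_def integrable_iff_bounded
          by (simp add: Sc_nonneg ennreal_mult_less_top)
        finally show "(\<integral>\<^sup>+w. \<Delta> 0 w * indicator {0<..<z} w \<partial>M) < \<infinity>" .
      qed measurable
      finally show ?thesis by simp
    qed
    have "E z \<le> (INF N\<in>{N0..}. ennreal e + ennreal C * ennreal (Sc z) * (\<integral>\<^sup>+w\<in>{0<..<z}. \<Delta> N w \<partial>M))"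
    proof (rule INF_greatest)
      fix N assume "N \<in> {N0..}"
      then show "E z \<le> ennreal e + ennreal C * ennreal (Sc z) * (\<integral>\<^sup>+w\<in>{0<..<z}. \<Delta> N w \<partial>M)"
        using step[of N] unfolding E_def by (auto intro: INF_lower2[of "Suc N"])
    qed
    have decI: "decseq (\<lambda>N. \<integral>\<^sup>+w\<in>{0<..<z}. \<Delta> N w \<partial>M)"
      unfolding decseq_def by (intro allI impI nn_integral_mono mult_right_mono dec) auto
    have "(\<lambda>N. \<integral>\<^sup>+w\<in>{0<..<z}. \<Delta> N w \<partial>M) \<longlonglongrightarrow> (\<integral>\<^sup>+w\<in>{0<..<z}. E w \<partial>M)"
      using LIMSEQ_INF[OF decI] lim by simp
    then have "(\<lambda>N. ennreal e + ennreal C * ennreal (Sc z) * (\<integral>\<^sup>+w\<in>{0<..<z}. \<Delta> N w \<partial>M)) \<longlonglongrightarrow> ennreal e + ennreal C * ennreal (Sc z) * (\<integral>\<^sup>+w\<in>{0<..<z}. E w \<partial>M)"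
      by (intro tendsto_add tendsto_const ennreal_tendsto_cmult) (auto simp: ennreal_mult_less_top)
    then have "E z \<le> ennreal e + ennreal C * ennreal (Sc z) * (\<integral>\<^sup>+w\<in>{0<..<z}. E w \<partial>M)"
      by (rule LIMSEQ_le_const) (use step in \<open>auto intro!: exI[of _ N0] intro: order_trans[OF INF_lower] simp: E_def\<close>)
    then show "E z \<le> ennreal C * ennreal (Sc z) * (\<integral>\<^sup>+w\<in>{0<..<z}. E w \<partial>M) + ennreal e" by (simp add: add.commute)
  qed
  have "E y = 0"
  proof (rule gronwall[OF Em, of y "2 * C" C])
    show "E z \<le> ennreal (2 * C * Sc z)" if "0 < z" for z
      unfolding E_def by (rule INF_lower2[of 0]) (use \<Delta>b[OF that] in auto)
  qed (use C0 key y in auto)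
  have "Cauchy (\<lambda>n. f n y)"
  proof (rule metric_CauchyI)
    fix e :: real assume e: "0 < e"
    have "(INF N. \<Delta> N y) < ennreal e" using \<open>E y = 0\<close> e by (simp add: E_def)
    then obtain N where N: "\<Delta> N y < ennreal e" by (auto simp: INF_less_iff)
    show "\<exists>M. \<forall>i\<ge>M. \<forall>j\<ge>M. dist (f i y) (f j y) < e"
    proof (intro exI[of _ N] allI impI)
      fix i j assume "N \<le> i" "N \<le> j"
      then have "ennreal \<bar>f i y - f j y\<bar> \<le> \<Delta> N y" unfolding \<Delta>_def by (intro SUP_upper2[of "(i, j)"]) (auto simp: J_def)
      then have "ennreal \<bar>f i y - f j y\<bar> < ennreal e" using N by simp
      then show "dist (f i y) (f j y) < e" by (simp add: dist_real_def ennreal_less_iff)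
    qed
  qed
  then show ?thesis by (rule Cauchy_convergent)
qed

end

section \<open>Moments and the renewal transform\<close>

context absorbed_diffusion
begin

section \<open>Transition probabilities and initial laws\<close>

lemma P_subprob: "(\<lambda>x::real. P x) \<in> borel \<rightarrow>\<^sub>M subprob_algebra E"
  by (rule measurable_prob_algebraD[OF law_ennreal_measurable])

lemma transition_joint:
  assumes [measurable]: "B \<in> sets borel"
  shows "(\<lambda>p. transition (snd p) (ennreal (fst p)) B * indicator {0..} (snd p)) \<in> borel_measurable (borel \<Otimes>\<^sub>M borel)"
proof -
  note [measurable] = P_subprob
  have "(\<lambda>p::real \<times> real. \<integral>\<^sup>+\<omega>. (case (p, \<omega>) of (p, \<omega>) \<Rightarrow> if 0 \<le> snd p \<and> located X (snd p) B \<omega> then 1 else 0) \<partial>P (fst p)) \<in> borel_measurable (borel \<Otimes>\<^sub>M borel)"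
    by (rule nn_integral_measurable_subprob_algebra2[where N=E]) measurable
  also have "(\<lambda>p::real \<times> real. \<integral>\<^sup>+\<omega>. (case (p, \<omega>) of (p, \<omega>) \<Rightarrow> if 0 \<le> snd p \<and> located X (snd p) B \<omega> then 1 else 0) \<partial>P (fst p))
     = (\<lambda>p. transition (snd p) (ennreal (fst p)) B * indicator {0..} (snd p))"
  proof
    fix p :: "real \<times> real"
    obtain x t where [simp]: "p = (x, t)" by (cases p)
    show "(\<integral>\<^sup>+\<omega>. (case (p, \<omega>) of (p, \<omega>) \<Rightarrow> if 0 \<le> snd p \<and> located X (snd p) B \<omega> then 1 else 0) \<partial>P (fst p)) =
       transition (snd p) (ennreal (fst p)) B * indicator {0..} (snd p)"
    proof (cases "0 \<le> t")
      case True
      have "(\<integral>\<^sup>+\<omega>. (if located X t B \<omega> then 1 else 0) \<partial>P x) = (\<integral>\<^sup>+\<omega>. indicator {\<omega>\<in>\<Omega>. located X t B \<omega>} \<omega> \<partial>P x)"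
        by (intro nn_integral_cong) (auto split: split_indicator)
      then show ?thesis using True located_sets[OF True, of B] by (simp add: transition_def)
    qed simp
  qed
  finally show ?thesis .
qed

lemma transition_measurable_space:
  assumes t: "0 \<le> t" and B: "B \<in> sets borel"
  shows "(\<lambda>x. transition t (ennreal x) B) \<in> borel_measurable borel"
proof -
  have "(\<lambda>x::real. (x, t)) \<in> borel \<rightarrow>\<^sub>M borel \<Otimes>\<^sub>M borel" by measurable
  from measurable_compose[OF this transition_joint[OF B]] show ?thesis using t by simp
qed

lemma transition_zero:
  assumes t: "0 \<le> t" and B: "B \<in> sets borel" "0 \<notin> B"
  shows "transition t 0 B = 0"
proof -
  have 0: "(0::ennreal) \<in> I" by (rule finite_in_I) simp
  have "AE \<omega> in law X 0. \<not> located X t B \<omega>"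
    using start[OF 0] stopped[unfolded stopped_at_zero_def, rule_format, OF 0]
  proof eventually_elim
    case (elim \<omega>)
    have "hitting X 0 \<omega> \<le> ennreal 0" by (rule hitting_le) (use elim in auto)
    then have "located X t {0} \<omega>" using elim(2) t by (auto intro: order_trans)
    then show ?case using B by (auto simp: located_def)
  qed
  then have "emeasure (law X 0) {\<omega>\<in>space (law X 0). located X t B \<omega>} = 0"
    by (rule emeasure_eq_0_AE)
  then show ?thesis by (simp add: transition_def space_law[OF 0])
qed

text \<open>Positive states mean survival, so a condition on the absorption time becomes one on the
  state at time \<open>t\<close>.\<close>

lemma emeasure_survival:
  assumes x: "0 < x" and t: "0 \<le> t" and B: "B \<in> sets borel" "0 \<notin> B"
  shows "emeasure (P x) {\<omega>\<in>\<Omega>. located X t B \<omega> \<and> ennreal t < hitting X 0 \<omega>} = transition t (ennreal x) B"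
    and "emeasure (P x) {\<omega>\<in>\<Omega>. ennreal t < hitting X 0 \<omega>} = transition t (ennreal x) {0<..}"
proof -
  have m: "{\<omega>\<in>\<Omega>. ennreal t < hitting X 0 \<omega>} \<in> sets E" by measurable
  have "{\<omega>\<in>\<Omega>. located X t B \<omega> \<and> ennreal t < hitting X 0 \<omega>} = {\<omega>\<in>\<Omega>. located X t B \<omega>} \<inter> {\<omega>\<in>\<Omega>. ennreal t < hitting X 0 \<omega>}" by auto
  then have m': "{\<omega>\<in>\<Omega>. located X t B \<omega> \<and> ennreal t < hitting X 0 \<omega>} \<in> sets E"
    using located_sets[OF t B(1)] m by simp
  have 1: "located X t B \<omega> \<Longrightarrow> located X t {0<..} \<omega>" for \<omega>
    using B(2) by (auto simp: located_def zero_less_iff_neq_zero)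
  show "emeasure (P x) {\<omega>\<in>\<Omega>. located X t B \<omega> \<and> ennreal t < hitting X 0 \<omega>} = transition t (ennreal x) B"
    unfolding transition_def
  proof (rule emeasure_eq_AE)
    show "AE \<omega> in P x. (\<omega> \<in> {\<omega>\<in>\<Omega>. located X t B \<omega> \<and> ennreal t < hitting X 0 \<omega>}) = (\<omega> \<in> {\<omega>\<in>\<Omega>. located X t B \<omega>})"
      using AE_regular_path[OF x] by eventually_elim (use less_hitting_zero_iff[OF _ t] 1 in auto)
  qed (use m' located_sets[OF t B(1)] in simp_all)
  show "emeasure (P x) {\<omega>\<in>\<Omega>. ennreal t < hitting X 0 \<omega>} = transition t (ennreal x) {0<..}"
    unfolding transition_def
  proof (rule emeasure_eq_AE)
    show "AE \<omega> in P x. (\<omega> \<in> {\<omega>\<in>\<Omega>. ennreal t < hitting X 0 \<omega>}) = (\<omega> \<in> {\<omega>\<in>\<Omega>. located X t {0<..} \<omega>})"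
      using AE_regular_path[OF x] by eventually_elim (use less_hitting_zero_iff[OF _ t] in auto)
  qed (use m located_sets[OF t, of "{0<..}"] in simp_all)
qed

lemma prob_on_posD:
  assumes "prob_on_pos \<mu>"
  shows "prob_space \<mu>" "sets \<mu> = sets borel" "AE x in \<mu>. 0 < x" "space \<mu> = UNIV"
  using assms sets_eq_imp_space_eq[of \<mu> borel] by (auto simp: prob_on_pos_def)

lemma law_from_measurable:
  assumes "prob_on_pos \<mu>" shows "(\<lambda>x. P x) \<in> \<mu> \<rightarrow>\<^sub>M subprob_algebra E"
  using P_subprob measurable_cong_sets[OF prob_on_posD(2)[OF assms] refl] by blast

lemma sets_law_from: assumes "prob_on_pos \<mu>" shows "sets (law_from X \<mu>) = sets E"
  unfolding law_from_def
  by (rule sets_bind) (use prob_on_posD(4)[OF assms] in auto)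

lemma space_law_from: assumes "prob_on_pos \<mu>" shows "space (law_from X \<mu>) = \<Omega>"
  by (rule sets_eq_imp_space_eq[OF sets_law_from[OF assms]])

lemma emeasure_law_from:
  assumes "prob_on_pos \<mu>" "S \<in> sets E"
  shows "emeasure (law_from X \<mu>) S = (\<integral>\<^sup>+x. emeasure (P x) S \<partial>\<mu>)"
  unfolding law_from_def
  by (rule emeasure_bind[OF _ law_from_measurable[OF assms(1)] assms(2)]) (use prob_on_posD(4)[OF assms(1)] in simp)

lemma nn_integral_law_from:
  assumes "prob_on_pos \<mu>" "f \<in> borel_measurable E"
  shows "(\<integral>\<^sup>+\<omega>. f \<omega> \<partial>law_from X \<mu>) = (\<integral>\<^sup>+x. \<integral>\<^sup>+\<omega>. f \<omega> \<partial>P x \<partial>\<mu>)"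
  unfolding law_from_def by (rule nn_integral_bind[OF assms(2) law_from_measurable[OF assms(1)]])

lemma prob_space_law_from: assumes "prob_on_pos \<mu>" shows "prob_space (law_from X \<mu>)"
proof
  interpret prob_space \<mu> by (rule prob_on_posD(1)[OF assms])
  have "emeasure (law_from X \<mu>) (space (law_from X \<mu>)) = (\<integral>\<^sup>+x. emeasure (P x) \<Omega> \<partial>\<mu>)"
    unfolding space_law_from[OF assms] by (rule emeasure_law_from[OF assms]) simp
  also have "\<dots> = (\<integral>\<^sup>+x. 1 \<partial>\<mu>)"
    by (rule nn_integral_cong) (use prob_space.emeasure_space_1[OF prob_space_P] in simp)
  finally show "emeasure (law_from X \<mu>) (space (law_from X \<mu>)) = 1" by (simp add: emeasure_space_1)
qed

lemma emeasure_law_from_survival: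
  assumes \<mu>: "prob_on_pos \<mu>" and t: "0 \<le> t" and B: "B \<in> sets borel" "0 \<notin> B"
  shows "emeasure (law_from X \<mu>) {\<omega>\<in>\<Omega>. located X t B \<omega> \<and> ennreal t < hitting X 0 \<omega>} = (\<integral>\<^sup>+x. transition t (ennreal x) B \<partial>\<mu>)"
    and "emeasure (law_from X \<mu>) {\<omega>\<in>\<Omega>. ennreal t < hitting X 0 \<omega>} = (\<integral>\<^sup>+x. transition t (ennreal x) {0<..} \<partial>\<mu>)"
proof -
  have m: "{\<omega>\<in>\<Omega>. ennreal t < hitting X 0 \<omega>} \<in> sets E" by measurable
  have "{\<omega>\<in>\<Omega>. located X t B \<omega> \<and> ennreal t < hitting X 0 \<omega>} = {\<omega>\<in>\<Omega>. located X t B \<omega>} \<inter> {\<omega>\<in>\<Omega>. ennreal t < hitting X 0 \<omega>}" by auto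
  then have m': "{\<omega>\<in>\<Omega>. located X t B \<omega> \<and> ennreal t < hitting X 0 \<omega>} \<in> sets E"
    using located_sets[OF t B(1)] m by simp
  show "emeasure (law_from X \<mu>) {\<omega>\<in>\<Omega>. located X t B \<omega> \<and> ennreal t < hitting X 0 \<omega>} = (\<integral>\<^sup>+x. transition t (ennreal x) B \<partial>\<mu>)"
    unfolding emeasure_law_from[OF \<mu> m']
    by (rule nn_integral_cong_AE) (use prob_on_posD(3)[OF \<mu>] emeasure_survival(1)[OF _ t B] in \<open>auto elim!: eventually_mono\<close>)
  show "emeasure (law_from X \<mu>) {\<omega>\<in>\<Omega>. ennreal t < hitting X 0 \<omega>} = (\<integral>\<^sup>+x. transition t (ennreal x) {0<..} \<partial>\<mu>)"
    unfolding emeasure_law_from[OF \<mu> m]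
    by (rule nn_integral_cong_AE) (use prob_on_posD(3)[OF \<mu>] emeasure_survival(2)[OF _ t B] in \<open>auto elim!: eventually_mono\<close>)
qed

lemma integral_survival_eq_potential:
  assumes \<mu>: "prob_on_pos \<mu>" and B: "B \<in> sets borel" "0 \<notin> B"
  shows "(\<integral>\<^sup>+t\<in>{0..}. (\<integral>\<^sup>+x. transition t (ennreal x) B \<partial>\<mu>) \<partial>lborel) = (\<integral>\<^sup>+x. emeasure (potential (ennreal x)) B \<partial>\<mu>)"
proof -
  interpret prob_space \<mu> by (rule prob_on_posD(1)[OF \<mu>])
  interpret pair_sigma_finite \<mu> lborel ..
  note [measurable_cong] = prob_on_posD(2)[OF \<mu>]
  note [measurable] = transition_joint[OF B(1)]
  have B0: "B \<inter> {0<..} = B" using B(2) by (auto simp: zero_less_iff_neq_zero)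
  have "(\<integral>\<^sup>+t\<in>{0..}. (\<integral>\<^sup>+x. transition t (ennreal x) B \<partial>\<mu>) \<partial>lborel) = (\<integral>\<^sup>+t. (\<integral>\<^sup>+x. transition t (ennreal x) B * indicator {0..} t \<partial>\<mu>) \<partial>lborel)"
    by (rule nn_integral_cong) (auto simp: indicator_def)
  also have "\<dots> = (\<integral>\<^sup>+x. (\<integral>\<^sup>+t. transition t (ennreal x) B * indicator {0..} t \<partial>lborel) \<partial>\<mu>)"
    using transition_joint[OF B(1)] measurable_cong_sets[of "\<mu> \<Otimes>\<^sub>M lborel" "borel \<Otimes>\<^sub>M borel"]
    by (intro Fubini') (simp add: case_prod_beta prob_on_posD(2)[OF \<mu>] cong: measurable_cong_sets)
  also have "\<dots> = (\<integral>\<^sup>+x. emeasure (potential (ennreal x)) B \<partial>\<mu>)"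
    by (rule nn_integral_cong) (simp add: emeasure_potential[OF ennreal_in_I B(1)] B0)
  finally show ?thesis .
qed

text \<open>A quasi-stationary distribution lives on (0, \<infinity>), so given survival the state
  is finite with probability 1 at each positive time. Integration over time gives zero potential at
  infinity from some starting point, and irreducibility gives it from all.\<close>

lemma potential_no_infinity:
  assumes \<nu>: "quasi_stationary X \<nu>"
  shows "emeasure (potential (ennreal x)) {\<top>} = 0"
proof -
  have p: "prob_on_pos \<nu>" using \<nu> by (simp add: quasi_stationary_def)
  interpret N: prob_space \<nu> by (rule prob_on_posD(1)[OF p])
  interpret prob_space "law_from X \<nu>" by (rule prob_space_law_from[OF p])
  have N1: "measure \<nu> {0<..} = 1" using prob_on_posD(3)[OF p] prob_on_posD(2)[OF p] by (subst N.prob_eq_1) auto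
  have zero: "(\<integral>\<^sup>+x. transition t (ennreal x) {\<top>} \<partial>\<nu>) = 0" if t: "0 < t" for t
  proof -
    let ?A = "{\<omega>\<in>\<Omega>. located X t {0<..<\<top>} \<omega> \<and> ennreal t < hitting X 0 \<omega>}" and ?B = "{\<omega>\<in>\<Omega>. ennreal t < hitting X 0 \<omega>}"
    let ?C = "{\<omega>\<in>\<Omega>. located X t {\<top>} \<omega> \<and> ennreal t < hitting X 0 \<omega>}"
    have im: "ennreal ` {0<..} = {0<..<\<top>}" using pos_part_lift_eq[of UNIV] by (simp add: pos_part_lift_UNIV)
    \<comment> \<open>A quotient equal to 1 has a nonzero denominator, so the two probabilities
      agree.\<close>
    have "measure (law_from X \<nu>) ?A / measure (law_from X \<nu>) ?B = 1"
      using \<nu>[unfolded quasi_stationary_def cond_prob_def space_law_from[OF p], THEN conjunct2, rule_format, OF t, of "{0<..}"]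
      by (simp add: im N1)
    then have e: "measure (law_from X \<nu>) ?A = measure (law_from X \<nu>) ?B" by (simp add: divide_eq_1_iff)
    have loc: "{\<omega>\<in>\<Omega>. located X t B \<omega>} \<in> sets E" if "B \<in> sets borel" for B using located_sets[of t B] t that by simp
    have B: "?B \<in> events" unfolding sets_law_from[OF p] by measurable
    have "?A = {\<omega>\<in>\<Omega>. located X t {0<..<\<top>} \<omega>} \<inter> ?B" "?C = {\<omega>\<in>\<Omega>. located X t {\<top>} \<omega>} \<inter> ?B" by auto
    then have AC: "?A \<in> events" "?C \<in> events" using loc B by (simp_all add: sets_law_from[OF p])
    have "measure (law_from X \<nu>) ?A + measure (law_from X \<nu>) ?C = measure (law_from X \<nu>) (?A \<union> ?C)"
      by (rule finite_measure_Union[symmetric, OF AC]) (auto simp: located_def)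
    also have "\<dots> \<le> measure (law_from X \<nu>) ?B" by (rule finite_measure_mono[OF _ B]) auto
    finally have "measure (law_from X \<nu>) ?C = 0" using e measure_nonneg[of "law_from X \<nu>" ?C] by linarith
    then have "emeasure (law_from X \<nu>) ?C = 0" by (simp add: emeasure_eq_measure)
    then show ?thesis using emeasure_law_from_survival(1)[OF p, of t "{\<top>}"] t by simp
  qed
  have "(\<integral>\<^sup>+x. emeasure (potential (ennreal x)) {\<top>} \<partial>\<nu>) = (\<integral>\<^sup>+t\<in>{0..}. (\<integral>\<^sup>+x. transition t (ennreal x) {\<top>} \<partial>\<nu>) \<partial>lborel)"
    by (rule integral_survival_eq_potential[symmetric, OF p]) auto
  also have "\<dots> = (\<integral>\<^sup>+t. 0 \<partial>(lborel :: real measure))"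
  proof (rule nn_integral_cong_AE)
    have "AE t in lborel. t \<noteq> (0::real)" by (rule AE_lborel_singleton)
    then show "AE t in lborel. (\<integral>\<^sup>+x. transition t (ennreal x) {\<top>} \<partial>\<nu>) * indicator {0..} t = 0"
      by eventually_elim (use zero in \<open>auto simp: indicator_def\<close>)
  qed
  finally have i0: "(\<integral>\<^sup>+x. emeasure (potential (ennreal x)) {\<top>} \<partial>\<nu>) = 0" by simp
  have "\<exists>x>0. emeasure (potential (ennreal x)) {\<top>} = 0"
  proof (rule ccontr)
    assume n: "\<not> ?thesis"
    have pos: "(\<integral>\<^sup>+t. transition t (ennreal x) {\<top>} * indicator {0..} t \<partial>lborel) = emeasure (potential (ennreal x)) {\<top>}" for x :: real
    proof -
      have "{\<top>} \<inter> {0<..} = {\<top>::ennreal}" by auto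
      then show ?thesis by (simp add: emeasure_potential[OF ennreal_in_I])
    qed
    note [measurable] = transition_joint[of "{\<top>}", simplified]
    have "(\<lambda>x::real. \<integral>\<^sup>+t. transition t (ennreal x) {\<top>} * indicator {0..} t \<partial>lborel) \<in> borel_measurable borel"
    proof (rule lborel.borel_measurable_nn_integral)
      have "(\<lambda>p. transition (snd p) (ennreal (fst p)) {\<top>} * indicator {0..} (snd p)) \<in> borel_measurable (borel \<Otimes>\<^sub>M lborel)"
        by measurable
      then show "(\<lambda>(x, t). transition t (ennreal x) {\<top>} * indicator {0..} t) \<in> borel_measurable (borel \<Otimes>\<^sub>M lborel)"
        by (simp add: case_prod_beta)
    qed
    then have m: "(\<lambda>x. emeasure (potential (ennreal x)) {\<top>}) \<in> borel_measurable \<nu>"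
      unfolding pos measurable_cong_sets[OF prob_on_posD(2)[OF p] refl] .
    have "AE x in \<nu>. emeasure (potential (ennreal x)) {\<top>} = 0" using i0 by (simp add: nn_integral_0_iff_AE[OF m])
    then have "AE x in \<nu>. False" using prob_on_posD(3)[OF p] by eventually_elim (use n in auto)
    then show False using N.AE_False by simp
  qed
  then obtain x0 where x0: "0 < x0" "emeasure (potential (ennreal x0)) {\<top>} = 0" by blast
  show ?thesis by (rule potential_transfer(2)[OF x0(1) _ x0(2)]) simp
qed

text \<open>A finite mean under \<mu> is finite from almost every starting point; one such point is
  enough by irreducibility.\<close>

lemma mean_finite_of_moment:
  assumes \<mu>: "prob_on_pos \<mu>" and fin: "T0_moment X \<mu> 1 < \<top>"
  shows "emeasure (potential (ennreal x)) UNIV < \<top>"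
proof -
  interpret prob_space \<mu> by (rule prob_on_posD(1)[OF \<mu>])
  have "(\<integral>\<^sup>+x. \<integral>\<^sup>+\<omega>. hitting X 0 \<omega> \<partial>P x \<partial>\<mu>) < \<top>"
    using fin nn_integral_law_from[OF \<mu> hitting_measurable, of 0] by (simp add: T0_moment_def)
  moreover have "(\<lambda>x. \<integral>\<^sup>+\<omega>. hitting X 0 \<omega> \<partial>P x) \<in> borel_measurable \<mu>"
    using measurable_compose[OF law_from_measurable[OF \<mu>] nn_integral_measurable_subprob_algebra[OF hitting_measurable]] .
  ultimately have "AE x in \<mu>. (\<integral>\<^sup>+\<omega>. hitting X 0 \<omega> \<partial>P x) \<noteq> \<infinity>" by (intro nn_integral_PInf_AE) auto
  then have "AE x in \<mu>. 0 < x \<and> (\<integral>\<^sup>+\<omega>. hitting X 0 \<omega> \<partial>P x) \<noteq> \<infinity>" using prob_on_posD(3)[OF \<mu>] by eventually_elim auto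
  note ae = this
  have "\<exists>x. 0 < x \<and> (\<integral>\<^sup>+\<omega>. hitting X 0 \<omega> \<partial>P x) \<noteq> \<infinity>"
  proof (rule ccontr)
    assume n: "\<not> ?thesis"
    have "AE x in \<mu>. False" using ae by eventually_elim (use n in blast)
    then show False by simp
  qed
  then obtain x0 where x0: "0 < x0" "emeasure (potential (ennreal x0)) UNIV < \<top>" by (auto simp: potential_UNIV less_top)
  show ?thesis by (rule potential_transfer(1)[OF x0(1) _ x0(2)]) simp
qed

end

section \<open>Moments of the absorption time when no time is spent at infinity\<close>

locale natural_diffusion = green_diffusion X I m s
  for X :: "'w markov_family" and I and m :: "ennreal measure" and s :: "real \<Rightarrow> real" +
  assumes no_infinity: "\<And>x. emeasure (potential (ennreal x)) {\<top>} = 0"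
begin

text \<open>The Markov property at time \<open>u\<close>, integrated over \<open>u\<close>: the part
  of the occupation integral after \<open>t\<close> is the Green operator applied to the transition
  function at time \<open>t\<close>. Absorbed paths contribute nothing as 0 is outside
  \<open>B\<close>, and for almost every \<open>u\<close> the state at time \<open>u\<close> is
  almost surely not infinity.\<close>

lemma potential_semigroup:
  assumes x: "0 < x" and t: "0 \<le> t" and B[measurable]: "B \<in> sets borel" and B0: "0 \<notin> B"
  shows "(\<integral>\<^sup>+u\<in>{0..}. transition (u + t) (ennreal x) B \<partial>lborel) = (\<integral>\<^sup>+z. ennreal (Sc (min x z)) * transition t (ennreal z) B \<partial>M)"
proof -
  \<comment> \<open>Cut off at 0 and infinity, so that the integral against the Green measure lives
    on (0, \<infinity>), where the density is known.\<close>
  define tr where "tr z = transition t (ennreal (enn2real z)) B * indicator {0<..<\<top>} z" for z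
  note ms = transition_measurable_space[OF t B]
  have tr[measurable]: "tr \<in> borel_measurable borel"
  proof -
    have "(\<lambda>z. transition t (ennreal (enn2real z)) B) \<in> borel_measurable borel"
      by (rule measurable_compose[OF _ ms]) measurable
    then show ?thesis unfolding tr_def[abs_def] by measurable
  qed
  have ae: "AE u in lborel. 0 \<le> u \<longrightarrow> transition u (ennreal x) {\<top>} = 0"
  proof -
    have "{\<top>} \<inter> {0<..} = {\<top>::ennreal}" by auto
    then have "(\<integral>\<^sup>+u\<in>{0..}. transition u (ennreal x) {\<top>} \<partial>lborel) = 0"
      using no_infinity[of x] by (simp add: emeasure_potential[OF ennreal_in_I])
    moreover have "(\<lambda>u. transition u (ennreal x) {\<top>} * indicator {0..} u) \<in> borel_measurable lborel"
      using transition_measurable_time[OF ennreal_in_I, of "{\<top>}" x] by simp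
    ultimately have "AE u in lborel. transition u (ennreal x) {\<top>} * indicator {0..} u = 0"
      by (simp add: nn_integral_0_iff_AE)
    then show ?thesis by eventually_elim (auto simp: indicator_def split: if_splits)
  qed
  have ck: "transition (u + t) (ennreal x) B = (\<integral>\<^sup>+\<omega>. tr (path u \<omega>) * indicator (occ_set (\<lambda>_. \<top>)) (\<omega>, u) \<partial>P x)"
    if u: "0 \<le> u" and u0: "transition u (ennreal x) {\<top>} = 0" for u
  proof -
    have alive: "ennreal u < life X \<omega>" if "located X (u + t) B \<omega>" for \<omega>
    proof -
      have "ennreal u \<le> ennreal (u + t)" using t by (intro ennreal_leI) simp
      also have "\<dots> < life X \<omega>" using that by (simp add: located_def)
      finally show ?thesis .
    qed
    have "transition (u + t) (ennreal x) B = emeasure (P x) {\<omega> \<in> \<Omega>. ennreal u < life X \<omega> \<and> located X (enn2real (ennreal u) + t) B \<omega>}"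
      unfolding transition_def using u alive by (intro arg_cong2[where f=emeasure]) auto
    also have "\<dots> = (\<integral>\<^sup>+\<omega> \<in> {\<omega> \<in> \<Omega>. ennreal u < life X \<omega>}. transition t (pos X (enn2real (ennreal u)) \<omega>) B \<partial>P x)"
      unfolding transition_def by (rule strong_markov_at[OF ennreal_in_I stopping_time_const t B])
    also have "\<dots> = (\<integral>\<^sup>+\<omega>. tr (path u \<omega>) * indicator (occ_set (\<lambda>_. \<top>)) (\<omega>, u) \<partial>P x)"
    proof (rule nn_integral_cong_AE)
      have "emeasure (P x) {\<omega> \<in> \<Omega>. located X u {\<top>} \<omega>} = 0" using u0 by (simp add: transition_def)
      then have "AE \<omega> in P x. \<omega> \<notin> {\<omega> \<in> \<Omega>. located X u {\<top>} \<omega>}"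
        using located_sets[OF u, of "{\<top>}"] by (intro AE_not_in) (auto simp: null_sets_def)
      then show "AE \<omega> in P x. transition t (pos X (enn2real (ennreal u)) \<omega>) B * indicator {\<omega> \<in> \<Omega>. ennreal u < life X \<omega>} \<omega> =
          tr (path u \<omega>) * indicator (occ_set (\<lambda>_. \<top>)) (\<omega>, u)"
        using AE_space
      proof eventually_elim
        case (elim \<omega>)
        then have \<omega>: "\<omega> \<in> \<Omega>" and nt: "\<not> located X u {\<top>} \<omega>" by auto
        show ?case
        proof (cases "ennreal u < life X \<omega>")
          case True
          then have pt: "pos X u \<omega> \<noteq> \<top>" using nt by (auto simp: located_def)
          show ?thesis
          proof (cases "pos X u \<omega> = 0")
            case True then show ?thesis using u transition_zero[OF t B B0] by (simp add: occ_set_def located_def)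
          next
            case False
            then show ?thesis using True pt u \<omega>
              by (simp add: occ_set_def located_def path_def tr_def zero_less_iff_neq_zero less_top)
          qed
        qed (auto simp: occ_set_def located_def)
      qed
    qed
    finally show ?thesis .
  qed
  interpret prob_space "P x" by (rule prob_space_P)
  interpret pair_sigma_finite "P x" lborel by (rule pair_law) simp
  have "(\<integral>\<^sup>+u\<in>{0..}. transition (u + t) (ennreal x) B \<partial>lborel) = (\<integral>\<^sup>+u. \<integral>\<^sup>+\<omega>. tr (path u \<omega>) * indicator (occ_set (\<lambda>_. \<top>)) (\<omega>, u) \<partial>P x \<partial>lborel)"
  proof (rule nn_integral_cong_AE)
    show "AE u in lborel. transition (u + t) (ennreal x) B * indicator {0..} u = (\<integral>\<^sup>+\<omega>. tr (path u \<omega>) * indicator (occ_set (\<lambda>_. \<top>)) (\<omega>, u) \<partial>P x)"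
      using ae
    proof eventually_elim
      case (elim u)
      then show ?case using ck[of u] by (cases "0 \<le> u") (auto simp: occ_set_def)
    qed
  qed
  also have "\<dots> = (\<integral>\<^sup>+\<omega>. \<integral>\<^sup>+u. tr (path u \<omega>) * indicator (occ_set (\<lambda>_. \<top>)) (\<omega>, u) \<partial>lborel \<partial>P x)"
    by (rule Fubini') measurable
  also have "\<dots> = (\<integral>\<^sup>+z. tr z \<partial>potential (ennreal x))"
    by (rule nn_integral_occ[symmetric]) auto
  also have "\<dots> = (\<integral>\<^sup>+z. ennreal (Sc (min x z)) * transition t (ennreal z) B \<partial>M)"
    unfolding tr_def by (rule nn_integral_potential[OF x ms])
  finally show ?thesis .
qed

text \<open>Integrating tail probabilities shows that this is the expectation of T^(n+1) / (n+1)!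
  for the absorption time T; the index is one lower than the power.\<close>

definition surv_moment :: "nat \<Rightarrow> real \<Rightarrow> ennreal" where
  "surv_moment n x = (\<integral>\<^sup>+t. ennreal (t ^ n / fact n) * (transition t (ennreal x) {0<..} * indicator {0..} t) \<partial>lborel)"

lemma surv_moment_measurable [measurable]: "surv_moment n \<in> borel_measurable borel"
  unfolding surv_moment_def[abs_def]
proof (rule lborel.borel_measurable_nn_integral)
  note [measurable] = transition_joint[of "{0<..}", simplified]
  have "(\<lambda>p. ennreal (snd p ^ n / fact n) * (transition (snd p) (ennreal (fst p)) {0<..} * indicator {0..} (snd p))) \<in> borel_measurable (borel \<Otimes>\<^sub>M lborel)"
    by measurable
  then show "(\<lambda>(x, t). ennreal (t ^ n / fact n) * (transition t (ennreal x) {0<..} * indicator {0..} t)) \<in> borel_measurable (borel \<Otimes>\<^sub>M lborel)"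
    by (simp add: case_prod_beta)
qed

lemma power_integral:
  assumes "0 \<le> r"
  shows "(\<integral>\<^sup>+t. ennreal (t ^ n / fact n) * indicator {0..r} t \<partial>lborel) = ennreal (r ^ Suc n / fact (Suc n))"
proof -
  have "(\<integral>\<^sup>+t. ennreal (t ^ n / fact n) * indicator {0..r} t \<partial>lborel) = ennreal (r ^ Suc n / fact (Suc n) - 0 ^ Suc n / fact (Suc n))"
  proof (rule nn_integral_FTC_Icc)
    fix t :: real
    have "((\<lambda>t. t ^ Suc n / fact (Suc n)) has_real_derivative (real (Suc n) * t ^ (Suc n - Suc 0) / fact (Suc n))) (at t)"
      by (rule DERIV_cdivide[OF DERIV_pow])
    also have "real (Suc n) * t ^ (Suc n - Suc 0) / fact (Suc n) = t ^ n / fact n"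
      unfolding fact_Suc by (simp del: of_nat_Suc)
    finally have "((\<lambda>t. t ^ Suc n / fact (Suc n)) has_real_derivative (t ^ n / fact n)) (at t)" .
    then show "((\<lambda>t. t ^ Suc n / fact (Suc n)) has_real_derivative (t ^ n / fact n)) (at t)"
      .
  qed (use assms in auto)
  then show ?thesis by simp
qed

lemma hitting_moment:
  assumes x: "0 < x"
  shows "(\<integral>\<^sup>+\<omega>. (hitting X 0 \<omega>) ^ Suc n \<partial>P x) = ennreal (fact (Suc n)) * surv_moment n x"
proof -
  interpret prob_space "P x" by (rule prob_space_P)
  interpret pair_sigma_finite "P x" lborel by (rule pair_law) simp
  let ?f = "\<lambda>\<omega> t. ennreal (t ^ n / fact n) * (indicator {p. 0 \<le> snd p \<and> ennreal (snd p) < hitting X 0 (fst p)} (\<omega>, t) :: ennreal)"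
  have fm: "(\<lambda>p. ?f (fst p) (snd p)) \<in> borel_measurable (P x \<Otimes>\<^sub>M lborel)" by measurable
  have "(\<integral>\<^sup>+\<omega>. (hitting X 0 \<omega>) ^ Suc n \<partial>P x) = (\<integral>\<^sup>+\<omega>. ennreal (fact (Suc n)) * (\<integral>\<^sup>+t. ?f \<omega> t \<partial>lborel) \<partial>P x)"
  proof (rule nn_integral_cong_AE)
    show "AE \<omega> in P x. (hitting X 0 \<omega>) ^ Suc n = ennreal (fact (Suc n)) * (\<integral>\<^sup>+t. ?f \<omega> t \<partial>lborel)"
      using AE_regular_path[OF x]
    proof eventually_elim
      case (elim \<omega>)
      then obtain r where r: "hitting X 0 \<omega> = ennreal r" "0 \<le> r"
        by (cases "hitting X 0 \<omega>") (auto simp: regular_path_def)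
      have "(\<integral>\<^sup>+t. ?f \<omega> t \<partial>lborel) = (\<integral>\<^sup>+t. ennreal (t ^ n / fact n) * indicator {0..r} t \<partial>lborel)"
      proof (rule nn_integral_cong_AE)
        have "AE t in lborel. t \<noteq> r" by (rule AE_lborel_singleton)
        then show "AE t in lborel. ?f \<omega> t = ennreal (t ^ n / fact n) * indicator {0..r} t"
          by eventually_elim (use r in \<open>auto simp: ennreal_less_iff split: split_indicator\<close>)
      qed
      also have "\<dots> = ennreal (r ^ Suc n / fact (Suc n))" by (rule power_integral[OF r(2)])
      finally have "ennreal (fact (Suc n)) * (\<integral>\<^sup>+t. ?f \<omega> t \<partial>lborel) = ennreal (fact (Suc n) * (r ^ Suc n / fact (Suc n)))"
        using r(2) by (simp only: ennreal_mult'[symmetric] fact_ge_zero)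
      then show ?case using r by (simp add: ennreal_power del: power_Suc fact_Suc)
    qed
  qed
  also have "\<dots> = ennreal (fact (Suc n)) * (\<integral>\<^sup>+\<omega>. \<integral>\<^sup>+t. ?f \<omega> t \<partial>lborel \<partial>P x)"
    using fm by (intro nn_integral_cmult lborel.borel_measurable_nn_integral) (simp add: case_prod_beta)
  also have "(\<integral>\<^sup>+\<omega>. \<integral>\<^sup>+t. ?f \<omega> t \<partial>lborel \<partial>P x) = (\<integral>\<^sup>+t. \<integral>\<^sup>+\<omega>. ?f \<omega> t \<partial>P x \<partial>lborel)"
    by (rule Fubini'[symmetric]) (use fm in \<open>simp add: case_prod_beta\<close>)
  also have "\<dots> = surv_moment n x" unfolding surv_moment_def
  proof (rule nn_integral_cong)
    fix t :: real
    show "(\<integral>\<^sup>+\<omega>. ?f \<omega> t \<partial>P x) = ennreal (t ^ n / fact n) * (transition t (ennreal x) {0<..} * indicator {0..} t)"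
    proof (cases "0 \<le> t")
      case True
      have "(\<integral>\<^sup>+\<omega>. ?f \<omega> t \<partial>P x) = (\<integral>\<^sup>+\<omega>. ennreal (t ^ n / fact n) * indicator {\<omega>\<in>\<Omega>. ennreal t < hitting X 0 \<omega>} \<omega> \<partial>P x)"
        using True by (intro nn_integral_cong) (auto split: split_indicator)
      also have "\<dots> = ennreal (t ^ n / fact n) * emeasure (P x) {\<omega>\<in>\<Omega>. ennreal t < hitting X 0 \<omega>}"
        by (rule nn_integral_cmult_indicator) measurable
      finally show ?thesis using True emeasure_survival(2)[OF x True, of "{0<..}"] by simp
    qed (simp add: indicator_def)
  qed
  finally show ?thesis .
qed

lemma surv_moment_0: "surv_moment 0 x = emeasure (potential (ennreal x)) UNIV"
  using emeasure_potential[OF ennreal_in_I, of UNIV x] by (simp add: surv_moment_def)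

text \<open>The state space exceeds (0, \<infinity>) by 0 and infinity, and both have zero
  potential.\<close>

lemma potential_UNIV_density:
  assumes x: "0 < x" shows "emeasure (potential (ennreal x)) UNIV = (\<integral>\<^sup>+z. ennreal (Sc (min x z)) \<partial>M)"
proof -
  have z: "emeasure (potential (ennreal x)) {0} = 0" by (simp add: emeasure_potential[OF ennreal_in_I] transition_def located_def)
  have "emeasure (potential (ennreal x)) UNIV = emeasure (potential (ennreal x)) (pos_part_lift UNIV \<union> {0} \<union> {\<top>})"
    by (rule arg_cong[where f="emeasure _"]) (auto simp: pos_part_lift_UNIV zero_less_iff_neq_zero less_top)
  also have "\<dots> \<le> emeasure (potential (ennreal x)) (pos_part_lift UNIV) + emeasure (potential (ennreal x)) {0} + emeasure (potential (ennreal x)) {\<top>}"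
    by (intro order_trans[OF emeasure_subadditive] add_right_mono emeasure_subadditive) auto
  finally have "emeasure (potential (ennreal x)) UNIV \<le> emeasure (potential (ennreal x)) (pos_part_lift UNIV)"
    by (simp add: z no_infinity)
  moreover have "emeasure (potential (ennreal x)) (pos_part_lift UNIV) \<le> emeasure (potential (ennreal x)) UNIV" by (rule emeasure_mono) auto
  ultimately show ?thesis using potential_density[OF x, of UNIV] by simp
qed

text \<open>Kac's moment formula: normalised moments are iterated Green potentials. It follows from
  the semigroup identity by exchanging the integrals over 0 \<le> t \<le> u and integrating t^n /
  n!.\<close>

lemma surv_moment_Suc:
  assumes x: "0 < x"
  shows "surv_moment (Suc n) x = (\<integral>\<^sup>+z. ennreal (Sc (min x z)) * surv_moment n z \<partial>M)"
proof -
  interpret MM: pair_sigma_finite M "lborel :: real measure" ..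
  define R where "R t z = transition t (ennreal z) {0<..} * indicator {0..} t" for t z :: real
  have Rm[measurable]: "(\<lambda>p. R (snd p) (fst p)) \<in> borel_measurable (borel \<Otimes>\<^sub>M borel)"
    using transition_joint[of "{0<..}"] by (simp add: R_def)
  have Rt[measurable]: "(\<lambda>t. R t x) \<in> borel_measurable borel"
    using transition_measurable_time[OF ennreal_in_I, of "{0<..}" x] by (simp add: R_def)
  let ?g = "\<lambda>t. ennreal (t ^ n / fact n)"
  \<comment> \<open>The semigroup identity with time shifted by \<open>t\<close> and all ranges
    written as indicators, ready for the exchange of integrals.\<close>
  have sg: "(\<integral>\<^sup>+z. ennreal (Sc (min x z)) * R t z \<partial>M) = (\<integral>\<^sup>+u. R u x * indicator {t..} u * indicator {0..} t \<partial>lborel)" for t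
  proof (cases "0 \<le> t")
    case True
    have "(\<integral>\<^sup>+u. R u x * indicator {t..} u \<partial>lborel) = (\<integral>\<^sup>+u. R (t + 1 * u) x * indicator {t..} (t + 1 * u) \<partial>lborel)"
      by (subst nn_integral_real_affine[where c=1 and t=t]) auto
    also have "\<dots> = (\<integral>\<^sup>+u\<in>{0..}. transition (u + t) (ennreal x) {0<..} \<partial>lborel)"
      using True by (intro nn_integral_cong) (auto simp: R_def add.commute split: split_indicator)
    also have "\<dots> = (\<integral>\<^sup>+z. ennreal (Sc (min x z)) * transition t (ennreal z) {0<..} \<partial>M)"
      by (rule potential_semigroup[OF x True]) auto
    finally show ?thesis using True by (simp add: R_def)
  qed (simp add: R_def)
  have "(\<integral>\<^sup>+z. ennreal (Sc (min x z)) * surv_moment n z \<partial>M) = (\<integral>\<^sup>+z. \<integral>\<^sup>+t. ennreal (Sc (min x z)) * (?g t * R t z) \<partial>lborel \<partial>M)"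
    unfolding surv_moment_def R_def[symmetric]
  proof (rule nn_integral_cong, rule nn_integral_cmult[symmetric])
    fix z
    have "(\<lambda>t. R t z) \<in> borel_measurable borel"
      using transition_measurable_time[OF ennreal_in_I, of "{0<..}" z] by (simp add: R_def)
    then show "(\<lambda>t. ?g t * R t z) \<in> borel_measurable lborel" by measurable
  qed
  also have "\<dots> = (\<integral>\<^sup>+t. \<integral>\<^sup>+z. ennreal (Sc (min x z)) * (?g t * R t z) \<partial>M \<partial>lborel)"
  proof (rule MM.Fubini'[symmetric])
    have "(\<lambda>p. ennreal (Sc (min x (fst p))) * (?g (snd p) * R (snd p) (fst p))) \<in> borel_measurable (M \<Otimes>\<^sub>M lborel)"
      by measurable
    then show "(\<lambda>(z, t). ennreal (Sc (min x z)) * (?g t * R t z)) \<in> borel_measurable (M \<Otimes>\<^sub>M lborel)"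
      by (simp add: case_prod_beta)
  qed
  also have "\<dots> = (\<integral>\<^sup>+t. ?g t * (\<integral>\<^sup>+z. ennreal (Sc (min x z)) * R t z \<partial>M) \<partial>lborel)"
  proof (rule nn_integral_cong)
    fix t :: real
    have m: "(\<lambda>z. R t z) \<in> borel_measurable borel"
      using transition_measurable_space[of t "{0<..}"] by (cases "0 \<le> t") (auto simp: R_def)
    have "(\<integral>\<^sup>+z. ennreal (Sc (min x z)) * (?g t * R t z) \<partial>M) = (\<integral>\<^sup>+z. ?g t * (ennreal (Sc (min x z)) * R t z) \<partial>M)"
      by (rule nn_integral_cong) (simp only: ac_simps)
    also have "\<dots> = ?g t * (\<integral>\<^sup>+z. ennreal (Sc (min x z)) * R t z \<partial>M)"
      using m by (intro nn_integral_cmult) measurable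
    finally show "(\<integral>\<^sup>+z. ennreal (Sc (min x z)) * (?g t * R t z) \<partial>M) = ?g t * (\<integral>\<^sup>+z. ennreal (Sc (min x z)) * R t z \<partial>M)" .
  qed
  also have "\<dots> = (\<integral>\<^sup>+t. \<integral>\<^sup>+u. ?g t * (R u x * indicator {t..} u * indicator {0..} t) \<partial>lborel \<partial>lborel)"
    unfolding sg by (intro nn_integral_cong nn_integral_cmult[symmetric]) measurable
  also have "\<dots> = (\<integral>\<^sup>+u. \<integral>\<^sup>+t. ?g t * (R u x * indicator {t..} u * indicator {0..} t) \<partial>lborel \<partial>lborel)"
  proof (rule lborel_pair.Fubini'[symmetric])
    have "(\<lambda>p. ?g (fst p) * (R (snd p) x * indicator {q. fst q \<le> snd q} p * indicator {0..} (fst p))) \<in> borel_measurable (lborel \<Otimes>\<^sub>M lborel)"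
      by measurable
    then show "(\<lambda>(t, u). ?g t * (R u x * indicator {t..} u * indicator {0..} t)) \<in> borel_measurable (lborel \<Otimes>\<^sub>M lborel)"
      by (simp add: case_prod_beta indicator_def)
  qed
  also have "\<dots> = surv_moment (Suc n) x" unfolding surv_moment_def R_def[symmetric]
  proof (rule nn_integral_cong)
    fix u :: real
    have "(\<integral>\<^sup>+t. ?g t * (R u x * indicator {t..} u * indicator {0..} t) \<partial>lborel) = (\<integral>\<^sup>+t. R u x * (?g t * indicator {0..u} t) \<partial>lborel)"
      by (rule nn_integral_cong) (auto simp: mult.commute split: split_indicator)
    also have "\<dots> = R u x * (\<integral>\<^sup>+t. ?g t * indicator {0..u} t \<partial>lborel)" by (rule nn_integral_cmult) measurable
    also have "\<dots> = ennreal (u ^ Suc n / fact (Suc n)) * R u x"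
      using power_integral[of u n] by (cases "0 \<le> u") (auto simp: R_def mult.commute)
    finally show "(\<integral>\<^sup>+t. ?g t * (R u x * indicator {t..} u * indicator {0..} t) \<partial>lborel) = ennreal (u ^ Suc n / fact (Suc n)) * R u x" .
  qed
  finally show ?thesis ..
qed

section \<open>Potential densities and the renewal transform\<close>

lemma measurable_M [simp]: "measurable M N = measurable borel N"
  by (rule measurable_cong_sets) simp_all

text \<open>The density with respect to \<open>M\<close> of the Green measure started from \<mu>; as
  the kernel is symmetric, it is also the Green potential of the measure \<mu>.\<close>

definition pot_dens :: "real measure \<Rightarrow> real \<Rightarrow> real" where
  "pot_dens \<mu> z = (\<integral>x. Sc (min x z) \<partial>\<mu>)"

text \<open>The n-th moment divided by n!, with values in \<open>ennreal\<close>. Because of the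
  index of \<open>surv_moment\<close> the case 0 is separate; its value 1 is the total mass.\<close>

definition norm_moment :: "real measure \<Rightarrow> nat \<Rightarrow> ennreal" where
  "norm_moment \<mu> n = (case n of 0 \<Rightarrow> 1 | Suc k \<Rightarrow> \<integral>\<^sup>+x. surv_moment k x \<partial>\<mu>)"

lemma norm_moment_simps [simp]: "norm_moment \<mu> 0 = 1" "norm_moment \<mu> (Suc k) = (\<integral>\<^sup>+x. surv_moment k x \<partial>\<mu>)"
  by (simp_all add: norm_moment_def)

lemma T0_moment_eq:
  assumes \<mu>: "prob_on_pos \<mu>" shows "T0_moment X \<mu> n = ennreal (fact n) * norm_moment \<mu> n"
proof (cases n)
  case 0
  interpret prob_space "law_from X \<mu>" by (rule prob_space_law_from[OF \<mu>])
  show ?thesis using 0 by (simp add: T0_moment_def emeasure_space_1)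
next
  case (Suc k)
  have "T0_moment X \<mu> n = (\<integral>\<^sup>+x. (\<integral>\<^sup>+\<omega>. (hitting X 0 \<omega>) ^ Suc k \<partial>P x) \<partial>\<mu>)"
    unfolding T0_moment_def Suc by (rule nn_integral_law_from[OF \<mu>]) measurable
  also have "\<dots> = (\<integral>\<^sup>+x. ennreal (fact (Suc k)) * surv_moment k x \<partial>\<mu>)"
    by (rule nn_integral_cong_AE) (use prob_on_posD(3)[OF \<mu>] hitting_moment in \<open>auto elim!: eventually_mono simp del: power_Suc fact_Suc\<close>)
  also have "\<dots> = ennreal (fact (Suc k)) * (\<integral>\<^sup>+x. surv_moment k x \<partial>\<mu>)"
    by (rule nn_integral_cmult) (simp add: measurable_cong_sets[OF prob_on_posD(2)[OF \<mu>] refl])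
  finally show ?thesis using Suc by simp
qed

lemma normalized_moment_eq:
  assumes \<mu>: "prob_on_pos \<mu>" shows "normalized_moment X \<mu> n = enn2real (norm_moment \<mu> n)"
  by (simp add: normalized_moment_def T0_moment_eq[OF \<mu>] enn2real_mult)

lemma Sc_min_bounds: "0 \<le> Sc (min x z)" "Sc (min x z) \<le> Sc z" "Sc (min x z) \<le> Sc x"
  by (auto intro: Sc_nonneg Sc_mono)

definition renewal_dens :: "real measure \<Rightarrow> real \<Rightarrow> real" where
  "renewal_dens \<mu> z = pot_dens \<mu> z / enn2real (norm_moment \<mu> 1)"

context
  fixes \<mu> :: "real measure"
  assumes \<mu>: "prob_on_pos \<mu>"
begin

interpretation \<mu>: prob_space \<mu> by (rule prob_on_posD(1)[OF \<mu>])

lemma sets_\<mu> [simp, measurable_cong]: "sets \<mu> = sets borel"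
  by (rule prob_on_posD(2)[OF \<mu>])

lemma integrable_Sc_min: "integrable \<mu> (\<lambda>x. Sc (min x z))"
  by (rule \<mu>.integrable_const_bound[where B="Sc z"]) (auto simp: Sc_nonneg Sc_min_bounds)

lemma ennreal_pot_dens: "ennreal (pot_dens \<mu> z) = (\<integral>\<^sup>+x. ennreal (Sc (min x z)) \<partial>\<mu>)"
  unfolding pot_dens_def by (rule nn_integral_eq_integral[symmetric]) (auto simp: integrable_Sc_min Sc_nonneg)

lemma pot_dens_nonneg: "0 \<le> pot_dens \<mu> z"
  unfolding pot_dens_def by (intro integral_nonneg_AE) (auto simp: Sc_nonneg)

lemma pot_dens_le: "pot_dens \<mu> z \<le> Sc z"
proof -
  have "pot_dens \<mu> z \<le> (\<integral>x. Sc z \<partial>\<mu>)" unfolding pot_dens_def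
    by (intro integral_mono integrable_Sc_min) (auto simp: Sc_min_bounds)
  then show ?thesis by (simp add: \<mu>.prob_space)
qed

lemma pot_dens_zero: "z \<le> 0 \<Longrightarrow> pot_dens \<mu> z = 0"
  unfolding pot_dens_def by (simp add: Sc_def min_le_iff_disj)

lemma pot_dens_mono: "z \<le> w \<Longrightarrow> pot_dens \<mu> z \<le> pot_dens \<mu> w"
  unfolding pot_dens_def by (intro integral_mono integrable_Sc_min Sc_mono) auto

lemma pot_dens_measurable [measurable]: "pot_dens \<mu> \<in> borel_measurable borel"
  by (intro borel_measurable_mono monoI pot_dens_mono)

lemma pot_dens_pos: assumes "0 < z" shows "0 < pot_dens \<mu> z"
proof -
  have "pot_dens \<mu> z \<noteq> 0"
  proof
    assume "pot_dens \<mu> z = 0"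
    then have "AE x in \<mu>. Sc (min x z) = 0" unfolding pot_dens_def
      by (subst (asm) integral_nonneg_eq_0_iff_AE) (auto simp: integrable_Sc_min Sc_nonneg)
    then have "AE x in \<mu>. False" using prob_on_posD(3)[OF \<mu>]
      by eventually_elim (use Sc_pos assms in \<open>metis less_irrefl min_less_iff_conj\<close>)
    then show False by simp
  qed
  then show ?thesis using pot_dens_nonneg[of z] by simp
qed

text \<open>For each fixed \<open>w\<close> the increment of the kernel is at most that of
  \<open>Sc\<close>, and averaging over a probability measure preserves the Lipschitz bound in the
  scale.\<close>

lemma pot_dens_continuous: "continuous_on {0<..} (pot_dens \<mu>)"
proof (rule lipschitz_in_scale_continuous[where C="\<lambda>_. 1"])
  fix x y Y :: real assume xy: "0 < x" "x \<le> y"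
  have "pot_dens \<mu> y - pot_dens \<mu> x = (\<integral>w. Sc (min w y) - Sc (min w x) \<partial>\<mu>)"
    unfolding pot_dens_def by (rule Bochner_Integration.integral_diff[symmetric]) (rule integrable_Sc_min)+
  also have "\<dots> \<le> (\<integral>w. Sc y - Sc x \<partial>\<mu>)"
  proof (intro integral_mono Bochner_Integration.integrable_diff integrable_Sc_min)
    fix w
    show "Sc (min w y) - Sc (min w x) \<le> Sc y - Sc x"
      using Sc_mono[of x y] Sc_mono[of x w] Sc_mono[of w y] xy by (auto simp: min_def)
  qed auto
  also have "\<dots> = s y - s x" using Sc_diff[of x y] xy by (simp add: \<mu>.prob_space)
  finally show "\<bar>pot_dens \<mu> y - pot_dens \<mu> x\<bar> \<le> (s y - s x) * 1" using pot_dens_mono[OF xy(2)] by simp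
qed

lemma potential_from:
  assumes [measurable]: "\<phi> \<in> borel_measurable borel"
  shows "(\<integral>\<^sup>+x. \<integral>\<^sup>+z. ennreal (Sc (min x z)) * \<phi> z \<partial>M \<partial>\<mu>) = (\<integral>\<^sup>+z. ennreal (pot_dens \<mu> z) * \<phi> z \<partial>M)"
proof -
  interpret P: pair_sigma_finite M \<mu> ..
  have "(\<lambda>p. ennreal (Sc (min (snd p) (fst p))) * \<phi> (fst p)) \<in> borel_measurable (M \<Otimes>\<^sub>M \<mu>)" by measurable
  then have "(\<integral>\<^sup>+x. \<integral>\<^sup>+z. ennreal (Sc (min x z)) * \<phi> z \<partial>M \<partial>\<mu>) = (\<integral>\<^sup>+z. \<integral>\<^sup>+x. ennreal (Sc (min x z)) * \<phi> z \<partial>\<mu> \<partial>M)"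
    by (intro P.Fubini') (simp add: case_prod_beta)
  also have "\<dots> = (\<integral>\<^sup>+z. ennreal (pot_dens \<mu> z) * \<phi> z \<partial>M)"
    unfolding ennreal_pot_dens by (intro nn_integral_cong nn_integral_multc) measurable
  finally show ?thesis .
qed

lemma surv_moment_from: "(\<integral>\<^sup>+z. ennreal (pot_dens \<mu> z) * surv_moment n z \<partial>M) = norm_moment \<mu> (Suc (Suc n))"
  "(\<integral>\<^sup>+z. ennreal (pot_dens \<mu> z) \<partial>M) = norm_moment \<mu> 1"
proof -
  have "(\<integral>\<^sup>+z. ennreal (pot_dens \<mu> z) * surv_moment n z \<partial>M) = (\<integral>\<^sup>+x. \<integral>\<^sup>+z. ennreal (Sc (min x z)) * surv_moment n z \<partial>M \<partial>\<mu>)"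
    by (rule potential_from[symmetric]) measurable
  also have "\<dots> = (\<integral>\<^sup>+x. surv_moment (Suc n) x \<partial>\<mu>)"
    by (rule nn_integral_cong_AE) (use prob_on_posD(3)[OF \<mu>] surv_moment_Suc in \<open>auto elim!: eventually_mono\<close>)
  finally show "(\<integral>\<^sup>+z. ennreal (pot_dens \<mu> z) * surv_moment n z \<partial>M) = norm_moment \<mu> (Suc (Suc n))" by simp
  have "(\<integral>\<^sup>+z. ennreal (pot_dens \<mu> z) \<partial>M) = (\<integral>\<^sup>+x. \<integral>\<^sup>+z. ennreal (Sc (min x z)) * 1 \<partial>M \<partial>\<mu>)"
    by (subst potential_from) auto
  also have "\<dots> = (\<integral>\<^sup>+x. surv_moment 0 x \<partial>\<mu>)"
    by (rule nn_integral_cong_AE) (use prob_on_posD(3)[OF \<mu>] surv_moment_0 potential_UNIV_density in \<open>auto elim!: eventually_mono\<close>)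
  finally show "(\<integral>\<^sup>+z. ennreal (pot_dens \<mu> z) \<partial>M) = norm_moment \<mu> 1" by simp
qed

lemma norm_moment_1_pos: "0 < norm_moment \<mu> 1"
proof -
  have "(\<integral>\<^sup>+z. ennreal (pot_dens \<mu> z) \<partial>M) \<noteq> 0"
  proof
    assume "(\<integral>\<^sup>+z. ennreal (pot_dens \<mu> z) \<partial>M) = 0"
    then have "AE z in M. ennreal (pot_dens \<mu> z) = 0" by (subst (asm) nn_integral_0_iff_AE) auto
    then have "AE z in M. False" using AE_M_pos by eventually_elim (use pot_dens_pos in \<open>auto simp: ennreal_eq_0_iff not_le[symmetric]\<close>)
    then have "emeasure M UNIV = 0" using AE_iff_measurable[of UNIV M "\<lambda>_. False"] by simp
    moreover have "emeasure M {1<..<2} \<le> emeasure M UNIV" by (rule emeasure_mono) auto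
    ultimately show False using M_open_pos[of 1 2] by simp
  qed
  then show ?thesis unfolding surv_moment_from(2) by (simp add: zero_less_iff_neq_zero)
qed

lemma renewal_formula:
  assumes A[measurable]: "A \<in> sets borel"
  shows "(\<integral>\<^sup>+t\<in>{0..}. emeasure (law_from X \<mu>)
              {\<omega> \<in> space (law_from X \<mu>). located X t (ennreal ` (A \<inter> {0<..})) \<omega> \<and> ennreal t < hitting X 0 \<omega>} \<partial>lborel)
    = (\<integral>\<^sup>+z\<in>A. ennreal (pot_dens \<mu> z) \<partial>M)"
proof -
  have "(\<integral>\<^sup>+t\<in>{0..}. emeasure (law_from X \<mu>)
              {\<omega> \<in> space (law_from X \<mu>). located X t (ennreal ` (A \<inter> {0<..})) \<omega> \<and> ennreal t < hitting X 0 \<omega>} \<partial>lborel)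
    = (\<integral>\<^sup>+t\<in>{0..}. (\<integral>\<^sup>+x. transition t (ennreal x) (pos_part_lift A) \<partial>\<mu>) \<partial>lborel)"
    unfolding space_law_from[OF \<mu>] pos_part_lift_eq[symmetric]
    by (rule nn_integral_cong) (auto simp: emeasure_law_from_survival(1)[OF \<mu>] split: split_indicator)
  also have "\<dots> = (\<integral>\<^sup>+x. emeasure (potential (ennreal x)) (pos_part_lift A) \<partial>\<mu>)"
    by (rule integral_survival_eq_potential[OF \<mu>]) auto
  also have "\<dots> = (\<integral>\<^sup>+x. \<integral>\<^sup>+z. ennreal (Sc (min x z)) * indicator A z \<partial>M \<partial>\<mu>)"
    by (rule nn_integral_cong_AE) (use prob_on_posD(3)[OF \<mu>] potential_density[OF _ A] in \<open>auto elim!: eventually_mono\<close>)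
  also have "\<dots> = (\<integral>\<^sup>+z\<in>A. ennreal (pot_dens \<mu> z) \<partial>M)" by (rule potential_from) measurable
  finally show ?thesis .
qed

end

text \<open>The transform is built by \<open>measure_of\<close> from a bare set function. Since
  \<open>measure_of\<close> depends only on values on the generated sets, agreement there with a
  density measure suffices, and additivity is inherited.\<close>

lemma renewal_transform_eq:
  assumes \<mu>: "prob_on_pos \<mu>" and fin: "norm_moment \<mu> 1 < \<top>"
  shows "renewal_transform X \<mu> = density M (\<lambda>z. ennreal (renewal_dens \<mu> z))"
proof -
  note [measurable] = pot_dens_measurable[OF \<mu>]
  have pos: "0 < enn2real (norm_moment \<mu> 1)" using norm_moment_1_pos[OF \<mu>] fin by (simp add: enn2real_positive_iff)
  let ?D = "density M (\<lambda>z. ennreal (renewal_dens \<mu> z))"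
  have "renewal_transform X \<mu> = measure_of UNIV (sets borel) (emeasure ?D)"
    unfolding renewal_transform_def
  proof (rule measure_of_eq)
    fix A :: "real set" assume "A \<in> sigma_sets UNIV (sets borel)"
    then have A[measurable]: "A \<in> sets borel" using sets.sigma_sets_eq[of "borel :: real measure"] by simp
    have m1: "T0_moment X \<mu> 1 = ennreal (enn2real (norm_moment \<mu> 1))" using fin by (simp add: T0_moment_eq[OF \<mu>])
    have "emeasure ?D A = (\<integral>\<^sup>+z\<in>A. ennreal (renewal_dens \<mu> z) \<partial>M)" unfolding renewal_dens_def
      by (rule emeasure_density) simp_all
    also have "\<dots> = (\<integral>\<^sup>+z. (ennreal (pot_dens \<mu> z) * indicator A z) / ennreal (enn2real (norm_moment \<mu> 1)) \<partial>M)"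
      using pos pot_dens_nonneg[OF \<mu>] by (intro nn_integral_cong) (auto simp: renewal_dens_def divide_ennreal[symmetric] split: split_indicator)
    also have "\<dots> = (\<integral>\<^sup>+z\<in>A. ennreal (pot_dens \<mu> z) \<partial>M) / T0_moment X \<mu> 1"
      unfolding m1 by (rule nn_integral_divide) simp
    finally show "(\<integral>\<^sup>+t\<in>{0..}. emeasure (law_from X \<mu>)
              {\<omega> \<in> space (law_from X \<mu>). located X t (ennreal ` (A \<inter> {0<..})) \<omega> \<and> ennreal t < hitting X 0 \<omega>} \<partial>lborel) / T0_moment X \<mu> 1
       = emeasure ?D A" by (simp add: renewal_formula[OF \<mu> A])
  qed simp
  also have "\<dots> = ?D" using measure_of_of_measure[of ?D] by simp
  finally show ?thesis .
qed

lemma prob_on_pos_density: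
  assumes [measurable]: "f \<in> borel_measurable borel" and 1: "(\<integral>\<^sup>+z. ennreal (f z) \<partial>M) = 1"
  shows "prob_on_pos (density M (\<lambda>z. ennreal (f z)))"
  unfolding prob_on_pos_def
proof (intro conjI)
  have "emeasure (density M (\<lambda>z. ennreal (f z))) UNIV = 1" by (subst emeasure_density) (simp_all add: 1)
  then show "prob_space (density M (\<lambda>z. ennreal (f z)))" by (intro prob_spaceI) simp
  show "AE x in density M (\<lambda>z. ennreal (f z)). 0 < x"
    by (subst AE_density) (use AE_M_pos in \<open>auto elim!: eventually_mono\<close>)
qed simp

text \<open>Kac's formula read from \<mu>: the transform shifts the sequence of normalised moments
  by one and divides it by the first moment. The moments of all iterates are thereby ratios of
  moments of \<mu>.\<close>

lemma renewal_step:
  assumes \<mu>: "prob_on_pos \<mu>" and fin: "norm_moment \<mu> 1 < \<top>"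
  shows "prob_on_pos (renewal_transform X \<mu>)"
    and "norm_moment (renewal_transform X \<mu>) n = norm_moment \<mu> (Suc n) / norm_moment \<mu> 1"
    and "(\<integral>\<^sup>+z. ennreal (renewal_dens \<mu> z) \<partial>M) = 1"
    and "renewal_dens \<mu> \<in> borel_measurable borel"
proof -
  note [measurable] = pot_dens_measurable[OF \<mu>]
  define e where "e = enn2real (norm_moment \<mu> 1)"
  have e: "0 < e" "norm_moment \<mu> 1 = ennreal e" using norm_moment_1_pos[OF \<mu>] fin by (auto simp: e_def enn2real_positive_iff)
  have rd: "ennreal (renewal_dens \<mu> z) = ennreal (pot_dens \<mu> z) / ennreal e" for z
    using e pot_dens_nonneg[OF \<mu>] by (simp add: renewal_dens_def divide_ennreal)
  show rm[measurable]: "renewal_dens \<mu> \<in> borel_measurable borel" unfolding renewal_dens_def[abs_def] by measurable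
  have i: "(\<integral>\<^sup>+z. ennreal (renewal_dens \<mu> z) * \<phi> z \<partial>M) = (\<integral>\<^sup>+z. ennreal (pot_dens \<mu> z) * \<phi> z \<partial>M) / ennreal e"
    if [measurable]: "\<phi> \<in> borel_measurable borel" for \<phi>
  proof -
    have "(\<integral>\<^sup>+z. ennreal (renewal_dens \<mu> z) * \<phi> z \<partial>M) = (\<integral>\<^sup>+z. (ennreal (pot_dens \<mu> z) * \<phi> z) / ennreal e \<partial>M)"
      unfolding rd by (rule nn_integral_cong) (simp add: ennreal_times_divide mult.commute)
    also have "\<dots> = (\<integral>\<^sup>+z. ennreal (pot_dens \<mu> z) * \<phi> z \<partial>M) / ennreal e"
      by (rule nn_integral_divide) simp
    finally show ?thesis .
  qed
  show 1: "(\<integral>\<^sup>+z. ennreal (renewal_dens \<mu> z) \<partial>M) = 1"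
    using i[of "\<lambda>_. 1"] surv_moment_from(2)[OF \<mu>] e by (simp del: norm_moment_simps)
  show "prob_on_pos (renewal_transform X \<mu>)"
    unfolding renewal_transform_eq[OF \<mu> fin] by (rule prob_on_pos_density[OF rm 1])
  show "norm_moment (renewal_transform X \<mu>) n = norm_moment \<mu> (Suc n) / norm_moment \<mu> 1"
  proof (cases n)
    case 0
    then show ?thesis using e by (simp add: e(2)[simplified] del: norm_moment_simps(2)) 
  next
    case (Suc k)
    have "norm_moment (renewal_transform X \<mu>) n = (\<integral>\<^sup>+z. ennreal (renewal_dens \<mu> z) * surv_moment k z \<partial>M)"
      unfolding renewal_transform_eq[OF \<mu> fin] Suc norm_moment_simps by (rule nn_integral_density) simp_all
    also have "\<dots> = norm_moment \<mu> (Suc (Suc k)) / norm_moment \<mu> 1"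
      unfolding i[OF surv_moment_measurable] surv_moment_from(1)[OF \<mu>] e(2) ..
    finally show ?thesis by (simp add: Suc)
  qed
qed

text \<open>The kernel is \<open>Sc y\<close> reduced by \<open>s y - s z\<close> for
  \<open>z\<close> up to \<open>y\<close>. As \<open>f\<close> has total mass 1, the main term
  integrates to exactly \<open>Sc y\<close>, and the reduction is the Volterra term.\<close>

lemma pot_dens_density:
  assumes f[measurable]: "f \<in> borel_measurable borel" and f0: "\<And>z. 0 \<le> f z" and 1: "(\<integral>\<^sup>+z. ennreal (f z) \<partial>M) = 1"
    and y: "0 < y"
  shows "pot_dens (density M (\<lambda>z. ennreal (f z))) y = Sc y - volterra f y"
proof -
  have i: "integrable M f" by (rule integrableI_nonneg) (use f0 1 in auto)
  have I: "(\<integral>z. f z \<partial>M) = 1" using 1 f0 by (simp add: integral_eq_nn_integral)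
  have j: "integrable M (\<lambda>z. f z * Sc (min z y))"
    by (rule Bochner_Integration.integrable_bound[of M "\<lambda>z. f z * Sc y"])
       (use i f0 Sc_nonneg in \<open>auto intro!: AE_I2 mult_left_mono simp: Sc_min_bounds abs_mult\<close>)
  have "pot_dens (density M (\<lambda>z. ennreal (f z))) y = (\<integral>z. f z * Sc (min z y) \<partial>M)"
    unfolding pot_dens_def by (subst integral_density) (use f0 in auto)
  moreover have "volterra f y = (\<integral>z. f z * Sc y - f z * Sc (min z y) \<partial>M)"
    unfolding volterra_def set_lebesgue_integral_def
  proof (rule integral_cong_AE)
    show "AE z in M. indicator {0<..y} z *\<^sub>R ((s y - s z) * f z) = f z * Sc y - f z * Sc (min z y)"
      using AE_M_pos
    proof eventually_elim
      case (elim z)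
      show ?case using Sc_diff[of z y] elim y by (auto simp: min_def indicator_def algebra_simps)
        (metis diff_add_eq distrib_left)
    qed
    show "(\<lambda>z. indicator {0<..y} z *\<^sub>R ((s y - s z) * f z)) \<in> borel_measurable M"
    proof -
      have "(\<lambda>z. indicator {0<..y} z *\<^sub>R ((s y - s z) * f z)) = (\<lambda>z. indicator {0<..y} z *\<^sub>R ((Sc y - Sc z) * f z))"
        using Sc_diff y by (auto simp: indicator_def)
      then show ?thesis by simp
    qed
  qed simp
  moreover have "(\<integral>z. f z * Sc y - f z * Sc (min z y) \<partial>M) = Sc y - (\<integral>z. f z * Sc (min z y) \<partial>M)"
    using i j by (subst Bochner_Integration.integral_diff) (simp_all add: I)
  ultimately show ?thesis by simp
qed

text \<open>Continuous densities that differ at a point differ on an interval to its right, which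
  has positive mass by full support.\<close>

lemma cont_density_density:
  assumes f[measurable]: "f \<in> borel_measurable borel" and f0: "\<And>z. 0 \<le> f z" "\<And>z. z \<le> 0 \<Longrightarrow> f z = 0" and fc: "continuous_on {0<..} f"
  shows "cont_density m (density M (\<lambda>z. ennreal (f z))) = f"
  unfolding cont_density_def
proof (rule the_equality)
  show "(\<forall>x\<le>0. f x = 0) \<and> (\<forall>x>0. 0 \<le> f x) \<and> continuous_on {0<..} f \<and> density M (\<lambda>z. ennreal (f z)) = density M (\<lambda>x. ennreal (f x))"
    using assms by auto
  fix g assume g: "(\<forall>x\<le>0. g x = 0) \<and> (\<forall>x>0. 0 \<le> g x) \<and> continuous_on {0<..} g \<and> density M (\<lambda>z. ennreal (f z)) = density M (\<lambda>x. ennreal (g x))"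
  have "(\<lambda>x. indicator {0<..} x *\<^sub>R g x) \<in> borel_measurable borel"
    by (rule borel_measurable_continuous_on_indicator) (use g in auto)
  moreover have "(\<lambda>x. indicator {0<..} x *\<^sub>R g x) = g" using g by (auto simp: indicator_def fun_eq_iff)
  ultimately have [measurable]: "g \<in> borel_measurable borel" by simp
  have "AE x in M. ennreal (f x) = ennreal (g x)"
    by (rule M.density_unique) (use g in auto)
  then have ae: "AE x in M. f x = g x" using AE_M_pos
    by eventually_elim (use f0 g in auto)
  show "g = f"
  proof
    fix x
    show "g x = f x"
    proof (cases "0 < x")
      case True
      show ?thesis
      proof (rule ccontr)
        assume ne: "g x \<noteq> f x"
        have "continuous_on {0<..} (\<lambda>x. g x - f x)" using g fc by (intro continuous_intros) auto
        then have "isCont (\<lambda>x. g x - f x) x" using True by (simp add: continuous_on_eq_continuous_at)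
        then have "\<exists>e>0. \<forall>y. dist x y < e \<longrightarrow> g y - f y \<noteq> 0" by (rule continuous_at_avoid) (use ne in simp)
        then obtain e where e: "e > 0" "\<And>y. dist x y < e \<Longrightarrow> g y - f y \<noteq> 0" by auto
        have "emeasure M {x<..<x+e} = 0"
        proof -
          have "AE y in M. y \<notin> {x<..<x+e}" using ae
          proof eventually_elim
            case (elim y)
            then show ?case using e(2)[of y] by (auto simp: dist_real_def)
          qed
          from emeasure_eq_0_AE[OF this] have "emeasure M {y\<in>space M. y \<in> {x<..<x+e}} = 0" .
          also have "{y\<in>space M. y \<in> {x<..<x+e}} = {x<..<x+e}" by auto
          finally show ?thesis .
        qed
        then show False using M_open_pos[of x "x+e"] True e(1) by simp
      qed
    qed (use g f0 in auto)
  qed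
qed

lemma renewal_dens_props:
  assumes \<mu>: "prob_on_pos \<mu>" and fin: "norm_moment \<mu> 1 < \<top>"
  shows "0 \<le> renewal_dens \<mu> z" "z \<le> 0 \<Longrightarrow> renewal_dens \<mu> z = 0" "0 < z \<Longrightarrow> 0 < renewal_dens \<mu> z"
    "renewal_dens \<mu> z \<le> Sc z / enn2real (norm_moment \<mu> 1)"
    "z \<le> w \<Longrightarrow> renewal_dens \<mu> z \<le> renewal_dens \<mu> w" "continuous_on {0<..} (renewal_dens \<mu>)"
proof -
  have e: "0 < enn2real (norm_moment \<mu> 1)" using norm_moment_1_pos[OF \<mu>] fin by (simp add: enn2real_positive_iff)
  show "0 \<le> renewal_dens \<mu> z" "z \<le> 0 \<Longrightarrow> renewal_dens \<mu> z = 0" "0 < z \<Longrightarrow> 0 < renewal_dens \<mu> z"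
    "renewal_dens \<mu> z \<le> Sc z / enn2real (norm_moment \<mu> 1)" "z \<le> w \<Longrightarrow> renewal_dens \<mu> z \<le> renewal_dens \<mu> w"
    using e pot_dens_nonneg[OF \<mu>, of z] pot_dens_zero[OF \<mu>, of z] pot_dens_pos[OF \<mu>, of z] pot_dens_le[OF \<mu>, of z] pot_dens_mono[OF \<mu>, of z w]
    by (auto simp: renewal_dens_def intro: divide_right_mono)
  show "continuous_on {0<..} (renewal_dens \<mu>)"
    unfolding renewal_dens_def[abs_def] using e by (intro continuous_intros pot_dens_continuous \<mu>) auto
qed

section \<open>Iterates of the transform and the limit of their densities\<close>

lemma renewal_iterates:
  assumes \<mu>: "prob_on_pos \<mu>" and fin: "\<And>n. norm_moment \<mu> n < \<top>"
  shows "prob_on_pos ((renewal_transform X ^^ n) \<mu>) \<and> 0 < enn2real (norm_moment \<mu> n) \<and>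
    (\<forall>k. norm_moment ((renewal_transform X ^^ n) \<mu>) k = ennreal (enn2real (norm_moment \<mu> (n + k)) / enn2real (norm_moment \<mu> n)))"
proof (induction n)
  case 0
  then show ?case using \<mu> fin by simp
next
  case (Suc n)
  let ?\<mu> = "(renewal_transform X ^^ n) \<mu>" and ?a = "\<lambda>n. enn2real (norm_moment \<mu> n)"
  have p: "prob_on_pos ?\<mu>" and an: "0 < ?a n" and k: "\<And>k. norm_moment ?\<mu> k = ennreal (?a (n + k) / ?a n)"
    using Suc by auto
  have f1: "norm_moment ?\<mu> 1 < \<top>" unfolding k by simp
  have "0 < ?a (n + 1) / ?a n" using norm_moment_1_pos[OF p] unfolding k by (simp add: ennreal_less_zero_iff)
  then have aS: "0 < ?a (Suc n)" using an by (simp add: zero_less_divide_iff)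
  have "norm_moment (renewal_transform X ?\<mu>) k' = ennreal (?a (Suc n + k') / ?a (Suc n))" for k'
  proof -
    have "norm_moment (renewal_transform X ?\<mu>) k' = ennreal (?a (n + Suc k') / ?a n) / ennreal (?a (n + 1) / ?a n)"
      unfolding renewal_step(2)[OF p f1] k ..
    also have "\<dots> = ennreal ((?a (n + Suc k') / ?a n) / (?a (n + 1) / ?a n))"
      using an aS by (intro divide_ennreal) auto
    also have "(?a (n + Suc k') / ?a n) / (?a (n + 1) / ?a n) = ?a (Suc n + k') / ?a (Suc n)" using an by simp
    finally show ?thesis .
  qed
  then show ?case using renewal_step(1)[OF p f1] aS by simp
qed

lemma volterra_tendsto:
  assumes [measurable]: "\<And>n. f n \<in> borel_measurable borel" "F \<in> borel_measurable borel"
    and b: "\<And>n z. 0 < z \<Longrightarrow> \<bar>f n z\<bar> \<le> C * Sc z" and lim: "\<And>z. 0 < z \<Longrightarrow> (\<lambda>n. f n z) \<longlonglongrightarrow> F z" and y: "0 < y"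
  shows "(\<lambda>n. volterra (f n) y) \<longlonglongrightarrow> volterra F y"
proof -
  \<comment> \<open>On (0, y] differences of \<open>s\<close> equal those of \<open>Sc\<close>,
    which is Borel on the whole line.\<close>
  have e: "indicator {0<..y} z *\<^sub>R ((s y - s z) * g z) = indicator {0<..y} z * ((Sc y - Sc z) * g z)" for g :: "real \<Rightarrow> real" and z
    using Sc_diff[of z y] y by (auto simp: indicator_def)
  show ?thesis unfolding volterra_def set_lebesgue_integral_def e
  proof (rule integral_dominated_convergence[where w="\<lambda>z. Sc y * C * (indicator {0<..y} z *\<^sub>R Sc z)"])
    show "integrable M (\<lambda>z. Sc y * C * (indicator {0<..y} z *\<^sub>R Sc z))"
      using Sc_integrable_Ioc[of y] by (simp add: set_integrable_def)
    show "AE z in M. (\<lambda>n. indicator {0<..y} z * ((Sc y - Sc z) * f n z)) \<longlonglongrightarrow> indicator {0<..y} z * ((Sc y - Sc z) * F z)"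
      using AE_M_pos by eventually_elim (intro tendsto_intros lim)
    fix n
    show "AE z in M. norm (indicator {0<..y} z * ((Sc y - Sc z) * f n z)) \<le> Sc y * C * (indicator {0<..y} z *\<^sub>R Sc z)"
    proof (rule AE_I2)
      fix z
      show "norm (indicator {0<..y} z * ((Sc y - Sc z) * f n z)) \<le> Sc y * C * (indicator {0<..y} z *\<^sub>R Sc z)"
      proof (cases "0 < z \<and> z \<le> y")
        case True
        have "\<bar>Sc y - Sc z\<bar> * \<bar>f n z\<bar> \<le> Sc y * (C * Sc z)"
          using Sc_mono[of z y] Sc_nonneg[of z] b[of z n] True by (intro mult_mono) auto
        then show ?thesis using True by (simp add: abs_mult mult.assoc)
      qed (auto simp: indicator_def)
    qed
  qed simp_all
qed

text \<open>\<open>f n\<close> is the density of the iterate with index \<open>Suc n\<close>,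
  because \<open>renewal_dens\<close> describes the transform of its argument. Convergent ratios are
  bounded, which yields the bound by \<open>C * Sc\<close>; the limit inherits the recursion by
  dominated convergence.\<close>

lemma limit_density:
  assumes \<mu>: "prob_on_pos \<mu>" and fin: "\<And>n. norm_moment \<mu> n < \<top>"
    and lim: "(\<lambda>n. enn2real (norm_moment \<mu> n) / enn2real (norm_moment \<mu> (Suc n))) \<longlonglongrightarrow> lam" and lam: "0 < lam"
  defines "f \<equiv> \<lambda>n. renewal_dens ((renewal_transform X ^^ n) \<mu>)"
  shows "\<exists>F C. F \<in> borel_measurable borel \<and> (\<forall>y. (\<lambda>n. f n y) \<longlonglongrightarrow> F y) \<and> (\<forall>y\<le>0. F y = 0) \<and> (\<forall>y. 0 \<le> F y) \<and>
    (\<forall>y>0. F y \<le> C * Sc y) \<and> (\<forall>y>0. F y = lam * (Sc y - volterra F y))"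
proof -
  let ?\<mu> = "\<lambda>n. (renewal_transform X ^^ n) \<mu>" and ?a = "\<lambda>n. enn2real (norm_moment \<mu> n)"
  define r where "r n = ?a n / ?a (Suc n)" for n
  have it: "prob_on_pos (?\<mu> n)" "0 < ?a n" "norm_moment (?\<mu> n) 1 = ennreal (?a (Suc n) / ?a n)" for n
    unfolding Suc_eq_plus1 using renewal_iterates[OF \<mu> fin, of n] by blast+
  have r0: "0 < r n" for n unfolding r_def by (intro divide_pos_pos it(2))
  have rlim: "r \<longlonglongrightarrow> lam" using lim unfolding r_def[abs_def] .
  have f1: "norm_moment (?\<mu> n) 1 < \<top>" for n unfolding it(3) by simp
  \<comment> \<open>The first moment of the iterate is the reciprocal of a ratio, so the
    normalisation multiplies by \<open>r n\<close>.\<close>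
  have e1: "enn2real (norm_moment (?\<mu> n) 1) = 1 / r n" for n unfolding it(3) using it(2)[of n] it(2)[of "Suc n"] by (simp add: r_def)
  have f_eq: "f n = renewal_dens (?\<mu> n)" for n by (simp add: f_def)
  note fp = renewal_dens_props[OF it(1) f1, folded f_eq]
  have fm[measurable]: "f n \<in> borel_measurable borel" for n unfolding f_def by (rule renewal_step(4)[OF it(1) f1])
  have fr: "f n y \<le> r n * Sc y" for n y using fp(4)[of n y] unfolding e1 by (simp add: mult.commute)
  obtain C where C: "\<And>n. r n \<le> C"
    using convergent_imp_Bseq[OF convergentI[OF rlim]] unfolding Bseq_def by (metis abs_le_D1 real_norm_def)
  have C0: "0 < C" using r0[of 0] C[of 0] by simp
  have fC: "f n y \<le> C * Sc y" for n y using fr[of n y] mult_right_mono[OF C Sc_nonneg, of n y] by linarith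
  have rec: "f (Suc n) y = r (Suc n) * (Sc y - volterra (f n) y)" if y: "0 < y" for n y
  proof -
    have "?\<mu> (Suc n) = density M (\<lambda>z. ennreal (f n z))"
      using renewal_transform_eq[OF it(1) f1, of n] by (simp add: f_def)
    then have "pot_dens (?\<mu> (Suc n)) y = Sc y - volterra (f n) y"
      using pot_dens_density[OF fm fp(1) _ y, of n] renewal_step(3)[OF it(1) f1, of n] by (simp add: f_def)
    then show ?thesis unfolding f_def renewal_dens_def e1 by simp
  qed
  have conv: "convergent (\<lambda>n. f n y)" for y
  proof (cases "0 < y")
    case True
    show ?thesis
    proof (rule volterra_iteration_convergent[where f=f and C=C and r="\<lambda>n. r (Suc n)"])
      show "convergent (\<lambda>n. r (Suc n))" using LIMSEQ_Suc[OF rlim] by (rule convergentI)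
    qed (use fm fp(1) fC r0 C rec True in auto)
  next
    case False
    then show ?thesis using fp(2) by (simp add: convergent_const)
  qed
  define F where "F y = lim (\<lambda>n. f n y)" for y
  have Fl: "(\<lambda>n. f n y) \<longlonglongrightarrow> F y" for y using conv[of y] by (simp add: F_def convergent_LIMSEQ_iff)
  have Fm: "F \<in> borel_measurable borel" by (rule borel_measurable_LIMSEQ_real[OF Fl fm])
  have Fn: "0 \<le> F y" for y by (rule LIMSEQ_le_const[OF Fl]) (use fp(1) in auto)
  have FC: "F y \<le> C * Sc y" for y by (rule LIMSEQ_le_const2[OF Fl]) (use fC in auto)
  have F0: "F y = 0" if "y \<le> 0" for y using Fl[of y] fp(2)[OF that] by (simp add: LIMSEQ_const_iff)
  have Fe: "F y = lam * (Sc y - volterra F y)" if y: "0 < y" for y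
  proof (rule LIMSEQ_unique)
    show "(\<lambda>n. f (Suc n) y) \<longlonglongrightarrow> F y" by (rule LIMSEQ_Suc[OF Fl])
    have "(\<lambda>n. volterra (f n) y) \<longlonglongrightarrow> volterra F y"
      by (rule volterra_tendsto[OF fm Fm _ Fl y, of C]) (use fC fp(1) in simp)
    then have "(\<lambda>n. r (Suc n) * (Sc y - volterra (f n) y)) \<longlonglongrightarrow> lam * (Sc y - volterra F y)"
      by (intro tendsto_intros LIMSEQ_Suc[OF rlim])
    then show "(\<lambda>n. f (Suc n) y) \<longlonglongrightarrow> lam * (Sc y - volterra F y)" unfolding rec[OF y] .
  qed
  show ?thesis using Fm Fl F0 Fn FC Fe by blast
qed

text \<open>If the mass \<open>c\<close> is below 1, the Volterra term is at most
  \<open>c * Sc\<close>, and the equation forces \<open>F\<close> above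
  \<open>lam * (1 - c) * Sc\<close>. As \<open>Sc\<close> is not integrable, \<open>F\<close> would
  have infinite mass.\<close>

lemma solution_mass:
  assumes F[measurable]: "F \<in> borel_measurable borel" and F0: "\<And>y. 0 \<le> F y" and FC: "\<And>y. 0 < y \<Longrightarrow> F y \<le> C * Sc y"
    and Fe: "\<And>y. 0 < y \<Longrightarrow> F y = lam * (Sc y - volterra F y)" and lam: "0 < lam"
    and le: "(\<integral>\<^sup>+z. ennreal (F z) \<partial>M) \<le> 1" and inf: "(\<integral>\<^sup>+z. ennreal (Sc z) \<partial>M) = \<top>"
  shows "(\<integral>\<^sup>+z. ennreal (F z) \<partial>M) = 1"
proof (rule ccontr)
  assume ne: "(\<integral>\<^sup>+z. ennreal (F z) \<partial>M) \<noteq> 1"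
  define c where "c = enn2real (\<integral>\<^sup>+z. ennreal (F z) \<partial>M)"
  have fin: "(\<integral>\<^sup>+z. ennreal (F z) \<partial>M) < \<top>" using le by (rule le_less_trans) simp
  have c: "(\<integral>\<^sup>+z. ennreal (F z) \<partial>M) = ennreal c" "0 \<le> c" using fin by (simp_all add: c_def)
  have "ennreal c < 1" using ne le unfolding c by simp
  then have c1: "c < 1" using c(2) by (simp add: ennreal_less_iff flip: ennreal_1)
  have vi: "volterra_integrable F"
  proof (rule volterra_integrable_bound)
    show "\<exists>C. \<forall>z. 0 < z \<longrightarrow> z \<le> Y \<longrightarrow> \<bar>F z\<bar> \<le> C * Sc z" for Y using F0 FC by (intro exI[of _ C]) auto
  qed measurable
  have low: "lam * (1 - c) * Sc y \<le> F y" if y: "0 < y" for y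
  proof -
    have "ennreal \<bar>volterra F y\<bar> \<le> ennreal (Sc y) * (\<integral>\<^sup>+z\<in>{0<..<y}. ennreal \<bar>F z\<bar> \<partial>M)" by (rule volterra_bound[OF vi y])
    also have "\<dots> \<le> ennreal (Sc y) * (\<integral>\<^sup>+z. ennreal (F z) \<partial>M)"
      using F0 by (intro mult_left_mono nn_integral_mono) (auto simp: indicator_def)
    finally have "ennreal \<bar>volterra F y\<bar> \<le> ennreal (Sc y * c)" unfolding c by (simp add: ennreal_mult' Sc_nonneg)
    then have "\<bar>volterra F y\<bar> \<le> Sc y * c" using c(2) Sc_nonneg[of y] by (subst (asm) ennreal_le_iff) auto
    then have "(1 - c) * Sc y \<le> Sc y - volterra F y" by (simp add: algebra_simps abs_le_iff)
    then show ?thesis using Fe[OF y] lam by (simp add: mult.assoc)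
  qed
  have k: "0 < lam * (1 - c)" using lam c1 by simp
  have "ennreal (lam * (1 - c)) * (\<integral>\<^sup>+z. ennreal (Sc z) \<partial>M) = (\<integral>\<^sup>+z. ennreal (lam * (1 - c)) * ennreal (Sc z) \<partial>M)"
    by (rule nn_integral_cmult[symmetric]) simp
  also have "\<dots> \<le> (\<integral>\<^sup>+z. ennreal (F z) \<partial>M)"
  proof (rule nn_integral_mono_AE)
    show "AE z in M. ennreal (lam * (1 - c)) * ennreal (Sc z) \<le> ennreal (F z)"
      using AE_M_pos
    proof eventually_elim
      case (elim z)
      then show ?case using low[OF elim] k by (simp add: ennreal_mult'[symmetric] ennreal_leI)
    qed
  qed
  finally have "ennreal (lam * (1 - c)) * \<top> \<le> ennreal c" unfolding inf c .
  moreover have "ennreal (lam * (1 - c)) \<noteq> 0" unfolding ennreal_eq_0_iff using k by linarith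
  ultimately show False by (simp add: ennreal_mult_top top_unique)
qed

end

section \<open>Quasi-stationary distributions\<close>

text \<open>The hypothesis says that H(t) is \<open>lam\<close> times the integral of H over (t,
  \<infinity>). Boundedness makes H Lipschitz, hence continuous; then the integral equation makes it
  differentiable with H' = - lam H.\<close>

lemma exponential_of_tail_integral:
  fixes H :: "real \<Rightarrow> ennreal"
  assumes m[measurable]: "(\<lambda>t. H t * indicator {0..} t) \<in> borel_measurable borel"
    and le: "\<And>t. 0 \<le> t \<Longrightarrow> H t \<le> 1" and lam: "0 < lam"
    and eq: "\<And>t. 0 \<le> t \<Longrightarrow> ennreal lam * (\<integral>\<^sup>+u\<in>{0..}. H (u + t) \<partial>lborel) = H t"
    and t: "0 \<le> t"
  shows "H t = H 0 * ennreal (exp (- lam * t))"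
proof -
  \<comment> \<open>Real-valued, and set to 0 at negative times, where nothing is assumed about
    \<open>H\<close>.\<close>
  define h where "h t = enn2real (H t * indicator {0..} t)" for t
  have [measurable]: "h \<in> borel_measurable borel" unfolding h_def[abs_def] by measurable
  have Hh: "H t = ennreal (h t)" if "0 \<le> t" for t
    using le[OF that] that by (simp add: h_def less_top[symmetric] top_unique) (metis ennreal_enn2real_if ennreal_one_less_top leD)
  have h0: "0 \<le> h t" for t by (simp add: h_def)
  have h1: "h t \<le> 1" for t
  proof (cases "0 \<le> t")
    case True
    then have "ennreal (h t) \<le> ennreal 1" using le Hh by simp
    then show ?thesis by (subst (asm) ennreal_le_iff) auto
  qed (simp add: h_def)
  have tail: "ennreal (h t) = ennreal lam * (\<integral>\<^sup>+u. ennreal (h u) * indicator {t..} u \<partial>lborel)" if t: "0 \<le> t" for t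
  proof -
    have "(\<integral>\<^sup>+u. ennreal (h u) * indicator {t..} u \<partial>lborel) = (\<integral>\<^sup>+u. ennreal (h (t + 1 * u)) * indicator {t..} (t + 1 * u) \<partial>lborel)"
      by (subst nn_integral_real_affine[where c=1 and t=t]) auto
    also have "\<dots> = (\<integral>\<^sup>+u\<in>{0..}. H (u + t) \<partial>lborel)"
      using t by (intro nn_integral_cong) (auto simp: Hh add.commute split: split_indicator)
    finally show ?thesis using eq[OF t] Hh[OF t] by simp
  qed
  have step: "h a = lam * integral {a..b} h + h b" and hi: "integral {a..b} h \<le> b - a" "0 \<le> integral {a..b} h" if ab: "0 \<le> a" "a \<le> b" for a b
  proof -
    have si: "set_integrable lborel {a..b} h" unfolding set_integrable_def
    proof (rule Bochner_Integration.integrable_bound)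
      show "integrable lborel (indicator {a..b} :: real \<Rightarrow> real)" using ab by (intro integrable_real_indicator) auto
    qed (use h0 h1 in \<open>auto simp: indicator_def\<close>)
    have I: "(LINT x:{a..b}|lborel. h x) = integral {a..b} h" by (rule set_borel_integral_eq_integral(2)[OF si])
    have "(\<integral>\<^sup>+u. ennreal (h u) * indicator {a..} u \<partial>lborel) =
       (\<integral>\<^sup>+u. ennreal (h u) * indicator {a..b} u + ennreal (h u) * indicator {b..} u \<partial>lborel)"
    proof (rule nn_integral_cong_AE)
      have "AE u in lborel. u \<noteq> b" by (rule AE_lborel_singleton)
      then show "AE u in lborel. ennreal (h u) * indicator {a..} u = ennreal (h u) * indicator {a..b} u + ennreal (h u) * indicator {b..} u"
        by eventually_elim (use ab in \<open>auto split: split_indicator\<close>)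
    qed
    also have "\<dots> = (\<integral>\<^sup>+u. ennreal (h u) * indicator {a..b} u \<partial>lborel) + (\<integral>\<^sup>+u. ennreal (h u) * indicator {b..} u \<partial>lborel)"
      by (rule nn_integral_add) auto
    also have "(\<integral>\<^sup>+u. ennreal (h u) * indicator {a..b} u \<partial>lborel) = (\<integral>\<^sup>+u. ennreal (indicator {a..b} u *\<^sub>R h u) \<partial>lborel)"
      by (rule nn_integral_cong) (auto simp: indicator_def)
    also have "\<dots> = ennreal (integral {a..b} h)"
      unfolding I[symmetric] set_lebesgue_integral_def using si h0
      by (intro nn_integral_eq_integral) (auto simp: set_integrable_def)
    finally have sp: "(\<integral>\<^sup>+u. ennreal (h u) * indicator {a..} u \<partial>lborel) = ennreal (integral {a..b} h) + (\<integral>\<^sup>+u. ennreal (h u) * indicator {b..} u \<partial>lborel)" .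
    show i0: "0 \<le> integral {a..b} h" unfolding I[symmetric] set_lebesgue_integral_def
      by (intro integral_nonneg_AE) (auto simp: h0)
    have "ennreal (h a) = ennreal lam * ennreal (integral {a..b} h) + ennreal (h b)"
      using tail[of a] tail[of b] ab unfolding sp by (simp add: distrib_left)
    also have "\<dots> = ennreal (lam * integral {a..b} h + h b)" using lam i0 h0 by (simp add: ennreal_mult ennreal_plus)
    finally show "h a = lam * integral {a..b} h + h b"
      by (subst (asm) ennreal_inj) (use lam i0 h0 in auto)
    have "integral {a..b} h \<le> integral {a..b} (\<lambda>_. 1)"
      using set_borel_integral_eq_integral(1)[OF si] h1 by (intro integral_le) auto
    then show "integral {a..b} h \<le> b - a" using ab by simp
  qed
  have cont: "continuous_on {0..t} h"
    unfolding continuous_on_iff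
  proof (intro ballI allI impI)
    fix x e :: real assume x: "x \<in> {0..t}" and e: "0 < e"
    have L: "\<bar>h b - h a\<bar> \<le> lam * (b - a)" if "0 \<le> a" "a \<le> b" for a b
      using step[OF that] hi[OF that] lam mult_left_mono[of "integral {a..b} h" "b - a" lam] by (simp add: abs_le_iff)
    show "\<exists>d>0. \<forall>x'\<in>{0..t}. dist x' x < d \<longrightarrow> dist (h x') (h x) < e"
    proof (intro exI[of _ "e / lam"] conjI ballI impI)
      fix y assume y: "y \<in> {0..t}" "dist y x < e / lam"
      have "dist (h y) (h x) \<le> lam * dist y x"
        using L[of x y] L[of y x] x y by (cases "x \<le> y") (auto simp: dist_real_def abs_minus_commute)
      also have "\<dots> < e" using y(2) lam by (simp add: field_simps)
      finally show "dist (h y) (h x) < e" .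
    qed (use e lam in simp)
  qed
  \<comment> \<open>The differential equation is solved by showing that the product with the growing
    exponential has derivative 0.\<close>
  have "\<exists>c. \<forall>x\<in>{0..t}. h x * exp (lam * x) = c"
  proof (rule has_field_derivative_zero_constant)
    fix x assume x: "x \<in> {0..t}"
    have "((\<lambda>x. h 0 - lam * integral {0..x} h) has_real_derivative (0 - lam * h x)) (at x within {0..t})"
      by (rule DERIV_diff[OF DERIV_const DERIV_cmult[OF integral_has_real_derivative[OF cont x]]])
    then have "(h has_real_derivative (0 - lam * h x)) (at x within {0..t})"
      by (rule has_field_derivative_transform_within[OF _ zero_less_one x]) (use step[of 0] in auto)
    then show "((\<lambda>x. h x * exp (lam * x)) has_real_derivative 0) (at x within {0..t})"
      by (auto intro!: derivative_eq_intros)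
  qed simp
  then obtain c where "\<And>x. x \<in> {0..t} \<Longrightarrow> h x * exp (lam * x) = c" by blast
  from this[of 0] this[of t] have "h t * exp (lam * t) = h 0" using t by simp
  then have "h t = h 0 * exp (- lam * t)" by (simp add: exp_minus field_simps)
  then show ?thesis using Hh[OF t] Hh[of 0] h0 by (simp add: ennreal_mult)
qed

section \<open>Eigenmeasures of the Green operator and quasi-stationarity\<close>

context natural_diffusion
begin

text \<open>Densities of equal mass that converge pointwise converge in L1 by Scheffe, and
  distribution functions differ by at most the L1 distance. They converge at every point, not merely
  at continuity points.\<close>

lemma weak_conv_density:
  assumes [measurable]: "\<And>n. f n \<in> borel_measurable borel" "F \<in> borel_measurable borel"
    and nn: "\<And>n z. 0 \<le> f n z" "\<And>z. 0 \<le> F z" and one: "\<And>n. (\<integral>\<^sup>+z. ennreal (f n z) \<partial>M) = 1" "(\<integral>\<^sup>+z. ennreal (F z) \<partial>M) = 1"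
    and lim: "\<And>z. (\<lambda>n. f n z) \<longlonglongrightarrow> F z"
  shows "weak_conv_m (\<lambda>n. density M (\<lambda>z. ennreal (f n z))) (density M (\<lambda>z. ennreal (F z)))"
proof -
  have int: "integrable M g" if "g \<in> borel_measurable borel" "\<And>z. 0 \<le> g z" "(\<integral>\<^sup>+z. ennreal (g z) \<partial>M) = 1" for g :: "real \<Rightarrow> real"
    by (rule integrableI_nonneg) (use that in auto)
  have i: "integrable M (f n)" "integrable M F" for n
    by (rule int[OF _ nn(1) one(1)], simp) (rule int[OF _ nn(2) one(2)], simp)
  have L1: "(\<lambda>n. \<integral>\<^sup>+x. norm (f n x - F x) \<partial>M) \<longlonglongrightarrow> 0"
    by (rule Scheffe_lemma2) (use i nn one lim in auto)
  have cdf: "cdf (density M (\<lambda>z. ennreal (g z))) x = (\<integral>z. indicator {..x} z * g z \<partial>M)"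
    if [measurable]: "g \<in> borel_measurable borel" and g: "\<And>z. 0 \<le> g z" "(\<integral>\<^sup>+z. ennreal (g z) \<partial>M) = 1" for g :: "real \<Rightarrow> real" and x
  proof -
    have "emeasure (density M (\<lambda>z. ennreal (g z))) {..x} = (\<integral>\<^sup>+z. ennreal (indicator {..x} z * g z) \<partial>M)"
      by (subst emeasure_density) (auto intro!: nn_integral_cong simp: indicator_def)
    also have "\<dots> = ennreal (\<integral>z. indicator {..x} z * g z \<partial>M)"
      using integrable_mult_indicator[of "{..x}" M g] int[OF that] g by (intro nn_integral_eq_integral) auto
    finally show ?thesis unfolding cdf_def measure_def using g by (simp add: integral_nonneg_AE)
  qed
  show ?thesis unfolding weak_conv_m_def weak_conv_def
  proof (intro allI impI)
    fix x
    have "(\<lambda>n. cdf (density M (\<lambda>z. ennreal (f n z))) x - cdf (density M (\<lambda>z. ennreal (F z))) x) \<longlonglongrightarrow> 0"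
    proof (rule Lim_null_comparison)
      have "(\<lambda>n. enn2real (\<integral>\<^sup>+x. norm (f n x - F x) \<partial>M)) \<longlonglongrightarrow> 0"
      proof (rule tendsto_enn2real)
        show "(\<lambda>n. \<integral>\<^sup>+x. norm (f n x - F x) \<partial>M) \<longlonglongrightarrow> ennreal 0" using L1 by simp
      qed simp
      then show "(\<lambda>n. (\<integral>x. norm (f n x - F x) \<partial>M)) \<longlonglongrightarrow> 0" by (simp add: integral_eq_nn_integral)
      show "\<forall>\<^sub>F n in sequentially. norm (cdf (density M (\<lambda>z. ennreal (f n z))) x - cdf (density M (\<lambda>z. ennreal (F z))) x) \<le> (\<integral>x. norm (f n x - F x) \<partial>M)"
      proof (intro always_eventually allI)
        fix n
        have ii: "integrable M (\<lambda>z. indicator {..x} z * f n z)" "integrable M (\<lambda>z. indicator {..x} z * F z)"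
          using integrable_mult_indicator[of "{..x}" M "f n"] integrable_mult_indicator[of "{..x}" M F] i by simp_all
        have "cdf (density M (\<lambda>z. ennreal (f n z))) x - cdf (density M (\<lambda>z. ennreal (F z))) x = (\<integral>z. indicator {..x} z * f n z - indicator {..x} z * F z \<partial>M)"
          using ii by (simp add: cdf nn one)
        also have "norm \<dots> \<le> (\<integral>z. norm (indicator {..x} z * f n z - indicator {..x} z * F z) \<partial>M)" by (rule integral_norm_bound)
        also have "\<dots> \<le> (\<integral>z. norm (f n z - F z) \<partial>M)"
          using ii i by (intro integral_mono integrable_norm Bochner_Integration.integrable_diff) (auto simp: indicator_def)
        finally show "norm (cdf (density M (\<lambda>z. ennreal (f n z))) x - cdf (density M (\<lambda>z. ennreal (F z))) x) \<le> (\<integral>x. norm (f n x - F x) \<partial>M)" .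
      qed
    qed
    then show "(\<lambda>n. cdf (density M (\<lambda>z. ennreal (f n z))) x) \<longlonglongrightarrow> cdf (density M (\<lambda>z. ennreal (F z))) x"
      by (simp add: LIM_zero_iff)
  qed
qed

text \<open>Let H(t) be the probability, under \<nu>, of being in \<open>B\<close> at time
  \<open>t\<close>. By Fubini and the semigroup identity the integral of H over (t, \<infinity>) is
  that of the transition function at time \<open>t\<close> against the potential density of \<nu>,
  hence H(t) / lam by the eigenvalue equation.\<close>

lemma eigenmeasure_survival:
  assumes \<nu>: "prob_on_pos \<nu>" and \<nu>F: "\<nu> = density M (\<lambda>z. ennreal (F z))" and F[measurable]: "F \<in> borel_measurable borel"
    and eig: "\<And>y. 0 < y \<Longrightarrow> F y = lam * pot_dens \<nu> y" and lam: "0 < lam"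
    and B[measurable]: "B \<in> sets borel" and B0: "0 \<notin> B" and t: "0 \<le> t"
  shows "(\<integral>\<^sup>+x. transition t (ennreal x) B \<partial>\<nu>) = (\<integral>\<^sup>+x. indicator B (ennreal x) \<partial>\<nu>) * ennreal (exp (- lam * t))"
proof -
  interpret prob_space \<nu> by (rule prob_on_posD(1)[OF \<nu>])
  interpret N: pair_sigma_finite \<nu> "lborel :: real measure" ..
  note [measurable_cong] = prob_on_posD(2)[OF \<nu>]
  note tj[measurable] = transition_joint[OF B]
  define H where "H t = (\<integral>\<^sup>+x. transition t (ennreal x) B \<partial>\<nu>)" for t
  have le1: "transition t (ennreal x) B \<le> 1" for t x
    unfolding transition_def using prob_space.emeasure_le_1[OF prob_space_P] by blast
  have "H t = H 0 * ennreal (exp (- lam * t))"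
  proof (rule exponential_of_tail_integral[OF _ _ lam _ t])
    have "(\<lambda>t. \<integral>\<^sup>+x. transition t (ennreal x) B * indicator {0..} t \<partial>\<nu>) \<in> borel_measurable borel"
    proof (rule borel_measurable_nn_integral)
      have "(\<lambda>p. transition (fst p) (ennreal (snd p)) B * indicator {0..} (fst p)) \<in> borel_measurable (borel \<Otimes>\<^sub>M \<nu>)"
      proof -
        have c: "measurable (borel \<Otimes>\<^sub>M \<nu>) L = measurable ((borel :: real measure) \<Otimes>\<^sub>M borel) L" for L :: "ennreal measure"
          by (intro measurable_cong_sets sets_pair_measure_cong prob_on_posD(2)[OF \<nu>] refl)
        have "(\<lambda>p. (snd p, fst p)) \<in> borel \<Otimes>\<^sub>M borel \<rightarrow>\<^sub>M borel \<Otimes>\<^sub>M (borel :: real measure)" by measurable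
        from measurable_compose[OF this tj] show ?thesis unfolding c by simp
      qed
      then show "(\<lambda>(t, x). transition t (ennreal x) B * indicator {0..} t) \<in> borel_measurable (borel \<Otimes>\<^sub>M \<nu>)"
        by (simp add: case_prod_beta)
    qed
    also have "(\<lambda>t. \<integral>\<^sup>+x. transition t (ennreal x) B * indicator {0..} t \<partial>\<nu>) = (\<lambda>t. H t * indicator {0..} t)"
      unfolding H_def by (auto simp: indicator_def)
    finally show "(\<lambda>t. H t * indicator {0..} t) \<in> borel_measurable borel" .
    show "H t \<le> 1" for t
    proof -
      have "H t \<le> (\<integral>\<^sup>+x. 1 \<partial>\<nu>)" unfolding H_def by (intro nn_integral_mono le1)
      then show ?thesis by (simp add: emeasure_space_1)
    qed
    fix t :: real assume t: "0 \<le> t"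
    note tm = transition_measurable_space[OF t B]
    have "(\<integral>\<^sup>+u\<in>{0..}. H (u + t) \<partial>lborel) = (\<integral>\<^sup>+u. \<integral>\<^sup>+x. transition (u + t) (ennreal x) B * indicator {0..} u \<partial>\<nu> \<partial>lborel)"
      unfolding H_def by (rule nn_integral_cong) (auto simp: indicator_def)
    also have "\<dots> = (\<integral>\<^sup>+x. \<integral>\<^sup>+u. transition (u + t) (ennreal x) B * indicator {0..} u \<partial>lborel \<partial>\<nu>)"
    proof (rule N.Fubini')
      have c: "measurable (\<nu> \<Otimes>\<^sub>M lborel) L = measurable (borel \<Otimes>\<^sub>M (borel :: real measure)) L" for L :: "ennreal measure"
        by (intro measurable_cong_sets sets_pair_measure_cong prob_on_posD(2)[OF \<nu>] sets_lborel refl)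
      have "(\<lambda>p. (fst p, snd p + t)) \<in> borel \<Otimes>\<^sub>M borel \<rightarrow>\<^sub>M borel \<Otimes>\<^sub>M (borel :: real measure)" by measurable
      from measurable_compose[OF this tj]
      have q: "(\<lambda>p. transition (snd p + t) (ennreal (fst p)) B * indicator {0..} (snd p + t)) \<in> borel_measurable (borel \<Otimes>\<^sub>M borel)"
        by simp
      have "(\<lambda>p. transition (snd p + t) (ennreal (fst p)) B * indicator {0..} (snd p + t) * indicator {0..} (snd p)) \<in> borel_measurable (\<nu> \<Otimes>\<^sub>M lborel)"
        unfolding c by (rule borel_measurable_times_ennreal[OF q]) measurable
      also have "(\<lambda>p. transition (snd p + t) (ennreal (fst p)) B * indicator {0..} (snd p + t) * indicator {0..} (snd p)) =
        (\<lambda>(x, u). transition (u + t) (ennreal x) B * indicator {0..} u)"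
        using t by (auto simp: fun_eq_iff indicator_def)
      finally show "(\<lambda>(x, u). transition (u + t) (ennreal x) B * indicator {0..} u) \<in> borel_measurable (\<nu> \<Otimes>\<^sub>M lborel)" .
    qed
    also have "\<dots> = (\<integral>\<^sup>+x. \<integral>\<^sup>+z. ennreal (Sc (min x z)) * transition t (ennreal z) B \<partial>M \<partial>\<nu>)"
      by (rule nn_integral_cong_AE) (use prob_on_posD(3)[OF \<nu>] potential_semigroup[OF _ t B B0] in \<open>auto elim!: eventually_mono\<close>)
    also have "\<dots> = (\<integral>\<^sup>+z. ennreal (pot_dens \<nu> z) * transition t (ennreal z) B \<partial>M)"
      by (rule potential_from[OF \<nu> tm])
    finally have "ennreal lam * (\<integral>\<^sup>+u\<in>{0..}. H (u + t) \<partial>lborel) = (\<integral>\<^sup>+z. ennreal lam * (ennreal (pot_dens \<nu> z) * transition t (ennreal z) B) \<partial>M)"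
      using tm pot_dens_measurable[OF \<nu>] by (subst nn_integral_cmult) simp_all
    also have "\<dots> = (\<integral>\<^sup>+z. ennreal (F z) * transition t (ennreal z) B \<partial>M)"
    proof (rule nn_integral_cong_AE)
      show "AE z in M. ennreal lam * (ennreal (pot_dens \<nu> z) * transition t (ennreal z) B) = ennreal (F z) * transition t (ennreal z) B"
        using AE_M_pos
      proof eventually_elim
        case (elim z)
        have "ennreal (F z) = ennreal lam * ennreal (pot_dens \<nu> z)" unfolding eig[OF elim] using lam by (simp add: ennreal_mult')
        then show ?case by (simp add: mult.assoc)
      qed
    qed
    also have "\<dots> = H t" unfolding H_def \<nu>F using tm by (subst nn_integral_density) simp_all
    finally show "ennreal lam * (\<integral>\<^sup>+u\<in>{0..}. H (u + t) \<partial>lborel) = H t" .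
  qed
  \<comment> \<open>At time 0 the process sits at its starting point, which evaluates H(0).\<close>
  moreover have "transition 0 (ennreal x) B = indicator B (ennreal x)" for x
  proof -
    interpret P: prob_space "P x" by (rule prob_space_P)
    have "AE \<omega> in P x. located X 0 {ennreal x} \<omega>" by (rule start) simp
    then have "AE \<omega> in P x. (\<omega> \<in> {\<omega>\<in>\<Omega>. located X 0 B \<omega>}) = (\<omega> \<in> (if ennreal x \<in> B then \<Omega> else {}))"
      using AE_space by eventually_elim (auto simp: located_def)
    then have "transition 0 (ennreal x) B = emeasure (P x) (if ennreal x \<in> B then \<Omega> else {})"
      unfolding transition_def using located_sets[of 0 B] by (intro emeasure_eq_AE) auto
    then show ?thesis using P.emeasure_space_1 by (simp add: indicator_def)
  qed
  ultimately show ?thesis by (simp add: H_def)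
qed

text \<open>Numerator and denominator of the conditional probability both carry the factor
  \<open>exp (- lam * t)\<close>, which cancels.\<close>

lemma eigenmeasure_quasi_stationary:
  assumes \<nu>: "prob_on_pos \<nu>" and \<nu>F: "\<nu> = density M (\<lambda>z. ennreal (F z))" and F[measurable]: "F \<in> borel_measurable borel"
    and eig: "\<And>y. 0 < y \<Longrightarrow> F y = lam * pot_dens \<nu> y" and lam: "0 < lam"
  shows "quasi_stationary X \<nu>"
  unfolding quasi_stationary_def
proof (intro conjI allI impI ballI)
  show "prob_on_pos \<nu>" by (rule \<nu>)
  interpret prob_space \<nu> by (rule prob_on_posD(1)[OF \<nu>])
  interpret L: prob_space "law_from X \<nu>" by (rule prob_space_law_from[OF \<nu>])
  fix t :: real and A :: "real set" assume t: "0 < t" and A: "A \<in> sets borel" "A \<subseteq> {0<..}"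
  have t0: "0 \<le> t" using t by simp
  have lift: "ennreal ` A = pos_part_lift A" using A(2) by (simp add: pos_part_lift_eq Int_absorb2)
  note es = eigenmeasure_survival[OF \<nu> \<nu>F F eig lam _ _ t0]
  have "(\<integral>\<^sup>+x. indicator (pos_part_lift A) (ennreal x) \<partial>\<nu>) = (\<integral>\<^sup>+x. indicator A x \<partial>\<nu>)"
    by (rule nn_integral_cong_AE) (use prob_on_posD(3)[OF \<nu>] in \<open>auto elim!: eventually_mono simp: pos_part_lift_def indicator_def\<close>)
  also have "\<dots> = ennreal (measure \<nu> A)" using A prob_on_posD(2)[OF \<nu>] by (simp add: emeasure_eq_measure)
  finally have 1: "emeasure (law_from X \<nu>) {\<omega>\<in>\<Omega>. located X t (pos_part_lift A) \<omega> \<and> ennreal t < hitting X 0 \<omega>} = ennreal (measure \<nu> A * exp (- lam * t))"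
    using A by (simp add: emeasure_law_from_survival(1)[OF \<nu> t0] es ennreal_mult)
  have "(\<integral>\<^sup>+x. indicator {0<..} (ennreal x) \<partial>\<nu>) = (\<integral>\<^sup>+x. 1 \<partial>\<nu>)"
    by (rule nn_integral_cong_AE) (use prob_on_posD(3)[OF \<nu>] in \<open>auto elim!: eventually_mono\<close>)
  then have 2: "emeasure (law_from X \<nu>) {\<omega>\<in>\<Omega>. ennreal t < hitting X 0 \<omega>} = ennreal (exp (- lam * t))"
    using emeasure_law_from_survival(2)[OF \<nu> t0, of "{0<..}"] es[of "{0<..}"] by (simp add: emeasure_space_1)
  show "\<P>(\<omega> in law_from X \<nu>. located X t (ennreal ` A) \<omega> \<bar> ennreal t < hitting X 0 \<omega>) = measure \<nu> A"
    unfolding cond_prob_def space_law_from[OF \<nu>] lift measure_def[of "law_from X \<nu>"] 1 2 by simp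
qed

text \<open>Multiplying the defining identity by the survival probability and integrating over time
  shows that \<nu> is a fixed point of the renewal transform. The mean absorption time is finite
  because some interval (0, n] has positive \<nu>-mass but finite Green mass, the potential density
  being at most S there.\<close>

lemma quasi_stationary_renewal_fixed:
  assumes \<nu>: "quasi_stationary X \<nu>"
  shows "norm_moment \<nu> 1 < \<top>" "\<nu> = density M (\<lambda>z. ennreal (renewal_dens \<nu> z))"
proof -
  have p: "prob_on_pos \<nu>" using \<nu> by (simp add: quasi_stationary_def)
  interpret prob_space \<nu> by (rule prob_on_posD(1)[OF p])
  interpret L: prob_space "law_from X \<nu>" by (rule prob_space_law_from[OF p])
  define c where "c t = emeasure (law_from X \<nu>) {\<omega>\<in>\<Omega>. ennreal t < hitting X 0 \<omega>}" for t
  have A1: "emeasure (law_from X \<nu>) {\<omega>\<in>\<Omega>. located X t (pos_part_lift A) \<omega> \<and> ennreal t < hitting X 0 \<omega>} = ennreal (measure \<nu> A) * c t"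
    if t: "0 < t" and A: "A \<in> sets borel" "A \<subseteq> {0<..}" for t A
  proof -
    have lift: "ennreal ` A = pos_part_lift A" using A(2) by (simp add: pos_part_lift_eq Int_absorb2)
    let ?N = "measure (law_from X \<nu>) {\<omega>\<in>\<Omega>. located X t (pos_part_lift A) \<omega> \<and> ennreal t < hitting X 0 \<omega>}"
    let ?D = "measure (law_from X \<nu>) {\<omega>\<in>\<Omega>. ennreal t < hitting X 0 \<omega>}"
    have q: "?N / ?D = measure \<nu> A"
      using \<nu>[unfolded quasi_stationary_def cond_prob_def space_law_from[OF p], THEN conjunct2, rule_format, OF t A] by (simp add: lift)
    have "?N \<le> ?D" by (rule L.finite_measure_mono) (auto simp: sets_law_from[OF p])
    then have "?N = measure \<nu> A * ?D" using q measure_nonneg[of "law_from X \<nu>"] by (cases "?D = 0") (auto simp: antisym field_simps)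
    then show ?thesis unfolding c_def L.emeasure_eq_measure by (simp add: ennreal_mult)
  qed
  note [measurable] = pot_dens_measurable[OF p]
  have key: "(\<integral>\<^sup>+z\<in>A. ennreal (pot_dens \<nu> z) \<partial>M) = ennreal (measure \<nu> A) * norm_moment \<nu> 1"
    if A: "A \<in> sets borel" "A \<subseteq> {0<..}" for A
  proof -
    have cm: "(\<lambda>t. c t * indicator {0..} t) \<in> borel_measurable lborel"
    proof -
      have "(\<lambda>t. \<integral>\<^sup>+\<omega>. indicator {p. 0 \<le> fst p \<and> ennreal (fst p) < hitting X 0 (snd p)} (t, \<omega>) \<partial>law_from X \<nu>) \<in> borel_measurable borel"
      proof (rule L.borel_measurable_nn_integral)
        have q: "(\<lambda>p. indicator {p. 0 \<le> fst p \<and> ennreal (fst p) < hitting X 0 (snd p)} p) \<in> borel_measurable ((borel :: real measure) \<Otimes>\<^sub>M E)"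
          by measurable
        show "(\<lambda>(t, \<omega>). indicator {p. 0 \<le> fst p \<and> ennreal (fst p) < hitting X 0 (snd p)} (t, \<omega>)) \<in> borel_measurable (borel \<Otimes>\<^sub>M law_from X \<nu>)"
          unfolding measurable_cong_sets[OF sets_pair_measure_cong[OF refl sets_law_from[OF p]] refl] case_prod_beta prod.collapse by (rule q)
      qed
      also have "(\<lambda>t. \<integral>\<^sup>+\<omega>. indicator {p. 0 \<le> fst p \<and> ennreal (fst p) < hitting X 0 (snd p)} (t, \<omega>) \<partial>law_from X \<nu>) = (\<lambda>t. c t * indicator {0..} t)"
      proof
        fix t :: real
        have "(\<integral>\<^sup>+\<omega>. indicator {p. 0 \<le> fst p \<and> ennreal (fst p) < hitting X 0 (snd p)} (t, \<omega>) \<partial>law_from X \<nu>) =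
          (\<integral>\<^sup>+\<omega>. indicator {0..} t * indicator {\<omega>\<in>\<Omega>. ennreal t < hitting X 0 \<omega>} \<omega> \<partial>law_from X \<nu>)"
          by (rule nn_integral_cong) (auto simp: space_law_from[OF p] split: split_indicator)
        also have "\<dots> = indicator {0..} t * c t" unfolding c_def
          by (rule nn_integral_cmult_indicator) (use sets_law_from[OF p] in simp)
        finally show "(\<integral>\<^sup>+\<omega>. indicator {p. 0 \<le> fst p \<and> ennreal (fst p) < hitting X 0 (snd p)} (t, \<omega>) \<partial>law_from X \<nu>) = c t * indicator {0..} t"
          by (simp add: mult.commute)
      qed
      finally show ?thesis by simp
    qed
    have e: "(\<integral>\<^sup>+z\<in>A. ennreal (pot_dens \<nu> z) \<partial>M) = ennreal (measure \<nu> A) * (\<integral>\<^sup>+t\<in>{0..}. c t \<partial>lborel)" if A: "A \<in> sets borel" "A \<subseteq> {0<..}" for A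
    proof -
      have "(\<integral>\<^sup>+z\<in>A. ennreal (pot_dens \<nu> z) \<partial>M) = (\<integral>\<^sup>+t. ennreal (measure \<nu> A) * (c t * indicator {0..} t) \<partial>lborel)"
        unfolding renewal_formula[OF p A(1), symmetric] pos_part_lift_eq[symmetric] space_law_from[OF p]
      proof (rule nn_integral_cong_AE)
        have "AE t in lborel. t \<noteq> (0::real)" by (rule AE_lborel_singleton)
        then show "AE t in lborel. emeasure (law_from X \<nu>) {\<omega>\<in>\<Omega>. located X t (pos_part_lift A) \<omega> \<and> ennreal t < hitting X 0 \<omega>} * indicator {0..} t =
          ennreal (measure \<nu> A) * (c t * indicator {0..} t)"
          by eventually_elim (use A1[OF _ A] in \<open>auto simp: indicator_def\<close>)
      qed
      also have "\<dots> = ennreal (measure \<nu> A) * (\<integral>\<^sup>+t\<in>{0..}. c t \<partial>lborel)" by (rule nn_integral_cmult[OF cm])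
      finally show ?thesis .
    qed
    have "measure \<nu> {0<..} = 1" using prob_on_posD(2,3)[OF p] by (subst prob_eq_1) auto
    then have "(\<integral>\<^sup>+t\<in>{0..}. c t \<partial>lborel) = (\<integral>\<^sup>+z\<in>{0<..}. ennreal (pot_dens \<nu> z) \<partial>M)" using e[of "{0<..}"] by simp
    also have "\<dots> = (\<integral>\<^sup>+z. ennreal (pot_dens \<nu> z) \<partial>M)"
      by (rule nn_integral_cong_AE) (use AE_M_pos in \<open>auto elim!: eventually_mono\<close>)
    also have "\<dots> = norm_moment \<nu> 1" by (rule surv_moment_from(2)[OF p])
    finally show ?thesis using e[OF A] by simp
  qed
  show fin: "norm_moment \<nu> 1 < \<top>"
  proof -
    have "\<exists>n. 0 < measure \<nu> {0<..real n}"
    proof (rule ccontr)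
      assume "\<not> ?thesis"
      then have "measure \<nu> {0<..real n} = 0" for n by (meson measure_nonneg not_less order_antisym)
      then have "{0<..real n} \<in> null_sets \<nu>" for n using prob_on_posD(2)[OF p] by (auto simp: null_sets_def emeasure_eq_measure)
      then have "AE x in \<nu>. x \<notin> {0<..real n}" for n by (rule AE_not_in)
      then have "AE x in \<nu>. \<forall>n. x \<notin> {0<..real n}" unfolding AE_all_countable by blast
      then have "AE x in \<nu>. False" using prob_on_posD(3)[OF p]
      proof eventually_elim
        case (elim x)
        obtain n where "x \<le> real n" using real_arch_simple by blast
        then show ?case using elim by auto
      qed
      then show False by simp
    qed
    then obtain n where n: "0 < measure \<nu> {0<..real n}" by blast
    have "ennreal (measure \<nu> {0<..real n}) * norm_moment \<nu> 1 = (\<integral>\<^sup>+z\<in>{0<..real n}. ennreal (pot_dens \<nu> z) \<partial>M)"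
      by (rule key[symmetric]) auto
    also have "\<dots> \<le> (\<integral>\<^sup>+z. ennreal (norm (indicator {0<..real n} z *\<^sub>R Sc z)) \<partial>M)"
      using pot_dens_le[OF p] Sc_nonneg by (intro nn_integral_mono) (auto simp: indicator_def ennreal_leI)
    also have "\<dots> < \<top>" using Sc_integrable_Ioc[of "real n"] by (simp add: set_integrable_def integrable_iff_bounded)
    finally show ?thesis using n by (auto simp: ennreal_mult_less_top)
  qed
  define e where "e = enn2real (norm_moment \<nu> 1)"
  have e: "0 < e" "norm_moment \<nu> 1 = ennreal e" using norm_moment_1_pos[OF p] fin by (auto simp: e_def enn2real_positive_iff)
  note rm[measurable] = renewal_step(4)[OF p fin]
  show "\<nu> = density M (\<lambda>z. ennreal (renewal_dens \<nu> z))"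
  proof (rule measure_eqI)
    show "sets \<nu> = sets (density M (\<lambda>z. ennreal (renewal_dens \<nu> z)))" using prob_on_posD(2)[OF p] by simp
    fix A assume "A \<in> sets \<nu>"
    then have A[measurable]: "A \<in> sets borel" using prob_on_posD(2)[OF p] by simp
    have "emeasure (density M (\<lambda>z. ennreal (renewal_dens \<nu> z))) A = (\<integral>\<^sup>+z\<in>A. ennreal (renewal_dens \<nu> z) \<partial>M)"
      by (rule emeasure_density) simp_all
    also have "\<dots> = (\<integral>\<^sup>+z. (ennreal (pot_dens \<nu> z) * indicator (A \<inter> {0<..}) z) / ennreal e \<partial>M)"
    proof (rule nn_integral_cong_AE)
      show "AE z in M. ennreal (renewal_dens \<nu> z) * indicator A z = (ennreal (pot_dens \<nu> z) * indicator (A \<inter> {0<..}) z) / ennreal e"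
        using AE_M_pos
      proof eventually_elim
        case (elim z)
        have "ennreal (renewal_dens \<nu> z) = ennreal (pot_dens \<nu> z) / ennreal e"
          using e(1) pot_dens_nonneg[OF p] unfolding renewal_dens_def e_def[symmetric] by (simp add: divide_ennreal)
        then show ?case using elim by (auto split: split_indicator)
      qed
    qed
    also have "\<dots> = (\<integral>\<^sup>+z\<in>A \<inter> {0<..}. ennreal (pot_dens \<nu> z) \<partial>M) / ennreal e" by (rule nn_integral_divide) simp
    also have "\<dots> = ennreal (measure \<nu> (A \<inter> {0<..})) * ennreal e / ennreal e" unfolding e(2)[symmetric] by (subst key) auto
    also have "\<dots> = ennreal (measure \<nu> (A \<inter> {0<..}))" using e(1) by (simp add: ennreal_mult'[symmetric] divide_ennreal)
    also have "\<dots> = emeasure \<nu> (A \<inter> {0<..})" by (simp add: emeasure_eq_measure)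
    also have "\<dots> = emeasure \<nu> A"
      by (rule emeasure_eq_AE) (use prob_on_posD(2,3)[OF p] A in \<open>auto elim!: eventually_mono\<close>)
    finally show "emeasure \<nu> A = emeasure (density M (\<lambda>z. ennreal (renewal_dens \<nu> z))) A" by simp
  qed
qed

text \<open>The density is an eigenfunction of the Green operator, with the mean absorption time as
  eigenvalue. The Volterra form serves uniqueness, the kernel form boundedness and
  orthogonality.\<close>

lemma quasi_stationary_equation:
  assumes \<nu>: "quasi_stationary X \<nu>"
  shows "0 < enn2real (norm_moment \<nu> 1)" "renewal_dens \<nu> \<in> borel_measurable borel"
    "0 < y \<Longrightarrow> enn2real (norm_moment \<nu> 1) * renewal_dens \<nu> y = Sc y - volterra (renewal_dens \<nu>) y"
    "ennreal (enn2real (norm_moment \<nu> 1) * renewal_dens \<nu> y) = (\<integral>\<^sup>+x. ennreal (Sc (min x y)) * ennreal (renewal_dens \<nu> x) \<partial>M)"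
    "(\<integral>\<^sup>+x. ennreal (renewal_dens \<nu> x) \<partial>M) = 1"
proof -
  have p: "prob_on_pos \<nu>" using \<nu> by (simp add: quasi_stationary_def)
  note fix_\<nu> = quasi_stationary_renewal_fixed[OF \<nu>]
  note st = renewal_step[OF p fix_\<nu>(1)] and pr = renewal_dens_props[OF p fix_\<nu>(1)]
  show e: "0 < enn2real (norm_moment \<nu> 1)" using norm_moment_1_pos[OF p] fix_\<nu>(1) by (simp add: enn2real_positive_iff)
  show m: "renewal_dens \<nu> \<in> borel_measurable borel" by (rule st(4))
  show "(\<integral>\<^sup>+x. ennreal (renewal_dens \<nu> x) \<partial>M) = 1" by (rule st(3))
  have ep: "enn2real (norm_moment \<nu> 1) * renewal_dens \<nu> y = pot_dens \<nu> y" for y using e unfolding renewal_dens_def by simp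
  show "0 < y \<Longrightarrow> enn2real (norm_moment \<nu> 1) * renewal_dens \<nu> y = Sc y - volterra (renewal_dens \<nu>) y"
    using pot_dens_density[OF m pr(1) st(3), of y] fix_\<nu>(2) unfolding ep by simp
  have "(\<integral>\<^sup>+x. ennreal (Sc (min x y)) \<partial>\<nu>) = (\<integral>\<^sup>+x. ennreal (Sc (min x y)) \<partial>density M (\<lambda>z. ennreal (renewal_dens \<nu> z)))"
    using fix_\<nu>(2) by simp
  also have "\<dots> = (\<integral>\<^sup>+x. ennreal (Sc (min x y)) * ennreal (renewal_dens \<nu> x) \<partial>M)"
    using m by (subst nn_integral_density) (simp_all add: mult.commute)
  finally show "ennreal (enn2real (norm_moment \<nu> 1) * renewal_dens \<nu> y) = (\<integral>\<^sup>+x. ennreal (Sc (min x y)) * ennreal (renewal_dens \<nu> x) \<partial>M)"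
    unfolding ep ennreal_pot_dens[OF p] .
qed

text \<open>In the eigenvalue equation at \<open>y\<close>, the part up to \<open>c\<close> is at
  most \<open>Sc c\<close>, since the density \<open>h\<close> has mass 1, and the part beyond
  \<open>c\<close> is at most \<open>h y\<close> times the tail of the integral of S. With this tail
  below \<open>e / 2\<close> the second part is absorbed, leaving
  \<open>h y \<le> 2 * Sc c / e\<close>.\<close>

lemma quasi_stationary_density_bounded:
  assumes \<nu>: "quasi_stationary X \<nu>" and fin: "(\<integral>\<^sup>+z. ennreal (Sc z) \<partial>M) < \<top>"
  shows "\<exists>K\<ge>0. \<forall>y. renewal_dens \<nu> y \<le> K"
proof -
  define e where "e = enn2real (norm_moment \<nu> 1)"
  define h where "h = renewal_dens \<nu>"
  have p: "prob_on_pos \<nu>" using \<nu> by (simp add: quasi_stationary_def)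
  note eq = quasi_stationary_equation[OF \<nu>, folded e_def h_def]
  note pr = renewal_dens_props[OF p quasi_stationary_renewal_fixed(1)[OF \<nu>], folded e_def h_def]
  have [measurable]: "h \<in> borel_measurable borel" by (rule eq(2))
  define N where "N = density M (\<lambda>z. ennreal (Sc z))"
  have N: "emeasure N A = (\<integral>\<^sup>+z\<in>A. ennreal (Sc z) \<partial>M)" if "A \<in> sets borel" for A
    unfolding N_def using that by (subst emeasure_density) auto
  have Nf: "emeasure N A \<noteq> \<infinity>" if "A \<in> sets borel" for A
  proof -
    have "emeasure N A \<le> (\<integral>\<^sup>+z. ennreal (Sc z) \<partial>M)" unfolding N[OF that]
      by (intro nn_integral_mono) (auto simp: indicator_def)
    then show ?thesis using fin by auto
  qed
  have "(\<lambda>n. emeasure N {real n<..}) \<longlonglongrightarrow> emeasure N (\<Inter>n. {real n<..})"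
    by (rule Lim_emeasure_decseq) (use Nf in \<open>auto simp: decseq_def N_def\<close>)
  also have "(\<Inter>n. {real n<..}) = {}"
  proof (rule ccontr)
    assume "(\<Inter>n. {real n<..}) \<noteq> {}"
    then obtain x where "x \<in> (\<Inter>n. {real n<..})" by blast
    then have "real n < x" for n by blast
    then show False using real_arch_simple[of x] by (meson leD)
  qed
  finally have "(\<lambda>n. emeasure N {real n<..}) \<longlonglongrightarrow> 0" by simp
  then have "\<forall>\<^sub>F n in sequentially. emeasure N {real n<..} < ennreal (e / 2)"
  proof (rule order_tendstoD(2))
    show "(0::ennreal) < ennreal (e / 2)" using eq(1) by (subst ennreal_less_zero_iff) simp
  qed
  then obtain c where c: "emeasure N {real c<..} < ennreal (e / 2)" by (auto simp: eventually_sequentially)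
  define d where "d = enn2real (emeasure N {real c<..})"
  have d: "emeasure N {real c<..} = ennreal d" "0 \<le> d" using Nf[of "{real c<..}"] by (auto simp: d_def less_top)
  have d2: "d < e / 2" using c d by (simp add: ennreal_less_iff)
  \<comment> \<open>A form of concavity in the scale: the potential density increases, while its
    quotient by S decreases.\<close>
  have key: "h x * Sc (min x y) \<le> h y * Sc x" if x: "0 < x" and y: "0 < y" for x y
  proof (cases "x \<le> y")
    case True
    then show ?thesis using pr(5)[OF True] Sc_nonneg[of x] by (simp add: min_absorb1 mult_right_mono)
  next
    case False
    interpret prob_space \<nu> by (rule prob_on_posD(1)[OF p])
    have "pot_dens \<nu> x * Sc y = (\<integral>z. Sc (min z x) * Sc y \<partial>\<nu>)" unfolding pot_dens_def by simp
    also have "\<dots> \<le> (\<integral>z. Sc (min z y) * Sc x \<partial>\<nu>)"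
    proof (intro integral_mono integrable_mult_left integrable_Sc_min p)
      fix z
      show "Sc (min z x) * Sc y \<le> Sc (min z y) * Sc x"
      proof (cases "z \<le> y")
        case True
        then have "min z x = z" "min z y = z" using False by auto
        then show ?thesis using Sc_mono[of y x] False Sc_nonneg[of z] by (simp add: mult_left_mono)
      next
        case False
        then have "min z y = y" by simp
        then show ?thesis using mult_right_mono[OF Sc_min_bounds(2)[of z x] Sc_nonneg[of y]] by (simp add: mult.commute)
      qed
    qed
    also have "\<dots> = pot_dens \<nu> y * Sc x" unfolding pot_dens_def by simp
    finally have "pot_dens \<nu> x / e * Sc y \<le> pot_dens \<nu> y / e * Sc x" using eq(1) by (simp add: divide_right_mono)
    then show ?thesis using False by (simp add: h_def renewal_dens_def e_def min_absorb2 del: norm_moment_simps)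
  qed
  have "h y \<le> 2 * Sc (real c) / e" for y
  proof (cases "0 < y")
    case y: True
    have "ennreal (e * h y) = (\<integral>\<^sup>+x. ennreal (Sc (min x y)) * ennreal (h x) \<partial>M)" by (rule eq(4))
    also have "\<dots> \<le> (\<integral>\<^sup>+x. ennreal (Sc (real c)) * ennreal (h x) + ennreal (h y) * (ennreal (Sc x) * indicator {real c<..} x) \<partial>M)"
    proof (rule nn_integral_mono_AE)
      show "AE x in M. ennreal (Sc (min x y)) * ennreal (h x) \<le> ennreal (Sc (real c)) * ennreal (h x) + ennreal (h y) * (ennreal (Sc x) * indicator {real c<..} x)"
        using AE_M_pos
      proof eventually_elim
        case (elim x)
        show ?case
        proof (cases "x \<le> real c")
          case True
          then have "Sc (min x y) \<le> Sc (real c)" by (intro Sc_mono) auto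
          then have "ennreal (Sc (min x y)) * ennreal (h x) \<le> ennreal (Sc (real c)) * ennreal (h x)" by (intro mult_right_mono ennreal_leI) auto
          then show ?thesis using True by simp
        next
          case False
          have "ennreal (Sc (min x y)) * ennreal (h x) = ennreal (h x * Sc (min x y))"
            using pr(1) Sc_nonneg by (simp add: ennreal_mult mult.commute)
          also have "\<dots> \<le> ennreal (h y * Sc x)" by (rule ennreal_leI[OF key[OF elim y]])
          also have "\<dots> = ennreal (h y) * ennreal (Sc x)" using pr(1) Sc_nonneg by (simp add: ennreal_mult)
          finally show ?thesis using False by (auto intro: order_trans add_increasing)
        qed
      qed
    qed
    also have "\<dots> = ennreal (Sc (real c)) * (\<integral>\<^sup>+x. ennreal (h x) \<partial>M) + ennreal (h y) * emeasure N {real c<..}"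
      by (subst nn_integral_add) (simp_all add: nn_integral_cmult N)
    also have "\<dots> = ennreal (Sc (real c) + h y * d)" unfolding eq(5) d(1) using Sc_nonneg pr(1) d(2)
      by (simp add: ennreal_mult ennreal_plus)
    finally have "e * h y \<le> Sc (real c) + h y * d"
      using Sc_nonneg[of "real c"] pr(1)[of y] d(2) by (subst (asm) ennreal_le_iff) auto
    also have "\<dots> \<le> Sc (real c) + h y * (e / 2)" using d2 pr(1)[of y] by (intro add_left_mono mult_left_mono) auto
    finally have "e * h y \<le> 2 * Sc (real c)" by (simp add: algebra_simps)
    then show ?thesis using eq(1) by (simp add: field_simps)
  next
    case False
    then show ?thesis using pr(2)[of y] Sc_nonneg[of "real c"] eq(1) by simp
  qed
  moreover have "0 \<le> 2 * Sc (real c) / e" using Sc_nonneg[of "real c"] eq(1) by simp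
  ultimately show ?thesis unfolding h_def by blast
qed

text \<open>When \<open>\<integral> Sc dM < \<infinity>\<close>, the Green operator has only one positive eigenfunction: by symmetry,
  eigenfunctions for different eigenvalues are orthogonal.\<close>

lemma scale_not_integrable:
  assumes \<nu>: "quasi_stationary X \<nu>1" "quasi_stationary X \<nu>2" and ne: "\<nu>1 \<noteq> \<nu>2"
  shows "(\<integral>\<^sup>+z. ennreal (Sc z) \<partial>M) = \<top>"
proof (rule ccontr)
  assume "(\<integral>\<^sup>+z. ennreal (Sc z) \<partial>M) \<noteq> \<top>"
  then have fin: "(\<integral>\<^sup>+z. ennreal (Sc z) \<partial>M) < \<top>" by (simp add: less_top)
  have p: "prob_on_pos \<nu>1" "prob_on_pos \<nu>2" using \<nu> by (auto simp: quasi_stationary_def)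
  define e1 where "e1 = enn2real (norm_moment \<nu>1 1)"
  define e2 where "e2 = enn2real (norm_moment \<nu>2 1)"
  define h1 where "h1 = renewal_dens \<nu>1"
  define h2 where "h2 = renewal_dens \<nu>2"
  note eq1 = quasi_stationary_equation[OF \<nu>(1), folded e1_def h1_def]
  note eq2 = quasi_stationary_equation[OF \<nu>(2), folded e2_def h2_def]
  note pr1 = renewal_dens_props[OF p(1) quasi_stationary_renewal_fixed(1)[OF \<nu>(1)], folded e1_def h1_def]
  note pr2 = renewal_dens_props[OF p(2) quasi_stationary_renewal_fixed(1)[OF \<nu>(2)], folded e2_def h2_def]
  have [measurable]: "h1 \<in> borel_measurable borel" "h2 \<in> borel_measurable borel" by (rule eq1(2), rule eq2(2))
  have b1: "\<bar>h1 z\<bar> \<le> 1 / e1 * Sc z" and b2: "\<bar>h2 z\<bar> \<le> 1 / e2 * Sc z" for z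
    using pr1(1,4)[of z] pr2(1,4)[of z] by simp_all
  have vi: "volterra_integrable h1" "volterra_integrable h2"
  proof -
    show "volterra_integrable h1"
    proof (rule volterra_integrable_bound)
      show "\<exists>C. \<forall>z. 0 < z \<longrightarrow> z \<le> Y \<longrightarrow> \<bar>h1 z\<bar> \<le> C * Sc z" for Y using b1 by blast
    qed measurable
    show "volterra_integrable h2"
    proof (rule volterra_integrable_bound)
      show "\<exists>C. \<forall>z. 0 < z \<longrightarrow> z \<le> Y \<longrightarrow> \<bar>h2 z\<bar> \<le> C * Sc z" for Y using b2 by blast
    qed measurable
  qed
  \<comment> \<open>The inner product of the two densities in L2 of \<open>M\<close>. Symmetry
    evaluates the Green operator between them in two ways; as \<open>A\<close> is positive and
    finite, the eigenvalues coincide.\<close>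
  define A where "A = (\<integral>\<^sup>+z. ennreal (h1 z) * ennreal (h2 z) \<partial>M)"
  have "ennreal e1 * A = ennreal e2 * A"
  proof -
    have i: "(\<integral>\<^sup>+z. ennreal (Sc (min x z)) * ennreal (h2 z) \<partial>M) = ennreal (e2 * h2 x)" for x
      using eq2(4)[of x] by (simp add: min.commute)
    have "ennreal e1 * A = (\<integral>\<^sup>+z. ennreal (pot_dens \<nu>1 z) * ennreal (h2 z) \<partial>M)"
    proof -
      have "ennreal (pot_dens \<nu>1 z) = ennreal e1 * ennreal (h1 z)" for z
      proof -
        have "pot_dens \<nu>1 z = e1 * h1 z" using eq1(1) unfolding h1_def renewal_dens_def e1_def by simp
        then show ?thesis using eq1(1) by (simp add: ennreal_mult')
      qed
      then show ?thesis unfolding A_def by (simp add: nn_integral_cmult mult.assoc)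
    qed
    also have "\<dots> = (\<integral>\<^sup>+x. \<integral>\<^sup>+z. ennreal (Sc (min x z)) * ennreal (h2 z) \<partial>M \<partial>\<nu>1)"
      by (rule potential_from[OF p(1), symmetric]) simp
    also have "\<dots> = (\<integral>\<^sup>+x. ennreal (e2 * h2 x) \<partial>density M (\<lambda>z. ennreal (h1 z)))"
      unfolding i using quasi_stationary_renewal_fixed(2)[OF \<nu>(1)] by (simp add: h1_def)
    also have "\<dots> = (\<integral>\<^sup>+x. ennreal (h1 x) * ennreal (e2 * h2 x) \<partial>M)" by (rule nn_integral_density) simp_all
    also have "\<dots> = (\<integral>\<^sup>+x. ennreal e2 * (ennreal (h1 x) * ennreal (h2 x)) \<partial>M)"
      using eq2(1) by (intro nn_integral_cong) (simp add: ennreal_mult' ac_simps)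
    also have "\<dots> = ennreal e2 * A" unfolding A_def by (rule nn_integral_cmult) simp
    finally show ?thesis .
  qed
  moreover have "A \<noteq> 0"
  proof
    assume "A = 0"
    then have "AE z in M. ennreal (h1 z) * ennreal (h2 z) = 0" unfolding A_def by (subst (asm) nn_integral_0_iff_AE) auto
    then have "AE z in M. False" using AE_M_pos
    proof eventually_elim
      case (elim z)
      then show ?case using pr1(3)[of z] pr2(3)[of z] by (auto simp: ennreal_eq_0_iff)
    qed
    then have "emeasure M UNIV = 0" using AE_iff_measurable[of UNIV M "\<lambda>_. False"] by simp
    moreover have "emeasure M {1<..<2} \<le> emeasure M UNIV" by (rule emeasure_mono) auto
    ultimately show False using M_open_pos[of 1 2] by simp
  qed
  \<comment> \<open>One density is bounded, and the other is at most a multiple of S, which is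
    integrable under the assumption to be refuted.\<close>
  moreover have "A \<noteq> \<top>"
  proof -
    obtain K where K: "0 \<le> K" "\<And>y. h1 y \<le> K" using quasi_stationary_density_bounded[OF \<nu>(1) fin] by (auto simp: h1_def)
    have "A \<le> (\<integral>\<^sup>+z. ennreal (K * (1 / e2)) * ennreal (Sc z) \<partial>M)" unfolding A_def
    proof (rule nn_integral_mono)
      fix z
      have "h1 z * h2 z \<le> K * (1 / e2 * Sc z)" using K b2[of z] pr2(1)[of z] by (intro mult_mono) auto
      then have "ennreal (h1 z * h2 z) \<le> ennreal (K * (1 / e2) * Sc z)" by (intro ennreal_leI) (simp add: mult.assoc)
      then show "ennreal (h1 z) * ennreal (h2 z) \<le> ennreal (K * (1 / e2)) * ennreal (Sc z)"
        using pr1(1) pr2(1) K(1) eq2(1) Sc_nonneg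
        by (simp only: ennreal_mult[symmetric, of "h1 z" "h2 z"] ennreal_mult[symmetric, of "K * (1 / e2)" "Sc z"] mult_nonneg_nonneg zero_le_divide_1_iff less_imp_le)
    qed
    also have "\<dots> = ennreal (K * (1 / e2)) * (\<integral>\<^sup>+z. ennreal (Sc z) \<partial>M)" by (rule nn_integral_cmult) simp
    also have "\<dots> < \<top>" using fin by (simp add: ennreal_mult_less_top)
    finally show ?thesis by simp
  qed
  ultimately have e: "e1 = e2"
  proof (cases A)
    case (real a)
    assume "ennreal e1 * A = ennreal e2 * A" "A \<noteq> 0"
    then have "ennreal (e1 * a) = ennreal (e2 * a)" "a \<noteq> 0"
      using real eq1(1) eq2(1) by (auto simp: ennreal_mult less_imp_le)
    then show ?thesis using real(1) eq1(1) eq2(1) by (subst (asm) ennreal_inj) auto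
  qed simp
  \<comment> \<open>With equal eigenvalues the difference solves a homogeneous Volterra equation and
    vanishes by the Gronwall argument.\<close>
  define D where "D z = ennreal \<bar>h1 z - h2 z\<bar>" for z
  have [measurable]: "D \<in> borel_measurable borel" unfolding D_def[abs_def] by measurable
  have "h1 y = h2 y" for y
  proof (cases "0 < y")
    case True
    have "D y = 0"
    proof (rule gronwall[where E=D and Y=y and ?C1.0="2 / e1" and C="1 / e1"])
      fix z assume z: "0 < z" "z \<le> y"
      show "D z \<le> ennreal (2 / e1 * Sc z)" unfolding D_def using b1[of z] b2[of z] e by (intro ennreal_leI) (simp add: abs_le_iff)
      have "h1 z - h2 z = - (1 / e1) * volterra (\<lambda>x. h1 x - h2 x) z"
        using eq1(1) eq1(3)[OF z(1)] eq2(3)[OF z(1)] unfolding volterra_diff(2)[OF vi] e by (simp add: field_simps)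
      then have "D z = ennreal (1 / e1) * ennreal \<bar>volterra (\<lambda>x. h1 x - h2 x) z\<bar>"
        using eq1(1) unfolding D_def by (simp only: abs_mult abs_minus_cancel) (simp add: ennreal_mult'[symmetric])
      also have "\<dots> \<le> ennreal (1 / e1) * (ennreal (Sc z) * (\<integral>\<^sup>+w\<in>{0<..<z}. ennreal \<bar>h1 w - h2 w\<bar> \<partial>M))"
        by (intro mult_left_mono volterra_bound volterra_diff(1) vi z) simp
      finally show "D z \<le> ennreal (1 / e1) * ennreal (Sc z) * (\<integral>\<^sup>+w\<in>{0<..<z}. D w \<partial>M)" by (simp add: mult.assoc D_def)
    qed (use True eq1(1) in auto)
    then show ?thesis by (simp add: D_def)
  qed (use pr1(2) pr2(2) in auto)
  then have "h1 = h2" by blast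
  then show False using ne quasi_stationary_renewal_fixed(2)[OF \<nu>(1)] quasi_stationary_renewal_fixed(2)[OF \<nu>(2)]
    by (simp add: h1_def h2_def)
qed

end

theorem theorem1p1:
  fixes X :: "'w markov_family" and I :: "ennreal set"
    and m :: "ennreal measure" and s :: "real \<Rightarrow> real"
    and \<mu> :: "real measure" and lam :: real
  assumes "dmds_diffusion X I m s"
    and "irreducible_diffusion X I"
    and "stopped_at_zero X I"
    and "\<forall>x::real. 0 < x \<longrightarrow> \<P>(\<omega> in law X (ennreal x). hitting X 0 \<omega> < \<top>) = 1"
    and "infinite {\<nu>. quasi_stationary X \<nu>}"
    and "prob_on_pos \<mu>"
    and "\<forall>n\<ge>1. T0_moment X \<mu> n < \<top>"
    and "(\<lambda>n. normalized_moment X \<mu> (n - 1) / normalized_moment X \<mu> n) \<longlonglongrightarrow> lam"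
    and "0 < lam" and "lam \<le> lambda0 m s"
  shows "(\<forall>x>0. (\<lambda>n. cont_density m ((renewal_transform X ^^ n) \<mu>) x) \<longlonglongrightarrow> lam * psi m s (- lam) x) \<and>
         weak_conv_m (\<lambda>n. (renewal_transform X ^^ n) \<mu>) (nu_lambda m s lam) \<and>
         quasi_stationary X (nu_lambda m s lam)"
proof -
  interpret absorbed_diffusion X I
    by unfold_locales (use assms in \<open>auto simp: dmds_diffusion_def\<close>)
  \<comment> \<open>The orthogonality argument takes a pair of different quasi-stationary
    distributions; the first also rules out mass at infinity.\<close>
  obtain \<nu>1 \<nu>2 where \<nu>: "quasi_stationary X \<nu>1" "quasi_stationary X \<nu>2" "\<nu>1 \<noteq> \<nu>2"
  proof -
    obtain \<nu>1 where 1: "quasi_stationary X \<nu>1" using infinite_imp_nonempty[OF assms(5)] by auto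
    have "infinite ({\<nu>. quasi_stationary X \<nu>} - {\<nu>1})" using assms(5) by simp
    then obtain \<nu>2 where "\<nu>2 \<in> {\<nu>. quasi_stationary X \<nu>} - {\<nu>1}" using infinite_imp_nonempty by blast
    then show ?thesis using that[of \<nu>1 \<nu>2] 1 by auto
  qed
  have \<mu>: "prob_on_pos \<mu>" by fact
  interpret natural_diffusion X I m s
  proof unfold_locales
    show "speed_measure I m" "scale_function s" "local_generator_is_dmds X m s" using assms(1) by (auto simp: dmds_diffusion_def)
    show "I = {..<\<top>} \<or> I = UNIV" by (rule I_cases)
    show "emeasure (potential (ennreal x)) UNIV < \<top>" for x
      using mean_finite_of_moment[OF \<mu>] assms(7) by simp
    show "emeasure (potential (ennreal x)) {\<top>} = 0" for x by (rule potential_no_infinity[OF \<nu>(1)])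
  qed
  have fin: "norm_moment \<mu> n < \<top>" for n
  proof (cases n)
    case (Suc k)
    have "T0_moment X \<mu> n < \<top>" using assms(7) Suc by auto
    moreover have "(0::real) < fact n" by (rule fact_gt_zero)
    ultimately show ?thesis unfolding T0_moment_eq[OF \<mu>]
      by (auto simp: ennreal_mult_less_top ennreal_eq_0_iff simp del: norm_moment_simps fact_Suc)
  qed simp
  have lim: "(\<lambda>n. enn2real (norm_moment \<mu> n) / enn2real (norm_moment \<mu> (Suc n))) \<longlonglongrightarrow> lam"
    using LIMSEQ_Suc[OF assms(8)] unfolding normalized_moment_eq[OF \<mu>] diff_Suc_1 .
  \<comment> \<open>\<open>f n\<close> belongs to the iterate with index \<open>Suc n\<close>, so
    the sequences in the claim are treated with their first term removed.\<close>
  define f where "f n = renewal_dens ((renewal_transform X ^^ n) \<mu>)" for n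
  obtain F C where Fm[measurable]: "F \<in> borel_measurable borel" and Fl: "\<And>y. (\<lambda>n. f n y) \<longlonglongrightarrow> F y" and F0: "\<And>y. y \<le> 0 \<Longrightarrow> F y = 0"
    and Fn: "\<And>y. 0 \<le> F y" and FC: "\<And>y. 0 < y \<Longrightarrow> F y \<le> C * Sc y" and Fe: "\<And>y. 0 < y \<Longrightarrow> F y = lam * (Sc y - volterra F y)"
    using limit_density[OF \<mu> fin lim assms(9)] unfolding f_def by blast
  have it: "prob_on_pos ((renewal_transform X ^^ n) \<mu>)" "norm_moment ((renewal_transform X ^^ n) \<mu>) 1 < \<top>" for n
    using renewal_iterates[OF \<mu> fin, of n] by (auto simp del: norm_moment_simps)
  note fp = renewal_dens_props[OF it, folded f_def] and fs = renewal_step[OF it, folded f_def]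
  have fm: "(\<lambda>z. ennreal (f n z)) \<in> borel_measurable borel" for n by (rule measurable_compose[OF fs(4)]) simp
  have dens: "(renewal_transform X ^^ Suc n) \<mu> = density M (\<lambda>z. ennreal (f n z))" for n
    using renewal_transform_eq[OF it] by (simp add: f_def)
  \<comment> \<open>Fatou's lemma gives this inequality only; that no mass escapes needs the
    non-integrability of S.\<close>
  have le: "(\<integral>\<^sup>+z. ennreal (F z) \<partial>M) \<le> 1"
  proof -
    have "(\<integral>\<^sup>+z. ennreal (F z) \<partial>M) = (\<integral>\<^sup>+z. liminf (\<lambda>n. ennreal (f n z)) \<partial>M)"
      by (intro nn_integral_cong lim_imp_Liminf[symmetric] tendsto_ennrealI Fl) simp
    also have "\<dots> \<le> liminf (\<lambda>n. \<integral>\<^sup>+z. ennreal (f n z) \<partial>M)" by (rule nn_integral_liminf) (simp add: fm)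
    also have "\<dots> = 1" by (simp add: fs(3) Liminf_const)
    finally show ?thesis .
  qed
  have mass: "(\<integral>\<^sup>+z. ennreal (F z) \<partial>M) = 1"
    by (rule solution_mass[OF Fm Fn FC Fe assms(9) le scale_not_integrable[OF \<nu>]])
  have psi: "lam * psi m s (- lam) y = F y" for y
    by (rule psi_volterra[OF Fm _ _ Fe F0, of C]) (use FC Fn assms(9) in auto)
  define \<nu> where "\<nu> = density M (\<lambda>z. ennreal (F z))"
  have nu: "nu_lambda m s lam = \<nu>" unfolding nu_lambda_def \<nu>_def psi ..
  \<comment> \<open>At index 0 the measure is \<mu> itself, which need not have a density;
    \<open>cont_density\<close> may then be an unspecified value, without effect on the
    limit.\<close>
  have conv1: "(\<lambda>n. cont_density m ((renewal_transform X ^^ n) \<mu>) x) \<longlonglongrightarrow> lam * psi m s (- lam) x" if x: "0 < x" for x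
  proof (rule LIMSEQ_imp_Suc)
    have "cont_density m ((renewal_transform X ^^ Suc n) \<mu>) = f n" for n
      unfolding dens by (rule cont_density_density) (use fs(4) fp in auto)
    then show "(\<lambda>n. cont_density m ((renewal_transform X ^^ Suc n) \<mu>) x) \<longlonglongrightarrow> lam * psi m s (- lam) x"
      using Fl[of x] psi by simp
  qed
  have "weak_conv_m (\<lambda>n. (renewal_transform X ^^ Suc n) \<mu>) \<nu>"
    unfolding dens \<nu>_def by (rule weak_conv_density) (use fs(3,4) fp(1) Fm Fn mass Fl in auto)
  then have conv2: "weak_conv_m (\<lambda>n. (renewal_transform X ^^ n) \<mu>) \<nu>"
    unfolding weak_conv_m_def weak_conv_def by (auto intro: LIMSEQ_imp_Suc)
  have p\<nu>: "prob_on_pos \<nu>" unfolding \<nu>_def by (rule prob_on_pos_density[OF Fm mass])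
  have "quasi_stationary X \<nu>"
  proof (rule eigenmeasure_quasi_stationary[OF p\<nu> \<nu>_def Fm _ assms(9)])
    show "F y = lam * pot_dens \<nu> y" if "0 < y" for y
      unfolding \<nu>_def pot_dens_density[OF Fm Fn mass that] by (rule Fe[OF that])
  qed
  then show ?thesis using conv1 conv2 unfolding nu by blast
qed

end
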